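(* Let $(X,\mathsf d,\mathfrak m)$ be an extended metric measure space satisfying the $\mathrm{BCD}(K,\infty)$ condition for some $K\in\mathbb R$, and let $\Omega$ be a probability measure on $\mathcal{P}(X)$ with $\mathrm{Var}(\Omega)<\infty$ and $\int_{\mathcal{P}(X)}\mathrm{Ent}_{\mathfrak m}(\mu)\,d\Omega(\mu)<\infty$. Then $\Omega$ has a Wasserstein barycenter if one of the following holds: (A) $(X,\mathsf d,\mathfrak m)$ satisfies the exponential volume growth condition $\int_Xe^{-c\,\mathsf d(x_0,x)^2}\,d\mathfrak m(x)<\infty$ for some $x_0\in X$ and $c>0$, and $\Omega$ is concentrated on $\mathcal P_2(X,\mathsf d)$; (B) $\mathfrak m$ is a probability measure.
   Context: Extended metric measure space: $(X,\tau,\mathsf d)$ an extended metric-topological space in the sense of Ambrosio–Erbar–Savaré ($\mathsf d:X\times X\to[0,\infty]$ an extended metric compatible with the Hausdorff topology $\tau$), $(X,\mathsf d)$ complete, $\mathfrak m$ a nonnegative Radon measure with full support. $\mathcal P(X)$: Radon probability measures; $\mathcal P_2(X,\mathsf d)$: those with finite second moment. $W_2$: (extended) quadratic Wasserstein distance. $\mathrm{Var}(\Omega)=\inf_\nu\int W_2^2(\mu,\nu)\,d\Omega(\mu)$; a Wasserstein barycenter is a minimizer. $\mathrm{Ent}_{\mathfrak m}(\mu)=\int\rho\ln\rho\,d\mathfrak m$ if $\mu=\rho\mathfrak m$, else $+\infty$. $\mathrm{BCD}(K,\infty)$: for every probability measure $\Omega'$ on $\mathcal P(X)$ with finite support and finite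 variance there exists a barycenter $\bar\mu$ of $\Omega'$ with $\mathrm{Ent}_{\mathfrak m}(\bar\mu)\le\int\mathrm{Ent}_{\mathfrak m}(\mu)\,d\Omega'(\mu)-\frac K2\mathrm{Var}(\Omega')$. *)

theory Defs
  imports "HOL-Probability.Probability"
begin

section \<open>Extended metric-topological spaces (Ambrosio--Erbar--Savare)\<close>

definition borel_of :: "'a topology \<Rightarrow> 'a measure" where
  "borel_of T = sigma (topspace T) {U. openin T U}"

definition ext_metric :: "('a \<Rightarrow> 'a \<Rightarrow> ennreal) \<Rightarrow> bool" where
  "ext_metric d \<longleftrightarrow>
     (\<forall>x y. d x y = 0 \<longleftrightarrow> x = y) \<and>
     (\<forall>x y. d x y = d y x) \<and>
     (\<forall>x y z. d x z \<le> d x y + d y z)"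

definition Lip_b :: "'a topology \<Rightarrow> ('a \<Rightarrow> 'a \<Rightarrow> ennreal) \<Rightarrow> real \<Rightarrow> ('a \<Rightarrow> real) set" where
  "Lip_b T d L = {f. continuous_map T euclideanreal f \<and> (\<exists>B. \<forall>x\<in>topspace T. \<bar>f x\<bar> \<le> B) \<and>
                      (\<forall>x\<in>topspace T. \<forall>y\<in>topspace T. ennreal \<bar>f x - f y\<bar> \<le> ennreal L * d x y)}"

text \<open>Extended metric-topological space (AES): the topology is the initial topology of the
  bounded continuous Lipschitz functions, and d is recovered as the supremum over the
  1-Lipschitz ones.  We take the whole type as the underlying set, and require Hausdorffness.\<close>
definition emt_space :: "'a topology \<Rightarrow> ('a \<Rightarrow> 'a \<Rightarrow> ennreal) \<Rightarrow> bool" where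
  "emt_space T d \<longleftrightarrow>
     topspace T = UNIV \<and> Hausdorff_space T \<and> ext_metric d \<and>
     (\<forall>U. openin T U \<longleftrightarrow>
        openin (topology_generated_by
          {f -` V | f V. f \<in> (\<Union>L. Lip_b T d L) \<and> open V}) U) \<and>
     (\<forall>x y. d x y = (SUP f\<in>Lip_b T d 1. ennreal \<bar>f x - f y\<bar>))"

definition ext_complete :: "('a \<Rightarrow> 'a \<Rightarrow> ennreal) \<Rightarrow> bool" where
  "ext_complete d \<longleftrightarrow>
     (\<forall>s :: nat \<Rightarrow> 'a. (\<forall>e>0. \<exists>N. \<forall>m\<ge>N. \<forall>n\<ge>N. d (s m) (s n) < e) \<longrightarrow>
        (\<exists>x. (\<lambda>n. d (s n) x) \<longlonglongrightarrow> 0))"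

definition inner_regular_compact :: "'a topology \<Rightarrow> 'a measure \<Rightarrow> bool" where
  "inner_regular_compact T \<mu> \<longleftrightarrow>
     (\<forall>B\<in>sets \<mu>. emeasure \<mu> B = (SUP K\<in>{K. compactin T K \<and> K \<subseteq> B}. emeasure \<mu> K))"

definition radon_measure :: "'a topology \<Rightarrow> 'a measure \<Rightarrow> bool" where
  "radon_measure T \<mu> \<longleftrightarrow>
     sets \<mu> = sets (borel_of T) \<and>
     (\<forall>x\<in>topspace T. \<exists>U. openin T U \<and> x \<in> U \<and> emeasure \<mu> U < \<infinity>) \<and>
     inner_regular_compact T \<mu>"

definition full_support :: "'a topology \<Rightarrow> 'a measure \<Rightarrow> bool" where
  "full_support T \<mu> \<longleftrightarrow> (\<forall>U. openin T U \<and> U \<noteq> {} \<longrightarrow> emeasure \<mu> U > 0)"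

definition ext_mms :: "'a topology \<Rightarrow> ('a \<Rightarrow> 'a \<Rightarrow> ennreal) \<Rightarrow> 'a measure \<Rightarrow> bool" where
  "ext_mms T d m \<longleftrightarrow> emt_space T d \<and> ext_complete d \<and> radon_measure T m \<and> full_support T m"

definition Prob :: "'a topology \<Rightarrow> 'a measure set" where
  "Prob T = {\<mu>. radon_measure T \<mu> \<and> prob_space \<mu>}"

definition Prob2 :: "'a topology \<Rightarrow> ('a \<Rightarrow> 'a \<Rightarrow> ennreal) \<Rightarrow> 'a measure set" where
  "Prob2 T d = {\<mu>\<in>Prob T. \<exists>x0. (\<integral>\<^sup>+ x. (d x0 x)\<^sup>2 \<partial>\<mu>) < \<infinity>}"

definition couplings :: "'a topology \<Rightarrow> 'a measure \<Rightarrow> 'a measure \<Rightarrow> ('a \<times> 'a) measure set" where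
  "couplings T \<mu> \<nu> = {\<gamma>. \<gamma> \<in> Prob (prod_topology T T) \<and>
      (\<forall>A\<in>sets (borel_of T). emeasure \<gamma> (A \<times> UNIV) = emeasure \<mu> A \<and>
                              emeasure \<gamma> (UNIV \<times> A) = emeasure \<nu> A)}"

definition W2sq :: "'a topology \<Rightarrow> ('a \<Rightarrow> 'a \<Rightarrow> ennreal) \<Rightarrow> 'a measure \<Rightarrow> 'a measure \<Rightarrow> ennreal" where
  "W2sq T d \<mu> \<nu> = (INF \<gamma>\<in>couplings T \<mu> \<nu>. \<integral>\<^sup>+ p. (d (fst p) (snd p))\<^sup>2 \<partial>\<gamma>)"

definition narrow_topology :: "'a topology \<Rightarrow> 'a measure topology" where
  "narrow_topology T = topology_generated_by
     {{\<mu>\<in>Prob T. integral\<^sup>L \<mu> f \<in> V} | f V.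
        continuous_map T euclideanreal f \<and> (\<exists>B. \<forall>x\<in>topspace T. \<bar>f x\<bar> \<le> B) \<and> open V}"

definition prob_on_P :: "'a topology \<Rightarrow> 'a measure measure \<Rightarrow> bool" where
  "prob_on_P T \<Omega> \<longleftrightarrow> prob_space \<Omega> \<and> sets \<Omega> = sets (borel_of (narrow_topology T))
                       \<and> space \<Omega> = Prob T"

definition finite_support_P :: "'a topology \<Rightarrow> 'a measure measure \<Rightarrow> bool" where
  "finite_support_P T \<Omega> \<longleftrightarrow>
     (\<exists>S w. finite S \<and> S \<subseteq> Prob T \<and> (\<forall>\<mu>\<in>S. w \<mu> \<ge> (0::real)) \<and>
        (\<forall>A\<in>sets \<Omega>. emeasure \<Omega> A = ennreal (\<Sum>\<mu>\<in>S \<inter> A. w \<mu>)))"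

definition Var :: "'a topology \<Rightarrow> ('a \<Rightarrow> 'a \<Rightarrow> ennreal) \<Rightarrow> 'a measure measure \<Rightarrow> ennreal" where
  "Var T d \<Omega> = (INF \<nu>\<in>Prob T. \<integral>\<^sup>+ \<mu>. W2sq T d \<mu> \<nu> \<partial>\<Omega>)"

definition barycenter :: "'a topology \<Rightarrow> ('a \<Rightarrow> 'a \<Rightarrow> ennreal) \<Rightarrow> 'a measure measure \<Rightarrow> 'a measure \<Rightarrow> bool" where
  "barycenter T d \<Omega> \<nu> \<longleftrightarrow> \<nu> \<in> Prob T \<and> (\<integral>\<^sup>+ \<mu>. W2sq T d \<mu> \<nu> \<partial>\<Omega>) = Var T d \<Omega>"

text \<open>Integral of an ereal-valued function as positive part minus negative part,
  with the convention \<infinity> - \<infinity> = \<infinity>.\<close>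
definition ereal_integral :: "'b measure \<Rightarrow> ('b \<Rightarrow> ereal) \<Rightarrow> ereal" where
  "ereal_integral M g =
     (let P = (\<integral>\<^sup>+ x. e2ennreal (g x) \<partial>M); N = (\<integral>\<^sup>+ x. e2ennreal (- g x) \<partial>M)
      in if P = \<infinity> then \<infinity> else enn2ereal P - enn2ereal N)"

definition Ent :: "'a measure \<Rightarrow> 'a measure \<Rightarrow> ereal" where
  "Ent m \<mu> =
     (if \<exists>\<rho>. \<rho> \<in> borel_measurable m \<and> \<mu> = density m \<rho>
      then (let \<rho> = (SOME \<rho>. \<rho> \<in> borel_measurable m \<and> \<mu> = density m \<rho>)
            in ereal_integral m (\<lambda>x. ereal (enn2real (\<rho> x) * ln (enn2real (\<rho> x)))))
      else \<infinity>)"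

definition Ent_integral :: "'a measure \<Rightarrow> 'a measure measure \<Rightarrow> ereal" where
  "Ent_integral m \<Omega> = ereal_integral \<Omega> (Ent m)"

definition BCD :: "'a topology \<Rightarrow> ('a \<Rightarrow> 'a \<Rightarrow> ennreal) \<Rightarrow> 'a measure \<Rightarrow> real \<Rightarrow> bool" where
  "BCD T d m K \<longleftrightarrow>
     (\<forall>\<Omega>'. prob_on_P T \<Omega>' \<and> finite_support_P T \<Omega>' \<and> Var T d \<Omega>' < \<infinity> \<longrightarrow>
        (\<exists>\<nu>. barycenter T d \<Omega>' \<nu> \<and>
             Ent m \<nu> \<le> Ent_integral m \<Omega>' - ereal (K / 2 * enn2real (Var T d \<Omega>'))))"

definition exp_volume_growth :: "('a \<Rightarrow> 'a \<Rightarrow> ennreal) \<Rightarrow> 'a measure \<Rightarrow> bool" where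
  "exp_volume_growth d m \<longleftrightarrow>
     (\<exists>x0 c. c > (0::real) \<and>
        (\<integral>\<^sup>+ x. (if d x0 x = \<infinity> then 0 else ennreal (exp (- c * (enn2real (d x0 x))\<^sup>2))) \<partial>m) < \<infinity>)"

definition concentrated_on :: "'b measure \<Rightarrow> 'b set \<Rightarrow> bool" where
  "concentrated_on M S \<longleftrightarrow> (\<exists>A\<in>sets M. A \<subseteq> S \<and> emeasure M A = emeasure M (space M))"

end

theory Submission
  imports Defs
begin

text \<open>
  Since neither tightness nor separability is available, no compactness of measures on \<open>X\<close> is used
  to produce the barycenter. Fix a competitor \<open>\<eta>\<close> for \<open>\<Omega>\<close>. For each finitely supported weight whose
  mean entropy is bounded by \<open>C\<close>, BCD yields a measure that is at least as good as \<open>\<eta>\<close> and has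
  bounded entropy. A finite minimax argument makes one measure serve finitely many weights at once. Since the entropy is
  uniformly convex with respect to the \<open>L\<^sup>1\<close> distance of densities, a directed family of nonempty
  convex closed sets of densities of bounded entropy has a common point, so one measure \<open>\<nu>\<close> serves
  all such weights. A Lagrange multiplier for the constraint on the mean entropy turns this into a
  pointwise bound on \<open>W2sq \<mu> \<nu>\<close>, whose integral shows that \<open>\<nu>\<close> is at least as good as \<open>\<eta>\<close> for \<open>\<Omega>\<close>. All
  the \<open>\<nu>\<close> obtained in this way have densities in one entropy sublevel, and intersecting once more over
  all \<open>\<eta>\<close> gives a barycenter.

  The lower semicontinuity of \<open>W2sq\<close> that is used on the way rests on the compactness of couplings,
  obtained from pointwise limits of set functions on a product of intervals and the extension of
  contents.

  If \<open>m\<close> is infinite, entropies are taken relative to \<open>exp (- c d(x1, x)\<^sup>2) m\<close> for a point \<open>x1\<close> at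
  finite distance from the measures in question. The finiteness of this measure is derived from BCD
  itself: a barycenter of the uniform measures on a small compact set of weight \<open>1 - t\<close> and on a
  distant one of weight \<open>t\<close> stays near the former, which bounds the volume of the latter.
\<close>

subsection \<open>Contents and Radon measures\<close>

text \<open>No countability is imposed on \<open>T\<close>, the entropy is not known to be
  measurable and \<open>W2sq\<close> is only lower semicontinuous, so passing to the limit along
  finitely supported approximations of \<open>\<Omega>\<close> is not at hand. The order of
  quantifiers is changed instead: a bound \<open>v\<close> on entropies is fixed in advance, and one
  density must beat \<open>\<eta>\<close> for every finite weight whose mean of \<open>v\<close> is
  at most \<open>C\<close>. Two-point weights already carry the duality, because there is a single
  linear constraint; the resulting bound \<open>h + s C \<le> g + s v\<close> loses its multiplier
  after integration since \<open>C\<close> exceeds the integral of \<open>v\<close>.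

  For the last intersection over all \<open>\<eta>\<close> to make sense, \<open>v\<close> and
  \<open>C\<close> must not depend on \<open>\<eta>\<close>. They are computed from one reference
  measure \<open>\<eta>0\<close>, with which every barycenter furnished by BCD is compared.

  Since \<open>d\<close> may be infinite, growth of \<open>m\<close> about one point says nothing
  about points at infinite distance from it; the growth estimate is therefore made about a point
  tied to \<open>\<Omega>\<close>.\<close>

lemma space_borel_of [simp]: "space (borel_of Z) = topspace Z"
  by (simp add: borel_of_def space_measure_of_conv)

lemma sets_borel_of: "sets (borel_of Z) = sigma_sets (topspace Z) {U. openin Z U}"
  unfolding borel_of_def by (rule sets_measure_of) (auto dest: openin_subset)

lemma openin_borel_of: "openin Z U \<Longrightarrow> U \<in> sets (borel_of Z)"
  by (simp add: sets_borel_of sigma_sets.Basic)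

lemma closedin_borel_of: "closedin Z F \<Longrightarrow> F \<in> sets (borel_of Z)"
  by (metis closedin_def openin_borel_of sets.compl_sets space_borel_of double_diff subset_refl)

lemma compactin_borel_of: "Hausdorff_space Z \<Longrightarrow> compactin Z K \<Longrightarrow> K \<in> sets (borel_of Z)"
  by (simp add: closedin_borel_of compactin_imp_closedin)

lemma continuous_map_measurable_borel_of:
  assumes "continuous_map Y Z f"
  shows "f \<in> borel_of Y \<rightarrow>\<^sub>M borel_of Z"
  unfolding borel_of_def[of Z]
proof (rule measurable_measure_of)
  show "{U. openin Z U} \<subseteq> Pow (topspace Z)" by (auto dest: openin_subset)
  show "f \<in> space (borel_of Y) \<rightarrow> topspace Z"
    using assms by (simp add: continuous_map_def)
  fix U assume "U \<in> {U. openin Z U}"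
  then have "openin Y {x \<in> topspace Y. f x \<in> U}"
    using assms by (simp add: continuous_map_def)
  moreover have "f -` U \<inter> space (borel_of Y) = {x \<in> topspace Y. f x \<in> U}" by auto
  ultimately show "f -` U \<inter> space (borel_of Y) \<in> sets (borel_of Y)"
    by (simp add: openin_borel_of)
qed

lemma lsc_ennreal_measurable_borel_of:
  fixes f :: "'a \<Rightarrow> ennreal"
  assumes "\<And>a. openin Z {x \<in> topspace Z. a < f x}"
  shows "f \<in> borel_measurable (borel_of Z)"
  using assms by (intro borel_measurableI_greater) (simp add: openin_borel_of)

text \<open>\<open>K - G\<close> and \<open>K - G'\<close> are disjoint compact sets; removing
  disjoint open neighbourhoods of them from \<open>K\<close> leaves the two pieces. This gives
  subadditivity of the inner content of open sets, whose closures may be far from compact.\<close>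

lemma compactin_subset_Un_open_split:
  assumes H: "Hausdorff_space Z" and K: "compactin Z K"
    and G: "openin Z G" "openin Z G'" and sub: "K \<subseteq> G \<union> G'"
  obtains L L' where "compactin Z L" "compactin Z L'" "L \<subseteq> G" "L' \<subseteq> G'" "K = L \<union> L'"
proof -
  have c: "compactin Z (K - V)" if "openin Z V" for V
  proof -
    have "closedin Z (topspace Z - V)" using that by auto
    then have "compactin Z ((topspace Z - V) \<inter> K)" using K by (rule closed_Int_compactin)
    moreover have "(topspace Z - V) \<inter> K = K - V" using compactin_subset_topspace[OF K] by auto
    ultimately show ?thesis by simp
  qed
  have "disjnt (K - G) (K - G')" using sub by (auto simp: disjnt_def)
  then obtain V V' where V: "openin Z V" "openin Z V'" "K - G \<subseteq> V" "K - G' \<subseteq> V'" "disjnt V V'"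
    using Hausdorff_space_compact_separation[OF H c[OF G(1)] c[OF G(2)]] by metis
  have "compactin Z (K - V)" "compactin Z (K - V')" using c V by auto
  moreover have "K - V \<subseteq> G" "K - V' \<subseteq> G'" using V by auto
  moreover have "K = (K - V) \<union> (K - V')" using V by (auto simp: disjnt_def)
  ultimately show ?thesis using that by blast
qed

text \<open>Halmos' extension of a content, without local compactness.\<close>

theorem content_extension:
  fixes Z :: "'a topology" and lam :: "'a set \<Rightarrow> ennreal"
  assumes H: "Hausdorff_space Z"
    and empty: "lam {} = 0"
    and sub: "\<And>K L. compactin Z K \<Longrightarrow> compactin Z L \<Longrightarrow> lam (K \<union> L) \<le> lam K + lam L"
    and super: "\<And>K L. compactin Z K \<Longrightarrow> compactin Z L \<Longrightarrow> K \<inter> L = {} \<Longrightarrow> lam K + lam L \<le> lam (K \<union> L)"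
  obtains \<gamma> where "sets \<gamma> = sets (borel_of Z)"
    "\<And>G. openin Z G \<Longrightarrow> emeasure \<gamma> G = (SUP K\<in>{K. compactin Z K \<and> K \<subseteq> G}. lam K)"
    "\<And>K. compactin Z K \<Longrightarrow> lam K \<le> emeasure \<gamma> K"
    "\<And>B. B \<in> sets \<gamma> \<Longrightarrow> emeasure \<gamma> B = (INF G\<in>{G. openin Z G \<and> B \<subseteq> G}. emeasure \<gamma> G)"
proof -
  \<comment> \<open>\<open>inn\<close> extends \<open>lam\<close> to open sets from inside, and
    \<open>f\<close> extends \<open>inn\<close> to all sets from outside; \<open>f\<close> is the
    outer measure.\<close>
  define inn where "inn G = (SUP K\<in>{K. compactin Z K \<and> K \<subseteq> G}. lam K)" for G
  define f where "f A = (INF G\<in>{G. openin Z G \<and> A \<subseteq> G}. inn G)" for A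
  let ?X = "topspace Z"
  have inn_mono: "inn G \<le> inn G'" if "G \<subseteq> G'" for G G'
    unfolding inn_def using that by (intro SUP_subset_mono) auto
  have lam_inn: "lam K \<le> inn G" if "compactin Z K" "K \<subseteq> G" for K G
    unfolding inn_def using that by (intro SUP_upper) auto
  have inn_empty: "inn {} = 0"
  proof -
    have "{K. compactin Z K \<and> K \<subseteq> {}} = {{}}" by auto
    then show ?thesis by (simp only: inn_def) (simp add: empty)
  qed
  have inn_Un: "inn (G \<union> G') \<le> inn G + inn G'" if GG: "openin Z G" "openin Z G'" for G G'
    unfolding inn_def[of "G \<union> G'"]
  proof (rule SUP_least, safe)
    fix K assume "compactin Z K" "K \<subseteq> G \<union> G'"
    then obtain L L' where L: "compactin Z L" "compactin Z L'" "L \<subseteq> G" "L' \<subseteq> G'" "K = L \<union> L'"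
      by (rule compactin_subset_Un_open_split[OF H _ GG])
    have "lam K \<le> lam L + lam L'" using sub[OF L(1,2)] L(5) by simp
    also have "\<dots> \<le> inn G + inn G'" using lam_inn[OF L(1,3)] lam_inn[OF L(2,4)] by (rule add_mono)
    finally show "lam K \<le> inn G + inn G'" .
  qed
  have inn_UN_fin: "inn (\<Union>i<n. G i) \<le> (\<Sum>i<n. inn (G i))"
    if "\<And>i. openin Z (G i)" for G and n :: nat
  proof (induction n)
    case 0 then show ?case by (simp add: inn_empty)
  next
    case (Suc n)
    have "inn (\<Union>i<Suc n. G i) \<le> inn (\<Union>i<n. G i) + inn (G n)"
      using inn_Un[of "\<Union>i<n. G i" "G n"] that openin_clauses(3)[of "G ` {..<n}" Z] by (auto simp add: lessThan_Suc Un_commute)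
    also have "\<dots> \<le> (\<Sum>i<Suc n. inn (G i))" using Suc by (simp add: add_mono)
    finally show ?case .
  qed
  \<comment> \<open>A compact subset of a countable union lies in a finite one, so countable
    subadditivity comes from the binary case.\<close>
  have inn_UN: "inn (\<Union>i. G i) \<le> (\<Sum>i. inn (G i))" if G: "\<And>i::nat. openin Z (G i)" for G
    unfolding inn_def[of "\<Union>i. G i"]
  proof (rule SUP_least, safe)
    fix K assume K: "compactin Z K" "K \<subseteq> (\<Union>i. G i)"
    then obtain \<F> where \<F>: "finite \<F>" "\<F> \<subseteq> range G" "K \<subseteq> \<Union>\<F>"
      using compactinD[of Z K "range G"] G by auto
    then obtain I where I: "finite I" "\<F> = G ` I" by (metis finite_subset_image)
    then obtain n where "I \<subseteq> {..<n}" using finite_nat_iff_bounded by auto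
    then have "K \<subseteq> (\<Union>i<n. G i)" using \<F> I by blast
    then have "lam K \<le> (\<Sum>i<n. inn (G i))"
      using order_trans[OF lam_inn[OF K(1)] inn_UN_fin[OF G]] by simp
    also have "\<dots> \<le> (\<Sum>i. inn (G i))" by (rule sum_le_suminf) auto
    finally show "lam K \<le> (\<Sum>i. inn (G i))" .
  qed
  have f_open: "f G = inn G" if "openin Z G" for G
    unfolding f_def using that by (intro antisym INF_lower INF_greatest inn_mono) auto
  have f_mono: "f A \<le> f B" if "A \<subseteq> B" for A B
    unfolding f_def using that by (intro INF_superset_mono) auto
  have f_le: "f A \<le> inn G" if "openin Z G" "A \<subseteq> G" for A G
    unfolding f_def using that by (intro INF_lower) auto
  have csub: "countably_subadditive (Pow ?X) f"
  proof (simp add: countably_subadditive_def, safe)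
    fix A :: "nat \<Rightarrow> _" assume A: "range A \<subseteq> Pow ?X"
    show "f (\<Union>i. A i) \<le> (\<Sum>n. f (A n))"
    proof (rule ennreal_le_epsilon)
      fix e :: real assume e: "0 < e" "(\<Sum>n. f (A n)) < top"
      then have *: "\<And>n. f (A n) < f (A n) + e * (1/2)^Suc n"
        by (auto simp add: less_top dest!: ennreal_suminf_lessD)
      have "\<exists>G. openin Z G \<and> A n \<subseteq> G \<and> inn G < f (A n) + e * (1/2)^Suc n" for n
        using *[of n] unfolding f_def[of "A n"] INF_less_iff by auto
      then obtain G where G: "\<And>n. openin Z (G n)" "\<And>n. A n \<subseteq> G n"
        "\<And>n. inn (G n) < f (A n) + e * (1/2)^Suc n" by metis
      have "f (\<Union>i. A i) \<le> inn (\<Union>i. G i)"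
        using G by (intro f_le) (auto intro: openin_Union)
      also have "\<dots> \<le> (\<Sum>i. inn (G i))" by (rule inn_UN[OF G(1)])
      also have "\<dots> \<le> (\<Sum>n. f (A n) + e * (1/2) ^ Suc n)"
        using G(3) by (intro suminf_le allI less_imp_le) auto
      also have "... = (\<Sum>n. f (A n)) + (\<Sum>n. ennreal e * ennreal ((1/2) ^ Suc n))"
        using \<open>0 < e\<close> by (subst suminf_add[symmetric])
                       (auto simp del: ennreal_suminf_cmult simp add: ennreal_mult[symmetric])
      also have "\<dots> = (\<Sum>n. f (A n)) + e"
        unfolding ennreal_suminf_cmult
        by (subst suminf_ennreal_eq[OF zero_le_power power_half_series]) auto
      finally show "f (\<Union>i. A i) \<le> (\<Sum>n. f (A n)) + e" .
    qed
  qed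
  have pos: "positive (Pow ?X) f"
    using f_open[of "{}"] by (simp add: positive_def inn_empty)
  have oms: "outer_measure_space (Pow ?X) f"
    unfolding outer_measure_space_def using pos csub f_mono by (auto simp: increasing_def)
  interpret P: sigma_algebra ?X "Pow ?X" by (rule sigma_algebra_Pow)
  have subadd: "f (A \<union> B) \<le> f A + f B" if "A \<subseteq> ?X" "B \<subseteq> ?X" "A \<inter> B = {}" for A B
    using P.countably_subadditive_subadditive[OF pos csub] that by (auto simp: subadditive_def)
  \<comment> \<open>Caratheodory's condition: for open \<open>U\<close> containing \<open>a\<close>,
    exhaust \<open>U \<inter> G\<close> by compact \<open>K\<close>, then \<open>U - K\<close>,
    which contains \<open>a - G\<close>, by compact \<open>L\<close>. The sets \<open>K\<close> and
    \<open>L\<close> are disjoint, so superadditivity of \<open>lam\<close> applies.\<close>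
  have open_L: "G \<in> lambda_system ?X (Pow ?X) f" if G: "openin Z G" for G
    unfolding P.lambda_system_eq
  proof (safe)
    show "x \<in> G \<Longrightarrow> x \<in> ?X" for x using G openin_subset by blast
    fix a assume a: "a \<subseteq> ?X"
    show "f (a \<inter> G) + f (a - G) = f a"
    proof (rule antisym)
      show "f (a \<inter> G) + f (a - G) \<le> f a"
        unfolding f_def[of a]
      proof (rule INF_greatest, safe)
        fix U assume U: "openin Z U" "a \<subseteq> U"
        have "f (a \<inter> G) + f (a - G) \<le> inn (U \<inter> G) + f (a - G)"
          using U G by (intro add_right_mono f_le) auto
        also have "\<dots> = (SUP K\<in>{K. compactin Z K \<and> K \<subseteq> U \<inter> G}. lam K + f (a - G))"
          unfolding inn_def by (rule ennreal_SUP_add_left[symmetric]) (auto intro: exI[of _ "{}"])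
        also have "\<dots> \<le> inn U"
        proof (rule SUP_least, safe)
          fix K assume K: "compactin Z K" "K \<subseteq> U \<inter> G"
          have o: "openin Z (U - K)"
            using K(1) H U(1) by (simp add: compactin_imp_closedin openin_diff)
          have "lam K + f (a - G) \<le> lam K + inn (U - K)"
            using U K by (intro add_left_mono f_le o) auto
          also have "\<dots> = (SUP L\<in>{L. compactin Z L \<and> L \<subseteq> U - K}. lam K + lam L)"
            unfolding inn_def by (rule ennreal_SUP_add_right) (auto intro: exI[of _ "{}"])
          also have "\<dots> \<le> inn U"
          proof (rule SUP_least, safe)
            fix L assume L: "compactin Z L" "L \<subseteq> U - K"
            have "lam K + lam L \<le> lam (K \<union> L)" using K L by (intro super[OF K(1) L(1)]) auto
            also have "\<dots> \<le> inn U" using K L by (intro lam_inn compactin_Un) auto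
            finally show "lam K + lam L \<le> inn U" .
          qed
          finally show "lam K + f (a - G) \<le> inn U" .
        qed
        finally show "f (a \<inter> G) + f (a - G) \<le> inn U" .
      qed
      show "f a \<le> f (a \<inter> G) + f (a - G)"
        using subadd[of "a \<inter> G" "a - G"] a by (auto simp: Int_Diff_Un)
    qed
  qed
  have ms: "measure_space ?X (lambda_system ?X (Pow ?X) f) f"
    by (rule P.caratheodory_lemma[OF oms])
  then have sL: "sigma_algebra ?X (lambda_system ?X (Pow ?X) f)" by (simp add: measure_space_def)
  have "sigma_sets ?X {U. openin Z U} \<subseteq> lambda_system ?X (Pow ?X) f"
    by (rule sigma_algebra.sigma_sets_subset[OF sL]) (auto intro: open_L)
  then have ms': "measure_space ?X (sets (borel_of Z)) f"
    using measure_down[OF ms] sets.sigma_algebra_axioms[of "borel_of Z"]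
    by (simp add: sets_borel_of sigma_algebra_sigma_sets openin_subset subset_iff Pow_def)
  define \<gamma> where "\<gamma> = measure_of ?X (sets (borel_of Z)) f"
  have sets: "sets \<gamma> = sets (borel_of Z)"
    unfolding \<gamma>_def by (metis sets.sets_measure_of_eq space_borel_of)
  have em: "emeasure \<gamma> B = f B" if "B \<in> sets \<gamma>" for B
    using that ms' unfolding \<gamma>_def[symmetric]
    by (intro emeasure_measure_of[OF \<gamma>_def])
       (auto simp: measure_space_def sets dest: subsetD[OF sets.sets_into_space])
  show ?thesis
  proof (rule that[OF sets])
    fix G assume "openin Z G"
    then show "emeasure \<gamma> G = (SUP K\<in>{K. compactin Z K \<and> K \<subseteq> G}. lam K)"
      using em f_open by (simp add: sets openin_borel_of inn_def)
  next
    fix K assume K: "compactin Z K"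
    then have "lam K \<le> f K" unfolding f_def by (intro INF_greatest lam_inn) auto
    then show "lam K \<le> emeasure \<gamma> K" using em K H by (simp add: sets compactin_borel_of)
  next
    fix B assume B: "B \<in> sets \<gamma>"
    show "emeasure \<gamma> B = (INF G\<in>{G. openin Z G \<and> B \<subseteq> G}. emeasure \<gamma> G)"
      unfolding em[OF B] f_def[of B]
      by (intro INF_cong refl) (use em f_open in \<open>simp add: sets openin_borel_of\<close>)
  qed
qed

lemma radon_measureI:
  assumes fin: "finite_measure M" and sets: "sets M = sets (borel_of Z)"
    and approx: "\<And>B e. B \<in> sets M \<Longrightarrow> 0 < e \<Longrightarrow>
      \<exists>K. compactin Z K \<and> K \<subseteq> B \<and> emeasure M B \<le> emeasure M K + ennreal e"
  shows "radon_measure Z M"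
  unfolding radon_measure_def inner_regular_compact_def
proof (intro conjI ballI sets)
  fix x assume "x \<in> topspace Z"
  then show "\<exists>U. openin Z U \<and> x \<in> U \<and> emeasure M U < \<infinity>"
    using finite_measure.emeasure_finite[OF fin] by (intro exI[of _ "topspace Z"]) (simp add: less_top)
next
  fix B assume B: "B \<in> sets M"
  show "emeasure M B = (SUP K\<in>{K. compactin Z K \<and> K \<subseteq> B}. emeasure M K)"
  proof (rule antisym)
    show "emeasure M B \<le> (SUP K\<in>{K. compactin Z K \<and> K \<subseteq> B}. emeasure M K)"
    proof (rule ennreal_le_epsilon)
      fix e :: real assume "0 < e"
      from approx[OF B this] obtain K where K: "compactin Z K" "K \<subseteq> B"
        "emeasure M B \<le> emeasure M K + ennreal e" by auto
      have "emeasure M K \<le> (SUP K\<in>{K. compactin Z K \<and> K \<subseteq> B}. emeasure M K)"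
        using K by (intro SUP_upper) auto
      then show "emeasure M B \<le> (SUP K\<in>{K. compactin Z K \<and> K \<subseteq> B}. emeasure M K) + ennreal e"
        using K(3) by (meson add_right_mono order_trans)
    qed
    show "(SUP K\<in>{K. compactin Z K \<and> K \<subseteq> B}. emeasure M K) \<le> emeasure M B"
      using B by (intro SUP_least emeasure_mono) auto
  qed
qed

lemma radon_measure_approx:
  assumes "radon_measure Z M" "B \<in> sets M" "emeasure M B < \<infinity>" "0 < (e::real)"
  obtains K where "compactin Z K" "K \<subseteq> B" "emeasure M B \<le> emeasure M K + ennreal e"
proof (cases "emeasure M B = 0")
  case True then show ?thesis using that[of "{}"] by simp
next
  case False
  have "emeasure M B - ennreal e < emeasure M B"
    using assms False by (cases "emeasure M B") (auto simp: ennreal_minus ennreal_lessI)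
  also have "emeasure M B = (SUP K\<in>{K. compactin Z K \<and> K \<subseteq> B}. emeasure M K)"
    using assms by (simp add: radon_measure_def inner_regular_compact_def)
  finally obtain K where "compactin Z K" "K \<subseteq> B" "emeasure M B - ennreal e < emeasure M K"
    unfolding less_SUP_iff by auto
  then show ?thesis using that[of K] ennreal_minus_le_iff[of "emeasure M B" "ennreal e" "emeasure M K"]
    by (simp add: add.commute less_imp_le)
qed

lemma Prob_sets: "\<mu> \<in> Prob T \<Longrightarrow> sets \<mu> = sets (borel_of T)"
  by (simp add: Prob_def radon_measure_def)

lemma Prob_space: "\<mu> \<in> Prob T \<Longrightarrow> space \<mu> = topspace T"
  using sets_eq_imp_space_eq[OF Prob_sets] by simp

lemma Prob_prob_space: "\<mu> \<in> Prob T \<Longrightarrow> prob_space \<mu>"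
  by (simp add: Prob_def)

lemma Prob_approx:
  assumes "\<mu> \<in> Prob T" "B \<in> sets (borel_of T)" "0 < (e::real)"
  obtains K where "compactin T K" "K \<subseteq> B" "measure \<mu> B \<le> measure \<mu> K + e"
proof -
  interpret prob_space \<mu> using assms by (simp add: Prob_def)
  have "radon_measure T \<mu>" using assms by (simp add: Prob_def)
  then obtain K where "compactin T K" "K \<subseteq> B" "emeasure \<mu> B \<le> emeasure \<mu> K + ennreal e"
    using radon_measure_approx[of T \<mu> B e] assms emeasure_finite[of B]
    unfolding Prob_sets[OF assms(1)] by (metis infinity_ennreal_def less_top)
  then show ?thesis using that[of K] assms(3)
    by (simp add: emeasure_eq_measure flip: ennreal_plus)
qed

lemma ProbI:
  assumes "prob_space M" and sets: "sets M = sets (borel_of Z)"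
    and approx: "\<And>B e. B \<in> sets (borel_of Z) \<Longrightarrow> 0 < e \<Longrightarrow>
      \<exists>K. compactin Z K \<and> K \<subseteq> B \<and> measure M B \<le> measure M K + e"
  shows "M \<in> Prob Z"
proof -
  interpret prob_space M by fact
  have "radon_measure Z M"
  proof (rule radon_measureI[OF _ sets])
    show "finite_measure M" by unfold_locales
    fix B and e :: real assume "B \<in> sets M" "0 < e"
    then show "\<exists>K. compactin Z K \<and> K \<subseteq> B \<and> emeasure M B \<le> emeasure M K + ennreal e"
      using approx[of B e] by (auto simp: sets emeasure_eq_measure simp flip: ennreal_plus)
  qed
  then show ?thesis using assms(1) by (simp add: Prob_def)
qed

text \<open>Inner regularity carries the inequality from compact to Borel sets; applied to a
  complement, with both total masses \<open>1\<close>, it reverses.\<close>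

lemma Prob_eqI_le_compact:
  assumes "\<mu> \<in> Prob T" "\<nu> \<in> Prob T" "Hausdorff_space T"
    and le: "\<And>K. compactin T K \<Longrightarrow> measure \<mu> K \<le> measure \<nu> K"
  shows "\<mu> = \<nu>"
proof (rule measure_eqI)
  show s: "sets \<mu> = sets \<nu>" using assms by (simp add: Prob_sets)
  interpret m: prob_space \<mu> using assms by (simp add: Prob_def)
  interpret n: prob_space \<nu> using assms by (simp add: Prob_def)
  have *: "measure \<mu> B \<le> measure \<nu> B" if B: "B \<in> sets (borel_of T)" for B
  proof (rule field_le_epsilon)
    fix e :: real assume "0 < e"
    then obtain K where K: "compactin T K" "K \<subseteq> B" "measure \<mu> B \<le> measure \<mu> K + e"
      using Prob_approx[OF assms(1) B] by metis
    have "measure \<nu> K \<le> measure \<nu> B"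
      using K B assms by (intro n.finite_measure_mono) (auto simp: Prob_sets)
    then show "measure \<mu> B \<le> measure \<nu> B + e" using le[OF K(1)] K(3) by linarith
  qed
  fix B assume "B \<in> sets \<mu>"
  then have B: "B \<in> sets (borel_of T)" using assms by (simp add: Prob_sets)
  then have "topspace T - B \<in> sets (borel_of T)" by (metis sets.compl_sets space_borel_of)
  then have "measure \<mu> (topspace T - B) \<le> measure \<nu> (topspace T - B)" by (rule *)
  then have "measure \<nu> B \<le> measure \<mu> B"
    using m.prob_compl[of B] n.prob_compl[of B] B assms by (simp add: Prob_sets Prob_space)
  then show "emeasure \<mu> B = emeasure \<nu> B"
    using *[OF B] by (simp add: m.emeasure_eq_measure n.emeasure_eq_measure)
qed

text \<open>A compact set that nearly exhausts the preimage of \<open>B\<close> has a compact image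
  inside \<open>B\<close>.\<close>

lemma Prob_distr:
  assumes M: "M \<in> Prob Y" and f: "continuous_map Y Z f"
    and HZ: "Hausdorff_space Z"
  shows "distr M (borel_of Z) f \<in> Prob Z"
proof -
  have fm: "f \<in> M \<rightarrow>\<^sub>M borel_of Z"
    using continuous_map_measurable_borel_of[OF f] measurable_cong_sets[OF Prob_sets[OF M] refl] by blast
  interpret M: prob_space M using M by (simp add: Prob_def)
  show ?thesis
  proof (rule ProbI)
    show "prob_space (distr M (borel_of Z) f)" by (rule M.prob_space_distr[OF fm])
    fix B and e :: real assume B: "B \<in> sets (borel_of Z)" and e: "0 < e"
    have "f -` B \<inter> space M \<in> sets (borel_of Y)"
      using measurable_sets[OF fm B] M by (simp add: Prob_sets)
    then obtain K where K: "compactin Y K" "K \<subseteq> f -` B \<inter> space M"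
      "measure M (f -` B \<inter> space M) \<le> measure M K + e" using Prob_approx[OF M _ e] by metis
    have cK: "compactin Z (f ` K)" using K f by (simp add: image_compactin)
    have fK: "f ` K \<in> sets (borel_of Z)" by (rule compactin_borel_of[OF HZ cK])
    have "measure M K \<le> measure M (f -` (f ` K) \<inter> space M)"
      using K measurable_sets[OF fm fK] by (intro M.finite_measure_mono) auto
    then show "\<exists>K. compactin Z K \<and> K \<subseteq> B \<and>
        measure (distr M (borel_of Z) f) B \<le> measure (distr M (borel_of Z) f) K + e"
      using cK K B fK fm by (intro exI[of _ "f ` K"]) (auto simp: measure_distr)
  qed simp
qed

subsection \<open>Couplings\<close>

locale hausdorff_univ =
  fixes T :: "'a topology"
  assumes H: "Hausdorff_space T" and top: "topspace T = UNIV"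
begin

abbreviation "TT \<equiv> prod_topology T T"

text \<open>Without countability the Borel sets of the product can exceed the product sigma-algebra,
  where alone the product measure is defined. The sets \<open>orect\<close> form a lattice that lies
  in both and still separates compact sets from complements of open ones.\<close>

abbreviation "orect R \<equiv> openin TT R \<and> R \<in> sets (borel_of T \<Otimes>\<^sub>M borel_of T)"

lemma HTT: "Hausdorff_space TT"
  using H by (simp add: Hausdorff_space_prod_topology)

lemma space_borel_T: "space (borel_of T) = UNIV" "space (borel_of TT) = UNIV"
  by (simp_all add: top)

text \<open>Open boxes inside \<open>G\<close> cover \<open>K\<close>; a finite union of them is
  open and product-measurable.\<close>

lemma orect_between:
  assumes K: "compactin TT K" and G: "openin TT G" "K \<subseteq> G"
  obtains R where "orect R" "K \<subseteq> R" "R \<subseteq> G"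
proof -
  define \<U> where "\<U> = {U \<times> V | U V. openin T U \<and> openin T V \<and> U \<times> V \<subseteq> G}"
  have "K \<subseteq> \<Union>\<U>"
  proof
    fix z assume "z \<in> K"
    then have "z \<in> G" using G by auto
    then obtain U V where "openin T U" "openin T V" "fst z \<in> U" "snd z \<in> V" "U \<times> V \<subseteq> G"
      using G(1) unfolding openin_prod_topology_alt by (metis prod.collapse)
    then show "z \<in> \<Union>\<U>" unfolding \<U>_def by (auto intro!: exI[of _ "U \<times> V"] simp: mem_Times_iff)
  qed
  moreover have o: "orect U" if "U \<in> \<U>" for U
    using that unfolding \<U>_def by (auto simp: openin_prod_Times_iff intro!: pair_measureI openin_borel_of)
  ultimately obtain \<F> where F: "finite \<F>" "\<F> \<subseteq> \<U>" "K \<subseteq> \<Union>\<F>"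
    using compactinD[OF K, of \<U>] by blast
  have "orect (\<Union>\<F>)" using F o by (auto intro!: sets.finite_Union)
  moreover have "\<Union>\<F> \<subseteq> G" using F unfolding \<U>_def by auto
  ultimately show ?thesis using that F by blast
qed

lemma coupling_marginals:
  assumes "\<gamma> \<in> couplings T \<mu> \<nu>" "A \<in> sets (borel_of T)"
  shows "measure \<gamma> (A \<times> UNIV) = measure \<mu> A" "measure \<gamma> (UNIV \<times> A) = measure \<nu> A"
  using assms by (simp_all add: couplings_def measure_def)

text \<open>The converse inclusion can fail, for instance for the diagonal of a very large discrete
  space.\<close>

lemma pair_sets_subset: "sets (borel_of T \<Otimes>\<^sub>M borel_of T) \<subseteq> sets (borel_of TT)"
proof -
  have "fst \<in> borel_of TT \<rightarrow>\<^sub>M borel_of T" "snd \<in> borel_of TT \<rightarrow>\<^sub>M borel_of T"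
    by (auto intro: continuous_map_measurable_borel_of continuous_map_fst continuous_map_snd)
  then have "(\<lambda>z. (fst z, snd z)) \<in> borel_of TT \<rightarrow>\<^sub>M borel_of T \<Otimes>\<^sub>M borel_of T"
    by (rule measurable_Pair)
  then have id: "(\<lambda>z. z) \<in> borel_of TT \<rightarrow>\<^sub>M borel_of T \<Otimes>\<^sub>M borel_of T" by simp
  show ?thesis
    using measurable_sets[OF id] by (auto simp: top)
qed

lemma couplingsI_distr:
  assumes "\<gamma> \<in> Prob TT" "distr \<gamma> (borel_of T) fst = \<mu>" "distr \<gamma> (borel_of T) snd = \<nu>"
  shows "\<gamma> \<in> couplings T \<mu> \<nu>"
proof -
  have m: "fst \<in> \<gamma> \<rightarrow>\<^sub>M borel_of T" "snd \<in> \<gamma> \<rightarrow>\<^sub>M borel_of T"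
    using Prob_sets[OF assms(1)] continuous_map_measurable_borel_of[OF continuous_map_fst, of T T]
      continuous_map_measurable_borel_of[OF continuous_map_snd, of T T]
    by (auto cong: measurable_cong_sets)
  have "emeasure \<gamma> (A \<times> UNIV) = emeasure \<mu> A" "emeasure \<gamma> (UNIV \<times> A) = emeasure \<nu> A"
    if "A \<in> sets (borel_of T)" for A
  proof -
    have "fst -` A \<inter> space \<gamma> = A \<times> UNIV" "snd -` A \<inter> space \<gamma> = UNIV \<times> A"
      by (auto simp: Prob_space[OF assms(1)] top)
    then show "emeasure \<gamma> (A \<times> UNIV) = emeasure \<mu> A" "emeasure \<gamma> (UNIV \<times> A) = emeasure \<nu> A"
      using that m assms(2,3) by (auto simp: emeasure_distr)
  qed
  then show ?thesis using assms(1) by (simp add: couplings_def)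
qed

text \<open>\<open>p\<close> stands for a product measure or for a pointwise limit of couplings,
  where only finite additivity survives. \<open>prect\<close> is the Frechet bound for couplings; it
  supplies both tightness and the marginals. The second conclusion says that mass of
  \<open>\<gamma>\<close> on an open set is already visible to \<open>p\<close>, which is what lower
  semicontinuity of costs needs.\<close>

theorem coupling_of_content:
  assumes mu: "\<mu> \<in> Prob T" and nu: "\<nu> \<in> Prob T"
    and p0: "\<And>R. orect R \<Longrightarrow> 0 \<le> p R" and p1: "\<And>R. orect R \<Longrightarrow> p R \<le> (1::real)"
    and pmono: "\<And>R R'. orect R \<Longrightarrow> orect R' \<Longrightarrow> R \<subseteq> R' \<Longrightarrow> p R \<le> p R'"
    and psub: "\<And>R R'. orect R \<Longrightarrow> orect R' \<Longrightarrow> p (R \<union> R') \<le> p R + p R'"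
    and psuper: "\<And>R R'. orect R \<Longrightarrow> orect R' \<Longrightarrow> R \<inter> R' = {} \<Longrightarrow> p R + p R' \<le> p (R \<union> R')"
    and prect: "\<And>U V. openin T U \<Longrightarrow> openin T V \<Longrightarrow> measure \<mu> U + measure \<nu> V - 1 \<le> p (U \<times> V)"
  obtains \<gamma> where "\<gamma> \<in> couplings T \<mu> \<nu>"
    "\<And>G r. openin TT G \<Longrightarrow> r < measure \<gamma> G \<Longrightarrow> \<exists>R. orect R \<and> R \<subseteq> G \<and> r < p R"
proof -
  interpret mu: prob_space \<mu> using mu by (simp add: Prob_def)
  interpret nu: prob_space \<nu> using nu by (simp add: Prob_def)
  \<comment> \<open>Regularization of \<open>p\<close> from outside; on compact sets it is a
    content.\<close>
  define lam where "lam K = (INF R\<in>{R. orect R \<and> K \<subseteq> R}. ennreal (p R))" for K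
  have OU: "orect UNIV" using openin_topspace[of TT] sets.top[of "borel_of T \<Otimes>\<^sub>M borel_of T"]
    by (simp add: top space_pair_measure)
  have OI: "orect (R \<inter> R')" "orect (R \<union> R')" if "orect R" "orect R'" for R R' using that by auto
  have pe: "p {} = 0" using psuper[of "{}" "{}"] p0[of "{}"] by simp
  have lam_le: "lam K \<le> ennreal (p R)" if "orect R" "K \<subseteq> R" for K R
    unfolding lam_def using that by (intro INF_lower) auto
  have lam1: "lam K \<le> 1" for K using lam_le[OF OU, of K] p1[OF OU] by (simp add: order_trans)
  have lam_close: "\<exists>R. orect R \<and> K \<subseteq> R \<and> ennreal (p R) \<le> lam K + ennreal e" if "0 < e" for K e
  proof -
    have "lam K \<noteq> top" using lam1[of K] by (auto simp: top_unique)
    then have "lam K < lam K + ennreal e" using that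
      by (cases "lam K") (auto simp: ennreal_lessI simp flip: ennreal_plus)
    then show ?thesis unfolding lam_def[of K] INF_less_iff by (auto intro: less_imp_le)
  qed
  have l0: "lam {} = 0" using lam_le[of "{}" "{}"] pe by simp
  have lsub: "lam (K \<union> L) \<le> lam K + lam L" for K L
  proof (rule ennreal_le_epsilon)
    fix e :: real assume "0 < e"
    then obtain R R' where R: "orect R" "K \<subseteq> R" "ennreal (p R) \<le> lam K + ennreal (e/2)"
      "orect R'" "L \<subseteq> R'" "ennreal (p R') \<le> lam L + ennreal (e/2)"
      using lam_close[of "e/2" K] lam_close[of "e/2" L] by auto
    have "lam (K \<union> L) \<le> ennreal (p (R \<union> R'))" using R by (intro lam_le OI) auto
    also have "\<dots> \<le> ennreal (p R + p R')" using R psub by (intro ennreal_leI) auto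
    also have "\<dots> = ennreal (p R) + ennreal (p R')" using R p0 by (simp add: ennreal_plus)
    also have "\<dots> \<le> (lam K + ennreal (e/2)) + (lam L + ennreal (e/2))" using R by (intro add_mono)
    also have "\<dots> = lam K + lam L + (ennreal (e/2) + ennreal (e/2))" by (simp add: ac_simps)
    also have "ennreal (e/2) + ennreal (e/2) = ennreal e" using \<open>0 < e\<close> by (simp flip: ennreal_plus)
    finally show "lam (K \<union> L) \<le> lam K + lam L + ennreal e" .
  qed
  have lsuper: "lam K + lam L \<le> lam (K \<union> L)"
    if K: "compactin TT K" and L: "compactin TT L" and "K \<inter> L = {}" for K L
  proof -
    have "disjnt K L" using that by (simp add: disjnt_def)
    then obtain G G' where G: "openin TT G" "openin TT G'" "K \<subseteq> G" "L \<subseteq> G'" "disjnt G G'"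
      using Hausdorff_space_compact_separation[OF HTT K L] by metis
    obtain Q where Q: "orect Q" "K \<subseteq> Q" "Q \<subseteq> G" using orect_between[OF K G(1,3)] by auto
    obtain Q' where Q': "orect Q'" "L \<subseteq> Q'" "Q' \<subseteq> G'" using orect_between[OF L G(2,4)] by auto
    show ?thesis unfolding lam_def[of "K \<union> L"]
    proof (rule INF_greatest)
      fix R assume "R \<in> {R. orect R \<and> K \<union> L \<subseteq> R}"
      then have R: "orect R" "K \<union> L \<subseteq> R" by auto
      have o: "orect (R \<inter> Q)" "orect (R \<inter> Q')" using R Q Q' by auto
      have "lam K + lam L \<le> ennreal (p (R \<inter> Q)) + ennreal (p (R \<inter> Q'))"
        using R Q Q' by (intro add_mono lam_le) auto
      also have "\<dots> = ennreal (p (R \<inter> Q) + p (R \<inter> Q'))" using p0 o by (simp add: ennreal_plus)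
      also have "\<dots> \<le> ennreal (p R)"
      proof (rule ennreal_leI)
        have "p (R \<inter> Q) + p (R \<inter> Q') \<le> p ((R \<inter> Q) \<union> (R \<inter> Q'))"
          using G Q Q' by (intro psuper o) (auto simp: disjnt_def)
        also have "\<dots> \<le> p R" using R o by (intro pmono) auto
        finally show "p (R \<inter> Q) + p (R \<inter> Q') \<le> p R" .
      qed
      finally show "lam K + lam L \<le> ennreal (p R)" .
    qed
  qed
  obtain \<gamma> where sets: "sets \<gamma> = sets (borel_of TT)"
    and gopen: "\<And>G. openin TT G \<Longrightarrow> emeasure \<gamma> G = (SUP K\<in>{K. compactin TT K \<and> K \<subseteq> G}. lam K)"
    and gcomp: "\<And>K. compactin TT K \<Longrightarrow> lam K \<le> emeasure \<gamma> K"
    and gouter: "\<And>B. B \<in> sets \<gamma> \<Longrightarrow> emeasure \<gamma> B = (INF G\<in>{G. openin TT G \<and> B \<subseteq> G}. emeasure \<gamma> G)"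
    by (rule content_extension[OF HTT l0 lsub lsuper]) (assumption | rule that)+
  have sp: "space \<gamma> = UNIV" using sets_eq_imp_space_eq[OF sets] by (simp add: top)
  \<comment> \<open>By Wallace's theorem an open set around \<open>C \<times> D\<close> contains an
    open box around it, and \<open>prect\<close> bounds \<open>p\<close> of that box from
    below.\<close>
  have tight: "\<exists>Q. compactin TT Q \<and> ennreal (1 - e) \<le> lam Q" if e: "0 < e" for e
  proof -
    have U: "UNIV \<in> sets (borel_of T)" by (metis sets.top space_borel_T(1))
    have e2: "0 < e/2" using e by simp
    obtain C where C: "compactin T C" "measure \<mu> UNIV \<le> measure \<mu> C + e/2"
      using Prob_approx[OF mu U e2] by metis
    obtain D where D: "compactin T D" "measure \<nu> UNIV \<le> measure \<nu> D + e/2"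
      using Prob_approx[OF nu U e2] by metis
    have [simp]: "measure \<mu> UNIV = 1" "measure \<nu> UNIV = 1"
      using mu.prob_space nu.prob_space by (simp_all add: Prob_space[OF mu] Prob_space[OF nu] top)
    have "ennreal (1 - e) \<le> lam (C \<times> D)" unfolding lam_def
    proof (rule INF_greatest)
      fix R assume "R \<in> {R. orect R \<and> C \<times> D \<subseteq> R}"
      then have R: "orect R" "C \<times> D \<subseteq> R" by auto
      then obtain U V where UV: "openin T U" "openin T V" "C \<subseteq> U" "D \<subseteq> V" "U \<times> V \<subseteq> R"
        using Wallace_theorem_prod_topology[OF C(1) D(1)] by metis
      have oUV: "orect (U \<times> V)" using UV by (auto simp: openin_prod_Times_iff intro!: pair_measureI openin_borel_of)
      have "measure \<mu> C \<le> measure \<mu> U" "measure \<nu> D \<le> measure \<nu> V"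
        using UV by (auto intro!: mu.finite_measure_mono nu.finite_measure_mono simp: Prob_sets[OF mu] Prob_sets[OF nu] openin_borel_of)
      then have "1 - e \<le> measure \<mu> U + measure \<nu> V - 1" using C D by simp
      also have "\<dots> \<le> p (U \<times> V)" by (rule prect[OF UV(1,2)])
      also have "\<dots> \<le> p R" using oUV R UV by (intro pmono) auto
      finally show "ennreal (1 - e) \<le> ennreal (p R)" by (rule ennreal_leI)
    qed
    then show ?thesis using C D by (intro exI[of _ "C \<times> D"]) (simp add: compactin_Times)
  qed
  have "emeasure \<gamma> UNIV = 1"
  proof (rule antisym)
    show "emeasure \<gamma> UNIV \<le> 1"
      using gopen[of UNIV] openin_topspace[of TT] lam1 by (simp add: top SUP_least)
    show "1 \<le> emeasure \<gamma> UNIV"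
    proof (rule ennreal_le_epsilon)
      fix e :: real assume e: "0 < e"
      obtain Q where Q: "compactin TT Q" "ennreal (1 - e) \<le> lam Q" using tight[OF e] by auto
      have "ennreal (1 - e) \<le> emeasure \<gamma> UNIV"
        using Q gcomp[of Q] emeasure_mono[of Q UNIV \<gamma>] sp sets.top[of \<gamma>] by (metis order_trans subset_UNIV)
      moreover have "1 \<le> ennreal (1 - e) + ennreal e"
      proof (cases "e \<le> 1")
        case True then show ?thesis using e by (simp flip: ennreal_plus)
      next
        case False then show ?thesis by (simp add: add_increasing)
      qed
      ultimately show "1 \<le> emeasure \<gamma> UNIV + ennreal e" by (meson add_right_mono order_trans)
    qed
  qed
  then have pg: "prob_space \<gamma>" by (intro prob_spaceI) (simp add: sp)
  then interpret g: prob_space \<gamma> .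
  \<comment> \<open>\<open>\<gamma>\<close> comes only with outer regularity: cover the complement
    of \<open>B\<close> by an open \<open>G\<close> of nearly the same mass, and remove
    \<open>G\<close> from a nearly full compact \<open>Q\<close>.\<close>
  have gP: "\<gamma> \<in> Prob TT"
  proof (rule ProbI[OF pg sets])
    fix B and e :: real assume B: "B \<in> sets (borel_of TT)" and e: "0 < e"
    have cB: "UNIV - B \<in> sets \<gamma>" using B sets sets.compl_sets[of B \<gamma>] by (simp add: sp)
    have "emeasure \<gamma> (UNIV - B) < emeasure \<gamma> (UNIV - B) + ennreal (e/2)"
      using e by (simp add: g.emeasure_eq_measure ennreal_less_iff flip: ennreal_plus)
    then obtain G where G: "openin TT G" "UNIV - B \<subseteq> G" "emeasure \<gamma> G < emeasure \<gamma> (UNIV - B) + ennreal (e/2)"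
      unfolding gouter[OF cB] INF_less_iff by auto
    have "ennreal (measure \<gamma> G) \<le> ennreal (measure \<gamma> (UNIV - B) + e/2)"
      using e less_imp_le[OF G(3)] by (simp add: g.emeasure_eq_measure flip: ennreal_plus)
    then have G3: "measure \<gamma> G \<le> measure \<gamma> (UNIV - B) + e/2"
      using e by (subst (asm) ennreal_le_iff) auto
    obtain Q where Q: "compactin TT Q" "ennreal (1 - e/2) \<le> lam Q" using tight[of "e/2"] e by auto
    have "ennreal (1 - e/2) \<le> emeasure \<gamma> Q" using Q gcomp order_trans by blast
    then have Q2: "1 - e/2 \<le> measure \<gamma> Q" by (simp add: g.emeasure_eq_measure)
    have cl: "closedin TT (topspace TT - G)" using G(1) by (rule openin_closedin_eq[THEN iffD1, THEN conjunct2])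
    have "compactin TT ((topspace TT - G) \<inter> Q)" by (rule closed_Int_compactin[OF cl Q(1)])
    then have cK: "compactin TT (Q - G)" by (simp add: top Int_commute Diff_eq)
    have Gs: "G \<in> sets \<gamma>" "Q \<in> sets \<gamma>" "B \<in> sets \<gamma>"
      using G Q B sets by (auto intro: openin_borel_of compactin_borel_of[OF HTT])
    have "measure \<gamma> B \<le> measure \<gamma> ((Q - G) \<union> (UNIV - Q) \<union> (G - (UNIV - B)))"
      using Gs cB by (intro g.finite_measure_mono) (auto simp: sp intro!: sets.Un sets.Diff sets.compl_sets[of _ \<gamma>, unfolded sp])
    also have "\<dots> \<le> measure \<gamma> (Q - G) + measure \<gamma> (UNIV - Q) + measure \<gamma> (G - (UNIV - B))"
      using Gs cB sets.compl_sets[of Q \<gamma>]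
      by (intro order_trans[OF measure_Un_le] add_right_mono measure_Un_le) (auto simp: sp)
    also have "measure \<gamma> (UNIV - Q) = 1 - measure \<gamma> Q" using g.prob_compl[of Q] Gs by (simp add: sp)
    also have "measure \<gamma> (G - (UNIV - B)) = measure \<gamma> G - measure \<gamma> (UNIV - B)"
      using Gs G cB by (intro g.finite_measure_Diff) auto
    finally have "measure \<gamma> B \<le> measure \<gamma> (Q - G) + e" using G3 Q2 by simp
    then show "\<exists>K. compactin TT K \<and> K \<subseteq> B \<and> measure \<gamma> B \<le> measure \<gamma> K + e"
      using cK G by (intro exI[of _ "Q - G"]) auto
  qed
  have test: "\<exists>R. orect R \<and> R \<subseteq> G \<and> r < p R" if G: "openin TT G" and r: "r < measure \<gamma> G" for G r
  proof (cases "r < 0")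
    case True then show ?thesis using pe by (intro exI[of _ "{}"]) auto
  next
    case False
    have "ennreal r < emeasure \<gamma> G" using r False by (simp add: g.emeasure_eq_measure ennreal_less_iff)
    then obtain K where K: "compactin TT K" "K \<subseteq> G" "ennreal r < lam K"
      unfolding gopen[OF G] less_SUP_iff by auto
    obtain R where R: "orect R" "K \<subseteq> R" "R \<subseteq> G" using orect_between[OF K(1) G K(2)] by auto
    have "ennreal r < ennreal (p R)" using K(3) lam_le[OF R(1,2)] by order
    then have "r < p R" using False by (simp add: ennreal_less_iff)
    then show ?thesis using R by blast
  qed
  have pU: "p R \<le> 1 - p R'" if "orect R" "orect R'" "R \<inter> R' = {}" for R R'
    using psuper[OF that] p1[OF OI(2)[OF that(1,2)]] by linarith
  have oT: "openin T UNIV" using openin_topspace[of T] by (simp add: top)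
  \<comment> \<open>By inner regularity one inequality on compact sets identifies a marginal. A
    compact \<open>C\<close> and a compact \<open>L\<close> in its complement have disjoint open
    neighbourhoods \<open>U\<close> and \<open>V\<close>; their preimages are disjoint, so
    \<open>\<gamma>\<close> of the former is at most one minus \<open>p\<close> of the
    latter.\<close>
  have marg: "distr \<gamma> (borel_of T) f = \<sigma>"
    if f: "continuous_map TT T f" and s: "\<sigma> \<in> Prob T"
      and ps: "\<And>V. openin T V \<Longrightarrow> orect (f -` V) \<and> measure \<sigma> V \<le> p (f -` V)" for f \<sigma>
  proof (rule Prob_eqI_le_compact[OF Prob_distr[OF gP f H] s H])
    interpret s: prob_space \<sigma> using s by (simp add: Prob_def)
    fix C assume C: "compactin T C"
    have fm: "f \<in> \<gamma> \<rightarrow>\<^sub>M borel_of T"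
      using continuous_map_measurable_borel_of[OF f] measurable_cong_sets[OF sets refl] by blast
    have Cs: "C \<in> sets (borel_of T)" by (rule compactin_borel_of[OF H C])
    have cCs: "UNIV - C \<in> sets (borel_of T)" using Cs by (metis sets.compl_sets space_borel_T(1))
    show "measure (distr \<gamma> (borel_of T) f) C \<le> measure \<sigma> C"
    proof (rule field_le_epsilon)
      fix e :: real assume e: "0 < e"
      obtain L where L: "compactin T L" "L \<subseteq> UNIV - C" "measure \<sigma> (UNIV - C) \<le> measure \<sigma> L + e"
        using Prob_approx[OF s cCs e] by metis
      have "disjnt C L" using L by (auto simp: disjnt_def)
      then obtain U V where UV: "openin T U" "openin T V" "C \<subseteq> U" "L \<subseteq> V" "disjnt U V"
        using Hausdorff_space_compact_separation[OF H C L(1)] by metis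
      have "measure \<gamma> (f -` C) \<le> measure \<gamma> (f -` U)"
        using UV ps[OF UV(1)] sets openin_borel_of[of TT "f -` U"] by (intro g.finite_measure_mono) auto
      also have "\<dots> \<le> 1 - p (f -` V)"
      proof (rule ccontr)
        assume "\<not> measure \<gamma> (f -` U) \<le> 1 - p (f -` V)"
        then obtain R where R: "orect R" "R \<subseteq> f -` U" "1 - p (f -` V) < p R"
          using test[of "f -` U" "1 - p (f -` V)"] ps[OF UV(1)] by auto
        have "R \<inter> f -` V = {}" using R UV by (auto simp: disjnt_def)
        then show False using pU[OF R(1), of "f -` V"] ps[OF UV(2)] R by auto
      qed
      also have "\<dots> \<le> 1 - measure \<sigma> V" using ps[OF UV(2)] by simp
      also have "\<dots> \<le> 1 - measure \<sigma> L"
        using UV by (simp add: s.finite_measure_mono Prob_sets[OF s] openin_borel_of)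
      also have "\<dots> \<le> measure \<sigma> C + e"
        using L(3) s.prob_compl[of C] Cs by (simp add: Prob_sets[OF s] Prob_space[OF s] top)
      finally show "measure (distr \<gamma> (borel_of T) f) C \<le> measure \<sigma> C + e"
        using fm Cs by (simp add: measure_distr sp)
    qed
  qed
  have v1: "fst -` V = V \<times> UNIV" "snd -` V = UNIV \<times> V" for V :: "'a set" by auto
  have Us: "UNIV \<in> sets (borel_of T)" by (metis sets.top space_borel_T(1))
  have m1: "measure \<mu> UNIV = 1" "measure \<nu> UNIV = 1"
      using mu.prob_space nu.prob_space by (simp_all add: Prob_space[OF mu] Prob_space[OF nu] top)
  have "\<gamma> \<in> couplings T \<mu> \<nu>"
  proof (rule couplingsI_distr[OF gP])
    \<comment> \<open>With the whole space as second factor the Frechet bound reads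
      \<open>measure \<mu> U \<le> p (U \<times> UNIV)\<close>.\<close>
    show "distr \<gamma> (borel_of T) fst = \<mu>"
      using prect[OF _ oT] m1 oT
      by (intro marg[OF continuous_map_fst mu]) (auto simp: v1 openin_prod_Times_iff intro!: pair_measureI openin_borel_of Us)
    show "distr \<gamma> (borel_of T) snd = \<nu>"
      using prect[OF oT] m1 oT
      by (intro marg[OF continuous_map_snd nu]) (auto simp: v1 openin_prod_Times_iff intro!: pair_measureI openin_borel_of Us)
  qed
  then show ?thesis by (rule that) (rule test)
qed

end

section \<open>Pointwise limits of set functions, and layer sums\<close>

lemma compact_unit_functions: "compact {f :: 'b \<Rightarrow> real. \<forall>B. 0 \<le> f B \<and> f B \<le> 1}"
proof -
  have "compactin (product_topology (\<lambda>_::'b. euclideanreal) UNIV) (PiE UNIV (\<lambda>_. {0..1}))"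
    by (simp add: compactin_PiE)
  moreover have "PiE UNIV (\<lambda>_::'b. {0..1::real}) = {f. \<forall>B. 0 \<le> f B \<and> f B \<le> 1}"
    by (auto simp: PiE_def Pi_def)
  ultimately show ?thesis by (simp add: euclidean_product_topology)
qed

text \<open>\<open>F'\<close> plays the role of a subnet: the index \<open>B\<close> ranges over an
  arbitrary type, so subsequences do not suffice.\<close>

lemma convergent_subfilter_unit_functions:
  fixes \<phi> :: "'i \<Rightarrow> 'b \<Rightarrow> real"
  assumes F: "F \<noteq> bot" and r: "\<And>i B. 0 \<le> \<phi> i B" "\<And>i B. \<phi> i B \<le> 1"
  obtains F' p where "F' \<noteq> bot" "F' \<le> F" "\<And>B. ((\<lambda>i. \<phi> i B) \<longlongrightarrow> p B) F'"
proof -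
  let ?C = "{f :: 'b \<Rightarrow> real. \<forall>B. 0 \<le> f B \<and> f B \<le> 1}"
  have "eventually (\<lambda>f. f \<in> ?C) (filtermap \<phi> F)" using r by (auto simp: eventually_filtermap)
  moreover have "filtermap \<phi> F \<noteq> bot" using F by (simp add: filtermap_bot_iff)
  ultimately obtain p where p: "inf (nhds p) (filtermap \<phi> F) \<noteq> bot"
    using compact_unit_functions[where 'b='b] unfolding compact_filter by blast
  \<comment> \<open>\<open>p\<close> is a cluster point of \<open>\<phi>\<close> along
    \<open>F\<close>; adding the preimages of its neighbourhoods to \<open>F\<close> keeps the
    filter proper.\<close>
  let ?F = "inf F (filtercomap \<phi> (nhds p))"
  have "?F \<noteq> bot"
  proof
    assume "?F = bot"
    then have "eventually (\<lambda>_. False) ?F" by simp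
    then obtain P Q where P: "eventually P F" "eventually Q (nhds p)" "\<And>i. P i \<Longrightarrow> Q (\<phi> i) \<Longrightarrow> False"
      unfolding eventually_inf eventually_filtercomap by blast
    have "eventually (\<lambda>f. \<not> Q f) (filtermap \<phi> F)"
      unfolding eventually_filtermap using P(1) by (rule eventually_mono) (use P(3) in auto)
    then have "eventually (\<lambda>_. False) (inf (nhds p) (filtermap \<phi> F))"
      using P(2) unfolding eventually_inf by blast
    then show False using p by (simp add: trivial_limit_def)
  qed
  moreover have "((\<lambda>i. \<phi> i B) \<longlongrightarrow> p B) ?F" for B
  proof -
    have o: "open ((\<lambda>f :: 'b \<Rightarrow> real. f B) -` S)" if "open S" for S
      by (rule open_vimage[OF that continuous_on_product_coordinates])
    show ?thesis
    proof (rule topological_tendstoI)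
      fix S assume "open S" "p B \<in> S"
      then have "eventually (\<lambda>f. f B \<in> S) (nhds p)"
        using o[of S] eventually_nhds_in_open[of "(\<lambda>f. f B) -` S" p] by simp
      then have "eventually (\<lambda>i. \<phi> i B \<in> S) (filtercomap \<phi> (nhds p))"
        by (rule eventually_filtercomapI)
      then show "eventually (\<lambda>i. \<phi> i B \<in> S) ?F" by (rule filter_leD[OF inf_le2])
    qed
  qed
  ultimately show ?thesis using that[of ?F p] by simp
qed

text \<open>A lower Riemann sum of the layer-cake formula: at most \<open>c / \<delta>\<close> of
  the levels \<open>\<delta> k\<close> with \<open>k \<ge> 1\<close> lie below
  \<open>c\<close>.\<close>

lemma sum_levels_le:
  fixes c :: ennreal and \<delta> :: real
  assumes d: "0 < \<delta>"
  shows "(\<Sum>k=1..N. ennreal \<delta> * indicator {x. ennreal (\<delta> * real k) < x} c) \<le> c"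
proof (cases c)
  case top then show ?thesis by simp
next
  case (real r)
  let ?S = "{k \<in> {1..N}. \<delta> * real k < r}"
  have eq: "indicator {x. ennreal (\<delta> * real k) < x} c = (if \<delta> * real k < r then 1 else (0::ennreal))" for k
    using real d by (simp add: indicator_def ennreal_less_iff)
  have "(\<Sum>k=1..N. ennreal \<delta> * indicator {x. ennreal (\<delta> * real k) < x} c) = (\<Sum>k\<in>?S. ennreal \<delta>)"
    unfolding eq by (subst sum.inter_filter) (auto intro!: sum.cong)
  also have "\<dots> = of_nat (card ?S) * ennreal \<delta>" by simp
  also have "\<dots> \<le> ennreal r"
  proof (cases "?S = {}")
    case False
    define M where "M = Max ?S"
    have M: "M \<in> ?S" unfolding M_def using False by (intro Max_in) auto
    have "?S \<subseteq> {1..M}" unfolding M_def using False by (auto intro!: Max_ge)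
    then have "card ?S \<le> M" using card_mono[of "{1..M}" ?S] by simp
    then have "real (card ?S) * \<delta> \<le> real M * \<delta>" using d by (simp add: mult_right_mono)
    also have "\<dots> \<le> r" using M by (simp add: mult.commute)
    finally have "ennreal (real (card ?S) * \<delta>) \<le> ennreal r" by (rule ennreal_leI)
    then show ?thesis using d by (simp add: ennreal_mult ennreal_of_nat_eq_real_of_nat)
  next
    case True then show ?thesis by (simp only: True) simp
  qed
  finally show ?thesis using real by simp
qed

text \<open>With step \<open>1/n\<close> up to height \<open>n\<close>, the layer sum misses the
  truncated value by at most one step.\<close>

lemma sum_levels_ge:
  fixes c :: ennreal and n :: nat
  shows "min c (of_nat n) \<le> (\<Sum>k=1..n*n. ennreal (1/n) * indicator {x. ennreal ((1/n) * real k) < x} c) + ennreal (1/n)"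
proof (cases "n = 0")
  case True then show ?thesis by simp
next
  case n: False
  let ?\<delta> = "1 / real n"
  obtain r where r: "0 \<le> r" "r \<le> real n" "min c (of_nat n) = ennreal r"
  proof (cases "min c (of_nat n)")
    case (real r)
    have "ennreal r \<le> ennreal (real n)" using real(2) by (metis ennreal_of_nat_eq_real_of_nat min.cobounded2)
    then show ?thesis using that[of r] real by (simp)
  next
    case top then have "(top::ennreal) \<le> of_nat n" by (metis min.cobounded2)
    then show ?thesis by (simp add: top_unique)
  qed
  have rc: "ennreal r \<le> c" using r(3) by (metis min.cobounded1)
  \<comment> \<open>The number of indices \<open>k \<ge> 1\<close> with \<open>k / n < r\<close>; it
    is \<open>0\<close> for \<open>r = 0\<close>.\<close>
  define m where "m = nat (\<lceil>r * n\<rceil> - 1)"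
  have m1: "real m + 1 \<ge> r * n" unfolding m_def by linarith
  have m2: "k \<in> {1..n*n} \<and> ennreal (?\<delta> * real k) < c" if "k \<in> {1..m}" for k
  proof -
    have "real k < r * n" using that unfolding m_def by (auto simp: le_nat_iff) linarith
    also have "\<dots> \<le> real n * real n" using r by (simp add: mult_right_mono)
    finally have "real k < real (n * n)" by simp
    moreover have "?\<delta> * real k < r" using \<open>real k < r * n\<close> n by (simp add: field_simps)
    then have "ennreal (?\<delta> * real k) < ennreal r" using n by (subst ennreal_less_iff) auto
    moreover have "k \<le> n * n" using \<open>real k < real (n * n)\<close> by linarith
    ultimately show ?thesis using that rc by (auto intro: less_le_trans)
  qed
  have "ennreal r \<le> ennreal (real m * ?\<delta> + ?\<delta>)"
    using m1 n by (intro ennreal_leI) (simp add: field_simps)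
  also have "\<dots> = (\<Sum>k=1..m. ennreal ?\<delta>) + ennreal ?\<delta>"
    by (simp add: ennreal_of_nat_eq_real_of_nat flip: ennreal_mult ennreal_plus)
  also have "(\<Sum>k=1..m. ennreal ?\<delta>) = (\<Sum>k=1..m. ennreal ?\<delta> * indicator {x. ennreal (?\<delta> * real k) < x} c)"
    using m2 by (intro sum.cong) auto
  also have "\<dots> \<le> (\<Sum>k=1..n*n. ennreal ?\<delta> * indicator {x. ennreal (?\<delta> * real k) < x} c)"
    using m2 by (intro sum_mono2) auto
  finally show ?thesis using r(3) by simp
qed

text \<open>An integral is thus controlled by the measures of finitely many superlevel sets at a
  time, which are open when \<open>c\<close> is lower semicontinuous. Truncation at height
  \<open>n\<close> is removed by Fatou's lemma; the discretization error is \<open>1/n\<close> times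
  the finite total mass.\<close>

lemma nn_integral_le_levels:
  fixes c :: "'b \<Rightarrow> ennreal"
  assumes fin: "finite_measure M" and c[measurable]: "c \<in> borel_measurable M"
    and le: "\<And>\<delta> N. 0 < \<delta> \<Longrightarrow>
      (\<Sum>k=1..N. ennreal \<delta> * emeasure M {z \<in> space M. ennreal (\<delta> * real k) < c z}) \<le> a"
  shows "(\<integral>\<^sup>+z. c z \<partial>M) \<le> a"
proof -
  interpret finite_measure M by fact
  define s where "s n z = (\<Sum>k=1..n*n. ennreal (1/n) * indicator {x. ennreal ((1/n) * real k) < x} (c z))" for n :: nat and z
  have sm[measurable]: "s n \<in> borel_measurable M" for n unfolding s_def by measurable
  have int_s: "(\<integral>\<^sup>+z. s n z \<partial>M) \<le> a" if "0 < n" for n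
  proof -
    have "(\<integral>\<^sup>+z. s n z \<partial>M) = (\<Sum>k=1..n*n. \<integral>\<^sup>+z. ennreal (1/n) * indicator {x. ennreal ((1/n) * real k) < x} (c z) \<partial>M)"
      unfolding s_def by (rule nn_integral_sum) measurable
    also have "\<dots> = (\<Sum>k=1..n*n. ennreal (1/n) * emeasure M {z \<in> space M. ennreal ((1/n) * real k) < c z})"
    proof (intro sum.cong refl)
      fix k
      have "(\<integral>\<^sup>+z. ennreal (1/n) * indicator {x. ennreal ((1/n) * real k) < x} (c z) \<partial>M)
        = (\<integral>\<^sup>+z. ennreal (1/n) * indicator {z \<in> space M. ennreal ((1/n) * real k) < c z} z \<partial>M)"
        by (intro nn_integral_cong) (auto simp: indicator_def)
      also have "\<dots> = ennreal (1/n) * emeasure M {z \<in> space M. ennreal ((1/n) * real k) < c z}"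
        by (rule nn_integral_cmult_indicator) measurable
      finally show "(\<integral>\<^sup>+z. ennreal (1/n) * indicator {x. ennreal ((1/n) * real k) < x} (c z) \<partial>M)
        = ennreal (1/n) * emeasure M {z \<in> space M. ennreal ((1/n) * real k) < c z}" .
    qed
    also have "\<dots> \<le> a" using that by (intro le) simp
    finally show ?thesis .
  qed
  have lim: "(\<lambda>n. min (c z) (of_nat n)) \<longlonglongrightarrow> c z" for z
  proof -
    have "(\<lambda>n. min (c z) (of_nat n)) \<longlonglongrightarrow> min (c z) (top::ennreal)"
      by (intro tendsto_min tendsto_const) (rule of_nat_tendsto_top_ennreal)
    then show ?thesis by simp
  qed
  have "(\<integral>\<^sup>+z. c z \<partial>M) = (\<integral>\<^sup>+z. liminf (\<lambda>n. min (c z) (of_nat n)) \<partial>M)"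
    using lim by (intro nn_integral_cong) (rule lim_imp_Liminf[symmetric]; simp)
  also have "\<dots> \<le> liminf (\<lambda>n. \<integral>\<^sup>+z. min (c z) (of_nat n) \<partial>M)"
    by (rule nn_integral_liminf) measurable
  also have "\<dots> \<le> liminf (\<lambda>n. a + ennreal (1 / real n) * emeasure M (space M))"
  proof (rule Liminf_mono)
    show "\<forall>\<^sub>F n in sequentially. (\<integral>\<^sup>+z. min (c z) (of_nat n) \<partial>M) \<le> a + ennreal (1 / real n) * emeasure M (space M)"
      using eventually_gt_at_top[of 0]
    proof eventually_elim
      case (elim n)
      have "(\<integral>\<^sup>+z. min (c z) (of_nat n) \<partial>M) \<le> (\<integral>\<^sup>+z. s n z + ennreal (1/n) \<partial>M)"
        unfolding s_def by (intro nn_integral_mono sum_levels_ge)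
      also have "\<dots> = (\<integral>\<^sup>+z. s n z \<partial>M) + ennreal (1/n) * emeasure M (space M)"
        by (subst nn_integral_add) auto
      also have "\<dots> \<le> a + ennreal (1/n) * emeasure M (space M)"
        using int_s[OF elim] by (rule add_right_mono)
      finally show ?case .
    qed
  qed
  also have "\<dots> = a"
  proof (rule lim_imp_Liminf)
    have "(\<lambda>n. ennreal (1 / real n * measure M (space M))) \<longlonglongrightarrow> ennreal 0"
      by (intro tendsto_ennrealI tendsto_mult_left_zero lim_1_over_n)
    then have "(\<lambda>n. a + ennreal (1 / real n * measure M (space M))) \<longlonglongrightarrow> a + ennreal 0"
      by (intro tendsto_add tendsto_const)
    then show "(\<lambda>n. a + ennreal (1 / real n) * emeasure M (space M)) \<longlonglongrightarrow> a"
      by (simp add: emeasure_eq_measure flip: ennreal_mult)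
  qed simp
  finally show ?thesis .
qed

section \<open>Existence and stability of couplings\<close>

context hausdorff_univ
begin

text \<open>The product measure lives on the product sigma-algebra;
  \<open>coupling_of_content\<close> turns its values on \<open>orect\<close> sets into a Radon
  measure on all Borel sets of the product.\<close>

lemma product_coupling:
  assumes mu: "\<mu> \<in> Prob T" and nu: "\<nu> \<in> Prob T"
  obtains \<gamma> where "\<gamma> \<in> couplings T \<mu> \<nu>"
proof -
  interpret mu: prob_space \<mu> using mu by (simp add: Prob_def)
  interpret nu: prob_space \<nu> using nu by (simp add: Prob_def)
  interpret pair_prob_space \<mu> \<nu> ..
  have s: "sets (\<mu> \<Otimes>\<^sub>M \<nu>) = sets (borel_of T \<Otimes>\<^sub>M borel_of T)"
    using Prob_sets[OF mu] Prob_sets[OF nu] by (rule sets_pair_measure_cong)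
  let ?p = "measure (\<mu> \<Otimes>\<^sub>M \<nu>)"
  have rect: "measure \<mu> U + measure \<nu> V - 1 \<le> ?p (U \<times> V)" if "openin T U" "openin T V" for U V
  proof -
    have "?p (U \<times> V) = measure \<mu> U * measure \<nu> V"
      using that mu nu by (simp add: measure_def nu.emeasure_pair_measure_Times Prob_sets openin_borel_of enn2real_mult)
    \<comment> \<open>The Frechet bound is \<open>(1 - a) (1 - b) \<ge> 0\<close> for the masses
      \<open>a\<close> and \<open>b\<close> of the sides.\<close>
    moreover have "0 \<le> (1 - measure \<mu> U) * (1 - measure \<nu> V)" by (intro mult_nonneg_nonneg) auto
    ultimately show ?thesis by (simp add: algebra_simps)
  qed
  show ?thesis
    by (rule coupling_of_content[OF mu nu, of ?p])
       (use s rect that in \<open>auto intro: finite_measure_mono measure_Un_le simp: finite_measure_Union\<close>)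
qed

text \<open>The couplings \<open>P i\<close> are seen as set functions, and a pointwise limit is
  extended to a Radon measure; its tightness comes from the limits \<open>\<mu>\<close> and
  \<open>\<nu>\<close> alone. Filters and one-sided bounds on open sets are used because the narrow
  topology need not be metrizable.\<close>

lemma coupling_lsc:
  fixes c :: "'a \<times> 'a \<Rightarrow> ennreal" and P :: "'i \<Rightarrow> ('a \<times> 'a) measure"
  assumes F: "F \<noteq> bot" and mu: "\<mu> \<in> Prob T" and nu: "\<nu> \<in> Prob T"
    and c: "\<And>t. openin TT {z. t < c z}"
    and M: "\<And>U e. openin T U \<Longrightarrow> 0 < e \<Longrightarrow> eventually (\<lambda>i. measure \<mu> U - e < measure (M i) U) F"
    and N: "\<And>U e. openin T U \<Longrightarrow> 0 < e \<Longrightarrow> eventually (\<lambda>i. measure \<nu> U - e < measure (N i) U) F"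
    and P: "eventually (\<lambda>i. P i \<in> couplings T (M i) (N i) \<and> (\<integral>\<^sup>+z. c z \<partial>P i) \<le> a) F"
  obtains \<gamma> where "\<gamma> \<in> couplings T \<mu> \<nu>" "(\<integral>\<^sup>+z. c z \<partial>\<gamma>) \<le> a"
proof -
  \<comment> \<open>The minimum keeps values in the unit interval at indices where
    \<open>P i\<close> is not a probability measure; eventually it changes nothing.\<close>
  define \<phi> where "\<phi> i B = min 1 (measure (P i) B)" for i B
  obtain F' p where F': "F' \<noteq> bot" "F' \<le> F" and lim: "\<And>B. ((\<lambda>i. \<phi> i B) \<longlongrightarrow> p B) F'"
    by (rule convergent_subfilter_unit_functions[OF F, of \<phi>]) (auto simp: \<phi>_def)
  have ev: "eventually (\<lambda>i. P i \<in> couplings T (M i) (N i) \<and> (\<integral>\<^sup>+z. c z \<partial>P i) \<le> a) F'"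
    by (rule filter_leD[OF F'(2) P])
  have evp: "eventually (\<lambda>i. prob_space (P i) \<and> sets (P i) = sets (borel_of TT) \<and> (\<forall>B. \<phi> i B = measure (P i) B)) F'"
    using ev
  proof eventually_elim
    case (elim i)
    then have "P i \<in> Prob TT" by (simp add: couplings_def)
    then show ?case using prob_space.prob_le_1[OF Prob_prob_space]
      by (auto simp: \<phi>_def Prob_sets Prob_prob_space intro!: min_absorb2)
  qed
  have bs: "R \<in> sets (borel_of TT)" if "orect R" for R using that by (simp add: openin_borel_of)
  have r1: "0 \<le> p R" "p R \<le> 1" for R
    using tendsto_lowerbound[OF lim _ F'(1), of 0 R] tendsto_upperbound[OF lim _ F'(1), of R 1]
    by (auto simp: \<phi>_def)
  have rmono: "p R \<le> p R'" if "orect R" "orect R'" "R \<subseteq> R'" for R R'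
  proof (rule tendsto_le[OF F'(1) lim lim])
    show "\<forall>\<^sub>F i in F'. \<phi> i R \<le> \<phi> i R'" using evp
      by eventually_elim (use that bs in \<open>auto intro!: finite_measure.finite_measure_mono prob_space.finite_measure\<close>)
  qed
  have rsub: "p (R \<union> R') \<le> p R + p R'" if "orect R" "orect R'" for R R'
  proof (rule tendsto_le[OF F'(1) tendsto_add[OF lim lim] lim])
    show "\<forall>\<^sub>F i in F'. \<phi> i (R \<union> R') \<le> \<phi> i R + \<phi> i R'" using evp
      by eventually_elim (use that bs in \<open>auto intro!: measure_Un_le\<close>)
  qed
  have rsup: "p R + p R' \<le> p (R \<union> R')" if "orect R" "orect R'" "R \<inter> R' = {}" for R R'
  proof (rule tendsto_le[OF F'(1) lim tendsto_add[OF lim lim]])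
    show "\<forall>\<^sub>F i in F'. \<phi> i R + \<phi> i R' \<le> \<phi> i (R \<union> R')" using evp
      by eventually_elim (use that bs in \<open>auto simp: finite_measure.finite_measure_Union prob_space.finite_measure\<close>)
  qed
  \<comment> \<open>Any coupling gives \<open>U \<times> V\<close> at least the mass of
    \<open>U \<times> UNIV\<close> minus that of \<open>UNIV \<times> (UNIV - V)\<close>; this
    passes to the limit.\<close>
  have rrect: "measure \<mu> U + measure \<nu> V - 1 \<le> p (U \<times> V)" if UV: "openin T U" "openin T V" for U V
  proof (rule field_le_epsilon)
    fix e :: real assume e: "0 < e"
    have "measure \<mu> U + measure \<nu> V - 1 - e \<le> p (U \<times> V)"
    proof (rule tendsto_lowerbound[OF lim _ F'(1)])
      have e2: "0 < e/2" using e by simp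
      show "\<forall>\<^sub>F i in F'. measure \<mu> U + measure \<nu> V - 1 - e \<le> \<phi> i (U \<times> V)"
        using evp ev filter_leD[OF F'(2) M[OF UV(1) e2]] filter_leD[OF F'(2) N[OF UV(2) e2]]
      proof eventually_elim
        case (elim i)
        interpret p: prob_space "P i" using elim by simp
        have sp: "space (P i) = UNIV" using elim sets_eq_imp_space_eq[of "P i" "borel_of TT"] by (simp add: top)
        have s: "U \<times> UNIV \<in> sets (P i)" "UNIV \<times> V \<in> sets (P i)" "U \<times> V \<in> sets (P i)"
          using elim UV openin_topspace[of T] by (auto simp: openin_prod_Times_iff top intro!: openin_borel_of)
        have "measure (P i) (U \<times> UNIV) \<le> measure (P i) (U \<times> V \<union> (UNIV - UNIV \<times> V))"
          using s sets.compl_sets[OF s(2)] by (intro p.finite_measure_mono) (auto simp: sp)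
        also have "\<dots> \<le> measure (P i) (U \<times> V) + measure (P i) (UNIV - UNIV \<times> V)"
          using s sets.compl_sets[OF s(2)] by (intro measure_Un_le) (auto simp: sp)
        also have "measure (P i) (UNIV - UNIV \<times> V) = 1 - measure (P i) (UNIV \<times> V)"
          using p.prob_compl[OF s(2)] by (simp add: sp)
        finally have "measure (M i) U + measure (N i) V - 1 \<le> measure (P i) (U \<times> V)"
          using coupling_marginals[of "P i" "M i" "N i" U] coupling_marginals[of "P i" "M i" "N i" V] elim UV
          by (simp add: openin_borel_of)
        then show ?case using elim by auto
      qed
    qed
    then show "measure \<mu> U + measure \<nu> V - 1 \<le> p (U \<times> V) + e" by simp
  qed
  obtain \<gamma> where g: "\<gamma> \<in> couplings T \<mu> \<nu>"
    and test: "\<And>G r. openin TT G \<Longrightarrow> r < measure \<gamma> G \<Longrightarrow> \<exists>R. orect R \<and> R \<subseteq> G \<and> r < p R"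
    by (rule coupling_of_content[OF mu nu r1 rmono rsub rsup rrect]) (assumption | rule that)+
  have gP: "\<gamma> \<in> Prob TT" using g by (simp add: couplings_def)
  interpret g: prob_space \<gamma> using gP by (rule Prob_prob_space)
  have gsp: "space \<gamma> = UNIV" using Prob_space[OF gP] by (simp add: top)
  have cm: "c \<in> borel_measurable (borel_of TT)"
    using c by (intro lsc_ennreal_measurable_borel_of) (simp add: top)
  have "(\<integral>\<^sup>+z. c z \<partial>\<gamma>) \<le> a"
  proof (rule nn_integral_le_levels)
    show "finite_measure \<gamma>" by unfold_locales
    show "c \<in> borel_measurable \<gamma>" using cm Prob_sets[OF gP] by (simp cong: measurable_cong_sets)
    fix \<delta> :: real and n :: nat assume d: "0 < \<delta>"
    define G where "G k = {z. ennreal (\<delta> * real k) < c z}" for k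
    have Go: "openin TT (G k)" for k unfolding G_def by (rule c)
    have "(\<Sum>k=1..n. ennreal \<delta> * emeasure \<gamma> (G k)) = ennreal (\<Sum>k=1..n. \<delta> * measure \<gamma> (G k))"
      using d by (simp add: g.emeasure_eq_measure sum_ennreal flip: ennreal_mult)
    also have "\<dots> \<le> a"
    proof (rule ennreal_le_epsilon)
      fix e :: real assume e: "0 < e"
      \<comment> \<open>Chosen so that an error \<open>e'\<close> at each of \<open>n\<close> levels
        costs at most \<open>e\<close> in the layer sum; \<open>n + 1\<close> guards against
        \<open>n = 0\<close>.\<close>
      define e' where "e' = e / (\<delta> * (real n + 1))"
      have e': "0 < e'" "\<delta> * real n * e' \<le> e" using e d unfolding e'_def by (auto simp: divide_simps add_pos_nonneg)
      \<comment> \<open>Values of \<open>p\<close> are limits of values of \<open>P i\<close>, those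
        of \<open>\<gamma>\<close> need not be: mass of \<open>\<gamma>\<close> on
        \<open>G k\<close> is first transferred to an \<open>orect\<close> subset and from there to
        \<open>P i\<close>.\<close>
      have "\<exists>R. orect R \<and> R \<subseteq> G k \<and> measure \<gamma> (G k) - e' < p R" for k
        using e' by (intro test[OF Go]) simp
      then obtain R where R: "\<And>k. orect (R k)" "\<And>k. R k \<subseteq> G k" "\<And>k. measure \<gamma> (G k) - e' < p (R k)"
        by metis
      have "eventually (\<lambda>i. \<forall>k\<in>{1..n}. measure \<gamma> (G k) - e' < \<phi> i (R k)) F'"
        by (intro eventually_ball_finite ballI order_tendstoD(1)[OF lim R(3)]) auto
      with ev evp have "eventually (\<lambda>i. ennreal (\<Sum>k=1..n. \<delta> * (measure \<gamma> (G k) - e')) \<le> a) F'"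
      proof eventually_elim
        case (elim i)
        interpret p: prob_space "P i" using elim by simp
        have sp: "space (P i) = UNIV" using elim sets_eq_imp_space_eq[of "P i" "borel_of TT"] by (simp add: top)
        have cP[measurable]: "c \<in> borel_measurable (P i)" using cm elim by (simp cong: measurable_cong_sets)
        have Gs[measurable]: "G k \<in> sets (P i)" for k using Go elim by (simp add: openin_borel_of)
        have "(\<Sum>k=1..n. \<delta> * (measure \<gamma> (G k) - e')) \<le> (\<Sum>k=1..n. \<delta> * measure (P i) (G k))"
        proof (intro sum_mono mult_left_mono)
          fix k assume "k \<in> {1..n}"
          then have "measure \<gamma> (G k) - e' < measure (P i) (R k)" using elim by auto
          also have "\<dots> \<le> measure (P i) (G k)" using R by (intro p.finite_measure_mono) auto
          finally show "measure \<gamma> (G k) - e' \<le> measure (P i) (G k)" by simp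
        qed (use d in auto)
        then have "ennreal (\<Sum>k=1..n. \<delta> * (measure \<gamma> (G k) - e')) \<le> ennreal (\<Sum>k=1..n. \<delta> * measure (P i) (G k))"
          by (rule ennreal_leI)
        also have "\<dots> = (\<Sum>k=1..n. ennreal \<delta> * emeasure (P i) (G k))"
          using d by (simp add: p.emeasure_eq_measure sum_ennreal flip: ennreal_mult)
        also have "\<dots> = (\<integral>\<^sup>+z. (\<Sum>k=1..n. ennreal \<delta> * indicator (G k) z) \<partial>P i)"
          by (subst nn_integral_sum) (auto simp: nn_integral_cmult_indicator)
        also have "\<dots> \<le> (\<integral>\<^sup>+z. c z \<partial>P i)"
        proof (rule nn_integral_mono)
          fix z
          show "(\<Sum>k=1..n. ennreal \<delta> * indicator (G k) z) \<le> c z"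
            using sum_levels_le[OF d, where c="c z" and N=n] by (simp add: G_def indicator_def)
        qed
        also have "\<dots> \<le> a" using elim by simp
        finally show ?case .
      qed
      then have le: "ennreal (\<Sum>k=1..n. \<delta> * (measure \<gamma> (G k) - e')) \<le> a"
        using F'(1) by (simp add: eventually_const_iff)
      have "(\<Sum>k=1..n. \<delta> * measure \<gamma> (G k)) \<le> (\<Sum>k=1..n. \<delta> * (measure \<gamma> (G k) - e')) + e"
        using e' by (simp add: right_diff_distrib sum_subtractf ac_simps)
      then have "ennreal (\<Sum>k=1..n. \<delta> * measure \<gamma> (G k)) \<le> ennreal ((\<Sum>k=1..n. \<delta> * (measure \<gamma> (G k) - e')) + e)"
        by (rule ennreal_leI)
      also have "\<dots> \<le> ennreal (\<Sum>k=1..n. \<delta> * (measure \<gamma> (G k) - e')) + ennreal e"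
        using e by (cases "0 \<le> (\<Sum>k=1..n. \<delta> * (measure \<gamma> (G k) - e'))")
          (auto simp: ennreal_plus ennreal_neg intro!: ennreal_leI)
      also have "\<dots> \<le> a + ennreal e" using le by (rule add_right_mono)
      finally show "ennreal (\<Sum>k=1..n. \<delta> * measure \<gamma> (G k)) \<le> a + ennreal e" .
    qed
    finally show "(\<Sum>k=1..n. ennreal \<delta> * emeasure \<gamma> {z \<in> space \<gamma>. ennreal (\<delta> * real k) < c z}) \<le> a"
      by (simp add: gsp G_def)
  qed
  then show ?thesis using that g by blast
qed

end

subsection \<open>Lower semicontinuity of the transport cost\<close>

locale emt =
  fixes T :: "'a topology" and d :: "'a \<Rightarrow> 'a \<Rightarrow> ennreal"
  assumes emt: "emt_space T d"
begin

sublocale hausdorff_univ T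
  using emt by unfold_locales (auto simp: emt_space_def)

lemma d_refl [simp]: "d x x = 0"
  and d_sym: "d x y = d y x"
  and d_triangle: "d x z \<le> d x y + d y z"
proof -
  have "ext_metric d" using emt by (simp add: emt_space_def)
  then show "d x x = 0" "d x y = d y x" "d x z \<le> d x y + d y z" unfolding ext_metric_def by blast+
qed

text \<open>\<open>d\<close> is a supremum of continuous functions on the product, hence lower
  semicontinuous; in general it is not continuous for \<open>T\<close>.\<close>

lemma openin_d_gt: "openin TT {z. t < d (fst z) (snd z)}"
proof -
  have "{z. t < d (fst z) (snd z)} = (\<Union>f\<in>Lip_b T d 1. {z \<in> topspace TT. \<bar>f (fst z) - f (snd z)\<bar> \<in> {r. t < ennreal r}})"
    using emt by (auto simp: emt_space_def less_SUP_iff)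
  moreover have "openin TT {z \<in> topspace TT. \<bar>f (fst z) - f (snd z)\<bar> \<in> {r. t < ennreal r}}"
    if f: "f \<in> Lip_b T d 1" for f
  proof (rule openin_continuous_map_preimage[where Y=euclideanreal])
    have c: "continuous_map T euclideanreal f" using f by (simp add: Lip_b_def)
    show "continuous_map TT euclideanreal (\<lambda>z. \<bar>f (fst z) - f (snd z)\<bar>)"
      using continuous_map_compose[OF continuous_map_fst c] continuous_map_compose[OF continuous_map_snd c]
      by (intro continuous_map_real_abs continuous_map_diff) (auto simp: o_def)
    have "open (ennreal -` {t<..})" by (intro open_vimage continuous_on_ennreal) auto
    then show "openin euclideanreal {r. t < ennreal r}" by (simp add: vimage_def)
  qed
  ultimately show ?thesis by (auto intro!: openin_Union)
qed

lemma openin_d2_gt: "openin TT {z. t < (d (fst z) (snd z))\<^sup>2}"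
proof -
  \<comment> \<open>Squaring is an order isomorphism, so superlevel sets of the square are
    superlevel sets of \<open>d\<close>; the level is the square root of \<open>t\<close>, or
    \<open>top\<close>.\<close>
  have *: "\<exists>s. (\<forall>x. s < x \<longrightarrow> t < x\<^sup>2) \<and> (\<forall>x. t < x\<^sup>2 \<longrightarrow> s < x)" for t :: ennreal
  proof (cases t)
    case (real r)
    have "ennreal (sqrt r) < x \<longleftrightarrow> t < x\<^sup>2" for x
    proof (cases x)
      case (real y)
      then show ?thesis using \<open>t = ennreal r\<close> \<open>0 \<le> r\<close>
        by (simp add: ennreal_less_iff ennreal_power real_less_rsqrt real_sqrt_less_iff)
           (metis abs_of_nonneg real_sqrt_abs real_sqrt_less_iff)
    next
      case top then show ?thesis using \<open>t = ennreal r\<close> by (simp add: top_power_ennreal)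
    qed
    then show ?thesis by blast
  next
    case top then show ?thesis by (intro exI[of _ top]) (auto simp: less_top)
  qed
  obtain s where "\<And>x. s < x \<longleftrightarrow> t < x\<^sup>2" using *[of t] by blast
  then show ?thesis using openin_d_gt[of s] by simp
qed

lemma d_measurable: "(\<lambda>z. d (fst z) (snd z)) \<in> borel_measurable (borel_of TT)"
  by (intro lsc_ennreal_measurable_borel_of) (simp add: top openin_d_gt)

lemma d2_measurable: "(\<lambda>z. (d (fst z) (snd z))\<^sup>2) \<in> borel_measurable (borel_of TT)"
  using d_measurable by simp

lemma continuous_map_Pair_const: "continuous_map T TT (\<lambda>y. (x, y))" "continuous_map T TT (\<lambda>y. (y, x))"
  by (auto intro!: continuous_map_pairedI simp: top)

lemma d_measurable1: "(\<lambda>y. d x y) \<in> borel_measurable (borel_of T)"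
  using measurable_compose[OF continuous_map_measurable_borel_of[OF continuous_map_Pair_const(1)[of x]] d_measurable]
  by simp

section \<open>Lipschitz cut-off functions\<close>

definition lipc :: "('a \<Rightarrow> real) \<Rightarrow> bool" where
  "lipc f \<longleftrightarrow> continuous_map T euclideanreal f \<and> (\<exists>L\<ge>0. \<forall>x y. ennreal \<bar>f x - f y\<bar> \<le> ennreal L * d x y)"

lemma lipc_dominated:
  assumes "lipc f" "continuous_map T euclideanreal g" "0 \<le> C" "\<And>x y. \<bar>g x - g y\<bar> \<le> C * \<bar>f x - f y\<bar>"
  shows "lipc g"
proof -
  obtain L where L: "0 \<le> L" "\<And>x y. ennreal \<bar>f x - f y\<bar> \<le> ennreal L * d x y"
    using assms(1) by (auto simp: lipc_def)
  have "ennreal \<bar>g x - g y\<bar> \<le> ennreal (C * L) * d x y" for x y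
  proof -
    have "ennreal \<bar>g x - g y\<bar> \<le> ennreal C * ennreal \<bar>f x - f y\<bar>"
      using assms(3,4) by (simp add: ennreal_leI flip: ennreal_mult)
    also have "\<dots> \<le> ennreal C * (ennreal L * d x y)" by (intro mult_left_mono L) auto
    finally show ?thesis using assms(3) L by (simp add: ennreal_mult mult.assoc)
  qed
  then show ?thesis using assms L unfolding lipc_def by (metis mult_nonneg_nonneg)
qed

lemma lipc_add:
  assumes "lipc f" "lipc g" shows "lipc (\<lambda>x. f x + g x)"
proof -
  obtain L where L: "0 \<le> L" "\<And>x y. ennreal \<bar>f x - f y\<bar> \<le> ennreal L * d x y"
    using assms(1) by (auto simp: lipc_def)
  obtain M where M: "0 \<le> M" "\<And>x y. ennreal \<bar>g x - g y\<bar> \<le> ennreal M * d x y"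
    using assms(2) by (auto simp: lipc_def)
  have "ennreal \<bar>(f x + g x) - (f y + g y)\<bar> \<le> ennreal (L + M) * d x y" for x y
  proof -
    have "ennreal \<bar>(f x + g x) - (f y + g y)\<bar> \<le> ennreal (\<bar>f x - f y\<bar> + \<bar>g x - g y\<bar>)"
      by (intro ennreal_leI) simp
    also have "\<dots> = ennreal \<bar>f x - f y\<bar> + ennreal \<bar>g x - g y\<bar>" by simp
    also have "\<dots> \<le> ennreal L * d x y + ennreal M * d x y" by (intro add_mono L M)
    finally show ?thesis using L M by (simp add: distrib_right)
  qed
  moreover have "continuous_map T euclideanreal (\<lambda>x. f x + g x)"
    using assms by (intro continuous_map_add) (auto simp: lipc_def)
  ultimately show ?thesis using L M unfolding lipc_def by (metis add_nonneg_nonneg)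
qed

lemma lipc_const: "lipc (\<lambda>_. c)"
  by (auto simp: lipc_def)

lemma lipc_sum: "finite I \<Longrightarrow> (\<And>i. i \<in> I \<Longrightarrow> lipc (f i)) \<Longrightarrow> lipc (\<lambda>x. \<Sum>i\<in>I. f i x)"
  by (induction I rule: finite_induct) (auto intro: lipc_const lipc_add)

lemma lipc_min1: assumes "lipc f" shows "lipc (\<lambda>x. min 1 (f x))"
proof (rule lipc_dominated[OF assms, where C=1])
  show "continuous_map T euclideanreal (\<lambda>x. min 1 (f x))"
    using assms by (intro continuous_map_real_min) (auto simp: lipc_def)
qed auto

lemma lipc_max0: assumes "lipc f" shows "lipc (\<lambda>x. max 0 (f x))"
proof (rule lipc_dominated[OF assms, where C=1])
  show "continuous_map T euclideanreal (\<lambda>x. max 0 (f x))"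
    using assms by (intro continuous_map_real_max) (auto simp: lipc_def)
qed auto

text \<open>\<open>T\<close> is generated by Lipschitz functions, so the proof is an induction over
  the generation of \<open>U\<close>; basic sets are preimages of open sets of reals, where a tent
  can be placed.\<close>

lemma urysohn_point:
  assumes "openin T U" "x \<in> U"
  obtains h where "lipc h" "\<And>y. 0 \<le> h y" "h x = 1" "\<And>y. y \<notin> U \<Longrightarrow> h y = 0"
proof -
  have "generate_topology_on {f -` V | f V. f \<in> (\<Union>L. Lip_b T d L) \<and> open V} U"
    using emt assms(1) by (simp add: emt_space_def openin_topology_generated_by_iff)
  then have "\<forall>x\<in>U. \<exists>h. lipc h \<and> (\<forall>y. 0 \<le> h y) \<and> h x = 1 \<and> (\<forall>y. y \<notin> U \<longrightarrow> h y = 0)"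
  proof induction
    case Empty then show ?case by simp
  next
    case (Int a b)
    show ?case
    proof
      fix x assume "x \<in> a \<inter> b"
      then obtain h g where h: "lipc h" "\<forall>y. 0 \<le> h y" "h x = 1" "\<forall>y. y \<notin> a \<longrightarrow> h y = 0"
        and g: "lipc g" "\<forall>y. 0 \<le> g y" "g x = 1" "\<forall>y. y \<notin> b \<longrightarrow> g y = 0"
        using Int.IH by blast
      \<comment> \<open>\<open>min 1 h + min 1 g - 1\<close> vanishes (after truncation) as soon as one factor does.\<close>
      let ?k = "\<lambda>y. max 0 (min 1 (h y) + min 1 (g y) + (- 1))"
      have "lipc ?k" by (intro lipc_max0 lipc_add lipc_min1 lipc_const h g)
      then show "\<exists>h. lipc h \<and> (\<forall>y. 0 \<le> h y) \<and> h x = 1 \<and> (\<forall>y. y \<notin> a \<inter> b \<longrightarrow> h y = 0)"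
        using h g by (intro exI[of _ ?k]) (auto simp: max_def min_def)
    qed
  next
    case (UN K)
    show ?case
    proof
      fix x assume "x \<in> \<Union>K"
      then obtain k where k: "k \<in> K" "x \<in> k" by auto
      then obtain h where "lipc h" "\<forall>y. 0 \<le> h y" "h x = 1" "\<forall>y. y \<notin> k \<longrightarrow> h y = 0"
        using UN.IH by blast
      then show "\<exists>h. lipc h \<and> (\<forall>y. 0 \<le> h y) \<and> h x = 1 \<and> (\<forall>y. y \<notin> \<Union>K \<longrightarrow> h y = 0)"
        using k by (intro exI[of _ h]) auto
    qed
  next
    case (Basis s)
    then obtain f V L where f: "s = f -` V" "f \<in> Lip_b T d L" "open V" by auto
    have lf: "lipc f"
    proof -
      have "ennreal \<bar>f x - f y\<bar> \<le> ennreal (max L 0) * d x y" for x y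
        using f(2) by (auto simp: Lip_b_def top max_def ennreal_neg)
      then show ?thesis using f(2) by (auto simp: lipc_def Lip_b_def intro!: exI[of _ "max L 0"])
    qed
    show ?case
    proof
      fix x assume "x \<in> s"
      then obtain r where r: "0 < r" "ball (f x) r \<subseteq> V" using f open_contains_ball[of V] by auto
      \<comment> \<open>A tent of radius \<open>r\<close> in the values of \<open>f\<close>; its
        truncation at \<open>0\<close> vanishes where \<open>f\<close> leaves the ball.\<close>
      let ?g = "\<lambda>y. 1 - \<bar>f y - f x\<bar> / r"
      have "lipc ?g"
      proof (rule lipc_dominated[OF lf, where C="1/r"])
        show "continuous_map T euclideanreal ?g"
          using lf r by (intro continuous_map_diff continuous_map_real_abs continuous_map_real_divide) (auto simp: lipc_def)
        show "\<bar>?g y - ?g z\<bar> \<le> 1 / r * \<bar>f y - f z\<bar>" for y z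
        proof -
          have "\<bar>?g y - ?g z\<bar> = \<bar>\<bar>f z - f x\<bar> - \<bar>f y - f x\<bar>\<bar> / r"
            using r by (simp add: field_simps abs_divide flip: diff_divide_distrib)
          also have "\<dots> \<le> \<bar>f y - f z\<bar> / r" using r by (intro divide_right_mono) auto
          finally show ?thesis by simp
        qed
      qed (use r in auto)
      then have "lipc (\<lambda>y. max 0 (?g y))" by (rule lipc_max0)
      moreover have "max 0 (?g y) = 0" if "y \<notin> s" for y
      proof -
        have "f y \<notin> ball (f x) r" using that r f by auto
        then show ?thesis using r by (simp add: dist_real_def field_simps abs_minus_commute)
      qed
      ultimately show "\<exists>h. lipc h \<and> (\<forall>y. 0 \<le> h y) \<and> h x = 1 \<and> (\<forall>y. y \<notin> s \<longrightarrow> h y = 0)"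
        by (intro exI[of _ "\<lambda>y. max 0 (?g y)"]) auto
    qed
  qed
  then show ?thesis using assms(2) that by blast
qed

lemma urysohn_compact:
  assumes K: "compactin T K" and U: "openin T U" "K \<subseteq> U"
  obtains h where "lipc h" "\<And>y. 0 \<le> h y" "\<And>y. h y \<le> 1" "\<And>y. y \<in> K \<Longrightarrow> h y = 1" "\<And>y. y \<notin> U \<Longrightarrow> h y = 0"
proof -
  have "\<forall>x\<in>K. \<exists>h. lipc h \<and> (\<forall>y. 0 \<le> h y) \<and> h x = 1 \<and> (\<forall>y. y \<notin> U \<longrightarrow> h y = 0)"
    using urysohn_point[OF U(1)] U(2) by (metis subsetD)
  then obtain h where h: "\<And>x. x \<in> K \<Longrightarrow> lipc (h x) \<and> (\<forall>y. 0 \<le> h x y) \<and> h x x = 1 \<and> (\<forall>y. y \<notin> U \<longrightarrow> h x y = 0)"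
    by metis
  define W where "W x = {y \<in> topspace T. h x y \<in> {1/2<..}}" for x
  have "openin T (W x)" if "x \<in> K" for x
    unfolding W_def using h[OF that]
    by (intro openin_continuous_map_preimage[where Y=euclideanreal]) (auto simp: lipc_def)
  moreover have "K \<subseteq> (\<Union>x\<in>K. W x)" using h by (auto simp: W_def top)
  ultimately obtain \<F> where F: "finite \<F>" "\<F> \<subseteq> W ` K" "K \<subseteq> \<Union>\<F>"
    using compactinD[OF K, of "W ` K"] by auto
  then obtain I where I: "finite I" "I \<subseteq> K" "\<F> = W ` I" by (metis finite_subset_image)
  \<comment> \<open>Each \<open>h x\<close> exceeds \<open>1/2\<close> on \<open>W x\<close>;
    doubling makes the sum at least \<open>1\<close> on \<open>K\<close>, and truncation makes it
    exactly \<open>1\<close>.\<close>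
  let ?g = "\<lambda>y. min 1 (\<Sum>x\<in>I. h x y + h x y)"
  have nn: "0 \<le> (\<Sum>x\<in>I. h x y + h x y)" for y using h I by (intro sum_nonneg) (auto simp: subset_iff)
  have "lipc ?g" using h I by (intro lipc_min1 lipc_sum lipc_add) auto
  moreover have "?g y = 1" if yK: "y \<in> K" for y
  proof -
    obtain x where x: "x \<in> I" "y \<in> W x" using yK F(3) unfolding I(3) by blast
    have "1 \<le> h x y + h x y" using x by (auto simp: W_def)
    also have "\<dots> \<le> (\<Sum>x\<in>I. h x y + h x y)"
      using x I h by (intro member_le_sum) (auto simp: subset_iff)
    finally show ?thesis by simp
  qed
  moreover have "?g y = 0" if "y \<notin> U" for y
  proof -
    have "(\<Sum>x\<in>I. h x y + h x y) = 0" using that h I by (intro sum.neutral) (auto simp: subset_iff)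
    then show ?thesis by simp
  qed
  ultimately show ?thesis using that[of ?g] nn by simp
qed

text \<open>A cut-off with Lipschitz constant \<open>L\<close> drops from \<open>1\<close> to
  \<open>0\<close> between \<open>K\<close> and the complement of \<open>U\<close>, so distances are
  at least \<open>1 / (L + 1)\<close>; the added \<open>1\<close> avoids dividing by zero.\<close>

lemma compact_d_separated:
  assumes K: "compactin T K" and U: "openin T U" "K \<subseteq> U"
  obtains e :: real where "0 < e" "\<And>x y. x \<in> K \<Longrightarrow> y \<notin> U \<Longrightarrow> ennreal e \<le> d x y"
proof -
  obtain h where h: "lipc h" "\<And>y. y \<in> K \<Longrightarrow> h y = 1" "\<And>y. y \<notin> U \<Longrightarrow> h y = 0"
    using urysohn_compact[OF assms] by metis
  obtain L where L: "0 \<le> L" "\<And>x y. ennreal \<bar>h x - h y\<bar> \<le> ennreal L * d x y"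
    using h(1) by (auto simp: lipc_def)
  have "ennreal (1 / (L + 1)) \<le> d x y" if "x \<in> K" "y \<notin> U" for x y
  proof (cases "d x y")
    case (real r)
    have "1 \<le> ennreal L * d x y" using L(2)[of x y] h(2)[OF that(1)] h(3)[OF that(2)] by simp
    also have "\<dots> = ennreal (L * r)" using real L by (simp add: ennreal_mult)
    finally have "1 \<le> L * r" by simp
    also have "\<dots> \<le> (L + 1) * r" using real by (simp add: distrib_right)
    finally show ?thesis using real L by (auto simp: field_simps intro!: ennreal_leI)
  qed simp
  then show ?thesis using L that[of "1 / (L+1)"] by simp
qed

lemma lipc_integrable:
  assumes "lipc h" "\<And>y. 0 \<le> h y" "\<And>y. h y \<le> 1" "\<mu> \<in> Prob T"
  shows "integrable \<mu> h"
proof -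
  interpret prob_space \<mu> using assms by (simp add: Prob_def)
  have "h \<in> borel_of T \<rightarrow>\<^sub>M borel_of euclideanreal"
    using assms by (intro continuous_map_measurable_borel_of) (simp add: lipc_def)
  moreover have "borel_of euclideanreal = borel"
    by (simp add: borel_of_def borel_def)
  ultimately have "h \<in> borel_measurable \<mu>" using Prob_sets[OF assms(4)] by (simp cong: measurable_cong_sets)
  then show ?thesis using assms by (intro integrable_const_bound[where B=1]) auto
qed

section \<open>The narrow topology and semicontinuity of \<open>W2sq\<close>\<close>

lemma topspace_narrow [simp]: "topspace (narrow_topology T) = Prob T"
proof -
  have "\<exists>f V. Prob T = {\<mu> \<in> Prob T. integral\<^sup>L \<mu> f \<in> V} \<and> continuous_map T euclideanreal f \<and>
      (\<exists>B. \<forall>x\<in>topspace T. \<bar>f x\<bar> \<le> B) \<and> open V"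
    by (intro exI[of _ "\<lambda>_. 0"] exI[of _ UNIV]) auto
  then show ?thesis unfolding narrow_topology_def topology_generated_by_topspace by blast
qed

lemma openin_narrow:
  assumes "lipc h" "\<And>y. 0 \<le> h y" "\<And>y. h y \<le> 1" "open V"
  shows "openin (narrow_topology T) {\<mu> \<in> Prob T. integral\<^sup>L \<mu> h \<in> V}"
  unfolding narrow_topology_def
proof (rule topology_generated_by_Basis)
  have "\<exists>B. \<forall>x\<in>topspace T. \<bar>h x\<bar> \<le> B" using assms by (intro exI[of _ 1]) (auto simp: abs_of_nonneg)
  then show "{\<mu> \<in> Prob T. integral\<^sup>L \<mu> h \<in> V} \<in>
      {{\<mu> \<in> Prob T. integral\<^sup>L \<mu> f \<in> V} |f V. continuous_map T euclideanreal f \<and> (\<exists>B. \<forall>x\<in>topspace T. \<bar>f x\<bar> \<le> B) \<and> open V}"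
    using assms(1,4) unfolding lipc_def by blast
qed

lemma measure_le_integral:
  assumes h: "lipc h" "\<And>y. 0 \<le> h y" "\<And>y. h y \<le> 1" and mu: "\<mu> \<in> Prob T" and B: "B \<in> sets (borel_of T)"
  shows "(\<And>y. y \<in> B \<Longrightarrow> h y = 1) \<Longrightarrow> measure \<mu> B \<le> integral\<^sup>L \<mu> h"
    and "(\<And>y. y \<notin> B \<Longrightarrow> h y = 0) \<Longrightarrow> integral\<^sup>L \<mu> h \<le> measure \<mu> B"
proof -
  interpret prob_space \<mu> using mu by (simp add: Prob_def)
  have [simp]: "space \<mu> = UNIV" using Prob_space[OF mu] by (simp add: top)
  have "B \<in> sets \<mu>" using B Prob_sets[OF mu] by simp
  then have i: "integrable \<mu> (indicat_real B)" "measure \<mu> B = integral\<^sup>L \<mu> (indicat_real B)"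
    using emeasure_finite[of B] by (auto intro!: integrable_real_indicator simp: less_top simp del: emeasure_finite)
  note ih = lipc_integrable[OF h mu]
  show "measure \<mu> B \<le> integral\<^sup>L \<mu> h" if "\<And>y. y \<in> B \<Longrightarrow> h y = 1"
    unfolding i(2) by (intro integral_mono i ih) (use h that in \<open>auto simp: indicator_def\<close>)
  show "integral\<^sup>L \<mu> h \<le> measure \<mu> B" if "\<And>y. y \<notin> B \<Longrightarrow> h y = 0"
    unfolding i(2) by (intro integral_mono i ih) (use h that in \<open>auto simp: indicator_def\<close>)
qed

text \<open>Only the liminf inequality on open sets is extracted from the narrow topology, in the
  shape that \<open>coupling_lsc\<close> takes. It is read off from a cut-off between
  \<open>U\<close> and a compact \<open>K\<close> carrying nearly all of
  \<open>measure \<mu> U\<close>.\<close>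

lemma portmanteau:
  assumes mu: "\<mu> \<in> Prob T" and U: "openin T U" and e: "0 < (e::real)"
  shows "eventually (\<lambda>\<nu>. measure \<mu> U - e < measure \<nu> U) (nhdsin (narrow_topology T) \<mu>)"
proof -
  have Us: "U \<in> sets (borel_of T)" using U by (rule openin_borel_of)
  have e2: "0 < e/2" using e by simp
  obtain K where K: "compactin T K" "K \<subseteq> U" "measure \<mu> U \<le> measure \<mu> K + e/2"
    using Prob_approx[OF mu Us e2] by metis
  obtain h where h: "lipc h" "\<And>y. 0 \<le> h y" "\<And>y. h y \<le> 1" "\<And>y. y \<in> K \<Longrightarrow> h y = 1" "\<And>y. y \<notin> U \<Longrightarrow> h y = 0"
    using urysohn_compact[OF K(1) U K(2)] by metis
  let ?S = "{\<nu> \<in> Prob T. integral\<^sup>L \<nu> h \<in> {integral\<^sup>L \<mu> h - e/2<..}}"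
  have "openin (narrow_topology T) ?S" by (rule openin_narrow[OF h(1-3)]) auto
  moreover have "\<mu> \<in> ?S" using mu e by simp
  moreover have "measure \<mu> U - e < measure \<nu> U" if "\<nu> \<in> ?S" for \<nu>
    using that K(3) measure_le_integral(1)[OF h(1-3) mu compactin_borel_of[OF H K(1)] h(4)]
      measure_le_integral(2)[OF h(1-3) _ Us h(5), of \<nu>] by simp
  ultimately show ?thesis unfolding eventually_nhdsin by blast
qed

lemma W2sq_lsc:
  assumes F: "F \<noteq> bot" and mu: "\<mu> \<in> Prob T" and nu: "\<nu> \<in> Prob T"
    and M: "\<And>U e. openin T U \<Longrightarrow> 0 < e \<Longrightarrow> eventually (\<lambda>i. measure \<mu> U - e < measure (M i) U) F"
    and N: "\<And>U e. openin T U \<Longrightarrow> 0 < e \<Longrightarrow> eventually (\<lambda>i. measure \<nu> U - e < measure (N i) U) F"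
    and W: "eventually (\<lambda>i. W2sq T d (M i) (N i) \<le> a) F"
  shows "W2sq T d \<mu> \<nu> \<le> a"
proof (rule ennreal_le_epsilon)
  fix e :: real assume e: "0 < e" "a < top"
  let ?c = "\<lambda>z. (d (fst z) (snd z))\<^sup>2"
  \<comment> \<open>The infimum is not assumed attained: couplings of cost at most
    \<open>a + e\<close> are chosen where they exist, which is eventually.\<close>
  define P where "P i = (SOME \<gamma>. \<gamma> \<in> couplings T (M i) (N i) \<and> (\<integral>\<^sup>+z. ?c z \<partial>\<gamma>) \<le> a + ennreal e)" for i
  have "eventually (\<lambda>i. P i \<in> couplings T (M i) (N i) \<and> (\<integral>\<^sup>+z. ?c z \<partial>P i) \<le> a + ennreal e) F"
    using W
  proof eventually_elim
    case (elim i)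
    have "a < a + ennreal e" using e by (cases a) (auto simp: ennreal_less_iff simp flip: ennreal_plus)
    with elim have "W2sq T d (M i) (N i) < a + ennreal e" by (rule le_less_trans)
    then have "\<exists>\<gamma>. \<gamma> \<in> couplings T (M i) (N i) \<and> (\<integral>\<^sup>+z. ?c z \<partial>\<gamma>) \<le> a + ennreal e"
      unfolding W2sq_def INF_less_iff by (auto intro: less_imp_le)
    then show ?case unfolding P_def by (rule someI_ex)
  qed
  then obtain \<gamma> where "\<gamma> \<in> couplings T \<mu> \<nu>" "(\<integral>\<^sup>+z. ?c z \<partial>\<gamma>) \<le> a + ennreal e"
    using coupling_lsc[OF F mu nu openin_d2_gt M N] by blast
  then show "W2sq T d \<mu> \<nu> \<le> a + ennreal e"
    unfolding W2sq_def by (auto intro: INF_lower2)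
qed

lemma openin_narrow_W2sq_gt:
  assumes nu: "\<nu> \<in> Prob T"
  shows "openin (narrow_topology T) {\<mu> \<in> Prob T. a < W2sq T d \<mu> \<nu>}" (is "openin _ ?S")
proof -
  have "\<exists>V. openin (narrow_topology T) V \<and> \<mu> \<in> V \<and> V \<subseteq> ?S" if mu: "\<mu> \<in> ?S" for \<mu>
  proof (rule ccontr)
    assume no: "\<not> (\<exists>V. openin (narrow_topology T) V \<and> \<mu> \<in> V \<and> V \<subseteq> ?S)"
    \<comment> \<open>If \<open>\<mu>\<close> had no neighbourhood inside the set, all its
      neighbourhoods would meet the sublevel set, and the trace of the neighbourhood filter there
      would be proper.\<close>
    let ?F = "inf (nhdsin (narrow_topology T) \<mu>) (principal (Prob T - ?S))"
    have muP: "\<mu> \<in> Prob T" using mu by simp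
    have nb: "?F \<noteq> bot"
    proof
      assume "?F = bot"
      then have "eventually (\<lambda>_. False) ?F" by simp
      then obtain V where "openin (narrow_topology T) V" "\<mu> \<in> V" "\<forall>\<sigma>\<in>V. \<sigma> \<notin> Prob T - ?S"
        using muP unfolding eventually_inf_principal eventually_nhdsin by auto
      then show False using no openin_subset[of "narrow_topology T" V] by auto
    qed
    have "W2sq T d \<mu> \<nu> \<le> a"
    proof (rule W2sq_lsc[OF nb muP nu, where M="\<lambda>x. x" and N="\<lambda>_. \<nu>"])
      show "\<forall>\<^sub>F i in ?F. measure \<mu> U - e < measure i U" if "openin T U" "0 < e" for U e
        by (rule filter_leD[OF inf_le1 portmanteau[OF muP that]])
      show "\<forall>\<^sub>F i in ?F. W2sq T d i \<nu> \<le> a"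
        unfolding eventually_inf_principal by (rule always_eventually) auto
    qed auto
    then show False using mu by auto
  qed
  then show ?thesis by (subst openin_subopen) blast
qed

lemma W2sq_measurable:
  "\<nu> \<in> Prob T \<Longrightarrow> (\<lambda>\<mu>. W2sq T d \<mu> \<nu>) \<in> borel_measurable (borel_of (narrow_topology T))"
  by (intro lsc_ennreal_measurable_borel_of) (simp add: openin_narrow_W2sq_gt)

text \<open>Closed points make finite subsets of \<open>Prob T\<close> measurable, as the finitely
  supported measures below require. Two distinct Radon probabilities differ on some compact set in
  the desired direction, and a cut-off detects it.\<close>

lemma narrow_singleton_closed:
  assumes mu: "\<mu> \<in> Prob T"
  shows "closedin (narrow_topology T) {\<mu>}"
proof -
  interpret mu: prob_space \<mu> using mu by (rule Prob_prob_space)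
  have "\<exists>V. openin (narrow_topology T) V \<and> \<nu> \<in> V \<and> V \<subseteq> Prob T - {\<mu>}" if nu: "\<nu> \<in> Prob T - {\<mu>}" for \<nu>
  proof -
    obtain K where K: "compactin T K" "measure \<mu> K < measure \<nu> K"
    proof -
      have "\<not> (\<forall>K. compactin T K \<longrightarrow> measure \<nu> K \<le> measure \<mu> K)"
        using Prob_eqI_le_compact[OF _ mu H, of \<nu>] nu by auto
      then show thesis using that by (auto simp: not_le)
    qed
    have Ks: "K \<in> sets (borel_of T)" by (rule compactin_borel_of[OF H K(1)])
    have Kc: "UNIV - K \<in> sets (borel_of T)" using Ks by (metis sets.compl_sets space_borel_T(1))
    \<comment> \<open>Half the gap: the open complement of \<open>L\<close> then contains
      \<open>K\<close> and still has \<open>\<mu>\<close>-measure below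
      \<open>measure \<nu> K\<close>.\<close>
    let ?e = "(measure \<nu> K - measure \<mu> K) / 2"
    have "0 < ?e" using K by simp
    then obtain L where L: "compactin T L" "L \<subseteq> UNIV - K" "measure \<mu> (UNIV - K) \<le> measure \<mu> L + ?e"
      using Prob_approx[OF mu Kc] by metis
    have oU: "openin T (UNIV - L)" using compactin_imp_closedin[OF H L(1)] by (simp add: closedin_def top)
    have Ls: "L \<in> sets \<mu>" "K \<in> sets \<mu>" using Ks compactin_borel_of[OF H L(1)] Prob_sets[OF mu] by auto
    have "measure \<mu> (UNIV - L) \<le> measure \<mu> K + ?e"
      using L(3) mu.prob_compl[OF Ls(1)] mu.prob_compl[OF Ls(2)] by (simp add: Prob_space[OF mu] top)
    then have lt: "measure \<mu> (UNIV - L) < measure \<nu> K" using \<open>0 < ?e\<close> by (simp add: field_simps)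
    define V where "V = UNIV - L"
    have oV: "openin T V" and KV: "K \<subseteq> V" using oU L unfolding V_def by auto
    obtain h where h: "lipc h" "\<And>y. 0 \<le> h y" "\<And>y. h y \<le> 1" "\<And>y. y \<in> K \<Longrightarrow> h y = 1" "\<And>y. y \<notin> V \<Longrightarrow> h y = 0"
      using urysohn_compact[OF K(1) oV KV] by metis
    let ?S = "{\<sigma> \<in> Prob T. integral\<^sup>L \<sigma> h \<in> {measure \<mu> V<..}}"
    have S: "openin (narrow_topology T) ?S" by (rule openin_narrow[OF h(1-3)]) (rule open_greaterThan)
    have nP: "\<nu> \<in> Prob T" using nu by (rule DiffD1)
    have n1: "measure \<nu> K \<le> integral\<^sup>L \<nu> h" by (rule measure_le_integral(1)[OF h(1-3) nP Ks h(4)])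
    have nS: "\<nu> \<in> ?S" using nP less_le_trans[OF lt[folded V_def] n1] by blast
    have "integral\<^sup>L \<mu> h \<le> measure \<mu> V"
      by (rule measure_le_integral(2)[OF h(1-3) mu openin_borel_of[OF oV] h(5)])
    then have "?S \<subseteq> Prob T - {\<mu>}" by auto
    with S nS show ?thesis by blast
  qed
  then have "openin (narrow_topology T) (Prob T - {\<mu>})" by (subst openin_subopen) blast
  then show ?thesis using mu by (simp add: closedin_def)
qed

end

subsection \<open>A finite minimax principle\<close>

text \<open>Induction on \<open>J\<close>, with a separation in the plane at each step. The bound
  \<open>lower\<close> enters because the weights in \<open>hyp\<close> are strictly positive, while
  a separating functional may vanish on an axis: it controls the cost of perturbing the
  weights.\<close>

lemma finite_minimax:
  fixes Y :: "('i \<Rightarrow> real) set" and B \<delta> :: real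
  assumes "finite J"
    and conv: "\<And>y z t. y \<in> Y \<Longrightarrow> z \<in> Y \<Longrightarrow> 0 \<le> t \<Longrightarrow> t \<le> 1 \<Longrightarrow> (\<lambda>j. (1-t) * y j + t * z j) \<in> Y"
    and lower: "\<And>y j. y \<in> Y \<Longrightarrow> j \<in> J \<Longrightarrow> - B \<le> y j"
    and hyp: "\<And>l. (\<And>j. j \<in> J \<Longrightarrow> 0 < l j) \<Longrightarrow> \<exists>y\<in>Y. (\<Sum>j\<in>J. l j * y j) \<le> 0"
    and "0 < \<delta>"
  shows "\<exists>y\<in>Y. \<forall>j\<in>J. y j \<le> \<delta>"
  using assms
proof (induction J arbitrary: Y B \<delta> rule: finite_induct)
  case empty
  then show ?case using empty(3)[of "\<lambda>_. 1"] by auto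
next
  case (insert k J)
  note conv = insert.prems(1) and lower = insert.prems(2) and hyp = insert.prems(3) and \<delta> = insert.prems(4)
  show ?case
  proof (cases "J = {}")
    case True
    obtain y where "y \<in> Y" "y k \<le> 0" using hyp[of "\<lambda>_. 1"] True by auto
    then show ?thesis using \<delta> True by (intro bexI[of _ y]) auto
  next
    case False
    \<comment> \<open>The \<open>k\<close>-th constraint is imposed outright; the shift by
      \<open>\<delta>/2\<close> lets the induction hypothesis at \<open>\<delta>/2\<close> return
      the bound \<open>\<delta>\<close>.\<close>
    define Y1 where "Y1 = {\<lambda>j. y j - \<delta>/2 | y. y \<in> Y \<and> y k \<le> \<delta>}"
    show ?thesis
    proof (cases "\<forall>l. (\<forall>j\<in>J. 0 < l j) \<longrightarrow> (\<exists>y\<in>Y1. (\<Sum>j\<in>J. l j * y j) \<le> 0)")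
      case True
      have "\<exists>y\<in>Y1. \<forall>j\<in>J. y j \<le> \<delta>/2"
      proof (rule insert.IH)
        fix y z and t :: real assume yz: "y \<in> Y1" "z \<in> Y1" and t: "0 \<le> t" "t \<le> 1"
        then obtain y' z' where y': "y = (\<lambda>j. y' j - \<delta>/2)" "y' \<in> Y" "y' k \<le> \<delta>"
          and z': "z = (\<lambda>j. z' j - \<delta>/2)" "z' \<in> Y" "z' k \<le> \<delta>" unfolding Y1_def by auto
        have "(1-t) * y' k + t * z' k \<le> (1-t) * \<delta> + t * \<delta>"
          using y' z' t by (intro add_mono mult_left_mono) auto
        then have "(1-t) * y' k + t * z' k \<le> \<delta>" by (simp add: algebra_simps)
        moreover have "(\<lambda>j. (1-t) * y j + t * z j) = (\<lambda>j. ((1-t) * y' j + t * z' j) - \<delta>/2)"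
          unfolding y' z' by (rule ext) (simp add: field_simps)
        ultimately show "(\<lambda>j. (1-t) * y j + t * z j) \<in> Y1"
          using conv[OF y'(2) z'(2) t] unfolding Y1_def
          by (intro CollectI exI[of _ "\<lambda>j. (1-t) * y' j + t * z' j"] conjI)
      next
        fix y j assume "y \<in> Y1" "j \<in> J"
        then obtain y' where "y = (\<lambda>j. y' j - \<delta>/2)" "y' \<in> Y" unfolding Y1_def by auto
        then show "- (B + \<delta>/2) \<le> y j" using lower[of y' j] \<open>j \<in> J\<close> by simp
      next
        fix l :: "'i \<Rightarrow> real" assume "\<And>j. j \<in> J \<Longrightarrow> 0 < l j"
        then show "\<exists>y\<in>Y1. (\<Sum>j\<in>J. l j * y j) \<le> 0" using True by blast
      qed (use \<delta> in simp)
      then obtain y where y: "y \<in> Y" "y k \<le> \<delta>" "\<forall>j\<in>J. y j - \<delta>/2 \<le> \<delta>/2" unfolding Y1_def by auto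
      then have "\<forall>j\<in>insert k J. y j \<le> \<delta>" by auto
      then show ?thesis using y(1) by blast
    next
      case no: False
      then obtain l where l: "\<And>j. j \<in> J \<Longrightarrow> 0 < l j"
        and sep: "\<And>y. y \<in> Y1 \<Longrightarrow> 0 < (\<Sum>j\<in>J. l j * y j)" by (auto simp: not_le)
      define L where "L = (\<Sum>j\<in>J. l j)"
      have L: "0 < L" unfolding L_def using l False insert.hyps by (intro sum_pos) auto
      define a where "a y = (\<Sum>j\<in>J. l j * y j) - L * (\<delta>/2)" for y
      define b where "b y = y k - \<delta>" for y :: "'i \<Rightarrow> real"
      have sep': "0 < a y" if "y \<in> Y" "b y \<le> 0" for y
      proof -
        have "(\<lambda>j. y j - \<delta>/2) \<in> Y1" using that unfolding Y1_def b_def by auto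
        from sep[OF this] show ?thesis
          unfolding a_def L_def by (simp add: right_diff_distrib sum_subtractf sum_distrib_right sum_divide_distrib)
      qed
      \<comment> \<open>The weights \<open>l\<close> at which the induction fails merge
        \<open>J\<close> into one coordinate \<open>a\<close>, paired with \<open>b\<close> for
        \<open>k\<close>. No image point has both coordinates nonpositive, so a line separates the
        image from the closed negative quadrant.\<close>
      let ?A = "(\<lambda>y. (a y, b y)) ` Y" and ?N = "{p :: real \<times> real. fst p \<le> 0 \<and> snd p \<le> 0}"
      have "convex ?A"
        unfolding convex_alt
      proof (intro ballI allI impI)
        fix p q and t :: real assume "p \<in> ?A" "q \<in> ?A" and t: "0 \<le> t \<and> t \<le> 1"
        then obtain y z where y: "y \<in> Y" "p = (a y, b y)" and z: "z \<in> Y" "q = (a z, b z)" by auto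
        let ?w = "\<lambda>j. (1-t) * y j + t * z j"
        have "?w \<in> Y" using conv y z t by auto
        moreover have "a ?w = (1-t) * a y + t * a z" "b ?w = (1-t) * b y + t * b z"
          proof -
          have "(\<Sum>j\<in>J. l j * ((1-t) * y j + t * z j)) = (1-t) * (\<Sum>j\<in>J. l j * y j) + t * (\<Sum>j\<in>J. l j * z j)"
            by (simp add: sum.distrib sum_distrib_left distrib_left mult.left_commute)
          then show "a ?w = (1-t) * a y + t * a z" "b ?w = (1-t) * b y + t * b z"
            unfolding a_def b_def by (simp_all add: field_simps)
        qed
        ultimately show "(1 - t) *\<^sub>R p + t *\<^sub>R q \<in> ?A" using y z by (auto intro!: image_eqI[of _ _ ?w])
      qed
      moreover have "convex ?N"
        unfolding convex_alt by (auto intro!: add_nonpos_nonpos mult_nonneg_nonpos)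
      moreover have "?A \<noteq> {}" using hyp[of "\<lambda>_. 1"] by auto
      moreover have "?N \<noteq> {}" by (auto intro!: exI[of _ "0::real"])
      moreover have "?N \<inter> ?A = {}" using sep' by (auto simp: not_le[symmetric])
      ultimately obtain v c where v: "v \<noteq> 0" "\<And>p. p \<in> ?N \<Longrightarrow> inner v p \<le> c" "\<And>p. p \<in> ?A \<Longrightarrow> c \<le> inner v p"
        using separating_hyperplane_sets[of ?N ?A] by blast
      define s t where "s = fst v" and "t = snd v"
      have st: "s * x + t * z \<le> c" if "x \<le> 0" "z \<le> 0" for x z
        using v(2)[of "(x,z)"] that by (simp add: s_def t_def inner_prod_def)
      have c0: "0 \<le> c" using st[of 0 0] by simp
      have s0: "0 \<le> s"
      proof (rule ccontr)
        assume "\<not> 0 \<le> s"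
        then have "s * ((c+1)/s) = c + 1" "(c+1)/s \<le> 0" using c0 by (auto simp: divide_nonneg_neg)
        then show False using st[of "(c+1)/s" 0] by simp
      qed
      have t0: "0 \<le> t"
      proof (rule ccontr)
        assume "\<not> 0 \<le> t"
        then have "t * ((c+1)/t) = c + 1" "(c+1)/t \<le> 0" using c0 by (auto simp: divide_nonneg_neg)
        then show False using st[of 0 "(c+1)/t"] by simp
      qed
      have "s \<noteq> 0 \<or> t \<noteq> 0" using v(1) by (auto simp: s_def t_def prod_eq_iff)
      then have "0 < s \<or> 0 < t" using s0 t0 by auto
      then have pos: "0 < s * L / 2 + t"
      proof
        assume "0 < s" then have "0 < s * L / 2" using L by simp
        then show ?thesis using t0 by linarith
      next
        assume "0 < t" moreover have "0 \<le> s * L / 2" using L s0 by simp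
        ultimately show ?thesis by linarith
      qed
      have ge: "0 \<le> s * a y + t * b y" if "y \<in> Y" for y
        using v(3)[of "(a y, b y)"] that c0 by (auto simp: s_def t_def inner_prod_def)
      \<comment> \<open>By \<open>lower\<close>, an upper bound for the negative of the
        \<open>l\<close>-weighted sum plus \<open>y k\<close>, uniform over
        \<open>Y\<close>.\<close>
      define D where "D = (L + 1) * (\<bar>B\<bar> + 1)"
      have D: "0 < D" using L by (simp add: D_def)
      \<comment> \<open>Small enough that \<open>\<epsilon> D\<close> stays below the slack
        \<open>(s L / 2 + t) \<delta>\<close> contained in \<open>s a + t b\<close>.\<close>
      define \<epsilon> where "\<epsilon> = (s * L / 2 + t) * \<delta> / (2 * D)"
      have e: "0 < \<epsilon>" "\<epsilon> * D < (s * L / 2 + t) * \<delta>"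
      proof -
        have p: "0 < (s * L / 2 + t) * \<delta>" using pos \<delta> by (rule mult_pos_pos)
        then show "0 < \<epsilon>" using D by (simp add: \<epsilon>_def)
        have "\<epsilon> * D = (s * L / 2 + t) * \<delta> / 2" using D by (simp add: \<epsilon>_def)
        then show "\<epsilon> * D < (s * L / 2 + t) * \<delta>" using p by linarith
      qed
      \<comment> \<open>The hypothesis is applied to the separating weights, perturbed by
        \<open>\<epsilon>\<close> since \<open>s\<close> or \<open>t\<close> may be
        \<open>0\<close>.\<close>
      obtain y where y: "y \<in> Y" and le: "(\<Sum>j\<in>insert k J. (if j = k then t + \<epsilon> else (s + \<epsilon>) * l j) * y j) \<le> 0"

      proof -
        have "0 < (if j = k then t + \<epsilon> else (s + \<epsilon>) * l j)" if "j \<in> insert k J" for j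
          using that l s0 t0 e by (auto intro!: mult_pos_pos)
        then show thesis using hyp[of "\<lambda>j. if j = k then t + \<epsilon> else (s + \<epsilon>) * l j"] that by blast
      qed
      define S where "S = (\<Sum>j\<in>J. l j * y j)"
      have "(\<Sum>j\<in>J. (if j = k then t + \<epsilon> else (s + \<epsilon>) * l j) * y j) = (s + \<epsilon>) * S"
        unfolding S_def sum_distrib_left using insert.hyps by (intro sum.cong) auto
      then have le': "(t + \<epsilon>) * y k + (s + \<epsilon>) * S \<le> 0" using le insert.hyps by simp
      have "- B * L \<le> S"
        unfolding S_def L_def sum_distrib_left

      proof (rule sum_mono)
        fix j assume j: "j \<in> J"
        have "l j * (- B) \<le> l j * y j" using lower[OF y, of j] l[OF j] j by (intro mult_left_mono) auto
        then show "- B * l j \<le> l j * y j" by (simp add: mult.commute)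
      qed
      moreover have "- B \<le> y k" using lower[OF y] by simp
      ultimately have "- D \<le> S + y k"
      proof -
        have "B * L + B \<le> D" unfolding D_def
        proof -
          have "B * (L + 1) \<le> (\<bar>B\<bar> + 1) * (L + 1)" using L by (intro mult_right_mono) auto
          then show "B * L + B \<le> (L + 1) * (\<bar>B\<bar> + 1)" by (simp add: algebra_simps)
        qed
        then show ?thesis using \<open>- B * L \<le> S\<close> \<open>- B \<le> y k\<close> by linarith
      qed
      then have "- (\<epsilon> * D) \<le> \<epsilon> * (S + y k)" using e mult_left_mono[of "- D" "S + y k" \<epsilon>] by simp
      then have "s * S + t * y k \<le> \<epsilon> * D" using le' by (simp add: algebra_simps)
      then have "s * a y + t * b y < 0"
        using e unfolding a_def b_def S_def[symmetric] by (simp add: algebra_simps)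
      then show ?thesis using ge[OF y] by simp
    qed
  qed
qed

subsection \<open>Entropy of densities\<close>

text \<open>The tangent inequality of \<open>x ln x\<close> at \<open>s\<close> with a Hellinger
  remainder; it comes from \<open>ln y \<le> y - 1\<close> at \<open>y = sqrt (s / a)\<close>. At
  \<open>a = 0\<close> the value of \<open>ln 0\<close> is multiplied by \<open>0\<close>.\<close>

lemma xlnx_ge_sqrt:
  fixes a s :: real
  assumes a: "0 \<le> a" and s: "0 < s"
  shows "a * ln s + a - s + (sqrt a - sqrt s)\<^sup>2 \<le> a * ln a"
proof (cases "a = 0")
  case True then show ?thesis using s by simp
next
  case False
  then have a: "0 < a" using a by simp
  have "ln (sqrt (s / a)) \<le> sqrt (s / a) - 1" using a s by (intro ln_le_minus_one) simp
  then have "(ln s - ln a) / 2 \<le> sqrt (s / a) - 1" using a s by (simp add: ln_sqrt ln_div)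
  then have "a * ((ln s - ln a) / 2) \<le> a * (sqrt (s / a) - 1)" using a by (intro mult_left_mono) auto
  moreover have "a * sqrt (s / a) = sqrt a * sqrt s"
    using a by (simp add: real_sqrt_divide field_simps)
  ultimately show ?thesis using a s by (simp add: power2_diff field_simps)
qed

lemma xlnx_tangent:
  fixes a s :: real
  assumes a: "0 \<le> a" and s: "0 < s"
  shows "a * ln s + a - s \<le> a * ln a"
  using xlnx_ge_sqrt[OF assms] zero_le_power2[of "sqrt a - sqrt s"] by linarith

lemma xlnx_ge: "0 \<le> a \<Longrightarrow> (- 1::real) \<le> a * ln a"
  using xlnx_tangent[of a 1] by simp

lemma xlnx_convex:
  fixes a b t :: real
  assumes "0 \<le> a" "0 \<le> b" "0 \<le> t" "t \<le> 1"
  shows "((1-t) * a + t * b) * ln ((1-t) * a + t * b) \<le> (1-t) * (a * ln a) + t * (b * ln b)"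
proof -
  let ?s = "(1-t) * a + t * b"
  have s0: "0 \<le> ?s" using assms by simp
  show ?thesis
  proof (cases "?s = 0")
    case True
    then have "(1-t) * a = 0" "t * b = 0" using add_nonneg_eq_0_iff[of "(1-t) * a" "t * b"] assms by auto
    then show ?thesis using True by (auto simp: mult.assoc[symmetric])
  next
    case False
    then have s: "0 < ?s" using s0 by simp
    have "(1-t) * (a * ln ?s + a - ?s) + t * (b * ln ?s + b - ?s) \<le> (1-t) * (a * ln a) + t * (b * ln b)"
      using assms xlnx_tangent[OF _ s] by (intro add_mono mult_left_mono) auto
    moreover have "(1-t) * (a * ln ?s + a - ?s) + t * (b * ln ?s + b - ?s) = ?s * ln ?s"
      by (simp add: algebra_simps)
    ultimately show ?thesis by linarith
  qed
qed

text \<open>Add the remainders at \<open>a\<close> and \<open>b\<close> for the midpoint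
  \<open>s\<close>. This strong midpoint convexity in Hellinger distance is what produces Cauchy
  sequences later.\<close>

lemma xlnx_midpoint_gap:
  fixes a b :: real
  assumes "0 \<le> a" "0 \<le> b"
  shows "(sqrt a - sqrt b)\<^sup>2 / 2 \<le> a * ln a + b * ln b - 2 * ((a + b) / 2 * ln ((a + b) / 2))"
proof (cases "a + b = 0")
  case True
  then have "a = 0" "b = 0" using assms by auto
  then show ?thesis by simp
next
  case False
  define s where "s = (a + b) / 2"
  have s: "0 < s" using False assms by (simp add: s_def)
  have "(sqrt a - sqrt b)\<^sup>2 / 2 \<le> (sqrt a - sqrt s)\<^sup>2 + (sqrt b - sqrt s)\<^sup>2"
  proof -
    have "(x - y)\<^sup>2 / 2 \<le> (x - z)\<^sup>2 + (y - z)\<^sup>2" for x y z :: real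
      using zero_le_power2[of "x + y - 2 * z"] by (simp add: power2_eq_square field_simps)
    then show ?thesis .
  qed
  moreover have "a * ln s + b * ln s = 2 * (s * ln s)" "a + b = 2 * s"
    by (simp_all add: s_def field_simps)
  ultimately show ?thesis
    using xlnx_ge_sqrt[OF assms(1) s] xlnx_ge_sqrt[OF assms(2) s] unfolding s_def[symmetric] by linarith
qed

text \<open>Factor \<open>a - b\<close> through square roots and apply Young's inequality with
  parameter \<open>\<tau>\<close>; after integration the last term is a multiple of the total
  masses.\<close>

lemma abs_diff_le_sqrt:
  fixes a b \<tau> :: real
  assumes "0 \<le> a" "0 \<le> b" "0 < \<tau>"
  shows "\<bar>a - b\<bar> \<le> (sqrt a - sqrt b)\<^sup>2 / (2 * \<tau>) + \<tau> * (a + b)"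
proof -
  let ?x = "\<bar>sqrt a - sqrt b\<bar>" and ?y = "sqrt a + sqrt b"
  have "a - b = (sqrt a - sqrt b) * (sqrt a + sqrt b)"
    using assms by (simp add: algebra_simps)
  then have 1: "\<bar>a - b\<bar> = ?x * ?y" using assms by (simp add: abs_mult)
  have "0 \<le> (?x - \<tau> * ?y)\<^sup>2" by simp
  then have "2 * \<tau> * (?x * ?y) \<le> ?x\<^sup>2 + \<tau>\<^sup>2 * ?y\<^sup>2" by (simp add: power2_eq_square algebra_simps)
  then have "?x * ?y \<le> (?x\<^sup>2 + \<tau>\<^sup>2 * ?y\<^sup>2) / (2 * \<tau>)" using assms by (simp add: field_simps)
  also have "\<dots> = ?x\<^sup>2 / (2 * \<tau>) + \<tau> / 2 * ?y\<^sup>2" using assms by (simp add: field_simps power2_eq_square)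
  also have "?y\<^sup>2 \<le> 2 * (a + b)"
  proof -
    have "0 \<le> (sqrt a - sqrt b)\<^sup>2" by simp
    then have "2 * (sqrt a * sqrt b) \<le> a + b" using assms by (simp add: power2_diff)
    then show ?thesis using assms by (simp add: power2_sum)
  qed
  finally show ?thesis using 1 assms by (simp add: mult_left_mono algebra_simps)
qed

text \<open>Functions, not classes, with nonnegativity everywhere. Integrability of
  \<open>\<rho> ln \<rho>\<close> is demanded separately since the Bochner integral of a
  nonintegrable function is \<open>0\<close>.\<close>

definition ent_dens :: "'b measure \<Rightarrow> real \<Rightarrow> ('b \<Rightarrow> real) set" where
  "ent_dens M C = {\<rho> \<in> borel_measurable M. (\<forall>x. 0 \<le> \<rho> x) \<and> integrable M \<rho> \<and> (\<integral>x. \<rho> x \<partial>M) = 1 \<and>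
     integrable M (\<lambda>x. \<rho> x * ln (\<rho> x)) \<and> (\<integral>x. \<rho> x * ln (\<rho> x) \<partial>M) \<le> C}"

abbreviation l1 :: "'b measure \<Rightarrow> ('b \<Rightarrow> real) \<Rightarrow> ('b \<Rightarrow> real) \<Rightarrow> real" where
  "l1 M \<rho> \<sigma> \<equiv> (\<integral>x. \<bar>\<rho> x - \<sigma> x\<bar> \<partial>M)"

context finite_measure
begin

text \<open>The integrand lies between \<open>- 1\<close> and a convex combination of two integrable
  functions; constants are integrable because the measure is finite.\<close>

lemma xlnx_integrable_mix:
  assumes r: "\<rho> \<in> ent_dens M C" and s: "\<sigma> \<in> ent_dens M C" and t: "0 \<le> t" "t \<le> 1"
  shows "integrable M (\<lambda>x. ((1-t) * \<rho> x + t * \<sigma> x) * ln ((1-t) * \<rho> x + t * \<sigma> x))"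
proof (rule Bochner_Integration.integrable_bound)
  have [measurable]: "\<rho> \<in> borel_measurable M" "\<sigma> \<in> borel_measurable M" using r s by (auto simp: ent_dens_def)
  show "integrable M (\<lambda>x. 1 + (\<bar>\<rho> x * ln (\<rho> x)\<bar> + \<bar>\<sigma> x * ln (\<sigma> x)\<bar>))"
    using r s by (auto simp: ent_dens_def)
  show "(\<lambda>x. ((1-t) * \<rho> x + t * \<sigma> x) * ln ((1-t) * \<rho> x + t * \<sigma> x)) \<in> borel_measurable M" by measurable
  show "AE x in M. norm (((1-t) * \<rho> x + t * \<sigma> x) * ln ((1-t) * \<rho> x + t * \<sigma> x)) \<le> norm (1 + (\<bar>\<rho> x * ln (\<rho> x)\<bar> + \<bar>\<sigma> x * ln (\<sigma> x)\<bar>))"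
  proof (rule AE_I2)
    fix x
    have p: "0 \<le> \<rho> x" "0 \<le> \<sigma> x" using r s by (auto simp: ent_dens_def)
    have hm: "s * X \<le> \<bar>X\<bar>" if "0 \<le> s" "s \<le> 1" for s X :: real
    proof -
      have "s * X \<le> s * \<bar>X\<bar>" using that by (intro mult_left_mono) auto
      also have "\<dots> \<le> \<bar>X\<bar>" using that mult_right_mono[of s 1 "\<bar>X\<bar>"] by simp
      finally show ?thesis .
    qed
    have "(1-t) * (\<rho> x * ln (\<rho> x)) \<le> \<bar>\<rho> x * ln (\<rho> x)\<bar>" using t by (intro hm) auto
    moreover have "t * (\<sigma> x * ln (\<sigma> x)) \<le> \<bar>\<sigma> x * ln (\<sigma> x)\<bar>" using t by (intro hm) auto
    moreover have "- 1 \<le> ((1-t) * \<rho> x + t * \<sigma> x) * ln ((1-t) * \<rho> x + t * \<sigma> x)"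
      using p t by (intro xlnx_ge) simp
    ultimately show "norm (((1-t) * \<rho> x + t * \<sigma> x) * ln ((1-t) * \<rho> x + t * \<sigma> x)) \<le> norm (1 + (\<bar>\<rho> x * ln (\<rho> x)\<bar> + \<bar>\<sigma> x * ln (\<sigma> x)\<bar>))"
      using xlnx_convex[OF p t] by simp
  qed
qed

lemma ent_dens_convex:
  assumes r: "\<rho> \<in> ent_dens M C" and s: "\<sigma> \<in> ent_dens M C" and t: "0 \<le> t" "t \<le> 1"
  shows "(\<lambda>x. (1-t) * \<rho> x + t * \<sigma> x) \<in> ent_dens M C"
proof -
  have rs: "integrable M \<rho>" "integrable M \<sigma>" "integrable M (\<lambda>x. \<rho> x * ln (\<rho> x))" "integrable M (\<lambda>x. \<sigma> x * ln (\<sigma> x))"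
    using r s by (auto simp: ent_dens_def)
  have p: "0 \<le> \<rho> x" "0 \<le> \<sigma> x" for x using r s by (auto simp: ent_dens_def)
  have "(\<integral>x. ((1-t) * \<rho> x + t * \<sigma> x) * ln ((1-t) * \<rho> x + t * \<sigma> x) \<partial>M)
     \<le> (\<integral>x. (1-t) * (\<rho> x * ln (\<rho> x)) + t * (\<sigma> x * ln (\<sigma> x)) \<partial>M)"
    using rs p t by (intro integral_mono xlnx_integrable_mix[OF r s t] xlnx_convex) auto
  also have "\<dots> = (1-t) * (\<integral>x. \<rho> x * ln (\<rho> x) \<partial>M) + t * (\<integral>x. \<sigma> x * ln (\<sigma> x) \<partial>M)" using rs by simp
  also have "\<dots> \<le> (1-t) * C + t * C"
    using r s t by (intro add_mono mult_left_mono) (auto simp: ent_dens_def)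
  finally have "(\<integral>x. ((1-t) * \<rho> x + t * \<sigma> x) * ln ((1-t) * \<rho> x + t * \<sigma> x) \<partial>M) \<le> C" by (simp add: algebra_simps)
  then show ?thesis using r s t p xlnx_integrable_mix[OF r s t] by (auto simp: ent_dens_def)
qed

text \<open>The entropy gap at the midpoint controls the squared Hellinger distance, hence the
  \<open>L1\<close> distance. \<open>\<tau>\<close> is left free, to be fixed before the gap is made
  small.\<close>

lemma ent_dens_l1_gap:
  assumes r: "\<rho> \<in> ent_dens M C" and s: "\<sigma> \<in> ent_dens M C" and tau: "0 < \<tau>"
  shows "l1 M \<rho> \<sigma> \<le> ((\<integral>x. \<rho> x * ln (\<rho> x) \<partial>M) + (\<integral>x. \<sigma> x * ln (\<sigma> x) \<partial>M)
     - 2 * (\<integral>x. (\<rho> x + \<sigma> x) / 2 * ln ((\<rho> x + \<sigma> x) / 2) \<partial>M)) / \<tau> + 2 * \<tau>"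
proof -
  have rs: "integrable M \<rho>" "integrable M \<sigma>" "integrable M (\<lambda>x. \<rho> x * ln (\<rho> x))" "integrable M (\<lambda>x. \<sigma> x * ln (\<sigma> x))"
    "(\<integral>x. \<rho> x \<partial>M) = 1" "(\<integral>x. \<sigma> x \<partial>M) = 1"
    using r s by (auto simp: ent_dens_def)
  have p: "0 \<le> \<rho> x" "0 \<le> \<sigma> x" for x using r s by (auto simp: ent_dens_def)
  have eq: "(1 - 1/2) * \<rho> x + 1/2 * \<sigma> x = (\<rho> x + \<sigma> x) / 2" for x by (simp add: field_simps)
  have im: "integrable M (\<lambda>x. (\<rho> x + \<sigma> x) / 2 * ln ((\<rho> x + \<sigma> x) / 2))"
    using xlnx_integrable_mix[OF r s, of "1/2"] unfolding eq by simp
  have "l1 M \<rho> \<sigma> \<le> (\<integral>x. (\<rho> x * ln (\<rho> x) + \<sigma> x * ln (\<sigma> x) - 2 * ((\<rho> x + \<sigma> x) / 2 * ln ((\<rho> x + \<sigma> x) / 2))) / \<tau>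
      + \<tau> * (\<rho> x + \<sigma> x) \<partial>M)"
  proof (rule integral_mono)
    fix x
    let ?g = "\<rho> x * ln (\<rho> x) + \<sigma> x * ln (\<sigma> x) - 2 * ((\<rho> x + \<sigma> x) / 2 * ln ((\<rho> x + \<sigma> x) / 2))"
    have "(sqrt (\<rho> x) - sqrt (\<sigma> x))\<^sup>2 / (2 * \<tau>) = (sqrt (\<rho> x) - sqrt (\<sigma> x))\<^sup>2 / 2 / \<tau>" by simp
    also have "\<dots> \<le> ?g / \<tau>" using tau xlnx_midpoint_gap[OF p[of x]] by (intro divide_right_mono) auto
    finally show "\<bar>\<rho> x - \<sigma> x\<bar> \<le> ?g / \<tau> + \<tau> * (\<rho> x + \<sigma> x)"
      using abs_diff_le_sqrt[OF p[of x] tau] by linarith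
  next
    show "integrable M (\<lambda>x. \<bar>\<rho> x - \<sigma> x\<bar>)" using rs by auto
    show "integrable M (\<lambda>x. (\<rho> x * ln (\<rho> x) + \<sigma> x * ln (\<sigma> x) - 2 * ((\<rho> x + \<sigma> x) / 2 * ln ((\<rho> x + \<sigma> x) / 2))) / \<tau>
      + \<tau> * (\<rho> x + \<sigma> x))"
      using rs by (intro Bochner_Integration.integrable_add integrable_divide_zero Bochner_Integration.integrable_diff
          integrable_mult_right im) auto
  qed
  also have "\<dots> = ((\<integral>x. \<rho> x * ln (\<rho> x) \<partial>M) + (\<integral>x. \<sigma> x * ln (\<sigma> x) \<partial>M)
     - 2 * (\<integral>x. (\<rho> x + \<sigma> x) / 2 * ln ((\<rho> x + \<sigma> x) / 2) \<partial>M)) / \<tau> + \<tau> * (1 + 1)"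
    by (subst Bochner_Integration.integral_add, (intro Bochner_Integration.integrable_add integrable_divide_zero
          Bochner_Integration.integrable_diff integrable_mult_right im rs impI)+,
        subst integral_divide_zero, subst Bochner_Integration.integral_diff,
        (intro Bochner_Integration.integrable_add Bochner_Integration.integrable_diff integrable_mult_right im rs impI)+,
        simp add: rs im)
  finally show ?thesis by simp
qed

lemma xlnx_integral_ge:
  assumes r: "\<rho> \<in> ent_dens M C"
  shows "- measure M (space M) \<le> (\<integral>x. \<rho> x * ln (\<rho> x) \<partial>M)"
proof -
  have "(\<integral>x. - 1 \<partial>M) \<le> (\<integral>x. \<rho> x * ln (\<rho> x) \<partial>M)"
    using r by (intro integral_mono) (auto simp: ent_dens_def intro: xlnx_ge)
  then show ?thesis by simp
qed

text \<open>Fatou's lemma for \<open>\<rho> ln \<rho> + 1\<close>, which is nonnegative, along an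
  almost everywhere convergent subsequence.\<close>

lemma ent_dens_closed:
  assumes r: "\<And>n::nat. \<rho> n \<in> ent_dens M C" and s: "\<sigma> \<in> borel_measurable M" "\<And>x. 0 \<le> \<sigma> x" "integrable M \<sigma>"
    and lim: "(\<lambda>n. l1 M (\<rho> n) \<sigma>) \<longlonglongrightarrow> 0"
  shows "\<sigma> \<in> ent_dens M C"
proof -
  have ri: "integrable M (\<rho> n)" "\<rho> n \<in> borel_measurable M" "(\<integral>x. \<rho> n x \<partial>M) = 1"
    "integrable M (\<lambda>x. \<rho> n x * ln (\<rho> n x))" "(\<integral>x. \<rho> n x * ln (\<rho> n x) \<partial>M) \<le> C" "\<And>x. 0 \<le> \<rho> n x" for n
    using r[of n] by (auto simp: ent_dens_def)
  note [measurable] = s(1) ri(2)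
  have one: "(\<integral>x. \<sigma> x \<partial>M) = 1"
  proof -
    have "\<bar>1 - (\<integral>x. \<sigma> x \<partial>M)\<bar> \<le> l1 M (\<rho> n) \<sigma>" for n
      using ri[of n] s integral_abs_bound[of M "\<lambda>x. \<rho> n x - \<sigma> x"] by simp
    then have "\<bar>1 - (\<integral>x. \<sigma> x \<partial>M)\<bar> \<le> 0" by (intro LIMSEQ_le_const[OF lim]) auto
    then show ?thesis by simp
  qed
  obtain k where k: "strict_mono k" "AE x in M. (\<lambda>n. \<rho> (k n) x - \<sigma> x) \<longlonglongrightarrow> 0"
    using tendsto_L1_AE_subseq[of M "\<lambda>n x. \<rho> n x - \<sigma> x"] ri s lim by auto
  let ?f = "\<lambda>x. \<sigma> x * ln (\<sigma> x)"
  have cont: "(\<lambda>n. \<rho> (k n) x * ln (\<rho> (k n) x)) \<longlonglongrightarrow> \<sigma> x * ln (\<sigma> x)" if "(\<lambda>n. \<rho> (k n) x - \<sigma> x) \<longlonglongrightarrow> 0" for x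
  proof -
    have l: "(\<lambda>n. \<rho> (k n) x) \<longlonglongrightarrow> \<sigma> x" using that by (simp add: LIM_zero_iff)
    show ?thesis
    proof (cases "\<sigma> x = 0")
      case False
      then show ?thesis using l by (intro tendsto_mult tendsto_ln) auto
    next
      case True
      have "(\<lambda>n. sqrt (\<rho> (k n) x) * 2) \<longlonglongrightarrow> sqrt 0 * 2" using l True by (intro tendsto_intros) auto
      moreover have "(\<lambda>n. (\<rho> (k n) x)\<^sup>2) \<longlonglongrightarrow> 0\<^sup>2" using l True by (intro tendsto_intros) auto
      ultimately have "(\<lambda>n. sqrt (\<rho> (k n) x) * 2 + (\<rho> (k n) x)\<^sup>2) \<longlonglongrightarrow> 0" using tendsto_add by fastforce
      \<comment> \<open>At \<open>0\<close> the logarithm is not continuous; this bound shows that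
        the product still tends to \<open>0\<close>.\<close>
      moreover have "\<bar>a * ln a\<bar> \<le> sqrt a * 2 + a\<^sup>2" if "0 \<le> a" for a :: real
      proof (cases "a = 0")
        case False
        then have a: "0 < a" using that by simp
        have 1: "a * ln a \<le> a * a" using a ln_le_minus_one[OF a] by (intro mult_left_mono) auto
        have "ln (1 / sqrt a) \<le> 1 / sqrt a - 1" using a by (intro ln_le_minus_one) simp
        then have "- ln a \<le> 2 / sqrt a" using a by (simp add: ln_div ln_sqrt)
        then have "a * (- ln a) \<le> a * (2 / sqrt a)" using a by (intro mult_left_mono) auto
        also have "\<dots> = sqrt a * 2" using a by (simp add: field_simps)
        finally show ?thesis using 1 a by (auto simp: abs_le_iff power2_eq_square add_increasing add_increasing2)
      qed simp
      ultimately show ?thesis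
        using True ri(6) by (auto intro!: Lim_null_comparison[where g="\<lambda>n. sqrt (\<rho> (k n) x) * 2 + (\<rho> (k n) x)\<^sup>2"])
    qed
  qed
  have K: "(\<integral>\<^sup>+x. ennreal (?f x + 1) \<partial>M) \<le> ennreal (C + measure M (space M))"
  proof -
    have "(\<integral>\<^sup>+x. ennreal (?f x + 1) \<partial>M) = (\<integral>\<^sup>+x. liminf (\<lambda>n. ennreal (\<rho> (k n) x * ln (\<rho> (k n) x) + 1)) \<partial>M)"
      using k(2)
    proof (intro nn_integral_cong_AE, eventually_elim)
      case (elim x)
      have "(\<lambda>n. ennreal (\<rho> (k n) x * ln (\<rho> (k n) x) + 1)) \<longlonglongrightarrow> ennreal (?f x + 1)"
        by (intro tendsto_ennrealI tendsto_add cont elim tendsto_const)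
      then show ?case by (intro lim_imp_Liminf[symmetric]) auto
    qed
    also have "\<dots> \<le> liminf (\<lambda>n. \<integral>\<^sup>+x. ennreal (\<rho> (k n) x * ln (\<rho> (k n) x) + 1) \<partial>M)"
      by (rule nn_integral_liminf) measurable
    also have "\<dots> \<le> liminf (\<lambda>n. ennreal (C + measure M (space M)))"
    proof (intro Liminf_mono always_eventually allI)
      fix n
      have "(\<integral>\<^sup>+x. ennreal (\<rho> (k n) x * ln (\<rho> (k n) x) + 1) \<partial>M) = ennreal (\<integral>x. \<rho> (k n) x * ln (\<rho> (k n) x) + 1 \<partial>M)"
      proof (rule nn_integral_eq_integral)
        show "integrable M (\<lambda>x. \<rho> (k n) x * ln (\<rho> (k n) x) + 1)" using ri by auto
        show "AE x in M. 0 \<le> \<rho> (k n) x * ln (\<rho> (k n) x) + 1"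
          using xlnx_ge[OF ri(6)[of "k n"]] by (intro AE_I2) (smt (verit))
      qed
      also have "\<dots> \<le> ennreal (C + measure M (space M))"
        using ri[of "k n"] by (intro ennreal_leI) simp
      finally show "(\<integral>\<^sup>+x. ennreal (\<rho> (k n) x * ln (\<rho> (k n) x) + 1) \<partial>M) \<le> ennreal (C + measure M (space M))" .
    qed
    also have "\<dots> = ennreal (C + measure M (space M))" by (simp add: Liminf_const)
    finally show ?thesis .
  qed
  have nn: "0 \<le> ?f x + 1" for x using xlnx_ge[OF s(2)[of x]] by simp
  have i1: "integrable M (\<lambda>x. ?f x + 1)"
    using K nn by (intro integrableI_nonneg) (auto intro: le_less_trans)
  then have i: "integrable M ?f" using Bochner_Integration.integrable_diff[OF i1 integrable_const[of 1]] by simp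
  have "0 \<le> C + measure M (space M)" using xlnx_integral_ge[OF r[of 0]] ri(5)[of 0] by linarith
  moreover have "ennreal (\<integral>x. ?f x + 1 \<partial>M) \<le> ennreal (C + measure M (space M))"
    using K nn_integral_eq_integral[OF i1] nn by simp
  ultimately have "(\<integral>x. ?f x + 1 \<partial>M) \<le> C + measure M (space M)" by simp
  then have "(\<integral>x. ?f x \<partial>M) \<le> C" using i by simp
  then show ?thesis using s one i by (simp add: ent_dens_def)
qed

text \<open>The Riesz-Fischer argument: a subsequence with summable increments converges almost
  everywhere, and Fatou's lemma upgrades this to \<open>L1\<close> convergence of the whole
  sequence.\<close>

lemma ent_dens_complete:
  assumes r: "\<And>n::nat. \<rho> n \<in> ent_dens M C"
    and cauchy: "\<And>e. 0 < e \<Longrightarrow> \<exists>N. \<forall>m\<ge>N. \<forall>n\<ge>N. l1 M (\<rho> m) (\<rho> n) < e"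
  obtains \<sigma> where "\<sigma> \<in> ent_dens M C" "(\<lambda>n. l1 M (\<rho> n) \<sigma>) \<longlonglongrightarrow> 0"
proof -
  have ri: "integrable M (\<rho> n)" "\<rho> n \<in> borel_measurable M" "\<And>x. 0 \<le> \<rho> n x" for n
    using r[of n] by (auto simp: ent_dens_def)
  note [measurable] = ri(2)
  have "\<forall>k. \<exists>N. \<forall>m\<ge>N. \<forall>n\<ge>N. l1 M (\<rho> m) (\<rho> n) < (1/2)^k" using cauchy by simp
  then obtain N where N: "\<And>k m n. N k \<le> m \<Longrightarrow> N k \<le> n \<Longrightarrow> l1 M (\<rho> m) (\<rho> n) < (1/2)^k" by metis
  \<comment> \<open>The partial sum dominates \<open>N k\<close> and never decreases, so both
    \<open>R k\<close> and \<open>R (Suc k)\<close> are beyond \<open>N k\<close>; the summand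
    \<open>k\<close> makes \<open>R\<close> pass every bound.\<close>
  define R where "R k = k + (\<Sum>i\<le>k. N i)" for k
  have RN: "N k \<le> R k" "k \<le> R k" "N k \<le> R (Suc k)" for k
    proof -
    have "N k \<le> (\<Sum>i\<le>k. N i)" by (rule member_le_sum) auto
    then show "N k \<le> R k" "k \<le> R k" "N k \<le> R (Suc k)" unfolding R_def by auto
  qed
  have li: "(\<integral>\<^sup>+x. ennreal \<bar>\<rho> m x - \<rho> n x\<bar> \<partial>M) = ennreal (l1 M (\<rho> m) (\<rho> n))" for m n
    using ri by (intro nn_integral_eq_integral) auto
  have "(\<integral>\<^sup>+x. (\<Sum>k. ennreal \<bar>\<rho> (R (Suc k)) x - \<rho> (R k) x\<bar>) \<partial>M)
     = (\<Sum>k. \<integral>\<^sup>+x. ennreal \<bar>\<rho> (R (Suc k)) x - \<rho> (R k) x\<bar> \<partial>M)"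
    by (rule nn_integral_suminf) measurable
  also have "\<dots> \<le> (\<Sum>k. ennreal ((1/2)^k))"
    unfolding li using N RN by (intro suminf_le ennreal_leI less_imp_le) auto
  also have "\<dots> = ennreal 2"
    by (intro suminf_ennreal_eq) (auto intro: sums_unique2 geometric_sums[of "1/2::real", simplified])
  finally have "(\<integral>\<^sup>+x. (\<Sum>k. ennreal \<bar>\<rho> (R (Suc k)) x - \<rho> (R k) x\<bar>) \<partial>M) \<noteq> \<infinity>"
    by (auto simp: top_unique)
  then have "AE x in M. (\<Sum>k. ennreal \<bar>\<rho> (R (Suc k)) x - \<rho> (R k) x\<bar>) \<noteq> \<infinity>"
    by (intro nn_integral_noteq_infinite) auto
  then have conv: "AE x in M. convergent (\<lambda>k. \<rho> (R k) x)"
  proof eventually_elim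
    case (elim x)
    then have "summable (\<lambda>k. \<bar>\<rho> (R (Suc k)) x - \<rho> (R k) x\<bar>)"
      by (intro summable_suminf_not_top) auto
    then have "summable (\<lambda>k. \<rho> (R (Suc k)) x - \<rho> (R k) x)" by (rule summable_rabs_cancel)
    then have "convergent (\<lambda>n. \<Sum>k<n. \<rho> (R (Suc k)) x - \<rho> (R k) x)" by (simp add: summable_iff_convergent)
    then have "convergent (\<lambda>n. \<rho> (R n) x - \<rho> (R 0) x)" by (subst (asm) sum_lessThan_telescope)
    then have "convergent (\<lambda>n. (\<rho> (R n) x - \<rho> (R 0) x) + \<rho> (R 0) x)" by (intro convergent_add convergent_const)
    then show ?case by simp
  qed
  \<comment> \<open>\<open>lim\<close> is arbitrary where the sequence diverges;
    \<open>max 0\<close> makes \<open>\<sigma>\<close> nonnegative at those points too.\<close>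
  define \<sigma> where "\<sigma> x = max 0 (lim (\<lambda>k. \<rho> (R k) x))" for x
  have sm[measurable]: "\<sigma> \<in> borel_measurable M" unfolding \<sigma>_def by measurable
  have lim: "AE x in M. (\<lambda>k. \<rho> (R k) x) \<longlonglongrightarrow> \<sigma> x"
    using conv
  proof eventually_elim
    case (elim x)
    then have l: "(\<lambda>k. \<rho> (R k) x) \<longlonglongrightarrow> lim (\<lambda>k. \<rho> (R k) x)" by (simp add: convergent_LIMSEQ_iff)
    then have "0 \<le> lim (\<lambda>k. \<rho> (R k) x)" by (rule LIMSEQ_le_const) (use ri(3) in auto)
    then show ?case using l by (simp add: \<sigma>_def)
  qed
  have bound: "\<exists>N. \<forall>n\<ge>N. (\<integral>\<^sup>+x. ennreal \<bar>\<rho> n x - \<sigma> x\<bar> \<partial>M) \<le> ennreal e" if e: "0 < e" for e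
  proof -
    obtain N0 where N0: "\<And>m n. N0 \<le> m \<Longrightarrow> N0 \<le> n \<Longrightarrow> l1 M (\<rho> m) (\<rho> n) < e" using cauchy[OF e] by blast
    have "(\<integral>\<^sup>+x. ennreal \<bar>\<rho> n x - \<sigma> x\<bar> \<partial>M) \<le> ennreal e" if n: "N0 \<le> n" for n
    proof -
      have "(\<integral>\<^sup>+x. ennreal \<bar>\<rho> n x - \<sigma> x\<bar> \<partial>M) = (\<integral>\<^sup>+x. liminf (\<lambda>k. ennreal \<bar>\<rho> n x - \<rho> (R k) x\<bar>) \<partial>M)"
        using lim
      proof (intro nn_integral_cong_AE, eventually_elim)
        case (elim x)
        have "(\<lambda>k. ennreal \<bar>\<rho> n x - \<rho> (R k) x\<bar>) \<longlonglongrightarrow> ennreal \<bar>\<rho> n x - \<sigma> x\<bar>"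
          by (intro tendsto_ennrealI tendsto_rabs tendsto_diff tendsto_const elim)
        then show ?case by (intro lim_imp_Liminf[symmetric]) auto
      qed
      also have "\<dots> \<le> liminf (\<lambda>k. \<integral>\<^sup>+x. ennreal \<bar>\<rho> n x - \<rho> (R k) x\<bar> \<partial>M)"
        by (rule nn_integral_liminf) measurable
      also have "\<dots> \<le> liminf (\<lambda>k::nat. ennreal e)"
      proof (rule Liminf_mono)
        show "\<forall>\<^sub>F k in sequentially. (\<integral>\<^sup>+x. ennreal \<bar>\<rho> n x - \<rho> (R k) x\<bar> \<partial>M) \<le> ennreal e"
          using eventually_ge_at_top[of N0]
        proof eventually_elim
          case (elim k)
          then have "N0 \<le> R k" using RN(2)[of k] by simp
          then show ?case unfolding li using N0[OF n] by (intro ennreal_leI less_imp_le)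
        qed
      qed
      also have "\<dots> = ennreal e" by (simp add: Liminf_const)
      finally show ?thesis .
    qed
    then show ?thesis by blast
  qed
  have "integrable M \<sigma>"
  proof -
    obtain n where n: "(\<integral>\<^sup>+x. ennreal \<bar>\<rho> n x - \<sigma> x\<bar> \<partial>M) \<le> ennreal 1" using bound[of 1] by auto
    have "integrable M (\<lambda>x. \<rho> n x - \<sigma> x)"
      using n by (intro integrableI_bounded) (auto intro: le_less_trans)
    then have "integrable M (\<lambda>x. \<rho> n x - (\<rho> n x - \<sigma> x))" by (rule Bochner_Integration.integrable_diff[OF ri(1)])
    then show ?thesis by simp
  qed
  have l1b: "\<exists>N. \<forall>n\<ge>N. l1 M (\<rho> n) \<sigma> \<le> e" if "0 < e" for e
  proof -
    have "(\<integral>\<^sup>+x. ennreal \<bar>\<rho> n x - \<sigma> x\<bar> \<partial>M) = ennreal (l1 M (\<rho> n) \<sigma>)" for n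
      using ri \<open>integrable M \<sigma>\<close> by (intro nn_integral_eq_integral) auto
    then show ?thesis using bound[OF that] that by simp
  qed
  have "(\<lambda>n. l1 M (\<rho> n) \<sigma>) \<longlonglongrightarrow> 0"
  proof (rule LIMSEQ_I)
    fix e :: real assume e: "0 < e"
    then obtain N where N: "\<forall>n\<ge>N. l1 M (\<rho> n) \<sigma> \<le> e/2" using l1b[of "e/2"] by auto
    have "norm (l1 M (\<rho> n) \<sigma> - 0) < e" if "N \<le> n" for n
    proof -
      have "l1 M (\<rho> n) \<sigma> \<le> e/2" "0 \<le> l1 M (\<rho> n) \<sigma>" using N that by auto
      then show ?thesis using e by simp
    qed
    then show "\<exists>N. \<forall>n\<ge>N. norm (l1 M (\<rho> n) \<sigma> - 0) < e" by blast
  qed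
  moreover have "\<sigma> \<in> ent_dens M C"
    by (rule ent_dens_closed[OF r sm _ \<open>integrable M \<sigma>\<close> calculation]) (simp add: \<sigma>_def)
  ultimately show ?thesis using that by blast
qed

text \<open>The entropy is uniformly convex with respect to the \<open>L\<^sup>1\<close> distance, so near-minimisers along a
  directed family form a Cauchy sequence. This replaces weak compactness of entropy sublevels.\<close>

theorem ent_dens_directed_Inter:
  fixes \<A> :: "('a \<Rightarrow> real) set set"
  assumes ne: "\<A> \<noteq> {}"
    and nonempty: "\<And>A. A \<in> \<A> \<Longrightarrow> A \<noteq> {}"
    and sub: "\<And>A. A \<in> \<A> \<Longrightarrow> A \<subseteq> ent_dens M C"
    and mid: "\<And>A \<rho> \<sigma>. A \<in> \<A> \<Longrightarrow> \<rho> \<in> A \<Longrightarrow> \<sigma> \<in> A \<Longrightarrow> (\<lambda>x. (\<rho> x + \<sigma> x) / 2) \<in> A"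
    and closed: "\<And>A \<rho> \<sigma>. A \<in> \<A> \<Longrightarrow> (\<And>n::nat. \<rho> n \<in> A) \<Longrightarrow> \<sigma> \<in> ent_dens M C \<Longrightarrow>
       (\<lambda>n. l1 M (\<rho> n) \<sigma>) \<longlonglongrightarrow> 0 \<Longrightarrow> \<sigma> \<in> A"
    and directed: "\<And>A B. A \<in> \<A> \<Longrightarrow> B \<in> \<A> \<Longrightarrow> \<exists>D\<in>\<A>. D \<subseteq> A \<inter> B"
  shows "\<exists>\<sigma>. \<forall>A\<in>\<A>. \<sigma> \<in> A"
proof -
  define J where "J \<rho> = (\<integral>x. \<rho> x * ln (\<rho> x) \<partial>M)" for \<rho> :: "'a \<Rightarrow> real"
  define I where "I A = Inf (J ` A)" for A
  have Jlow: "- measure M (space M) \<le> J \<rho>" "J \<rho> \<le> C" if "\<rho> \<in> A" "A \<in> \<A>" for \<rho> A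
    using xlnx_integral_ge[of \<rho> C] sub that unfolding J_def by (auto simp: ent_dens_def)
  have bdd: "bdd_below (J ` A)" if "A \<in> \<A>" for A
    using Jlow that by (intro bdd_belowI[of _ "- measure M (space M)"]) auto
  have I_le: "I A \<le> J \<rho>" if "\<rho> \<in> A" "A \<in> \<A>" for \<rho> A
    unfolding I_def using that bdd by (intro cInf_lower) auto
  have I_C: "I A \<le> C" if "A \<in> \<A>" for A
    using nonempty[OF that] I_le[OF _ that] Jlow(2)[OF _ that] by (meson ex_in_conv order_trans)
  have I_close: "\<exists>\<rho>\<in>A. J \<rho> < I A + e" if "A \<in> \<A>" "0 < e" for A e
    using cInf_lessD[of "J ` A" "I A + e"] that nonempty[OF that(1)] by (auto simp: I_def)
  have I_mono: "I A \<le> I D" if "A \<in> \<A>" "D \<in> \<A>" "D \<subseteq> A" for A D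
    unfolding I_def using that bdd nonempty by (intro cInf_superset_mono) auto
  \<comment> \<open>The infimum of the entropy grows as the sets shrink; \<open>s\<close> is its
    limit along the directed family.\<close>
  define s where "s = (SUP A\<in>\<A>. I A)"
  have bs: "bdd_above (I ` \<A>)" using I_C by (intro bdd_aboveI[of _ C]) auto
  have I_s: "I A \<le> s" if "A \<in> \<A>" for A unfolding s_def using bs that by (intro cSUP_upper) auto
  have "\<exists>A\<in>\<A>. s - 1 / (real n + 1) < I A" for n :: nat
    using less_cSUP_iff[OF ne bs, of "s - 1 / (real n + 1)"] unfolding s_def[symmetric] by simp
  then obtain A where A: "\<And>n. A n \<in> \<A>" "\<And>n. s - 1 / (real n + 1) < I (A n)" by metis
  obtain meet where meet: "\<And>A B. A \<in> \<A> \<Longrightarrow> B \<in> \<A> \<Longrightarrow> meet A B \<in> \<A> \<and> meet A B \<subseteq> A \<inter> B"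
    using directed by metis
  \<comment> \<open>A decreasing sequence in the family whose infima tend to
    \<open>s\<close>.\<close>
  define B where "B = rec_nat (A 0) (\<lambda>n S. meet S (A (Suc n)))"
  have B0: "B 0 = A 0" and BS: "B (Suc n) = meet (B n) (A (Suc n))" for n by (simp_all add: B_def)
  have BA: "B n \<in> \<A>" for n by (induction n) (use A meet in \<open>auto simp: B0 BS\<close>)
  have BsubA: "B n \<subseteq> A n" for n using meet[OF BA A(1)] by (cases n) (auto simp: B0 BS)
  have Bdec: "B m \<subseteq> B n" if "n \<le> m" for n m
    using that by (induction rule: dec_induct) (use meet[OF BA A(1)] in \<open>auto simp: BS\<close>)
  have IB: "s - 1 / (real n + 1) < I (B n)" for n
    using A(2)[of n] I_mono[OF A(1) BA BsubA] by (rule less_le_trans)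
  \<comment> \<open>The midpoint lies in \<open>B n\<close>, so its entropy is above
    \<open>s - 1/(n+1)\<close>; the entropy gap is therefore at most \<open>4/(n+1)\<close>.\<close>
  have close: "l1 M \<rho> \<sigma> \<le> (4 / (real n + 1)) / \<tau> + 2 * \<tau>"
    if "\<rho> \<in> B n" "\<sigma> \<in> B n" "J \<rho> < s + 1 / (real n + 1)" "J \<sigma> < s + 1 / (real n + 1)" "0 < \<tau>" for \<rho> \<sigma> n \<tau>
  proof -
    have m: "(\<lambda>x. (\<rho> x + \<sigma> x) / 2) \<in> B n" by (rule mid[OF BA that(1,2)])
    have "J \<rho> + J \<sigma> - 2 * J (\<lambda>x. (\<rho> x + \<sigma> x) / 2) \<le> 4 / (real n + 1)"
    proof -
      define q where "q = 1 / (real n + 1)"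
      have "4 / (real n + 1) = 4 * q" by (simp add: q_def)
      then show ?thesis using that(3,4) I_le[OF m BA] IB[of n] unfolding q_def[symmetric] by linarith
    qed
    then have "(J \<rho> + J \<sigma> - 2 * J (\<lambda>x. (\<rho> x + \<sigma> x) / 2)) / \<tau> \<le> (4 / (real n + 1)) / \<tau>"
      using that(5) by (intro divide_right_mono) auto
    then show ?thesis
      using ent_dens_l1_gap[OF subsetD[OF sub[OF BA] that(1)] subsetD[OF sub[OF BA] that(2)] that(5)]
      unfolding J_def by linarith
  qed
  \<comment> \<open>The choice \<open>\<tau> = e/4\<close> turns the estimate into
    \<open>16 / ((n+1) e) + e/2\<close>.\<close>
  have small: "\<exists>N. \<forall>n\<ge>N. (4 / (real n + 1)) / (e/4) + 2 * (e/4) < e" if e: "0 < e" for e :: real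
  proof -
    obtain N :: nat where N: "64 / (e * e) < real N" using reals_Archimedean2 by blast
    have "(4 / (real n + 1)) / (e/4) + 2 * (e/4) < e" if "N \<le> n" for n
    proof -
      have "64 / (e * e) < real n + 1" using N that by linarith
      then have "64 < (real n + 1) * (e * e)" using e by (simp add: field_simps)
      then have "16 / ((real n + 1) * e) < e / 4" using e
        by (subst pos_divide_less_eq) (auto simp: algebra_simps add_pos_nonneg)
      then show ?thesis using e by (simp add: field_simps)
    qed
    then show ?thesis by blast
  qed
  have pick: "\<exists>\<rho>\<in>D. J \<rho> < s + 1 / (real n + 1)" if D: "D \<in> \<A>" for D and n :: nat
  proof -
    have "0 < 1 / (real n + 1)" by simp
    then obtain \<rho> where "\<rho> \<in> D" "J \<rho> < I D + 1 / (real n + 1)" using I_close[OF D] by blast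
    then show ?thesis using I_s[OF D] by (intro bexI[of _ \<rho>]) auto
  qed
  obtain \<rho> where \<rho>: "\<And>n. \<rho> n \<in> B n" "\<And>n. J (\<rho> n) < s + 1 / (real n + 1)"
  proof -
    have "\<forall>n. \<exists>\<rho>. \<rho> \<in> B n \<and> J \<rho> < s + 1 / (real n + 1)" using pick[OF BA] by blast
    then show thesis using that by metis
  qed
  have \<rho>d: "\<rho> n \<in> ent_dens M C" for n using \<rho>(1) sub[OF BA] by blast
  have step: "J (\<rho> m) < s + 1 / (real n + 1)" if "n \<le> m" for n m
  proof -
    have "1 / (real m + 1) \<le> 1 / (real n + 1)" using that by (simp add: frac_le)
    then show ?thesis using \<rho>(2)[of m] by linarith
  qed
  have "\<exists>N. \<forall>m\<ge>N. \<forall>n\<ge>N. l1 M (\<rho> m) (\<rho> n) < e" if e: "0 < e" for e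
  proof -
    obtain N where N: "(4 / (real N + 1)) / (e/4) + 2 * (e/4) < e" using small[OF e] by blast
    have "l1 M (\<rho> m) (\<rho> n) < e" if "N \<le> m" "N \<le> n" for m n
    proof -
      have "l1 M (\<rho> m) (\<rho> n) \<le> (4 / (real N + 1)) / (e/4) + 2 * (e/4)"
        using e by (intro close step that subsetD[OF Bdec[OF that(1)] \<rho>(1)] subsetD[OF Bdec[OF that(2)] \<rho>(1)]) simp
      then show ?thesis using N by linarith
    qed
    then show ?thesis by blast
  qed
  then obtain \<sigma> where \<sigma>: "\<sigma> \<in> ent_dens M C" and lim: "(\<lambda>n. l1 M (\<rho> n) \<sigma>) \<longlonglongrightarrow> 0"
    using ent_dens_complete[of \<rho> C, OF \<rho>d] by blast
  \<comment> \<open>For an arbitrary member \<open>E\<close>, near-minimisers inside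
    \<open>meet (B n) E\<close> are close to \<open>\<rho> n\<close> and share its limit, so
    \<open>\<sigma>\<close> is in \<open>E\<close> by closedness.\<close>
  have "\<sigma> \<in> E" if E: "E \<in> \<A>" for E
  proof -
    have "meet (B n) E \<in> \<A>" for n using meet[OF BA E] by blast
    obtain \<rho>' where \<rho>': "\<And>n. \<rho>' n \<in> meet (B n) E" "\<And>n. J (\<rho>' n) < s + 1 / (real n + 1)"
    proof -
      have "\<forall>n. \<exists>\<rho>. \<rho> \<in> meet (B n) E \<and> J \<rho> < s + 1 / (real n + 1)"
        using pick[OF \<open>\<And>n. meet (B n) E \<in> \<A>\<close>] by blast
      then show thesis using that by metis
    qed
    have in': "\<rho>' n \<in> B n" "\<rho>' n \<in> E" for n using \<rho>'(1)[of n] meet[OF BA E, of n] by blast+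
    have d': "\<rho>' n \<in> ent_dens M C" for n using in'(2) sub[OF E] by blast
    have l0: "(\<lambda>n. l1 M (\<rho>' n) (\<rho> n)) \<longlonglongrightarrow> 0"
    proof (rule LIMSEQ_I)
      fix e :: real assume e: "0 < e"
      obtain N where N: "\<forall>n\<ge>N. (4 / (real n + 1)) / (e/4) + 2 * (e/4) < e" using small[OF e] by blast
      have "norm (l1 M (\<rho>' n) (\<rho> n) - 0) < e" if "N \<le> n" for n
      proof -
        have "l1 M (\<rho>' n) (\<rho> n) \<le> (4 / (real n + 1)) / (e/4) + 2 * (e/4)"
          using e by (intro close in' \<rho> \<rho>'(2)) auto
        moreover have "0 \<le> l1 M (\<rho>' n) (\<rho> n)" by simp
        moreover have "(4 / (real n + 1)) / (e/4) + 2 * (e/4) < e" using N that by blast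
        ultimately show ?thesis by simp
      qed
      then show "\<exists>N. \<forall>n\<ge>N. norm (l1 M (\<rho>' n) (\<rho> n) - 0) < e" by blast
    qed
    have "(\<lambda>n. l1 M (\<rho>' n) \<sigma>) \<longlonglongrightarrow> 0"
    proof (rule tendsto_sandwich[OF _ _ tendsto_const])
      show "(\<lambda>n. l1 M (\<rho>' n) (\<rho> n) + l1 M (\<rho> n) \<sigma>) \<longlonglongrightarrow> 0" using tendsto_add[OF l0 lim] by simp
      show "\<forall>\<^sub>F n in sequentially. l1 M (\<rho>' n) \<sigma> \<le> l1 M (\<rho>' n) (\<rho> n) + l1 M (\<rho> n) \<sigma>"
      proof (intro always_eventually allI)
        fix n
        have i: "integrable M (\<rho> n)" "integrable M (\<rho>' n)" "integrable M \<sigma>"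
          using \<rho>d[of n] d'[of n] \<sigma> by (auto simp: ent_dens_def)
        have "l1 M (\<rho>' n) \<sigma> \<le> (\<integral>x. \<bar>\<rho>' n x - \<rho> n x\<bar> + \<bar>\<rho> n x - \<sigma> x\<bar> \<partial>M)"
          using i by (intro integral_mono) auto
        then show "l1 M (\<rho>' n) \<sigma> \<le> l1 M (\<rho>' n) (\<rho> n) + l1 M (\<rho> n) \<sigma>" using i by simp
      qed
    qed auto
    then show ?thesis by (rule closed[OF E in'(2) \<sigma>])
  qed
  then show ?thesis by blast
qed

end

lemma ennreal_less_add: "x < top \<Longrightarrow> 0 < e \<Longrightarrow> x < x + ennreal e"
  by (cases x) (auto simp: ennreal_less_iff simp flip: ennreal_plus)

subsection \<open>Linear combinations of measures\<close>

text \<open>One construction serves mixtures of couplings, a restriction plus a remainder, and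
  finitely supported measures on \<open>Prob T\<close>. The sigma-algebra is that of
  \<open>Z\<close>, whatever the \<open>N i\<close> are.\<close>

definition lincomb :: "'b measure \<Rightarrow> 'i set \<Rightarrow> ('i \<Rightarrow> ennreal) \<Rightarrow> ('i \<Rightarrow> 'b measure) \<Rightarrow> 'b measure" where
  "lincomb Z I w N = measure_of (space Z) (sets Z) (\<lambda>A. \<Sum>i\<in>I. w i * emeasure (N i) A)"

lemma sets_lincomb [simp]: "sets (lincomb Z I w N) = sets Z"
  and space_lincomb [simp]: "space (lincomb Z I w N) = space Z"
  by (simp_all add: lincomb_def)

lemma emeasure_lincomb:
  assumes s: "\<And>i. i \<in> I \<Longrightarrow> sets (N i) = sets Z" and A: "A \<in> sets Z"
  shows "emeasure (lincomb Z I w N) A = (\<Sum>i\<in>I. w i * emeasure (N i) A)"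
proof (rule emeasure_measure_of[OF lincomb_def])
  show "sets Z \<subseteq> Pow (space Z)" by (rule sets.space_closed)
  show "positive (sets (lincomb Z I w N)) (\<lambda>A. \<Sum>i\<in>I. w i * emeasure (N i) A)"
    by (simp add: positive_def)
  show "countably_additive (sets (lincomb Z I w N)) (\<lambda>A. \<Sum>i\<in>I. w i * emeasure (N i) A)"
  proof (rule countably_additiveI)
    fix F :: "nat \<Rightarrow> _" assume F: "range F \<subseteq> sets (lincomb Z I w N)" "disjoint_family F"
    have "(\<Sum>n. \<Sum>i\<in>I. w i * emeasure (N i) (F n)) = (\<Sum>i\<in>I. \<Sum>n. w i * emeasure (N i) (F n))"
      by (rule suminf_sum) auto
    also have "\<dots> = (\<Sum>i\<in>I. w i * emeasure (N i) (\<Union>n. F n))"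
      using F s by (intro sum.cong refl) (subst ennreal_suminf_cmult, subst suminf_emeasure, auto)
    finally show "(\<Sum>n. \<Sum>i\<in>I. w i * emeasure (N i) (F n)) = (\<Sum>i\<in>I. w i * emeasure (N i) (\<Union>n. F n))" .
  qed
  show "A \<in> sets (lincomb Z I w N)" using A by simp
qed

lemma nn_integral_lincomb:
  assumes s: "\<And>i. i \<in> I \<Longrightarrow> sets (N i) = sets Z" and f: "f \<in> borel_measurable Z"
  shows "(\<integral>\<^sup>+x. f x \<partial>lincomb Z I w N) = (\<Sum>i\<in>I. w i * (\<integral>\<^sup>+x. f x \<partial>N i))"
  using f
proof (induction rule: borel_measurable_induct)
  case (cong f g)
  have "(\<integral>\<^sup>+x. f x \<partial>lincomb Z I w N) = (\<integral>\<^sup>+x. g x \<partial>lincomb Z I w N)"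
    using cong by (intro nn_integral_cong) auto
  also have "\<dots> = (\<Sum>i\<in>I. w i * (\<integral>\<^sup>+x. f x \<partial>N i))"
    unfolding cong(4)
  proof (intro sum.cong refl arg_cong2[where f="(*)"] nn_integral_cong)
    fix i x assume "i \<in> I" "x \<in> space (N i)"
    then show "g x = f x" using cong(3)[of x] sets_eq_imp_space_eq[OF s, of i] by simp
  qed
  finally show ?case .
next
  case (set A)
  then show ?case using emeasure_lincomb[OF s set] s by simp
next
  case (mult u c)
  have "u \<in> borel_measurable (N i)" if "i \<in> I" for i using mult(2) s[OF that] by (simp cong: measurable_cong_sets)
  moreover have "u \<in> borel_measurable (lincomb Z I w N)" using mult(2) by (simp cong: measurable_cong_sets)
  ultimately show ?case using mult by (simp add: nn_integral_cmult sum_distrib_left mult.left_commute)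
next
  case (add u v)
  have "u \<in> borel_measurable (N i)" "v \<in> borel_measurable (N i)" if "i \<in> I" for i
    using \<open>u \<in> _\<close> \<open>v \<in> _\<close> s[OF that] by (simp_all cong: measurable_cong_sets)
  moreover have "u \<in> borel_measurable (lincomb Z I w N)" "v \<in> borel_measurable (lincomb Z I w N)"
    using \<open>u \<in> _\<close> \<open>v \<in> _\<close> by (simp_all cong: measurable_cong_sets)
  ultimately show ?case using add by (simp add: nn_integral_add sum.distrib distrib_left)
next
  case (seq U)
  have m: "U n \<in> borel_measurable (N i)" if "i \<in> I" for i n
    using seq(1) s[OF that] by (simp cong: measurable_cong_sets)
  have m': "U n \<in> borel_measurable (lincomb Z I w N)" for n using seq(1) by (simp cong: measurable_cong_sets)
  have "(\<integral>\<^sup>+x. (SUP n. U n) x \<partial>lincomb Z I w N) = (SUP n. \<integral>\<^sup>+x. U n x \<partial>lincomb Z I w N)"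
    using nn_integral_monotone_convergence_SUP[OF \<open>incseq U\<close> m'] by (simp add: image_comp)
  also have "\<dots> = (SUP n. \<Sum>i\<in>I. w i * (\<integral>\<^sup>+x. U n x \<partial>N i))" using seq.IH by simp
  also have "\<dots> = (\<Sum>i\<in>I. SUP n. w i * (\<integral>\<^sup>+x. U n x \<partial>N i))"
    using \<open>incseq U\<close> by (intro ennreal_SUP_sum) (auto simp: incseq_def le_fun_def intro!: mult_left_mono nn_integral_mono)
  also have "\<dots> = (\<Sum>i\<in>I. w i * (\<integral>\<^sup>+x. (SUP n. U n) x \<partial>N i))"
  proof (intro sum.cong refl)
    fix i assume "i \<in> I"
    then have "(\<integral>\<^sup>+x. (SUP n. U n) x \<partial>N i) = (SUP n. \<integral>\<^sup>+x. U n x \<partial>N i)"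
      using nn_integral_monotone_convergence_SUP[OF \<open>incseq U\<close> m] by (simp add: image_comp)
    then show "(SUP n. w i * (\<integral>\<^sup>+x. U n x \<partial>N i)) = w i * (\<integral>\<^sup>+x. (SUP n. U n) x \<partial>N i)"
      by (simp add: SUP_mult_left_ennreal)
  qed
  finally show ?case .
qed

lemma radon_lincomb:
  assumes I: "finite I" and r: "\<And>i. i \<in> I \<Longrightarrow> finite_measure (N i) \<and> radon_measure Z (N i)"
    and w: "\<And>i. i \<in> I \<Longrightarrow> 0 \<le> w i" and H: "Hausdorff_space Z"
  shows "finite_measure (lincomb (borel_of Z) I (\<lambda>i. ennreal (w i)) N)"
    and "radon_measure Z (lincomb (borel_of Z) I (\<lambda>i. ennreal (w i)) N)"
proof -
  let ?L = "lincomb (borel_of Z) I (\<lambda>i. ennreal (w i)) N"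
  have s: "sets (N i) = sets (borel_of Z)" if "i \<in> I" for i using r[OF that] by (simp add: radon_measure_def)
  have fin: "emeasure (N i) A < top" if "i \<in> I" for i A
    using finite_measure.emeasure_finite[of "N i" A] r[OF that] by (simp add: less_top)
  show fm: "finite_measure ?L"
  proof (rule finite_measureI)
    show "emeasure ?L (space ?L) \<noteq> \<infinity>"
      using fin I by (subst emeasure_lincomb[OF s]) (use sets.top[of "borel_of Z"] in \<open>auto simp: ennreal_mult_eq_top_iff less_top\<close>)
  qed
  show "radon_measure Z ?L"
  proof (rule radon_measureI[OF fm])
    fix B and e :: real assume B: "B \<in> sets ?L" and e: "0 < e"
    define D where "D = real (card I) + 1"
    \<comment> \<open>\<open>w i * e' i \<le> e / D\<close>, and \<open>card I\<close> times
      \<open>e / D\<close> is at most \<open>e\<close>; each added \<open>1\<close> prevents a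
      division by zero.\<close>
    define e' where "e' i = e / (D * (w i + 1))" for i
    have D: "0 < D" by (simp add: D_def)
    have e': "0 < e' i" if "i \<in> I" for i
      using e D w[OF that] by (auto simp: e'_def intro!: divide_pos_pos mult_pos_pos)
    have "\<exists>K. compactin Z K \<and> K \<subseteq> B \<and> emeasure (N i) B \<le> emeasure (N i) K + ennreal (e' i)" if i: "i \<in> I" for i
    proof -
      have "radon_measure Z (N i)" "B \<in> sets (N i)" "emeasure (N i) B < \<infinity>"
        using r[OF i] B s[OF i] fin[OF i] by auto
      from radon_measure_approx[OF this e'[OF i]] show ?thesis by blast
    qed
    then obtain K where K: "\<And>i. i \<in> I \<Longrightarrow> compactin Z (K i) \<and> K i \<subseteq> B \<and> emeasure (N i) B \<le> emeasure (N i) (K i) + ennreal (e' i)"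
      by metis
    let ?K = "\<Union>i\<in>I. K i"
    have cK: "compactin Z ?K" using I K by (intro compactin_Union) auto
    have KB: "?K \<subseteq> B" using K by blast
    have Ks: "?K \<in> sets (borel_of Z)" by (rule compactin_borel_of[OF H cK])
    have "emeasure ?L B = (\<Sum>i\<in>I. ennreal (w i) * emeasure (N i) B)" using B by (intro emeasure_lincomb[OF s]) auto
    also have "\<dots> \<le> (\<Sum>i\<in>I. ennreal (w i) * emeasure (N i) ?K + ennreal (e / D))"
    proof (rule sum_mono)
      fix i assume i: "i \<in> I"
      have "emeasure (N i) (K i) \<le> emeasure (N i) ?K"
        using i Ks s[OF i] by (intro emeasure_mono) auto
      then have "emeasure (N i) B \<le> emeasure (N i) ?K + ennreal (e' i)"
        using K[OF i] by (meson add_right_mono order_trans)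
      then have "ennreal (w i) * emeasure (N i) B \<le> ennreal (w i) * (emeasure (N i) ?K + ennreal (e' i))"
        by (rule mult_left_mono) simp
      also have "\<dots> = ennreal (w i) * emeasure (N i) ?K + ennreal (w i * e' i)"
        using w[OF i] e'[OF i] by (simp add: distrib_left ennreal_mult)
      also have "\<dots> \<le> ennreal (w i) * emeasure (N i) ?K + ennreal (e / D)"
      proof (intro add_left_mono ennreal_leI)
        have "w i * e' i = (e / D) * (w i / (w i + 1))" using D w[OF i] by (simp add: e'_def field_simps)
        also have "\<dots> \<le> (e / D) * 1" using e D w[OF i] by (intro mult_left_mono) (auto simp: divide_simps)
        finally show "w i * e' i \<le> e / D" by simp
      qed
      finally show "ennreal (w i) * emeasure (N i) B \<le> ennreal (w i) * emeasure (N i) ?K + ennreal (e / D)" .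
    qed
    also have "\<dots> = emeasure ?L ?K + of_nat (card I) * ennreal (e / D)"
      using Ks by (subst emeasure_lincomb[OF s]) (auto simp: sum.distrib)
    also have "\<dots> \<le> emeasure ?L ?K + ennreal e"
    proof (rule add_left_mono)
      have "of_nat (card I) * ennreal (e / D) = ennreal (real (card I) * (e / D))"
        using e D by (subst ennreal_mult) (auto simp: ennreal_of_nat_eq_real_of_nat)
      also have "\<dots> \<le> ennreal e" using e D by (intro ennreal_leI) (simp add: D_def field_simps)
      finally show "of_nat (card I) * ennreal (e / D) \<le> ennreal e" .
    qed
    finally show "\<exists>K. compactin Z K \<and> K \<subseteq> B \<and> emeasure ?L B \<le> emeasure ?L K + ennreal e"
      using cK KB by blast
  qed simp
qed

lemma radon_restrict:
  assumes f: "finite_measure M" and r: "radon_measure Z M" and S: "S \<in> sets M" and H: "Hausdorff_space Z"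
  shows "finite_measure (density M (indicator S))" "radon_measure Z (density M (indicator S))"
proof -
  interpret finite_measure M by fact
  have s: "sets M = sets (borel_of Z)" using r by (simp add: radon_measure_def)
  have em: "emeasure (density M (indicator S)) A = emeasure M (S \<inter> A)" if "A \<in> sets M" for A
    using that S by (subst emeasure_restricted) auto
  show f': "finite_measure (density M (indicator S))"
    by (rule finite_measureI) (simp add: em)
  show "radon_measure Z (density M (indicator S))"
  proof (rule radon_measureI[OF f'])
    fix B and e :: real assume B: "B \<in> sets (density M (indicator S))" and e: "0 < e"
    have "S \<inter> B \<in> sets M" "emeasure M (S \<inter> B) < \<infinity>" using S B emeasure_finite[of "S \<inter> B"] by (auto simp: less_top simp del: emeasure_finite)
    then obtain K where K: "compactin Z K" "K \<subseteq> S \<inter> B" "emeasure M (S \<inter> B) \<le> emeasure M K + ennreal e"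
      using radon_measure_approx[OF r _ _ e] by metis
    have Ks: "K \<in> sets M" using compactin_borel_of[OF H K(1)] s by simp
    have "S \<inter> K = K" using K by auto
    then show "\<exists>K. compactin Z K \<and> K \<subseteq> B \<and> emeasure (density M (indicator S)) B \<le> emeasure (density M (indicator S)) K + ennreal e"
      using K B Ks em by (intro exI[of _ K]) auto
  qed (simp add: s)
qed

section \<open>Measures given by densities, and their transport costs\<close>

abbreviation dm :: "'b measure \<Rightarrow> ('b \<Rightarrow> real) \<Rightarrow> 'b measure" where
  "dm M \<rho> \<equiv> density M (\<lambda>x. ennreal (\<rho> x))"

lemma dm_props:
  assumes r: "\<rho> \<in> ent_dens M C"
  shows "prob_space (dm M \<rho>)" and "A \<in> sets M \<Longrightarrow> measure (dm M \<rho>) A = (\<integral>x. indicator A x * \<rho> x \<partial>M)"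
    and "A \<in> sets M \<Longrightarrow> integrable M (\<lambda>x. indicator A x * \<rho> x)"
proof -
  have i: "integrable M \<rho>" "\<rho> \<in> borel_measurable M" "(\<integral>x. \<rho> x \<partial>M) = 1" "\<And>x. 0 \<le> \<rho> x"
    using r by (auto simp: ent_dens_def)
  show ia: "integrable M (\<lambda>x. indicator A x * \<rho> x)" if "A \<in> sets M" for A
    using integrable_real_mult_indicator[OF that i(1)] by (simp add: mult.commute)
  have em: "emeasure (dm M \<rho>) A = ennreal (\<integral>x. indicator A x * \<rho> x \<partial>M)" if A: "A \<in> sets M" for A
  proof -
    have "emeasure (dm M \<rho>) A = (\<integral>\<^sup>+x. ennreal (indicator A x * \<rho> x) \<partial>M)"
      using A i by (subst emeasure_density) (auto intro!: nn_integral_cong simp: indicator_def)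
    also have "\<dots> = ennreal (\<integral>x. indicator A x * \<rho> x \<partial>M)"
      using ia[OF A] i by (intro nn_integral_eq_integral) auto
    finally show ?thesis .
  qed
  show "measure (dm M \<rho>) A = (\<integral>x. indicator A x * \<rho> x \<partial>M)" if "A \<in> sets M"
    using em[OF that] i by (simp add: measure_def integral_nonneg)
  have "(\<integral>x. indicator (space M) x * \<rho> x \<partial>M) = (\<integral>x. \<rho> x \<partial>M)"
    by (rule Bochner_Integration.integral_cong) auto
  then show "prob_space (dm M \<rho>)" using em[of "space M"] i by (intro prob_spaceI) simp
qed

text \<open>The bound is uniform in \<open>A\<close>. Through it, \<open>L1\<close> convergence of
  densities yields the hypotheses on open sets in \<open>W2sq_lsc\<close>.\<close>

lemma dm_TV:
  assumes r: "\<rho> \<in> ent_dens M C" and s: "\<sigma> \<in> ent_dens M C" and A: "A \<in> sets M"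
  shows "\<bar>measure (dm M \<rho>) A - measure (dm M \<sigma>) A\<bar> \<le> l1 M \<rho> \<sigma>"
proof -
  have i: "integrable M \<rho>" "integrable M \<sigma>" using r s by (auto simp: ent_dens_def)
  have "measure (dm M \<rho>) A - measure (dm M \<sigma>) A = (\<integral>x. indicator A x * \<rho> x - indicator A x * \<sigma> x \<partial>M)"
    using dm_props(2,3)[OF r A] dm_props(2,3)[OF s A] by simp
  also have "\<bar>\<dots>\<bar> \<le> (\<integral>x. \<bar>indicator A x * \<rho> x - indicator A x * \<sigma> x\<bar> \<partial>M)"
    by (rule integral_abs_bound)
  also have "\<dots> \<le> l1 M \<rho> \<sigma>"
    using i dm_props(3)[OF r A] dm_props(3)[OF s A] by (intro integral_mono) (auto simp: indicator_def)
  finally show ?thesis .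
qed

context emt
begin

text \<open>Mixing a plan from \<open>\<mu>\<close> to \<open>\<nu>0\<close> with one to
  \<open>\<nu>1\<close> gives a plan to the mixture. Convexity is along linear interpolation of
  measures; \<open>mix\<close> is stated on sets so that it fits densities.\<close>

lemma W2sq_convex:
  assumes n0: "\<nu>0 \<in> Prob T" and n1: "\<nu>1 \<in> Prob T" and n: "\<nu> \<in> Prob T" and mu: "\<mu> \<in> Prob T"
    and t: "0 \<le> t" "t \<le> 1"
    and mix: "\<And>A. A \<in> sets (borel_of T) \<Longrightarrow> measure \<nu> A = (1-t) * measure \<nu>0 A + t * measure \<nu>1 A"
  shows "W2sq T d \<mu> \<nu> \<le> ennreal (1-t) * W2sq T d \<mu> \<nu>0 + ennreal t * W2sq T d \<mu> \<nu>1"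
proof -
  interpret n: prob_space \<nu> using n by (rule Prob_prob_space)
  interpret n0: prob_space \<nu>0 using n0 by (rule Prob_prob_space)
  interpret n1: prob_space \<nu>1 using n1 by (rule Prob_prob_space)
  interpret mu: prob_space \<mu> using mu by (rule Prob_prob_space)
  let ?c = "\<lambda>z. (d (fst z) (snd z))\<^sup>2"
  \<comment> \<open>The endpoints are separate because a vanishing weight may multiply an infinite
    cost, for which no plan of finite cost exists.\<close>
  consider "t = 0" | "t = 1" | "0 < t" "t < 1" using t by fastforce
  then show ?thesis
  proof cases
    case 1
    then have "\<nu> = \<nu>0" using mix n n0
      by (intro measure_eqI) (auto simp: Prob_sets n.emeasure_eq_measure n0.emeasure_eq_measure)
    then show ?thesis using 1 by simp
  next
    case 2
    then have "\<nu> = \<nu>1" using mix n n1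
      by (intro measure_eqI) (auto simp: Prob_sets n.emeasure_eq_measure n1.emeasure_eq_measure)
    then show ?thesis using 2 by simp
  next
    case 3
    have key: "W2sq T d \<mu> \<nu> \<le> ennreal (1-t) * (\<integral>\<^sup>+z. ?c z \<partial>\<gamma>0) + ennreal t * (\<integral>\<^sup>+z. ?c z \<partial>\<gamma>1)"
      if g0: "\<gamma>0 \<in> couplings T \<mu> \<nu>0" and g1: "\<gamma>1 \<in> couplings T \<mu> \<nu>1" for \<gamma>0 \<gamma>1
    proof -
      define N where "N = case_bool \<gamma>0 \<gamma>1"
      define w where "w = case_bool (1-t) t"
      define \<gamma> where "\<gamma> = lincomb (borel_of TT) UNIV (\<lambda>i. ennreal (w i)) N"
      have P: "N i \<in> Prob TT" for i using g0 g1 by (cases i) (auto simp: N_def couplings_def)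
      have s: "sets (N i) = sets (borel_of TT)" for i using P by (rule Prob_sets)
      have em: "emeasure \<gamma> A = ennreal (1-t) * emeasure \<gamma>0 A + ennreal t * emeasure \<gamma>1 A" if "A \<in> sets (borel_of TT)" for A
        unfolding \<gamma>_def using that by (subst emeasure_lincomb[OF s]) (auto simp: UNIV_bool N_def w_def)
      have As: "A \<times> UNIV \<in> sets (borel_of TT)" "UNIV \<times> A \<in> sets (borel_of TT)" if "A \<in> sets (borel_of T)" for A
      proof -
        have "UNIV \<in> sets (borel_of T)" by (metis sets.top space_borel_T(1))
        then show "A \<times> UNIV \<in> sets (borel_of TT)" "UNIV \<times> A \<in> sets (borel_of TT)"
          using that by (auto intro!: subsetD[OF pair_sets_subset] pair_measureI)
      qed
      have m1: "emeasure \<gamma> (A \<times> UNIV) = emeasure \<mu> A" "emeasure \<gamma> (UNIV \<times> A) = emeasure \<nu> A" if A: "A \<in> sets (borel_of T)" for A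
      proof -
        have "emeasure \<gamma> (A \<times> UNIV) = ennreal (1-t) * emeasure \<mu> A + ennreal t * emeasure \<mu> A"
          using em[OF As(1)[OF A]] g0 g1 A by (simp add: couplings_def)
        also have "\<dots> = emeasure \<mu> A"
          using t by (simp add: mu.emeasure_eq_measure flip: ennreal_mult ennreal_plus) (simp add: algebra_simps)
        finally show "emeasure \<gamma> (A \<times> UNIV) = emeasure \<mu> A" .
        have "emeasure \<gamma> (UNIV \<times> A) = ennreal (1-t) * emeasure \<nu>0 A + ennreal t * emeasure \<nu>1 A"
          using em[OF As(2)[OF A]] g0 g1 A by (simp add: couplings_def)
        also have "\<dots> = emeasure \<nu> A"
          using t mix[OF A] by (simp add: n.emeasure_eq_measure n0.emeasure_eq_measure n1.emeasure_eq_measure flip: ennreal_mult ennreal_plus)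
        finally show "emeasure \<gamma> (UNIV \<times> A) = emeasure \<nu> A" .
      qed
      have "radon_measure TT \<gamma>" unfolding \<gamma>_def
        using P 3 by (intro radon_lincomb HTT) (auto simp: Prob_def w_def prob_space.finite_measure split: bool.split)
      moreover have "prob_space \<gamma>"
      proof (rule prob_spaceI)
        have "UNIV \<in> sets (borel_of T)" by (metis sets.top space_borel_T(1))
        from m1(1)[OF this] show "emeasure \<gamma> (space \<gamma>) = 1"
          using mu.emeasure_space_1 by (simp add: \<gamma>_def top Prob_space[OF mu])
      qed
      ultimately have "\<gamma> \<in> couplings T \<mu> \<nu>" using m1 by (simp add: couplings_def Prob_def)
      then have "W2sq T d \<mu> \<nu> \<le> (\<integral>\<^sup>+z. ?c z \<partial>\<gamma>)" unfolding W2sq_def by (rule INF_lower)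
      also have "\<dots> = ennreal (1-t) * (\<integral>\<^sup>+z. ?c z \<partial>\<gamma>0) + ennreal t * (\<integral>\<^sup>+z. ?c z \<partial>\<gamma>1)"
        unfolding \<gamma>_def by (subst nn_integral_lincomb[OF s d2_measurable]) (auto simp: UNIV_bool N_def w_def)
      finally show ?thesis .
    qed
    show ?thesis
    proof (rule ennreal_le_epsilon)
      fix e :: real assume e: "0 < e" and fin: "ennreal (1-t) * W2sq T d \<mu> \<nu>0 + ennreal t * W2sq T d \<mu> \<nu>1 < top"
      have "W2sq T d \<mu> \<nu>0 < top" "W2sq T d \<mu> \<nu>1 < top"
        using fin 3 by (auto simp: ennreal_mult_less_top)
      then have lt: "W2sq T d \<mu> \<nu>0 < W2sq T d \<mu> \<nu>0 + ennreal e" "W2sq T d \<mu> \<nu>1 < W2sq T d \<mu> \<nu>1 + ennreal e"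
        using e by (auto intro: ennreal_less_add)
      obtain \<gamma>0 where g0: "\<gamma>0 \<in> couplings T \<mu> \<nu>0" "(\<integral>\<^sup>+z. ?c z \<partial>\<gamma>0) < W2sq T d \<mu> \<nu>0 + ennreal e"
        using lt(1) unfolding W2sq_def[of T d \<mu> \<nu>0] INF_less_iff by auto
      obtain \<gamma>1 where g1: "\<gamma>1 \<in> couplings T \<mu> \<nu>1" "(\<integral>\<^sup>+z. ?c z \<partial>\<gamma>1) < W2sq T d \<mu> \<nu>1 + ennreal e"
        using lt(2) unfolding W2sq_def[of T d \<mu> \<nu>1] INF_less_iff by auto
      have "W2sq T d \<mu> \<nu> \<le> ennreal (1-t) * (W2sq T d \<mu> \<nu>0 + ennreal e) + ennreal t * (W2sq T d \<mu> \<nu>1 + ennreal e)"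
        using g0 g1 by (intro order_trans[OF key[OF g0(1) g1(1)]] add_mono mult_left_mono) auto
      also have "\<dots> = ennreal (1-t) * W2sq T d \<mu> \<nu>0 + ennreal t * W2sq T d \<mu> \<nu>1 + (ennreal (1-t) * ennreal e + ennreal t * ennreal e)"
        by (simp add: distrib_left ac_simps)
      also have "ennreal (1-t) * ennreal e + ennreal t * ennreal e = ennreal e"
        using t e by (simp add: algebra_simps flip: ennreal_mult ennreal_plus)
      finally show "W2sq T d \<mu> \<nu> \<le> ennreal (1-t) * W2sq T d \<mu> \<nu>0 + ennreal t * W2sq T d \<mu> \<nu>1 + ennreal e" .
    qed
  qed
qed

text \<open>A compact set that nearly exhausts \<open>B\<close> for one \<open>\<rho> n\<close>
  close to \<open>\<sigma>\<close> does so for \<open>\<sigma>\<close>; total variation enters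
  twice, hence the thirds.\<close>

lemma dm_Prob_closed:
  assumes M: "sets M = sets (borel_of T)"
    and r: "\<And>n::nat. \<rho> n \<in> ent_dens M C" "\<And>n. dm M (\<rho> n) \<in> Prob T" and s: "\<sigma> \<in> ent_dens M C"
    and lim: "(\<lambda>n. l1 M (\<rho> n) \<sigma>) \<longlonglongrightarrow> 0"
  shows "dm M \<sigma> \<in> Prob T"
proof (rule ProbI[OF dm_props(1)[OF s]])
  show "sets (dm M \<sigma>) = sets (borel_of T)" using M by simp
  fix B and e :: real assume B: "B \<in> sets (borel_of T)" and e: "0 < e"
  have "eventually (\<lambda>n. l1 M (\<rho> n) \<sigma> < e/3) sequentially" using order_tendstoD(2)[OF lim, of "e/3"] e by simp
  then obtain n where n: "l1 M (\<rho> n) \<sigma> < e/3" by (meson eventually_sequentially order_refl)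
  have e3: "0 < e/3" using e by simp
  obtain K where K: "compactin T K" "K \<subseteq> B" "measure (dm M (\<rho> n)) B \<le> measure (dm M (\<rho> n)) K + e/3"
    using Prob_approx[OF r(2)[of n] B e3] by metis
  have "K \<in> sets M" "B \<in> sets M" using compactin_borel_of[OF H K(1)] M B by auto
  then have "measure (dm M \<sigma>) B \<le> measure (dm M \<sigma>) K + e"
    using dm_TV[OF r(1)[of n] s, of K] dm_TV[OF r(1)[of n] s, of B] K(3) n by linarith
  then show "\<exists>K. compactin T K \<and> K \<subseteq> B \<and> measure (dm M \<sigma>) B \<le> measure (dm M \<sigma>) K + e"
    using K by blast
qed

lemma W2sq_dm_lsc:
  assumes M: "sets M = sets (borel_of T)"
    and r: "\<And>n::nat. \<rho> n \<in> ent_dens M C" "\<And>n. dm M (\<rho> n) \<in> Prob T" and s: "\<sigma> \<in> ent_dens M C"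
    and lim: "(\<lambda>n. l1 M (\<rho> n) \<sigma>) \<longlonglongrightarrow> 0" and mu: "\<mu> \<in> Prob T"
  shows "W2sq T d \<mu> (dm M \<sigma>) \<le> liminf (\<lambda>n. W2sq T d \<mu> (dm M (\<rho> n)))"
proof (rule dense_ge)
  fix a assume a: "liminf (\<lambda>n. W2sq T d \<mu> (dm M (\<rho> n))) < a"
  \<comment> \<open>\<open>a\<close> exceeds the liminf, so indices of cost at most \<open>a\<close>
    occur infinitely often and the restricted filter is proper.\<close>
  let ?F = "inf sequentially (principal {n. W2sq T d \<mu> (dm M (\<rho> n)) \<le> a})"
  have nb: "?F \<noteq> bot"
  proof
    assume "?F = bot"
    then have "eventually (\<lambda>_. False) ?F" by simp
    then have "eventually (\<lambda>n. a \<le> W2sq T d \<mu> (dm M (\<rho> n))) sequentially"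
      unfolding eventually_inf_principal by (rule eventually_mono) auto
    then have "a \<le> liminf (\<lambda>n. W2sq T d \<mu> (dm M (\<rho> n)))" by (rule Liminf_bounded)
    then show False using a by simp
  qed
  show "W2sq T d \<mu> (dm M \<sigma>) \<le> a"
  proof (rule W2sq_lsc[OF nb mu dm_Prob_closed[OF M r s lim], where M="\<lambda>_. \<mu>" and N="\<lambda>n. dm M (\<rho> n)"])
    fix U and e :: real assume U: "openin T U" and e: "0 < e"
    have Us: "U \<in> sets M" using openin_borel_of[OF U] M by simp
    have "eventually (\<lambda>n. l1 M (\<rho> n) \<sigma> < e) sequentially" using order_tendstoD(2)[OF lim e] .
    then have "eventually (\<lambda>n. measure (dm M \<sigma>) U - e < measure (dm M (\<rho> n)) U) sequentially"
    proof eventually_elim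
      case (elim n)
      then show ?case using dm_TV[OF r(1)[of n] s Us] by linarith
    qed
    then show "eventually (\<lambda>n. measure (dm M \<sigma>) U - e < measure (dm M (\<rho> n)) U) ?F"
      by (rule filter_leD[OF inf_le1])
  next
    show "eventually (\<lambda>n. W2sq T d \<mu> (dm M (\<rho> n)) \<le> a) ?F" by (simp add: eventually_inf_principal)
  qed auto
qed

end

subsection \<open>The entropy functional\<close>

lemma ereal_integral_integrable:
  assumes f: "integrable M f"
  shows "ereal_integral M (\<lambda>x. ereal (f x)) = ereal (\<integral>x. f x \<partial>M)"
proof -
  have P: "(\<integral>\<^sup>+x. ennreal (f x) \<partial>M) < \<infinity>" "(\<integral>\<^sup>+x. ennreal (- f x) \<partial>M) < \<infinity>"
    using f unfolding real_integrable_def by (auto simp: less_top)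
  have "(\<integral>x. f x \<partial>M) = enn2real (\<integral>\<^sup>+x. ennreal (f x) \<partial>M) - enn2real (\<integral>\<^sup>+x. ennreal (- f x) \<partial>M)"
    by (rule real_lebesgue_integral_def[OF f])
  moreover have "enn2ereal a = ereal (enn2real a)" if "a < \<infinity>" for a
    using that by (cases a) auto
  ultimately show ?thesis using P unfolding ereal_integral_def Let_def by (auto simp: less_top)
qed

text \<open>\<open>ereal_integral\<close> is \<open>\<infinity>\<close> as soon as the positive part
  has infinite integral, so \<open>fin\<close> bounds that part; the integrable minorant bounds the
  negative part.\<close>

lemma ereal_integral_bounded_below:
  assumes f[measurable]: "f \<in> borel_measurable M" and g: "integrable M g" and le: "AE x in M. - g x \<le> f x"
    and fin: "ereal_integral M (\<lambda>x. ereal (f x)) < \<infinity>"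
  shows "integrable M f"
proof -
  have "(\<integral>\<^sup>+x. ennreal (f x) \<partial>M) \<noteq> \<infinity>"
    using fin unfolding ereal_integral_def Let_def by (auto split: if_splits)
  moreover have "(\<integral>\<^sup>+x. ennreal (- f x) \<partial>M) \<noteq> \<infinity>"
  proof -
    have "(\<integral>\<^sup>+x. ennreal (- f x) \<partial>M) \<le> (\<integral>\<^sup>+x. ennreal (g x) \<partial>M)"
      using le by (intro nn_integral_mono_AE) (auto intro!: ennreal_leI)
    also have "\<dots> < \<infinity>" using g unfolding real_integrable_def by (auto simp: less_top)
    finally show ?thesis by simp
  qed
  ultimately show ?thesis unfolding real_integrable_def by simp
qed

text \<open>\<open>Ent\<close> selects a density by Hilbert choice. Densities of finite total mass
  are unique almost everywhere even when \<open>m\<close> is not sigma-finite, so the choice does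
  not matter.\<close>

lemma Ent_density:
  assumes r[measurable]: "\<rho> \<in> borel_measurable m" and nn: "\<And>x. 0 \<le> \<rho> x" and fin: "(\<integral>\<^sup>+x. ennreal (\<rho> x) \<partial>m) \<noteq> \<infinity>"
  shows "Ent m (dm m \<rho>) = ereal_integral m (\<lambda>x. ereal (\<rho> x * ln (\<rho> x)))"
proof -
  let ?P = "\<lambda>\<rho>'. \<rho>' \<in> borel_measurable m \<and> dm m \<rho> = density m \<rho>'"
  have ex: "\<exists>\<rho>'. ?P \<rho>'" by (intro exI[of _ "\<lambda>x. ennreal (\<rho> x)"]) simp
  define \<rho>' where "\<rho>' = (SOME \<rho>'. ?P \<rho>')"
  have "?P \<rho>'" unfolding \<rho>'_def by (rule someI_ex[OF ex])
  then have "AE x in m. ennreal (\<rho> x) = \<rho>' x"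
    using finite_density_unique[of "\<lambda>x. ennreal (\<rho> x)" m \<rho>'] fin by simp
  then have ae: "AE x in m. \<rho> x = enn2real (\<rho>' x)"
    by eventually_elim (metis enn2real_ennreal nn)
  have "Ent m (dm m \<rho>) = ereal_integral m (\<lambda>x. ereal (enn2real (\<rho>' x) * ln (enn2real (\<rho>' x))))"
    unfolding Ent_def Let_def using ex by (simp add: \<rho>'_def)
  also have "\<dots> = ereal_integral m (\<lambda>x. ereal (\<rho> x * ln (\<rho> x)))"
  proof -
    have "(\<integral>\<^sup>+x. e2ennreal (ereal (enn2real (\<rho>' x) * ln (enn2real (\<rho>' x)))) \<partial>m) = (\<integral>\<^sup>+x. e2ennreal (ereal (\<rho> x * ln (\<rho> x))) \<partial>m)"
      "(\<integral>\<^sup>+x. e2ennreal (- ereal (enn2real (\<rho>' x) * ln (enn2real (\<rho>' x)))) \<partial>m) = (\<integral>\<^sup>+x. e2ennreal (- ereal (\<rho> x * ln (\<rho> x))) \<partial>m)"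
      by (rule nn_integral_cong_AE; use ae in eventually_elim; simp)+
    then show ?thesis unfolding ereal_integral_def by simp
  qed
  finally show ?thesis .
qed

lemma Ent_lessD:
  assumes E: "Ent m \<mu> < \<infinity>" and p: "prob_space \<mu>"
  obtains \<rho> where "\<rho> \<in> borel_measurable m" "\<And>x. 0 \<le> \<rho> x" "\<mu> = dm m \<rho>" "(\<integral>\<^sup>+x. ennreal (\<rho> x) \<partial>m) = 1"
    "Ent m \<mu> = ereal_integral m (\<lambda>x. ereal (\<rho> x * ln (\<rho> x)))"
proof -
  obtain \<rho>' where r[measurable]: "\<rho>' \<in> borel_measurable m" and mu: "\<mu> = density m \<rho>'"
    using E unfolding Ent_def by (auto split: if_splits)
  have "(\<integral>\<^sup>+x. \<rho>' x \<partial>m) = emeasure \<mu> (space \<mu>)"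
    unfolding mu by (simp add: emeasure_density cong: nn_integral_cong)
  then have one: "(\<integral>\<^sup>+x. \<rho>' x \<partial>m) = 1" using prob_space.emeasure_space_1[OF p] by simp
  then have "AE x in m. \<rho>' x \<noteq> \<infinity>" by (intro nn_integral_noteq_infinite) auto
  then have ae: "AE x in m. \<rho>' x = ennreal (enn2real (\<rho>' x))"
    by eventually_elim (auto simp: less_top)
  define \<rho> where "\<rho> x = enn2real (\<rho>' x)" for x
  have m[measurable]: "\<rho> \<in> borel_measurable m" unfolding \<rho>_def by measurable
  have eq: "\<mu> = dm m \<rho>" unfolding mu \<rho>_def using ae by (intro density_cong) auto
  have one': "(\<integral>\<^sup>+x. ennreal (\<rho> x) \<partial>m) = 1"
    using nn_integral_cong_AE[OF ae] one by (simp add: \<rho>_def)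
  have nn: "0 \<le> \<rho> x" for x by (simp add: \<rho>_def)
  show ?thesis using that[OF m nn eq one'] Ent_density[OF m nn] one' eq by simp
qed

text \<open>Passing from \<open>m\<close> to the finite measure \<open>e\<^sup>-\<^sup>\<psi> m\<close> changes the entropy by the \<open>\<psi>\<close>-moment.\<close>

definition weighted :: "'b measure \<Rightarrow> ('b \<Rightarrow> ennreal) \<Rightarrow> 'b measure" where
  "weighted m \<psi> = density m (\<lambda>x. ennreal (if \<psi> x = \<infinity> then 0 else exp (- enn2real (\<psi> x))))"

lemma sets_weighted [simp]: "sets (weighted m \<psi>) = sets m" "space (weighted m \<psi>) = space m"
  by (simp_all add: weighted_def)

text \<open>If \<open>\<nu> = r m\<close>, the density relative to \<open>weighted m \<psi>\<close>
  is \<open>r exp \<psi>\<close>, whence the extra \<open>r \<psi>\<close> in the entropy. Relative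
  to the finite measure the entropy is bounded below, and this makes \<open>r ln r\<close>
  integrable for \<open>m\<close>.\<close>

lemma Ent_weighted:
  assumes psi[measurable]: "\<psi> \<in> borel_measurable m"
    and fin: "(\<integral>\<^sup>+x. ennreal (if \<psi> x = \<infinity> then 0 else exp (- enn2real (\<psi> x))) \<partial>m) < \<infinity>"
    and E: "Ent m \<nu> \<le> ereal e" and p: "prob_space \<nu>"
    and q: "(\<integral>\<^sup>+x. \<psi> x \<partial>\<nu>) \<le> ennreal Q" and Q: "0 \<le> Q"
  obtains \<rho> where "\<rho> \<in> ent_dens (weighted m \<psi>) (e + Q)" "\<nu> = dm (weighted m \<psi>) \<rho>"
proof -
  define g where "g x = (if \<psi> x = \<infinity> then 0 else exp (- enn2real (\<psi> x)))" for x
  have gm[measurable]: "g \<in> borel_measurable m" unfolding g_def by measurable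
  have g0: "0 \<le> g x" for x by (simp add: g_def)
  have ig: "integrable m g" using fin by (intro integrableI_nonneg) (auto simp: g_def)
  have "Ent m \<nu> < \<infinity>" using E by (rule le_less_trans) simp
  then obtain r where rm[measurable]: "r \<in> borel_measurable m" and r0: "\<And>x. 0 \<le> r x" and nu: "\<nu> = dm m r"
    and r1: "(\<integral>\<^sup>+x. ennreal (r x) \<partial>m) = 1" and Er: "Ent m \<nu> = ereal_integral m (\<lambda>x. ereal (r x * ln (r x)))"
    using Ent_lessD[OF _ p] by metis
  have ir: "integrable m r" using r1 r0 by (intro integrableI_nonneg) auto
  have "integral\<^sup>L m r = enn2real (\<integral>\<^sup>+x. ennreal (r x) \<partial>m)" using r0 by (intro integral_eq_nn_integral) auto
  then have ir1: "(\<integral>x. r x \<partial>m) = 1" using r1 by simp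
  have q': "(\<integral>\<^sup>+x. ennreal (r x) * \<psi> x \<partial>m) \<le> ennreal Q"
    using q unfolding nu by (simp add: nn_integral_density)
  then have "(\<integral>\<^sup>+x. ennreal (r x) * \<psi> x \<partial>m) \<noteq> \<infinity>" by (auto simp: top_unique)
  then have "AE x in m. ennreal (r x) * \<psi> x \<noteq> \<infinity>" by (intro nn_integral_noteq_infinite) auto
  then have r_top: "AE x in m. \<psi> x = \<infinity> \<longrightarrow> r x = 0"
    by eventually_elim (use r0 in \<open>auto simp: ennreal_mult_eq_top_iff ennreal_eq_0_iff antisym\<close>)
  define p where "p x = enn2real (\<psi> x)" for x
  have pm[measurable]: "p \<in> borel_measurable m" unfolding p_def by measurable
  have p0: "0 \<le> p x" for x by (simp add: p_def)
  have rp: "(\<integral>\<^sup>+x. ennreal (r x * p x) \<partial>m) \<le> ennreal Q"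
  proof -
    have "(\<integral>\<^sup>+x. ennreal (r x * p x) \<partial>m) \<le> (\<integral>\<^sup>+x. ennreal (r x) * \<psi> x \<partial>m)"
    proof (rule nn_integral_mono)
      fix x
      have "ennreal (p x) \<le> \<psi> x" unfolding p_def by (cases "\<psi> x") auto
      then show "ennreal (r x * p x) \<le> ennreal (r x) * \<psi> x"
        using r0 p0 by (simp add: ennreal_mult mult_left_mono)
    qed
    then show ?thesis using q' by (rule order_trans)
  qed
  have irp: "integrable m (\<lambda>x. r x * p x)"
    using rp r0 p0 by (intro integrableI_nonneg) (auto intro: le_less_trans)
  have irpQ: "(\<integral>x. r x * p x \<partial>m) \<le> Q"
  proof -
    have "ennreal (\<integral>x. r x * p x \<partial>m) \<le> ennreal Q"
      using rp nn_integral_eq_integral[OF irp] r0 p0 by simp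
    then show ?thesis using Q by simp
  qed
  define \<rho> where "\<rho> x = (if \<psi> x = \<infinity> then 0 else r x * exp (p x))" for x
  have rhom[measurable]: "\<rho> \<in> borel_measurable m" unfolding \<rho>_def by measurable
  have rho0: "0 \<le> \<rho> x" for x using r0 by (simp add: \<rho>_def)
  have gr: "AE x in m. g x * \<rho> x = r x"
    using r_top by eventually_elim (auto simp: g_def \<rho>_def p_def exp_minus)
  have ent: "AE x in m. g x * (\<rho> x * ln (\<rho> x)) = r x * ln (r x) + r x * p x"
    using r_top
  proof eventually_elim
    case (elim x)
    show ?case
    proof (cases "\<psi> x = \<infinity> \<or> r x = 0")
      case True then show ?thesis using elim by (auto simp: g_def \<rho>_def)
    next
      case False
      then have "0 < r x" using r0[of x] by simp
      then show ?thesis using False by (simp add: g_def \<rho>_def p_def exp_minus ln_mult algebra_simps)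
    qed
  qed
  \<comment> \<open>\<open>x ln x \<ge> - 1\<close> for the density relative to the weighted
    measure, read back in terms of \<open>m\<close>.\<close>
  have lower: "AE x in m. - (r x * p x + g x) \<le> r x * ln (r x)"
    using ent
  proof eventually_elim
    case (elim x)
    have "g x * (- 1) \<le> g x * (\<rho> x * ln (\<rho> x))" using g0 xlnx_ge[OF rho0] by (intro mult_left_mono) auto
    then show ?case using elim by linarith
  qed
  have irl: "integrable m (\<lambda>x. r x * ln (r x))"
  proof (rule ereal_integral_bounded_below[OF _ _ lower])
    show "integrable m (\<lambda>x. r x * p x + g x)" using irp ig by auto
    show "ereal_integral m (\<lambda>x. ereal (r x * ln (r x))) < \<infinity>" using \<open>Ent m \<nu> < \<infinity>\<close> Er by simp
  qed measurable
  have irle: "(\<integral>x. r x * ln (r x) \<partial>m) \<le> e"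
    using E Er ereal_integral_integrable[OF irl] by simp
  let ?M = "weighted m \<psi>"
  have Mdef: "?M = dm m g" unfolding weighted_def g_def ..
  have nn: "AE x in m. 0 \<le> g x" using g0 by simp
  have i1: "integrable m (\<lambda>x. g x *\<^sub>R \<rho> x)" "(\<integral>x. g x *\<^sub>R \<rho> x \<partial>m) = 1"
  proof -
    show "integrable m (\<lambda>x. g x *\<^sub>R \<rho> x)"
      by (rule integrable_cong_AE_imp[OF ir]) (use gr in \<open>auto elim!: eventually_mono\<close>)
    have "(\<integral>x. g x *\<^sub>R \<rho> x \<partial>m) = (\<integral>x. r x \<partial>m)" using gr by (intro integral_cong_AE) auto
    then show "(\<integral>x. g x *\<^sub>R \<rho> x \<partial>m) = 1" using ir1 by simp
  qed
  have i2: "integrable m (\<lambda>x. g x *\<^sub>R (\<rho> x * ln (\<rho> x)))" "(\<integral>x. g x *\<^sub>R (\<rho> x * ln (\<rho> x)) \<partial>m) \<le> e + Q"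
  proof -
    have isum: "integrable m (\<lambda>x. r x * ln (r x) + r x * p x)" using irl irp by auto
    show "integrable m (\<lambda>x. g x *\<^sub>R (\<rho> x * ln (\<rho> x)))"
      by (rule integrable_cong_AE_imp[OF isum]) (use ent in \<open>auto elim!: eventually_mono\<close>)
    have "(\<integral>x. g x *\<^sub>R (\<rho> x * ln (\<rho> x)) \<partial>m) = (\<integral>x. r x * ln (r x) + r x * p x \<partial>m)"
      using ent by (intro integral_cong_AE) auto
    also have "\<dots> = (\<integral>x. r x * ln (r x) \<partial>m) + (\<integral>x. r x * p x \<partial>m)" using irl irp by simp
    finally show "(\<integral>x. g x *\<^sub>R (\<rho> x * ln (\<rho> x)) \<partial>m) \<le> e + Q" using irle irpQ by simp
  qed
  have "\<rho> \<in> ent_dens ?M (e + Q)"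
    unfolding ent_dens_def Mdef using i1 i2 rho0 nn
    by (simp add: integrable_density integral_density)
  moreover have "\<nu> = dm ?M \<rho>"
  proof -
    have "dm ?M \<rho> = density m (\<lambda>x. ennreal (g x) * ennreal (\<rho> x))"
      unfolding Mdef by (rule density_density_eq) measurable
    also have "\<dots> = dm m r"
    proof (rule density_cong)
      show "AE x in m. ennreal (g x) * ennreal (\<rho> x) = ennreal (r x)"
        using gr by eventually_elim (simp add: g0 rho0 flip: ennreal_mult)
    qed measurable
    finally show ?thesis using nu by simp
  qed
  ultimately show ?thesis using that by blast
qed

lemma finite_measure_weighted:
  assumes psi[measurable]: "\<psi> \<in> borel_measurable m"
    and fin: "(\<integral>\<^sup>+x. ennreal (if \<psi> x = \<infinity> then 0 else exp (- enn2real (\<psi> x))) \<partial>m) < \<infinity>"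
  shows "finite_measure (weighted m \<psi>)"
proof (rule finite_measureI)
  have "emeasure (weighted m \<psi>) (space m) = (\<integral>\<^sup>+x. ennreal (if \<psi> x = \<infinity> then 0 else exp (- enn2real (\<psi> x))) \<partial>m)"
    unfolding weighted_def by (subst emeasure_density) (auto cong: nn_integral_cong)
  then show "emeasure (weighted m \<psi>) (space (weighted m \<psi>)) \<noteq> \<infinity>" using fin by simp
qed

text \<open>\<open>f\<close> may fail to be measurable: its integral is then the supremum over
  simple functions below \<open>f\<close>, and a countable supremum of such functions realizes it.
  It is applied to the positive part of the entropy.\<close>

lemma nn_integral_lower_witness:
  obtains u where "u \<in> borel_measurable M" "\<And>x. u x \<le> f x" "(\<integral>\<^sup>+x. u x \<partial>M) = (\<integral>\<^sup>+x. f x \<partial>M)"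
proof -
  let ?S = "{g. simple_function M g \<and> g \<le> f}"
  have ne: "?S \<noteq> {}" by (auto intro!: exI[of _ "\<lambda>_. 0"] simp: le_fun_def)
  obtain a where a: "range a \<subseteq> integral\<^sup>S M ` ?S" "(SUP g\<in>?S. integral\<^sup>S M g) = (SUP n::nat. a n)"
    using ennreal_SUP_countable_SUP[OF ne, of "integral\<^sup>S M"] by blast
  have "\<forall>n. \<exists>g. g \<in> ?S \<and> a n = integral\<^sup>S M g" using a(1) by (auto simp: image_def subset_iff)
  then obtain g where g: "\<And>n. g n \<in> ?S" "\<And>n. a n = integral\<^sup>S M (g n)" by metis
  define u where "u x = (SUP n. g n x)" for x
  have um[measurable]: "u \<in> borel_measurable M"
    unfolding u_def using g(1) by (intro borel_measurable_SUP) (auto intro: borel_measurable_simple_function)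
  have ule: "u x \<le> f x" for x unfolding u_def using g(1) by (intro SUP_least) (auto simp: le_fun_def)
  have "(\<integral>\<^sup>+x. f x \<partial>M) = (SUP n. a n)" using a(2) by (simp add: nn_integral_def)
  also have "\<dots> \<le> (\<integral>\<^sup>+x. u x \<partial>M)"
  proof (rule SUP_least)
    fix n
    have "a n = (\<integral>\<^sup>+x. g n x \<partial>M)" using g by (simp add: nn_integral_eq_simple_integral)
    also have "\<dots> \<le> (\<integral>\<^sup>+x. u x \<partial>M)" unfolding u_def by (intro nn_integral_mono SUP_upper) auto
    finally show "a n \<le> (\<integral>\<^sup>+x. u x \<partial>M)" .
  qed
  finally have "(\<integral>\<^sup>+x. f x \<partial>M) \<le> (\<integral>\<^sup>+x. u x \<partial>M)" .
  moreover have "(\<integral>\<^sup>+x. u x \<partial>M) \<le> (\<integral>\<^sup>+x. f x \<partial>M)" using ule by (intro nn_integral_mono)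
  ultimately show ?thesis using that um ule by (metis antisym)
qed

section \<open>BCD for finite sums\<close>

context emt
begin

abbreviation "BP \<equiv> borel_of (narrow_topology T)"

definition fin_meas :: "'a measure set \<Rightarrow> ('a measure \<Rightarrow> real) \<Rightarrow> 'a measure measure" where
  "fin_meas S w = lincomb BP S (\<lambda>\<mu>. ennreal (w \<mu>)) (return BP)"

text \<open>\<open>f\<close> is arbitrary: singletons are measurable, so almost everywhere
  \<open>f\<close> is a finite combination of their indicators. This covers
  \<open>f = W2sq T d \<mu> \<nu>\<close> as well as the entropy.\<close>

lemma
  assumes S: "finite S" "S \<subseteq> Prob T" and w: "\<And>\<mu>. \<mu> \<in> S \<Longrightarrow> 0 \<le> w \<mu>" "(\<Sum>\<mu>\<in>S. w \<mu>) = 1"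
  shows prob_on_P_fin_meas: "prob_on_P T (fin_meas S w)"
    and finite_support_fin_meas: "finite_support_P T (fin_meas S w)"
    and nn_integral_fin_meas: "(\<integral>\<^sup>+\<mu>. f \<mu> \<partial>fin_meas S w) = (\<Sum>\<mu>\<in>S. ennreal (w \<mu>) * f \<mu>)"
proof -
  let ?O = "fin_meas S w"
  have em: "emeasure ?O A = ennreal (\<Sum>\<mu>\<in>S \<inter> A. w \<mu>)" if A: "A \<in> sets BP" for A
  proof -
    have "emeasure ?O A = (\<Sum>\<mu>\<in>S. ennreal (w \<mu>) * indicator A \<mu>)"
      unfolding fin_meas_def using A by (subst emeasure_lincomb) auto
    also have "\<dots> = (\<Sum>\<mu>\<in>S \<inter> A. ennreal (w \<mu>))"
      using S(1) by (intro sum.mono_neutral_cong_right) (auto simp: indicator_def)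
    also have "\<dots> = ennreal (\<Sum>\<mu>\<in>S \<inter> A. w \<mu>)" using w by (intro sum_ennreal) auto
    finally show ?thesis .
  qed
  have sp: "space ?O = Prob T" by (simp add: fin_meas_def)
  have se: "sets ?O = sets BP" by (simp add: fin_meas_def)
  have PB: "Prob T \<in> sets BP" using sets.top[of BP] by simp
  show "prob_on_P T ?O"
    unfolding prob_on_P_def using em[OF PB] S w sp se
    by (auto intro!: prob_spaceI simp: Int_absorb2)
  show "finite_support_P T ?O"
    unfolding finite_support_P_def using S w em se by (intro exI[of _ S] exI[of _ w]) auto
  have sing: "{\<mu>} \<in> sets BP" if "\<mu> \<in> S" for \<mu>
    using that S by (intro closedin_borel_of narrow_singleton_closed) auto
  have Ss: "S \<in> sets BP"
  proof -
    have "(\<Union>\<mu>\<in>S. {\<mu>}) \<in> sets BP" using S sing by (intro sets.finite_UN) auto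
    then show ?thesis by simp
  qed
  have "Prob T - S \<in> sets BP" using PB Ss by auto
  moreover have "S \<inter> (Prob T - S) = {}" by auto
  ultimately have "emeasure ?O (Prob T - S) = 0" using em by simp
  then have ae: "AE \<mu> in ?O. \<mu> \<in> S"
    using Ss PB sp se by (intro AE_I[of _ _ "Prob T - S"]) auto
  define g where "g \<mu> = (\<Sum>\<sigma>\<in>S. f \<sigma> * indicator {\<sigma>} \<mu>)" for \<mu>
  have gf: "g \<mu> = f \<mu>" if "\<mu> \<in> S" for \<mu>
  proof -
    have "g \<mu> = (\<Sum>\<sigma>\<in>{\<mu>}. f \<sigma> * indicator {\<sigma>} \<mu>)"
      unfolding g_def using S that by (intro sum.mono_neutral_right) (auto simp: indicator_def)
    then show ?thesis by simp
  qed
  have gm: "g \<in> borel_measurable BP"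
    unfolding g_def using sing by (intro borel_measurable_sum borel_measurable_times borel_measurable_indicator) auto
  have "(\<integral>\<^sup>+\<mu>. f \<mu> \<partial>?O) = (\<integral>\<^sup>+\<mu>. g \<mu> \<partial>?O)"
    using ae by (intro nn_integral_cong_AE) (auto elim!: eventually_mono simp: gf)
  also have "\<dots> = (\<Sum>\<mu>\<in>S. ennreal (w \<mu>) * (\<integral>\<^sup>+\<sigma>. g \<sigma> \<partial>return BP \<mu>))"
    unfolding fin_meas_def by (rule nn_integral_lincomb[OF _ gm]) simp
  also have "\<dots> = (\<Sum>\<mu>\<in>S. ennreal (w \<mu>) * f \<mu>)"
    using S by (intro sum.cong refl) (auto simp: nn_integral_return[OF _ gm] gf subset_iff)
  finally show "(\<integral>\<^sup>+\<mu>. f \<mu> \<partial>?O) = (\<Sum>\<mu>\<in>S. ennreal (w \<mu>) * f \<mu>)" .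
qed

text \<open>\<open>e\<close> gives real upper bounds, since \<open>Ent m \<mu>\<close> may be
  \<open>-\<infinity>\<close>. The assumed \<open>\<eta>\<close> witnesses that the variance is
  finite.\<close>

lemma BCD_finite:
  assumes BCD: "BCD T d m K" and S: "finite S" "S \<subseteq> Prob T"
    and w: "\<And>\<mu>. \<mu> \<in> S \<Longrightarrow> 0 \<le> w \<mu>" "(\<Sum>\<mu>\<in>S. w \<mu>) = 1"
    and e: "\<And>\<mu>. \<mu> \<in> S \<Longrightarrow> Ent m \<mu> \<le> ereal (e \<mu>)"
    and \<eta>: "\<eta> \<in> Prob T" "(\<Sum>\<mu>\<in>S. ennreal (w \<mu>) * W2sq T d \<mu> \<eta>) < \<infinity>"
  obtains \<nu> where "\<nu> \<in> Prob T"
    "\<And>\<eta>. \<eta> \<in> Prob T \<Longrightarrow> (\<Sum>\<mu>\<in>S. ennreal (w \<mu>) * W2sq T d \<mu> \<nu>) \<le> (\<Sum>\<mu>\<in>S. ennreal (w \<mu>) * W2sq T d \<mu> \<eta>)"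
    "Ent m \<nu> \<le> ereal ((\<Sum>\<mu>\<in>S. w \<mu> * e \<mu>) - K / 2 * enn2real (\<Sum>\<mu>\<in>S. ennreal (w \<mu>) * W2sq T d \<mu> \<nu>))"
proof -
  let ?O = "fin_meas S w"
  have O: "prob_on_P T ?O" "finite_support_P T ?O" and O3: "(\<integral>\<^sup>+\<mu>. f \<mu> \<partial>?O) = (\<Sum>\<mu>\<in>S. ennreal (w \<mu>) * f \<mu>)" for f
    using S w by (auto intro!: prob_on_P_fin_meas finite_support_fin_meas nn_integral_fin_meas)
  let ?V = "\<lambda>\<nu>. \<Sum>\<mu>\<in>S. ennreal (w \<mu>) * W2sq T d \<mu> \<nu>"
  have V: "Var T d ?O = (INF \<nu>\<in>Prob T. ?V \<nu>)" unfolding Var_def O3 ..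
  have "Var T d ?O \<le> ?V \<eta>" unfolding V using \<eta> by (intro INF_lower)
  then have "Var T d ?O < \<infinity>" using \<eta>(2) by (rule le_less_trans)
  then obtain \<nu> where b: "barycenter T d ?O \<nu>" and En: "Ent m \<nu> \<le> Ent_integral m ?O - ereal (K / 2 * enn2real (Var T d ?O))"
    using BCD O unfolding BCD_def by blast
  have nP: "\<nu> \<in> Prob T" and nV: "?V \<nu> = Var T d ?O" using b by (auto simp: barycenter_def O3)
  have "Ent_integral m ?O \<le> ereal (\<Sum>\<mu>\<in>S. w \<mu> * e \<mu>)"
  proof -
    \<comment> \<open>\<open>ereal_integral\<close> is a difference of two sums, so the positive
      parts are bounded above and the negative parts below; the latter may be infinite without
      harm.\<close>
    let ?P = "\<Sum>\<mu>\<in>S. ennreal (w \<mu>) * e2ennreal (Ent m \<mu>)" and ?N = "\<Sum>\<mu>\<in>S. ennreal (w \<mu>) * e2ennreal (- Ent m \<mu>)"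
    let ?p = "\<Sum>\<mu>\<in>S. w \<mu> * max 0 (e \<mu>)" and ?n = "\<Sum>\<mu>\<in>S. w \<mu> * max 0 (- e \<mu>)"
    have mx: "ennreal (max 0 x) = ennreal x" for x by (simp add: max_def ennreal_neg)
    have P: "?P \<le> ennreal ?p"
    proof -
      have "?P \<le> (\<Sum>\<mu>\<in>S. ennreal (w \<mu> * max 0 (e \<mu>)))"
      proof (rule sum_mono)
        fix \<mu> assume "\<mu> \<in> S"
        then show "ennreal (w \<mu>) * e2ennreal (Ent m \<mu>) \<le> ennreal (w \<mu> * max 0 (e \<mu>))"
          using w e2ennreal_mono[OF e] by (auto simp: ennreal_mult mx intro!: mult_left_mono)
      qed
      then show ?thesis using w by (simp add: sum_ennreal)
    qed
    have N: "ennreal ?n \<le> ?N"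
    proof -
      have "(\<Sum>\<mu>\<in>S. ennreal (w \<mu> * max 0 (- e \<mu>))) \<le> ?N"
      proof (rule sum_mono)
        fix \<mu> assume m: "\<mu> \<in> S"
        have "ereal (- e \<mu>) \<le> - Ent m \<mu>" using e[OF m] by (cases "Ent m \<mu>") auto
        from e2ennreal_mono[OF this] show "ennreal (w \<mu> * max 0 (- e \<mu>)) \<le> ennreal (w \<mu>) * e2ennreal (- Ent m \<mu>)"
          using w m by (auto simp: ennreal_mult mx intro!: mult_left_mono)
      qed
      then show ?thesis using w by (simp add: sum_ennreal)
    qed
    have nn: "0 \<le> ?p" "0 \<le> ?n" using w by (auto intro!: sum_nonneg)
    have "?P \<noteq> \<infinity>" using P by (auto simp: top_unique)
    then have "Ent_integral m ?O = enn2ereal ?P - enn2ereal ?N"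
      unfolding Ent_integral_def ereal_integral_def Let_def O3 by simp
    also have "\<dots> \<le> enn2ereal (ennreal ?p) - enn2ereal (ennreal ?n)"
      using P N by (intro ereal_minus_mono) (simp_all add: less_eq_ennreal.rep_eq)
    also have "\<dots> = ereal (?p - ?n)" using nn by simp
    also have "?p - ?n = (\<Sum>\<mu>\<in>S. w \<mu> * e \<mu>)"
      unfolding sum_subtractf[symmetric] by (intro sum.cong) (auto simp: max_def)
    finally show ?thesis .
  qed
  then have "Ent m \<nu> \<le> ereal (\<Sum>\<mu>\<in>S. w \<mu> * e \<mu>) - ereal (K / 2 * enn2real (?V \<nu>))"
    using En unfolding nV by (meson ereal_minus_mono order_refl order_trans)
  moreover have "?V \<nu> \<le> ?V \<eta>" if "\<eta> \<in> Prob T" for \<eta>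
    unfolding nV V using that by (intro INF_lower)
  ultimately show ?thesis using nP by (intro that[of \<nu>]) auto
qed

end

subsection \<open>Finitely supported weights\<close>

text \<open>Meaningful for finitely supported \<open>w\<close> only: a sum over an infinite set is
  \<open>0\<close>.\<close>

definition wsum :: "('b \<Rightarrow> real) \<Rightarrow> ('b \<Rightarrow> ennreal) \<Rightarrow> ennreal" where
  "wsum w f = (\<Sum>x | w x \<noteq> 0. ennreal (w x) * f x)"

text \<open>The last clause is the entropy budget: \<open>v\<close> is later chosen so that its mean
  bounds the entropy of the measure that BCD returns for \<open>w\<close>.\<close>

definition admissible :: "'b set \<Rightarrow> ('b \<Rightarrow> real) \<Rightarrow> real \<Rightarrow> ('b \<Rightarrow> real) \<Rightarrow> bool" where
  "admissible E v C w \<longleftrightarrow> finite {x. w x \<noteq> 0} \<and> {x. w x \<noteq> 0} \<subseteq> E \<and> (\<forall>x. 0 \<le> w x) \<and>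
     (\<Sum>x | w x \<noteq> 0. w x) = 1 \<and> (\<Sum>x | w x \<noteq> 0. w x * v x) \<le> C"

lemma wsum_superset:
  "finite U \<Longrightarrow> {x. w x \<noteq> 0} \<subseteq> U \<Longrightarrow> wsum w f = (\<Sum>x\<in>U. ennreal (w x) * f x)"
  unfolding wsum_def by (intro sum.mono_neutral_left) auto

text \<open>The elements of \<open>J\<close> are themselves weights and serve as their own indices.
  Stability under mixing lets the minimax multipliers be absorbed into one weight.\<close>

lemma admissible_mix:
  assumes J: "finite J" and adm: "\<And>j. j \<in> J \<Longrightarrow> admissible E v C j"
    and l: "\<And>j. j \<in> J \<Longrightarrow> 0 < l j" "(\<Sum>j\<in>J. l j) = 1"
  defines "w \<equiv> \<lambda>x. \<Sum>j\<in>J. l j * j x"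
  shows "admissible E v C w" and "wsum w f = (\<Sum>j\<in>J. ennreal (l j) * wsum j f)"
proof -
  define U where "U = (\<Union>j\<in>J. {x. j x \<noteq> 0})"
  have U: "finite U" "U \<subseteq> E" using J adm unfolding U_def admissible_def by auto
  have sub: "{x. w x \<noteq> 0} \<subseteq> U"
  proof
    fix x assume "x \<in> {x. w x \<noteq> 0}"
    then have "\<exists>j\<in>J. l j * j x \<noteq> 0" unfolding w_def using sum.neutral[of J "\<lambda>j. l j * j x"] by auto
    then show "x \<in> U" unfolding U_def by auto
  qed
  have subj: "{x. j x \<noteq> 0} \<subseteq> U" if "j \<in> J" for j using that unfolding U_def by auto
  have jn: "0 \<le> j x" if "j \<in> J" for j x using adm[OF that] by (simp add: admissible_def)
  have ext: "(\<Sum>x | i x \<noteq> 0. i x * f x) = (\<Sum>x\<in>U. i x * f x)" if "{x. i x \<noteq> 0} \<subseteq> U" for i and f :: "_ \<Rightarrow> real"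
    using that U by (intro sum.mono_neutral_left) auto
  have swap: "(\<Sum>x\<in>U. w x * f x) = (\<Sum>j\<in>J. l j * (\<Sum>x\<in>U. j x * f x))" for f :: "_ \<Rightarrow> real"
    unfolding w_def sum_distrib_right sum_distrib_left by (subst sum.swap) (simp add: mult.assoc)
  have "(\<Sum>x | w x \<noteq> 0. w x) = (\<Sum>j\<in>J. l j * (\<Sum>x | j x \<noteq> 0. j x))"
    using ext[OF sub, of "\<lambda>_. 1"] swap[of "\<lambda>_. 1"] ext[OF subj, of _ "\<lambda>_. 1"] by simp
  also have "\<dots> = (\<Sum>j\<in>J. l j)" using adm by (intro sum.cong) (auto simp: admissible_def)
  finally have one: "(\<Sum>x | w x \<noteq> 0. w x) = 1" using l(2) by simp
  have "(\<Sum>x | w x \<noteq> 0. w x * v x) = (\<Sum>j\<in>J. l j * (\<Sum>x | j x \<noteq> 0. j x * v x))"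
    using ext[OF sub, of v] swap[of v] ext[OF subj, of _ v] by simp
  also have "\<dots> \<le> (\<Sum>j\<in>J. l j * C)"
    using adm l by (intro sum_mono mult_left_mono) (auto simp: admissible_def less_imp_le)
  also have "\<dots> = C" using l(2) by (simp flip: sum_distrib_right)
  finally have le: "(\<Sum>x | w x \<noteq> 0. w x * v x) \<le> C" .
  have w0: "0 \<le> w x" for x unfolding w_def using jn l by (intro sum_nonneg mult_nonneg_nonneg) (auto simp: less_imp_le)
  show "admissible E v C w"
    unfolding admissible_def using one le w0 sub U finite_subset[OF sub U(1)] by blast
  have "wsum w f = (\<Sum>x\<in>U. ennreal (w x) * f x)" by (rule wsum_superset[OF U(1) sub])
  also have "\<dots> = (\<Sum>x\<in>U. \<Sum>j\<in>J. ennreal (l j) * (ennreal (j x) * f x))"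
  proof (intro sum.cong refl)
    fix x
    have "ennreal (w x) = (\<Sum>j\<in>J. ennreal (l j) * ennreal (j x))"
      unfolding w_def using jn l by (subst sum_ennreal[symmetric]) (auto simp: ennreal_mult less_imp_le)
    then show "ennreal (w x) * f x = (\<Sum>j\<in>J. ennreal (l j) * (ennreal (j x) * f x))"
      by (simp add: sum_distrib_right mult.assoc)
  qed
  also have "\<dots> = (\<Sum>j\<in>J. ennreal (l j) * (\<Sum>x\<in>U. ennreal (j x) * f x))"
    by (subst sum.swap) (simp add: sum_distrib_left)
  also have "\<dots> = (\<Sum>j\<in>J. ennreal (l j) * wsum j f)"
    using wsum_superset[OF U(1) subj] by (intro sum.cong) auto
  finally show "wsum w f = (\<Sum>j\<in>J. ennreal (l j) * wsum j f)" .
qed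

text \<open>The sum of two conditionals gives the unit weight at \<open>x\<close> when
  \<open>x = y\<close>.\<close>

lemma admissible_two_points:
  assumes xy: "x \<in> E" "y \<in> E" and t: "0 \<le> t" "t \<le> 1" and v: "(1-t) * v x + t * v y \<le> C"
  defines "w \<equiv> \<lambda>z. (if z = x then 1 - t else 0) + (if z = y then t else 0)"
  shows "admissible E v C w" "wsum w f = ennreal (1-t) * f x + ennreal t * f y"
proof -
  have sub: "{z. w z \<noteq> 0} \<subseteq> {x,y}" by (auto simp: w_def split: if_splits)
  have ext: "(\<Sum>z | w z \<noteq> 0. w z * f z) = (\<Sum>z\<in>{x,y}. w z * f z)" for f :: "_ \<Rightarrow> real"
    using sub by (intro sum.mono_neutral_left) auto
  have eq: "(\<Sum>z\<in>{x,y}. w z * f z) = (1-t) * f x + t * f y" for f :: "_ \<Rightarrow> real"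
    by (cases "x = y") (auto simp: w_def algebra_simps)
  have "(\<Sum>z | w z \<noteq> 0. w z) = 1" using ext[of "\<lambda>_. 1"] eq[of "\<lambda>_. 1"] by simp
  moreover have "(\<Sum>z | w z \<noteq> 0. w z * v z) \<le> C" using ext[of v] eq[of v] v by simp
  moreover have "0 \<le> w z" for z using t by (simp add: w_def)
  ultimately show "admissible E v C w"
    unfolding admissible_def using sub xy finite_subset[OF sub] by auto
  have "wsum w f = (\<Sum>z\<in>{x,y}. ennreal (w z) * f z)" by (rule wsum_superset[OF _ sub]) simp
  also have "\<dots> = ennreal (1-t) * f x + ennreal t * f y"
    using t by (cases "x = y") (auto simp: w_def simp flip: distrib_right ennreal_plus)
  finally show "wsum w f = ennreal (1-t) * f x + ennreal t * f y" .
qed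

text \<open>Two-point weights suffice because there is one linear constraint. \<open>y0\<close>,
  strictly below the budget, is the Slater point: it makes \<open>h\<close> finite and bounds the
  set whose supremum is \<open>s\<close>.\<close>

lemma lagrange_multiplier:
  fixes h g :: "'b \<Rightarrow> ennreal" and v :: "'b \<Rightarrow> real"
  assumes g: "\<And>x. x \<in> E \<Longrightarrow> g x < \<infinity>" and y0: "y0 \<in> E" "v y0 < C"
    and hyp: "\<And>x y t. x \<in> E \<Longrightarrow> y \<in> E \<Longrightarrow> 0 \<le> t \<Longrightarrow> t \<le> 1 \<Longrightarrow> (1-t) * v x + t * v y \<le> C \<Longrightarrow>
      ennreal (1-t) * h x + ennreal t * h y \<le> ennreal (1-t) * g x + ennreal t * g y"
  obtains s where "0 \<le> s" "\<And>x. x \<in> E \<Longrightarrow> h x < \<infinity>" "\<And>x. x \<in> E \<Longrightarrow> enn2real (h x) + s * C \<le> enn2real (g x) + s * v x"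
proof -
  have low: "h x \<le> g x" if "x \<in> E" "v x \<le> C" for x using hyp[of x x 0] that by simp
  have hfin: "h x < \<infinity>" if x: "x \<in> E" for x
  proof (cases "v x \<le> C")
    case True then show ?thesis using le_less_trans[OF low[OF x] g[OF x]] by simp
  next
    case False
    \<comment> \<open>The mixture of \<open>y0\<close> and \<open>x\<close> that meets the budget
      exactly.\<close>
    define t where "t = (C - v y0) / (v x - v y0)"
    have "t * (v x - v y0) = C - v y0" using False y0 by (simp add: t_def)
    then have "(1-t) * v y0 + t * v x = C" by (simp add: algebra_simps)
    moreover have "0 < t" "t \<le> 1" using False y0 by (auto simp: t_def)
    ultimately have t: "0 < t" "t \<le> 1" "(1-t) * v y0 + t * v x = C" by auto
    have "ennreal t * h x \<le> ennreal (1-t) * h y0 + ennreal t * h x" by simp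
    also have "\<dots> \<le> ennreal (1-t) * g y0 + ennreal t * g x" using t y0 x by (intro hyp) auto
    also have "\<dots> < \<infinity>" using g[OF x] g[OF y0(1)] by (simp add: ennreal_mult_less_top)
    finally show ?thesis using t by (auto simp: ennreal_mult_less_top)
  qed
  define k where "k x = enn2real (h x) - enn2real (g x)" for x
  have real_hyp: "(1-t) * k x + t * k y \<le> 0" if "x \<in> E" "y \<in> E" "0 \<le> t" "t \<le> 1" "(1-t) * v x + t * v y \<le> C" for x y t
  proof -
    have e: "ennreal ((1-t) * enn2real (k x) + t * enn2real (k y)) = ennreal (1-t) * k x + ennreal t * k y"
      if "k x < \<infinity>" "k y < \<infinity>" for k :: "'b \<Rightarrow> ennreal"
      using that \<open>0 \<le> t\<close> \<open>t \<le> 1\<close> by (cases "k x"; cases "k y") (auto simp: ennreal_mult)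
    have "ennreal ((1-t) * enn2real (h x) + t * enn2real (h y)) = ennreal (1-t) * h x + ennreal t * h y"
      using hfin that by (intro e) auto
    also have "\<dots> \<le> ennreal (1-t) * g x + ennreal t * g y" by (rule hyp[OF that])
    also have "\<dots> = ennreal ((1-t) * enn2real (g x) + t * enn2real (g y))"
      using g that by (intro e[symmetric]) auto
    finally have "(1-t) * enn2real (h x) + t * enn2real (h y) \<le> (1-t) * enn2real (g x) + t * enn2real (g y)"
      using that by (subst (asm) ennreal_le_iff) auto
    then show ?thesis unfolding k_def by (simp add: algebra_simps)
  qed
  have klow: "k x \<le> 0" if "x \<in> E" "v x \<le> C" for x using real_hyp[of x x 0] that by simp
  \<comment> \<open>Excess per unit of overspending on one side of \<open>C\<close> is at most the
    gain per unit saved on the other; test the two-point weight of mean exactly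
    \<open>C\<close>.\<close>
  have cross: "k z / (v z - C) \<le> - k x / (C - v x)" if "x \<in> E" "z \<in> E" "v x < C" "C < v z" for x z
  proof -
    define t where "t = (C - v x) / (v z - v x)"
    have "t * (v z - v x) = C - v x" using that by (simp add: t_def)
    then have "(1-t) * v x + t * v z = C" by (simp add: algebra_simps)
    moreover have "0 \<le> t" "t \<le> 1" using that by (auto simp: t_def)
    ultimately have t: "0 \<le> t" "t \<le> 1" "(1-t) * v x + t * v z = C" by auto
    have "(1-t) * k x + t * k z \<le> 0" using t that by (intro real_hyp) auto
    moreover have "1 - t = (v z - C) / (v z - v x)" using that by (simp add: t_def field_simps)
    ultimately have "((v z - C) * k x + (C - v x) * k z) / (v z - v x) \<le> 0"
      unfolding t_def by (simp add: add_divide_distrib)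
    then have "(v z - C) * k x + (C - v x) * k z \<le> 0" using that by (simp add: divide_le_0_iff)
    then show ?thesis using that by (simp add: field_simps)
  qed
  \<comment> \<open>Any nonnegative \<open>s\<close> between the two families of slopes works. The
    inserted \<open>0\<close> gives \<open>s \<ge> 0\<close> and a nonempty set.\<close>
  let ?R = "insert 0 {k z / (v z - C) | z. z \<in> E \<and> C < v z}"
  have Rle: "r \<le> - k x / (C - v x)" if "r \<in> ?R" "x \<in> E" "v x < C" for r x
  proof -
    have "0 \<le> - k x / (C - v x)" using klow[of x] that by (intro divide_nonneg_pos) auto
    then show ?thesis using that cross[of x] by auto
  qed
  have bdd: "bdd_above ?R" using Rle[OF _ y0] by (intro bdd_aboveI)
  define s where "s = Sup ?R"
  have s0: "0 \<le> s" unfolding s_def using bdd by (intro cSup_upper) auto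
  have "k x \<le> s * (v x - C)" if x: "x \<in> E" for x
  proof -
    consider "v x < C" | "v x = C" | "C < v x" by linarith
    then show ?thesis
    proof cases
      case 1
      have "s \<le> - k x / (C - v x)" unfolding s_def using Rle[OF _ x 1] by (intro cSup_least) auto
      then show ?thesis using 1 by (simp add: field_simps)
    next
      case 2 then show ?thesis using klow[OF x] by simp
    next
      case 3
      have "k x / (v x - C) \<le> s" unfolding s_def using x 3 by (intro cSup_upper bdd) auto
      then show ?thesis using 3 by (simp add: field_simps)
    qed
  qed
  then show ?thesis using that[OF s0 hfin] unfolding k_def by (simp add: algebra_simps)
qed

section \<open>One competitor for all weights\<close>

context emt
begin

lemma W2sq_nn_integral_lsc:
  assumes Om: "prob_on_P T \<Omega>" and M: "sets M = sets (borel_of T)"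
    and r: "\<And>n::nat. \<rho> n \<in> ent_dens M C" "\<And>n. dm M (\<rho> n) \<in> Prob T" and s: "\<sigma> \<in> ent_dens M C"
    and lim: "(\<lambda>n. l1 M (\<rho> n) \<sigma>) \<longlonglongrightarrow> 0"
    and le: "\<And>n. (\<integral>\<^sup>+\<mu>. W2sq T d \<mu> (dm M (\<rho> n)) \<partial>\<Omega>) \<le> a"
  shows "(\<integral>\<^sup>+\<mu>. W2sq T d \<mu> (dm M \<sigma>) \<partial>\<Omega>) \<le> a"
proof -
  have sp: "space \<Omega> = Prob T" and se: "sets \<Omega> = sets BP" using Om by (auto simp: prob_on_P_def)
  have "(\<integral>\<^sup>+\<mu>. W2sq T d \<mu> (dm M \<sigma>) \<partial>\<Omega>) \<le> (\<integral>\<^sup>+\<mu>. liminf (\<lambda>n. W2sq T d \<mu> (dm M (\<rho> n))) \<partial>\<Omega>)"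
    using W2sq_dm_lsc[OF M r s lim] sp by (intro nn_integral_mono) auto
  also have "\<dots> \<le> liminf (\<lambda>n. \<integral>\<^sup>+\<mu>. W2sq T d \<mu> (dm M (\<rho> n)) \<partial>\<Omega>)"
    using W2sq_measurable[OF r(2)] se by (intro nn_integral_liminf) (simp cong: measurable_cong_sets)
  also have "\<dots> \<le> liminf (\<lambda>n::nat. a)" using le by (intro Liminf_mono) auto
  also have "\<dots> = a" by (simp add: Liminf_const)
  finally show ?thesis .
qed

lemma dm_mix:
  assumes M: "finite_measure M" "sets M = sets (borel_of T)"
    and r: "\<rho> \<in> ent_dens M C" "dm M \<rho> \<in> Prob T" and s: "\<sigma> \<in> ent_dens M C" "dm M \<sigma> \<in> Prob T"
    and t: "0 \<le> t" "t \<le> 1"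
  defines "\<tau> \<equiv> \<lambda>x. (1-t) * \<rho> x + t * \<sigma> x"
  shows "\<tau> \<in> ent_dens M C" "dm M \<tau> \<in> Prob T"
    "A \<in> sets (borel_of T) \<Longrightarrow> measure (dm M \<tau>) A = (1-t) * measure (dm M \<rho>) A + t * measure (dm M \<sigma>) A"
proof -
  show tau: "\<tau> \<in> ent_dens M C" unfolding \<tau>_def by (rule finite_measure.ent_dens_convex[OF M(1) r(1) s(1) t])
  show mix: "measure (dm M \<tau>) A = (1-t) * measure (dm M \<rho>) A + t * measure (dm M \<sigma>) A" if A: "A \<in> sets (borel_of T)" for A
  proof -
    have A': "A \<in> sets M" using A M by simp
    have "(\<integral>x. indicator A x * \<tau> x \<partial>M) = (\<integral>x. (1-t) * (indicator A x * \<rho> x) + t * (indicator A x * \<sigma> x) \<partial>M)"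
      unfolding \<tau>_def by (intro Bochner_Integration.integral_cong) (auto simp: algebra_simps)
    then show ?thesis
      using dm_props(2,3)[OF tau A'] dm_props(2,3)[OF r(1) A'] dm_props(2,3)[OF s(1) A'] by simp
  qed
  show "dm M \<tau> \<in> Prob T"
  proof (rule ProbI[OF dm_props(1)[OF tau]])
    show "sets (dm M \<tau>) = sets (borel_of T)" using M by simp
    interpret p: prob_space "dm M \<rho>" using r(2) by (rule Prob_prob_space)
    interpret q: prob_space "dm M \<sigma>" using s(2) by (rule Prob_prob_space)
    fix B and e :: real assume B: "B \<in> sets (borel_of T)" and e: "0 < e"
    obtain K where K: "compactin T K" "K \<subseteq> B" "measure (dm M \<rho>) B \<le> measure (dm M \<rho>) K + e"
      using Prob_approx[OF r(2) B e] by metis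
    obtain L where L: "compactin T L" "L \<subseteq> B" "measure (dm M \<sigma>) B \<le> measure (dm M \<sigma>) L + e"
      using Prob_approx[OF s(2) B e] by metis
    have c: "compactin T (K \<union> L)" using K L by (intro compactin_Un) auto
    have KL: "K \<union> L \<in> sets (borel_of T)" by (rule compactin_borel_of[OF H c])
    have "measure (dm M \<rho>) K \<le> measure (dm M \<rho>) (K \<union> L)" "measure (dm M \<sigma>) L \<le> measure (dm M \<sigma>) (K \<union> L)"
      using KL M by (auto intro!: p.finite_measure_mono q.finite_measure_mono)
    then have "measure (dm M \<tau>) B \<le> (1-t) * (measure (dm M \<rho>) (K \<union> L) + e) + t * (measure (dm M \<sigma>) (K \<union> L) + e)"
      unfolding mix[OF B] using t K L by (intro add_mono mult_left_mono) auto
    also have "\<dots> = measure (dm M \<tau>) (K \<union> L) + e" unfolding mix[OF KL] by (simp add: algebra_simps)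
    finally show "\<exists>K. compactin T K \<and> K \<subseteq> B \<and> measure (dm M \<tau>) B \<le> measure (dm M \<tau>) K + e"
      using c K L by (intro exI[of _ "K \<union> L"]) auto
  qed
qed

lemma W2sq_nn_integral_convex:
  assumes Om: "prob_on_P T \<Omega>" and M: "finite_measure M" "sets M = sets (borel_of T)"
    and r: "\<rho> \<in> ent_dens M C" "dm M \<rho> \<in> Prob T" and s: "\<sigma> \<in> ent_dens M C" "dm M \<sigma> \<in> Prob T"
    and t: "0 \<le> t" "t \<le> 1"
  shows "(\<integral>\<^sup>+\<mu>. W2sq T d \<mu> (dm M (\<lambda>x. (1-t) * \<rho> x + t * \<sigma> x)) \<partial>\<Omega>) \<le>
     ennreal (1-t) * (\<integral>\<^sup>+\<mu>. W2sq T d \<mu> (dm M \<rho>) \<partial>\<Omega>) + ennreal t * (\<integral>\<^sup>+\<mu>. W2sq T d \<mu> (dm M \<sigma>) \<partial>\<Omega>)"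
proof -
  have sp: "space \<Omega> = Prob T" and se: "sets \<Omega> = sets BP" using Om by (auto simp: prob_on_P_def)
  note mix = dm_mix[OF M r s t]
  have m: "(\<lambda>\<mu>. W2sq T d \<mu> (dm M \<rho>)) \<in> borel_measurable \<Omega>" "(\<lambda>\<mu>. W2sq T d \<mu> (dm M \<sigma>)) \<in> borel_measurable \<Omega>"
    using W2sq_measurable[OF r(2)] W2sq_measurable[OF s(2)] se by (simp_all cong: measurable_cong_sets)
  have "(\<integral>\<^sup>+\<mu>. W2sq T d \<mu> (dm M (\<lambda>x. (1-t) * \<rho> x + t * \<sigma> x)) \<partial>\<Omega>) \<le>
      (\<integral>\<^sup>+\<mu>. ennreal (1-t) * W2sq T d \<mu> (dm M \<rho>) + ennreal t * W2sq T d \<mu> (dm M \<sigma>) \<partial>\<Omega>)"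
    using sp by (intro nn_integral_mono W2sq_convex r s mix t) auto
  also have "\<dots> = ennreal (1-t) * (\<integral>\<^sup>+\<mu>. W2sq T d \<mu> (dm M \<rho>) \<partial>\<Omega>) + ennreal t * (\<integral>\<^sup>+\<mu>. W2sq T d \<mu> (dm M \<sigma>) \<partial>\<Omega>)"
    using m by (simp add: nn_integral_add nn_integral_cmult)
  finally show ?thesis .
qed

lemma wsum_eq_nn_integral:
  assumes "admissible E v C w" "E \<subseteq> Prob T"
  shows "prob_on_P T (fin_meas {\<mu>. w \<mu> \<noteq> 0} w)" "wsum w f = (\<integral>\<^sup>+\<mu>. f \<mu> \<partial>fin_meas {\<mu>. w \<mu> \<noteq> 0} w)"
  using assms unfolding admissible_def wsum_def
  by (auto intro!: prob_on_P_fin_meas nn_integral_fin_meas[symmetric])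

text \<open>Minimax loses an arbitrary \<open>\<delta>\<close>, so the family passed to
  \<open>ent_dens_directed_Inter\<close> is indexed by finite sets of weights together with
  \<open>\<delta>\<close>; a common point then serves every weight without loss.\<close>

lemma uniform_competitor:
  assumes M: "finite_measure M" "sets M = sets (borel_of T)" and E: "E \<subseteq> Prob T"
    and C1: "\<And>w. admissible E v C w \<Longrightarrow>
      \<exists>\<rho>\<in>ent_dens M C. dm M \<rho> \<in> Prob T \<and> wsum w (\<lambda>\<mu>. W2sq T d \<mu> (dm M \<rho>)) \<le> wsum w g"
    and g: "\<And>\<mu>. \<mu> \<in> E \<Longrightarrow> g \<mu> < \<infinity>" and y0: "y0 \<in> E" "v y0 < C"
  obtains \<rho> where "\<rho> \<in> ent_dens M C" "dm M \<rho> \<in> Prob T"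
    "\<And>w. admissible E v C w \<Longrightarrow> wsum w (\<lambda>\<mu>. W2sq T d \<mu> (dm M \<rho>)) \<le> wsum w g"
proof -
  interpret finite_measure M by fact
  define D where "D = {\<rho> \<in> ent_dens M C. dm M \<rho> \<in> Prob T}"
  define V where "V w \<rho> = wsum w (\<lambda>\<mu>. W2sq T d \<mu> (dm M \<rho>))" for w \<rho>
  define b where "b w = enn2real (wsum w g)" for w
  have bw: "wsum w g = ennreal (b w)" "0 \<le> b w" if "admissible E v C w" for w
  proof -
    have "wsum w g < \<infinity>"
      using that g unfolding wsum_def admissible_def by (auto simp: ennreal_mult_less_top subset_iff)
    then show "wsum w g = ennreal (b w)" "0 \<le> b w" by (auto simp: b_def less_top)
  qed
  have Vconv: "V w (\<lambda>x. (1-t) * \<rho> x + t * \<sigma> x) \<le> ennreal (1-t) * V w \<rho> + ennreal t * V w \<sigma>"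
    if "admissible E v C w" "\<rho> \<in> D" "\<sigma> \<in> D" "0 \<le> t" "t \<le> 1" for w \<rho> \<sigma> t
    using that W2sq_nn_integral_convex[OF wsum_eq_nn_integral(1)[OF that(1) E] M, of \<rho> C \<sigma> t]
    unfolding V_def wsum_eq_nn_integral(2)[OF that(1) E] by (auto simp: D_def)
  have Dconv: "(\<lambda>x. (1-t) * \<rho> x + t * \<sigma> x) \<in> D" if "\<rho> \<in> D" "\<sigma> \<in> D" "0 \<le> t" "t \<le> 1" for \<rho> \<sigma> t
    using that dm_mix(1,2)[OF M, of \<rho> C \<sigma> t] by (auto simp: D_def)
  define A where "A J \<delta> = {\<rho> \<in> D. \<forall>j\<in>J. V j \<rho> \<le> ennreal (b j + \<delta>)}" for J \<delta>
  have A_ne: "A J \<delta> \<noteq> {}" if J: "finite J" "\<forall>j\<in>J. admissible E v C j" and \<delta>: "0 < \<delta>" for J \<delta>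
  proof -
    \<comment> \<open>Vectors dominating the excess costs, instead of the excess costs themselves:
      these are only convex in \<open>\<rho>\<close> and may be infinite, whereas this set is
      convex.\<close>
    define Y where "Y = {y. \<exists>\<rho>\<in>D. \<forall>j\<in>J. 0 \<le> y j + b j \<and> V j \<rho> \<le> ennreal (y j + b j)}"
    have "\<exists>y\<in>Y. \<forall>j\<in>J. y j \<le> \<delta>"
    proof (rule finite_minimax[OF J(1), where B="\<Sum>j\<in>J. b j"])
      fix y z and t :: real assume yz: "y \<in> Y" "z \<in> Y" and t: "0 \<le> t" "t \<le> 1"
      obtain \<rho> where \<rho>: "\<rho> \<in> D" "\<And>j. j \<in> J \<Longrightarrow> 0 \<le> y j + b j \<and> V j \<rho> \<le> ennreal (y j + b j)" using yz(1) unfolding Y_def by blast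
      obtain \<sigma> where \<sigma>: "\<sigma> \<in> D" "\<And>j. j \<in> J \<Longrightarrow> 0 \<le> z j + b j \<and> V j \<sigma> \<le> ennreal (z j + b j)" using yz(2) unfolding Y_def by blast
      have "0 \<le> ((1-t) * y j + t * z j) + b j \<and> V j (\<lambda>x. (1-t) * \<rho> x + t * \<sigma> x) \<le> ennreal (((1-t) * y j + t * z j) + b j)"
        if j: "j \<in> J" for j
      proof -
        have eq: "((1-t) * y j + t * z j) + b j = (1-t) * (y j + b j) + t * (z j + b j)" by (simp add: algebra_simps)
        have "V j (\<lambda>x. (1-t) * \<rho> x + t * \<sigma> x) \<le> ennreal (1-t) * V j \<rho> + ennreal t * V j \<sigma>"
          using J j \<rho> \<sigma> t by (intro Vconv) auto
        also have "\<dots> \<le> ennreal (1-t) * ennreal (y j + b j) + ennreal t * ennreal (z j + b j)"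
          using \<rho>(2)[OF j] \<sigma>(2)[OF j] by (intro add_mono mult_left_mono) auto
        also have "\<dots> = ennreal ((1-t) * (y j + b j) + t * (z j + b j))"
          using t \<rho>(2)[OF j] \<sigma>(2)[OF j] by (simp add: ennreal_mult)
        finally show ?thesis unfolding eq using t \<rho>(2)[OF j] \<sigma>(2)[OF j] by auto
      qed
      then show "(\<lambda>j. (1-t) * y j + t * z j) \<in> Y" unfolding Y_def using Dconv[OF \<rho>(1) \<sigma>(1) t] by blast
    next
      fix y j assume "y \<in> Y" "j \<in> J"
      then have "- b j \<le> y j" unfolding Y_def by (auto simp: algebra_simps)
      moreover have "b j \<le> (\<Sum>j\<in>J. b j)" using J bw(2) \<open>j \<in> J\<close> by (intro member_le_sum) auto
      ultimately show "- (\<Sum>j\<in>J. b j) \<le> y j" by simp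
    next
      fix l :: "('a measure \<Rightarrow> real) \<Rightarrow> real" assume l: "\<And>j. j \<in> J \<Longrightarrow> 0 < l j"
      show "\<exists>y\<in>Y. (\<Sum>j\<in>J. l j * y j) \<le> 0"
      proof (cases "J = {}")
        case True
        \<comment> \<open>For empty \<open>J\<close> it remains to see that \<open>D\<close> is
          nonempty, by the unit weight at \<open>y0\<close>.\<close>
        have "admissible E v C (\<lambda>z. (if z = y0 then 1 - 0 else 0) + (if z = y0 then 0 else 0))"
          using y0 by (intro admissible_two_points) auto
        from C1[OF this] have "D \<noteq> {}" unfolding D_def by blast
        then show ?thesis unfolding Y_def True by auto
      next
        case False
        define L where "L = (\<Sum>j\<in>J. l j)"
        have L: "0 < L" unfolding L_def using l False J by (intro sum_pos) auto
        \<comment> \<open>The normalized multipliers mix the weights in \<open>J\<close> into one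
          admissible weight, whose own competitor settles the inequality.\<close>
        define k where "k j = l j / L" for j
        define w where "w = (\<lambda>x. \<Sum>j\<in>J. k j * j x)"
        have l': "\<And>j. j \<in> J \<Longrightarrow> 0 < k j" "(\<Sum>j\<in>J. k j) = 1"
          using l L by (auto simp: k_def L_def simp flip: sum_divide_distrib)
        have adm: "\<And>j. j \<in> J \<Longrightarrow> admissible E v C j" using J by blast
        note mix = admissible_mix[OF J(1) adm l', folded w_def]
        have wadm: "admissible E v C w" using mix(1) by blast
        have weq: "wsum w f = (\<Sum>j\<in>J. ennreal (k j) * wsum j f)" for f using mix(2) by blast
        obtain \<rho> where \<rho>: "\<rho> \<in> D" "V w \<rho> \<le> wsum w g" using C1[OF wadm] unfolding D_def V_def by blast
        have le: "(\<Sum>j\<in>J. ennreal (k j) * V j \<rho>) \<le> (\<Sum>j\<in>J. ennreal (k j) * ennreal (b j))"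

        proof -
          have "(\<Sum>j\<in>J. ennreal (k j) * wsum j g) = (\<Sum>j\<in>J. ennreal (k j) * ennreal (b j))"
            using bw(1)[OF adm] by (intro sum.cong) auto
          then show ?thesis using \<rho>(2) unfolding V_def weq by simp
        qed
        have fin: "V j \<rho> < \<infinity>" if j: "j \<in> J" for j
        proof -
          have "ennreal (k j) * V j \<rho> \<le> (\<Sum>j\<in>J. ennreal (k j) * V j \<rho>)"
            using J j by (intro member_le_sum) auto
          also note le
          also have "(\<Sum>j\<in>J. ennreal (k j) * ennreal (b j)) < \<infinity>"
            using J(1) ennreal_mult_less_top[of "ennreal (k _)" "ennreal (b _)"] by (auto simp: less_top)
          finally show ?thesis using l'(1)[OF j] by (auto simp: ennreal_mult_less_top)
        qed
        define y where "y j = enn2real (V j \<rho>) - b j" for j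
        have Vy: "V j \<rho> = ennreal (y j + b j)" "0 \<le> y j + b j" if "j \<in> J" for j
          using fin[OF that] by (auto simp: y_def less_top)
        have "y \<in> Y" unfolding Y_def using \<rho>(1) Vy by (intro CollectI bexI[of _ \<rho>]) auto
        moreover have "(\<Sum>j\<in>J. l j * y j) \<le> 0"
        proof -
          have k0: "0 \<le> k j" if "j \<in> J" for j using l'(1)[OF that] by simp
          have b0: "0 \<le> b j" if "j \<in> J" for j using bw(2)[OF adm[OF that]] .
          have "ennreal (\<Sum>j\<in>J. k j * (y j + b j)) = (\<Sum>j\<in>J. ennreal (k j * (y j + b j)))"
            using Vy k0 by (intro sum_ennreal[symmetric] mult_nonneg_nonneg) auto
          also have "\<dots> = (\<Sum>j\<in>J. ennreal (k j) * V j \<rho>)"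
            using Vy k0 by (intro sum.cong refl) (simp add: ennreal_mult)
          also have "\<dots> \<le> (\<Sum>j\<in>J. ennreal (k j * b j))"
            using le b0 k0 by (simp add: ennreal_mult cong: sum.cong)
          also have "\<dots> = ennreal (\<Sum>j\<in>J. k j * b j)"
            using b0 k0 by (intro sum_ennreal mult_nonneg_nonneg) auto
          finally have "(\<Sum>j\<in>J. k j * (y j + b j)) \<le> (\<Sum>j\<in>J. k j * b j)"
            using b0 k0 by (subst (asm) ennreal_le_iff) (auto intro!: sum_nonneg)
          then have "(\<Sum>j\<in>J. k j * y j) \<le> 0" by (simp add: distrib_left sum.distrib)
          then have "(\<Sum>j\<in>J. l j * y j) / L \<le> 0" by (simp add: sum_divide_distrib k_def)
          then show ?thesis using L by (simp add: divide_le_0_iff)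
        qed
        ultimately show ?thesis by blast
      qed
    qed (rule \<delta>)
    then obtain y where y0: "y \<in> Y" "\<forall>j\<in>J. y j \<le> \<delta>" by auto
    then obtain \<rho> where "\<rho> \<in> D" "\<forall>j\<in>J. 0 \<le> y j + b j \<and> V j \<rho> \<le> ennreal (y j + b j)" unfolding Y_def by auto
    with y0 have y: "\<And>j. j \<in> J \<Longrightarrow> y j \<le> \<delta>" "\<rho> \<in> D" "\<And>j. j \<in> J \<Longrightarrow> V j \<rho> \<le> ennreal (y j + b j)" by auto
    have "V j \<rho> \<le> ennreal (b j + \<delta>)" if "j \<in> J" for j

    proof -
      have "ennreal (y j + b j) \<le> ennreal (b j + \<delta>)" using y(1)[OF that] by (intro ennreal_leI) simp
      then show ?thesis using y(3)[OF that] by (rule order_trans[rotated])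
    qed
    then show ?thesis using y(2) unfolding A_def by blast
  qed
  define \<A> where "\<A> = {A J \<delta> | J \<delta>. finite J \<and> (\<forall>j\<in>J. admissible E v C j) \<and> 0 < \<delta>}"
  have "\<exists>\<rho>. \<forall>B\<in>\<A>. \<rho> \<in> B"
  proof (rule ent_dens_directed_Inter)
    have "A {} 1 \<in> \<A>" unfolding \<A>_def by (intro CollectI exI[of _ "{}"] exI[of _ 1]) auto
    then show "\<A> \<noteq> {}" by blast
    show "B \<noteq> {}" if "B \<in> \<A>" for B using that A_ne unfolding \<A>_def by auto
    show "B \<subseteq> ent_dens M C" if "B \<in> \<A>" for B using that unfolding \<A>_def A_def D_def by auto
    show "(\<lambda>x. (\<rho> x + \<sigma> x) / 2) \<in> B" if B: "B \<in> \<A>" and rs: "\<rho> \<in> B" "\<sigma> \<in> B" for B \<rho> \<sigma>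
    proof -
      obtain J \<delta> where J: "B = A J \<delta>" "\<forall>j\<in>J. admissible E v C j" "0 < \<delta>" using B unfolding \<A>_def by auto
      have D: "\<rho> \<in> D" "\<sigma> \<in> D" using rs J unfolding A_def by auto
      have eq: "(\<lambda>x. (1 - 1/2) * \<rho> x + 1/2 * \<sigma> x) = (\<lambda>x. (\<rho> x + \<sigma> x) / 2)" by (auto simp: field_simps)
      have "V j (\<lambda>x. (\<rho> x + \<sigma> x) / 2) \<le> ennreal (b j + \<delta>)" if j: "j \<in> J" for j
      proof -
        have "V j (\<lambda>x. (1 - 1/2) * \<rho> x + 1/2 * \<sigma> x) \<le> ennreal (1 - 1/2) * V j \<rho> + ennreal (1/2) * V j \<sigma>"
          using J j D by (intro Vconv) auto
        also have "\<dots> \<le> ennreal (1 - 1/2) * ennreal (b j + \<delta>) + ennreal (1/2) * ennreal (b j + \<delta>)"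
          using rs j J unfolding A_def by (intro add_mono mult_left_mono) auto
        also have "\<dots> = ennreal (b j + \<delta>)"
        proof -
          have "0 \<le> b j + \<delta>" using J bw(2) j by (simp add: add_nonneg_nonneg)
          then show ?thesis by (subst (1 2) ennreal_mult[symmetric]) (auto simp del: ennreal_plus simp flip: ennreal_plus)
        qed
        finally show ?thesis unfolding eq .
      qed
      moreover have "(\<lambda>x. (\<rho> x + \<sigma> x) / 2) \<in> D" using Dconv[OF D, of "1/2"] unfolding eq by simp
      ultimately show ?thesis unfolding J A_def by blast
    qed
    show "\<sigma> \<in> B" if B: "B \<in> \<A>" and r: "\<And>n::nat. \<rho> n \<in> B" and s: "\<sigma> \<in> ent_dens M C"
      and lim: "(\<lambda>n. l1 M (\<rho> n) \<sigma>) \<longlonglongrightarrow> 0" for B \<rho> \<sigma>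
    proof -
      obtain J \<delta> where J: "B = A J \<delta>" "\<forall>j\<in>J. admissible E v C j" using B unfolding \<A>_def by auto
      have rd: "\<And>n. \<rho> n \<in> ent_dens M C" "\<And>n. dm M (\<rho> n) \<in> Prob T" using r unfolding J A_def D_def by auto
      have "V j \<sigma> \<le> ennreal (b j + \<delta>)" if j: "j \<in> J" for j
        unfolding V_def wsum_eq_nn_integral(2)[OF J(2)[rule_format, OF j] E]
      proof (rule W2sq_nn_integral_lsc[OF wsum_eq_nn_integral(1)[OF J(2)[rule_format, OF j] E] M(2) rd s lim])
        fix n
        have "V j (\<rho> n) \<le> ennreal (b j + \<delta>)" using r[of n] j unfolding J A_def by auto
        then show "(\<integral>\<^sup>+\<mu>. W2sq T d \<mu> (dm M (\<rho> n)) \<partial>fin_meas {\<mu>. j \<mu> \<noteq> 0} j) \<le> ennreal (b j + \<delta>)"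
          unfolding V_def wsum_eq_nn_integral(2)[OF J(2)[rule_format, OF j] E] .
      qed
      then show ?thesis unfolding J A_def D_def using s dm_Prob_closed[OF M(2) rd s lim] by blast
    qed
    show "\<exists>D\<in>\<A>. D \<subseteq> B \<inter> B'" if B: "B \<in> \<A>" "B' \<in> \<A>" for B B'
    proof -
      obtain J \<delta> where J: "B = A J \<delta>" "finite J" "\<forall>j\<in>J. admissible E v C j" "0 < \<delta>" using B(1) unfolding \<A>_def by auto
      obtain J' \<delta>' where J': "B' = A J' \<delta>'" "finite J'" "\<forall>j\<in>J'. admissible E v C j" "0 < \<delta>'" using B(2) unfolding \<A>_def by auto
      \<comment> \<open>More weights and a smaller slack give a smaller set.\<close>
      have 1: "A (J \<union> J') (min \<delta> \<delta>') \<in> \<A>" unfolding \<A>_def using J J'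
        by (intro CollectI exI[of _ "J \<union> J'"] exI[of _ "min \<delta> \<delta>'"] conjI refl) auto
      have "ennreal (b j + min \<delta> \<delta>') \<le> ennreal (b j + \<delta>)" "ennreal (b j + min \<delta> \<delta>') \<le> ennreal (b j + \<delta>')" for j
        by (auto intro!: ennreal_leI)
      note le = this
      have "A (J \<union> J') (min \<delta> \<delta>') \<subseteq> B \<inter> B'"
      proof
        fix \<rho> assume "\<rho> \<in> A (J \<union> J') (min \<delta> \<delta>')"
        then have r: "\<rho> \<in> D" "\<And>j. j \<in> J \<union> J' \<Longrightarrow> V j \<rho> \<le> ennreal (b j + min \<delta> \<delta>')" unfolding A_def by auto
        show "\<rho> \<in> B \<inter> B'"
          unfolding J(1) J'(1) A_def using r order_trans[OF r(2) le(1)] order_trans[OF r(2) le(2)] by auto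
      qed
      then show ?thesis using 1 by blast
    qed
  qed
  then obtain \<rho> where \<rho>: "\<And>B. B \<in> \<A> \<Longrightarrow> \<rho> \<in> B" by blast
  have inA: "\<rho> \<in> A J \<delta>" if "finite J" "\<forall>j\<in>J. admissible E v C j" "0 < \<delta>" for J \<delta>
    using \<rho> that unfolding \<A>_def by blast
  have "\<rho> \<in> D" using inA[of "{}" 1] unfolding A_def by auto
  moreover have "V w \<rho> \<le> wsum w g" if w: "admissible E v C w" for w
  proof (rule ennreal_le_epsilon)
    fix e :: real assume "0 < e"
    then have "V w \<rho> \<le> ennreal (b w + e)" using inA[of "{w}" e] w unfolding A_def by auto
    then show "V w \<rho> \<le> wsum w g + ennreal e" using bw[OF w] \<open>0 < e\<close> by simp
  qed
  ultimately show ?thesis using that[of \<rho>] unfolding D_def V_def by blast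
qed

end

lemma ent_dens_mono: "C \<le> C' \<Longrightarrow> ent_dens M C \<subseteq> ent_dens M C'"
  by (auto simp: ent_dens_def)

lemma e2ennreal_le_ennreal: "e2ennreal x \<le> ennreal r \<Longrightarrow> 0 \<le> r \<Longrightarrow> x \<le> ereal r"
  by (cases x) (auto simp: top_unique ennreal_le_iff)

section \<open>Moments, the entropy budget and the barycenter\<close>

context emt
begin

lemma coupling_distr:
  assumes g: "\<gamma> \<in> couplings T \<mu> \<nu>" and mu: "\<mu> \<in> Prob T" and nu: "\<nu> \<in> Prob T"
  shows "distr \<gamma> (borel_of T) fst = \<mu>" "distr \<gamma> (borel_of T) snd = \<nu>"
    "fst \<in> \<gamma> \<rightarrow>\<^sub>M borel_of T" "snd \<in> \<gamma> \<rightarrow>\<^sub>M borel_of T"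
proof -
  have gP: "\<gamma> \<in> Prob TT" using g by (simp add: couplings_def)
  show m: "fst \<in> \<gamma> \<rightarrow>\<^sub>M borel_of T" "snd \<in> \<gamma> \<rightarrow>\<^sub>M borel_of T"
    using Prob_sets[OF gP] continuous_map_measurable_borel_of[OF continuous_map_fst, of T T]
      continuous_map_measurable_borel_of[OF continuous_map_snd, of T T]
    by (auto cong: measurable_cong_sets)
  have sp: "space \<gamma> = UNIV" using Prob_space[OF gP] by (simp add: top)
  have v: "fst -` A \<inter> space \<gamma> = A \<times> UNIV" "snd -` A \<inter> space \<gamma> = UNIV \<times> A" for A :: "'a set" by (auto simp: sp)
  show "distr \<gamma> (borel_of T) fst = \<mu>" "distr \<gamma> (borel_of T) snd = \<nu>"
    using g m mu nu by (auto intro!: measure_eqI simp: Prob_sets emeasure_distr v couplings_def)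
qed

text \<open>\<open>lip\<close> is the triangle inequality for a squared distance, up to constants;
  it is integrated against near-optimal plans. The zero function satisfies it too.\<close>

lemma moment_bound:
  assumes psi: "\<psi> \<in> borel_measurable (borel_of T)" and c: "0 < c"
    and lip: "\<And>x y. \<psi> y \<le> ennreal (2 * c) * (d x y)\<^sup>2 + 2 * \<psi> x"
    and mu: "\<mu> \<in> Prob T" and nu: "\<nu> \<in> Prob T"
  shows "(\<integral>\<^sup>+x. \<psi> x \<partial>\<nu>) \<le> ennreal (2 * c) * W2sq T d \<mu> \<nu> + 2 * (\<integral>\<^sup>+x. \<psi> x \<partial>\<mu>)"
    and "(\<integral>\<^sup>+x. \<psi> x \<partial>\<mu>) \<le> ennreal (2 * c) * W2sq T d \<mu> \<nu> + 2 * (\<integral>\<^sup>+x. \<psi> x \<partial>\<nu>)"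
proof -
  let ?c = "\<lambda>z. (d (fst z) (snd z))\<^sup>2"
  have key: "(\<integral>\<^sup>+x. \<psi> x \<partial>\<nu>) \<le> ennreal (2 * c) * (\<integral>\<^sup>+z. ?c z \<partial>\<gamma>) + 2 * (\<integral>\<^sup>+x. \<psi> x \<partial>\<mu>)"
    "(\<integral>\<^sup>+x. \<psi> x \<partial>\<mu>) \<le> ennreal (2 * c) * (\<integral>\<^sup>+z. ?c z \<partial>\<gamma>) + 2 * (\<integral>\<^sup>+x. \<psi> x \<partial>\<nu>)"
    if g: "\<gamma> \<in> couplings T \<mu> \<nu>" for \<gamma>
  proof -
    note D = coupling_distr[OF g mu nu]
    have gP: "\<gamma> \<in> Prob TT" using g by (simp add: couplings_def)
    have [measurable]: "?c \<in> borel_measurable \<gamma>" using d2_measurable Prob_sets[OF gP] by (simp cong: measurable_cong_sets)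
    have [measurable]: "(\<lambda>z. \<psi> (fst z)) \<in> borel_measurable \<gamma>" "(\<lambda>z. \<psi> (snd z)) \<in> borel_measurable \<gamma>"
      using measurable_compose[OF D(3) psi] measurable_compose[OF D(4) psi] by auto
    have "\<psi> \<in> borel_measurable \<mu>" "\<psi> \<in> borel_measurable \<nu>"
      using psi mu nu by (simp_all add: Prob_sets cong: measurable_cong_sets)
    then have e: "(\<integral>\<^sup>+x. \<psi> x \<partial>\<mu>) = (\<integral>\<^sup>+z. \<psi> (fst z) \<partial>\<gamma>)" "(\<integral>\<^sup>+x. \<psi> x \<partial>\<nu>) = (\<integral>\<^sup>+z. \<psi> (snd z) \<partial>\<gamma>)"
      using nn_integral_distr[OF D(3), of \<psi>] nn_integral_distr[OF D(4), of \<psi>] D(1,2) by simp_all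
    have "(\<integral>\<^sup>+z. \<psi> (snd z) \<partial>\<gamma>) \<le> (\<integral>\<^sup>+z. ennreal (2 * c) * ?c z + 2 * \<psi> (fst z) \<partial>\<gamma>)"
      by (intro nn_integral_mono lip)
    then show "(\<integral>\<^sup>+x. \<psi> x \<partial>\<nu>) \<le> ennreal (2 * c) * (\<integral>\<^sup>+z. ?c z \<partial>\<gamma>) + 2 * (\<integral>\<^sup>+x. \<psi> x \<partial>\<mu>)"
      unfolding e by (simp add: nn_integral_add nn_integral_cmult)
    have "(\<integral>\<^sup>+z. \<psi> (fst z) \<partial>\<gamma>) \<le> (\<integral>\<^sup>+z. ennreal (2 * c) * ?c z + 2 * \<psi> (snd z) \<partial>\<gamma>)"
      by (intro nn_integral_mono, subst d_sym, rule lip)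
    then show "(\<integral>\<^sup>+x. \<psi> x \<partial>\<mu>) \<le> ennreal (2 * c) * (\<integral>\<^sup>+z. ?c z \<partial>\<gamma>) + 2 * (\<integral>\<^sup>+x. \<psi> x \<partial>\<nu>)"
      unfolding e by (simp add: nn_integral_add nn_integral_cmult)
  qed
  have inf: "X \<le> ennreal (2 * c) * W2sq T d \<mu> \<nu> + Y"
    if le: "\<And>\<gamma>. \<gamma> \<in> couplings T \<mu> \<nu> \<Longrightarrow> X \<le> ennreal (2 * c) * (\<integral>\<^sup>+z. ?c z \<partial>\<gamma>) + Y" for X Y
  proof (rule ennreal_le_epsilon)
    fix e :: real assume e: "0 < e" and fin: "ennreal (2 * c) * W2sq T d \<mu> \<nu> + Y < top"
    then have "W2sq T d \<mu> \<nu> < top" using c by (auto simp: ennreal_mult_less_top)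
    then have "W2sq T d \<mu> \<nu> < W2sq T d \<mu> \<nu> + ennreal (e / (2 * c))" using e c by (intro ennreal_less_add) auto
    then obtain \<gamma> where g: "\<gamma> \<in> couplings T \<mu> \<nu>" "(\<integral>\<^sup>+z. ?c z \<partial>\<gamma>) < W2sq T d \<mu> \<nu> + ennreal (e / (2 * c))"
      unfolding W2sq_def[of T d \<mu> \<nu>] INF_less_iff by auto
    have "X \<le> ennreal (2 * c) * (W2sq T d \<mu> \<nu> + ennreal (e / (2 * c))) + Y"
      using le[OF g(1)] g(2) by (meson add_right_mono less_imp_le mult_left_mono order_trans zero_le)
    also have "\<dots> = ennreal (2 * c) * W2sq T d \<mu> \<nu> + Y + ennreal (2 * c) * ennreal (e / (2 * c))"
      by (simp add: distrib_left ac_simps)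
    also have "ennreal (2 * c) * ennreal (e / (2 * c)) = ennreal e"
      using e c by (simp flip: ennreal_mult)
    finally show "X \<le> ennreal (2 * c) * W2sq T d \<mu> \<nu> + Y + ennreal e" .
  qed
  show "(\<integral>\<^sup>+x. \<psi> x \<partial>\<nu>) \<le> ennreal (2 * c) * W2sq T d \<mu> \<nu> + 2 * (\<integral>\<^sup>+x. \<psi> x \<partial>\<mu>)"
    by (rule inf[OF key(1)])
  show "(\<integral>\<^sup>+x. \<psi> x \<partial>\<mu>) \<le> ennreal (2 * c) * W2sq T d \<mu> \<nu> + 2 * (\<integral>\<^sup>+x. \<psi> x \<partial>\<nu>)"
    by (rule inf[OF key(2)])
qed

text \<open>The left side of assumption \<open>C\<close> bounds the entropy of the barycenter
  relative to \<open>weighted m \<psi>\<close>: \<open>\<bar>K\<bar> / 2\<close> pays for the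
  curvature term, \<open>6 c\<close> and \<open>4 Q0\<close> for the \<open>\<psi>\<close>-moment.
  It involves \<open>\<eta>0\<close> but not \<open>\<eta>\<close>, so one budget serves all
  \<open>\<eta>\<close>.\<close>

lemma BCD_competitor:
  assumes m: "sets m = sets (borel_of T)" and BCD: "BCD T d m K"
    and psi: "\<psi> \<in> borel_measurable (borel_of T)" and c: "0 < c"
    and lip: "\<And>x y. \<psi> y \<le> ennreal (2 * c) * (d x y)\<^sup>2 + 2 * \<psi> x"
    and fin: "(\<integral>\<^sup>+x. ennreal (if \<psi> x = \<infinity> then 0 else exp (- enn2real (\<psi> x))) \<partial>m) < \<infinity>"
    and eta0: "\<eta>0 \<in> Prob T" "(\<integral>\<^sup>+x. \<psi> x \<partial>\<eta>0) \<le> ennreal Q0" "0 \<le> Q0"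
    and S: "finite S" "S \<subseteq> Prob T" and w: "\<And>\<mu>. \<mu> \<in> S \<Longrightarrow> 0 \<le> w \<mu>" "(\<Sum>\<mu>\<in>S. w \<mu>) = 1"
    and e: "\<And>\<mu>. \<mu> \<in> S \<Longrightarrow> Ent m \<mu> \<le> ereal (e \<mu>)"
    and g: "\<And>\<mu>. \<mu> \<in> S \<Longrightarrow> W2sq T d \<mu> \<eta>0 = ennreal (g \<mu>)" "\<And>\<mu>. \<mu> \<in> S \<Longrightarrow> 0 \<le> g \<mu>"
    and C: "(\<Sum>\<mu>\<in>S. w \<mu> * (e \<mu> + (\<bar>K\<bar> / 2 + 6 * c) * g \<mu> + 4 * Q0)) \<le> C"
    and eta: "\<eta> \<in> Prob T"
  shows "\<exists>\<rho>\<in>ent_dens (weighted m \<psi>) C. dm (weighted m \<psi>) \<rho> \<in> Prob T \<and>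
    (\<Sum>\<mu>\<in>S. ennreal (w \<mu>) * W2sq T d \<mu> (dm (weighted m \<psi>) \<rho>)) \<le> (\<Sum>\<mu>\<in>S. ennreal (w \<mu>) * W2sq T d \<mu> \<eta>)"
proof -
  define G where "G = (\<Sum>\<mu>\<in>S. w \<mu> * g \<mu>)"
  let ?V = "\<lambda>\<nu>. \<Sum>\<mu>\<in>S. ennreal (w \<mu>) * W2sq T d \<mu> \<nu>"
  have sumen: "(\<Sum>\<mu>\<in>S. ennreal (w \<mu>) * ennreal (f \<mu>)) = ennreal (\<Sum>\<mu>\<in>S. w \<mu> * f \<mu>)"
    if "\<And>\<mu>. \<mu> \<in> S \<Longrightarrow> 0 \<le> f \<mu>" for f
  proof -
    have "(\<Sum>\<mu>\<in>S. ennreal (w \<mu>) * ennreal (f \<mu>)) = (\<Sum>\<mu>\<in>S. ennreal (w \<mu> * f \<mu>))"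
      using w that by (intro sum.cong) (auto simp: ennreal_mult)
    then show ?thesis using w that by (simp add: sum_ennreal)
  qed
  have V0: "?V \<eta>0 = ennreal G"
  proof -
    have "?V \<eta>0 = (\<Sum>\<mu>\<in>S. ennreal (w \<mu>) * ennreal (g \<mu>))" using g(1) by (intro sum.cong) auto
    then show ?thesis using sumen[of g] g(2) by (simp add: G_def)
  qed
  have G0: "0 \<le> G" unfolding G_def using w g by (intro sum_nonneg) auto
  have V0f: "?V \<eta>0 < \<infinity>" unfolding V0 by simp
  obtain \<nu> where nu: "\<nu> \<in> Prob T" and min: "\<And>\<eta>. \<eta> \<in> Prob T \<Longrightarrow> ?V \<nu> \<le> ?V \<eta>"
    and En: "Ent m \<nu> \<le> ereal ((\<Sum>\<mu>\<in>S. w \<mu> * e \<mu>) - K / 2 * enn2real (?V \<nu>))"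
    by (rule BCD_finite[OF BCD S w e eta0(1) V0f]) (assumption | rule that)+
  define r where "r = enn2real (?V \<nu>)"
  have VG: "?V \<nu> \<le> ennreal G" using min[OF eta0(1)] V0 by simp
  then have r: "r \<le> G" "0 \<le> r" unfolding r_def using enn2real_mono[OF VG] G0 by auto
  have Ent: "Ent m \<nu> \<le> ereal ((\<Sum>\<mu>\<in>S. w \<mu> * e \<mu>) + \<bar>K\<bar> / 2 * G)"
  proof -
    have "- K / 2 * r \<le> \<bar>K\<bar> / 2 * G" using r by (intro mult_mono) auto
    then show ?thesis using En unfolding r_def[symmetric] by (elim order_trans) simp
  qed
  \<comment> \<open>Two comparisons: \<open>\<mu>\<close> with \<open>\<eta>0\<close> gives
    \<open>2 c g + 2 Q0\<close>, and \<open>\<nu>\<close> with \<open>\<mu>\<close> doubles this and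
    adds \<open>2 c\<close> times the cost of \<open>\<nu>\<close>, whose mean is at most
    \<open>G\<close>. On average this is \<open>6 c G + 4 Q0\<close>.\<close>
  have q: "(\<integral>\<^sup>+x. \<psi> x \<partial>\<nu>) \<le> ennreal (6 * c * G + 4 * Q0)"
  proof -
    have qm: "(\<integral>\<^sup>+x. \<psi> x \<partial>\<mu>) \<le> ennreal (2 * c * g \<mu> + 2 * Q0)" if m: "\<mu> \<in> S" for \<mu>
    proof -
      have "(\<integral>\<^sup>+x. \<psi> x \<partial>\<mu>) \<le> ennreal (2 * c) * W2sq T d \<mu> \<eta>0 + 2 * (\<integral>\<^sup>+x. \<psi> x \<partial>\<eta>0)"
        using m S eta0 by (intro moment_bound(2)[OF psi c lip]) auto
      also have "\<dots> \<le> ennreal (2 * c) * ennreal (g \<mu>) + 2 * ennreal Q0"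
        unfolding g(1)[OF m] using eta0 by (intro add_left_mono mult_left_mono) auto
      also have "\<dots> = ennreal (2 * c * g \<mu> + 2 * Q0)"
        using c g(2)[OF m] eta0(3) by (simp add: ennreal_mult)
      finally show ?thesis .
    qed
    have "(\<Sum>\<mu>\<in>S. ennreal (w \<mu>)) = 1" using w by (subst sum_ennreal) auto
    then have "(\<integral>\<^sup>+x. \<psi> x \<partial>\<nu>) = (\<Sum>\<mu>\<in>S. ennreal (w \<mu>) * (\<integral>\<^sup>+x. \<psi> x \<partial>\<nu>))"
      by (simp flip: sum_distrib_right)
    also have "\<dots> \<le> (\<Sum>\<mu>\<in>S. ennreal (w \<mu>) * (ennreal (2 * c) * W2sq T d \<mu> \<nu> + 2 * ennreal (2 * c * g \<mu> + 2 * Q0)))"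
    proof (intro sum_mono mult_left_mono)
      fix \<mu> assume m: "\<mu> \<in> S"
      have "(\<integral>\<^sup>+x. \<psi> x \<partial>\<nu>) \<le> ennreal (2 * c) * W2sq T d \<mu> \<nu> + 2 * (\<integral>\<^sup>+x. \<psi> x \<partial>\<mu>)"
        using m S nu by (intro moment_bound(1)[OF psi c lip]) auto
      also have "\<dots> \<le> ennreal (2 * c) * W2sq T d \<mu> \<nu> + 2 * ennreal (2 * c * g \<mu> + 2 * Q0)"
        using qm[OF m] by (intro add_left_mono mult_left_mono) auto
      finally show "(\<integral>\<^sup>+x. \<psi> x \<partial>\<nu>) \<le> ennreal (2 * c) * W2sq T d \<mu> \<nu> + 2 * ennreal (2 * c * g \<mu> + 2 * Q0)" .
    qed simp
    also have "\<dots> = ennreal (2 * c) * ?V \<nu> + 2 * (\<Sum>\<mu>\<in>S. ennreal (w \<mu>) * ennreal (2 * c * g \<mu> + 2 * Q0))"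
      by (simp add: distrib_left sum.distrib sum_distrib_left mult.left_commute)
    also have "(\<Sum>\<mu>\<in>S. ennreal (w \<mu>) * ennreal (2 * c * g \<mu> + 2 * Q0)) = ennreal (\<Sum>\<mu>\<in>S. w \<mu> * (2 * c * g \<mu> + 2 * Q0))"
      using c g eta0 by (intro sumen) auto
    also have "(\<Sum>\<mu>\<in>S. w \<mu> * (2 * c * g \<mu> + 2 * Q0)) = 2 * c * G + 2 * Q0"
      using w(2) by (simp add: G_def distrib_left sum.distrib sum_distrib_left mult.left_commute flip: sum_distrib_right)
    also have "ennreal (2 * c) * ?V \<nu> + 2 * ennreal (2 * c * G + 2 * Q0) \<le> ennreal (2 * c) * ennreal G + 2 * ennreal (2 * c * G + 2 * Q0)"
      using VG by (intro add_right_mono mult_left_mono) auto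
    also have "\<dots> = ennreal (2 * c * G + 2 * (2 * c * G + 2 * Q0))"
      using c G0 eta0(3) by (subst ennreal_plus, simp, simp, subst (3) ennreal_mult) (auto simp: ennreal_mult)
    also have "2 * c * G + 2 * (2 * c * G + 2 * Q0) = 6 * c * G + 4 * Q0" by simp
    finally show ?thesis .
  qed
  have psi': "\<psi> \<in> borel_measurable m" using psi m by (simp cong: measurable_cong_sets)
  have Q: "0 \<le> 6 * c * G + 4 * Q0" using c G0 eta0(3) by simp
  obtain \<rho> where \<rho>: "\<rho> \<in> ent_dens (weighted m \<psi>) (((\<Sum>\<mu>\<in>S. w \<mu> * e \<mu>) + \<bar>K\<bar> / 2 * G) + (6 * c * G + 4 * Q0))" "\<nu> = dm (weighted m \<psi>) \<rho>"
    by (rule Ent_weighted[OF psi' fin Ent Prob_prob_space[OF nu] q Q])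
  have "(\<Sum>\<mu>\<in>S. w \<mu> * (e \<mu> + (\<bar>K\<bar> / 2 + 6 * c) * g \<mu> + 4 * Q0)) = (\<Sum>\<mu>\<in>S. w \<mu> * e \<mu>) + (\<bar>K\<bar> / 2 + 6 * c) * G + 4 * Q0"
    using w(2) by (simp add: G_def distrib_left sum.distrib sum_distrib_left mult.left_commute flip: sum_distrib_right)
  also have "\<dots> = ((\<Sum>\<mu>\<in>S. w \<mu> * e \<mu>) + \<bar>K\<bar> / 2 * G) + (6 * c * G + 4 * Q0)" by (simp add: algebra_simps)
  finally have "\<rho> \<in> ent_dens (weighted m \<psi>) C" using \<rho>(1) C ent_dens_mono by fastforce
  then show ?thesis using \<rho>(2) nu min[OF eta] by (intro bexI[of _ \<rho>]) auto
qed

text \<open>\<open>\<eta>0\<close> is a reference of finite cost and finite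
  \<open>\<psi>\<close>-moment; it fixes the budget \<open>C\<close> once and for all.\<close>

theorem barycenter_of_weighted:
  assumes m: "sets m = sets (borel_of T)" and BCD: "BCD T d m K"
    and psi: "\<psi> \<in> borel_measurable (borel_of T)" and c: "0 < c"
    and lip: "\<And>x y. \<psi> y \<le> ennreal (2 * c) * (d x y)\<^sup>2 + 2 * \<psi> x"
    and fin: "(\<integral>\<^sup>+x. ennreal (if \<psi> x = \<infinity> then 0 else exp (- enn2real (\<psi> x))) \<partial>m) < \<infinity>"
    and Om: "prob_on_P T \<Omega>" and EI: "Ent_integral m \<Omega> < \<infinity>"
    and eta0: "\<eta>0 \<in> Prob T" "(\<integral>\<^sup>+x. \<psi> x \<partial>\<eta>0) < \<infinity>" "(\<integral>\<^sup>+\<mu>. W2sq T d \<mu> \<eta>0 \<partial>\<Omega>) < \<infinity>"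
  shows "\<exists>\<nu>. barycenter T d \<Omega> \<nu>"
proof -
  interpret Om: prob_space \<Omega> using Om by (simp add: prob_on_P_def)
  have sp: "space \<Omega> = Prob T" and se: "sets \<Omega> = sets BP" using Om by (auto simp: prob_on_P_def)
  define F where "F \<eta> = (\<integral>\<^sup>+\<mu>. W2sq T d \<mu> \<eta> \<partial>\<Omega>)" for \<eta>
  have W2m[measurable]: "(\<lambda>\<mu>. W2sq T d \<mu> \<eta>) \<in> borel_measurable \<Omega>" if "\<eta> \<in> Prob T" for \<eta>
    using W2sq_measurable[OF that] se by (simp cong: measurable_cong_sets)
  let ?M = "weighted m \<psi>"
  have psi': "\<psi> \<in> borel_measurable m" using psi m by (simp cong: measurable_cong_sets)
  have Mf: "finite_measure ?M" by (rule finite_measure_weighted[OF psi' fin])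
  interpret M: finite_measure ?M by (rule Mf)
  have Ms: "sets ?M = sets (borel_of T)" using m by simp
  define Q0 where "Q0 = enn2real (\<integral>\<^sup>+x. \<psi> x \<partial>\<eta>0)"
  have Q0: "(\<integral>\<^sup>+x. \<psi> x \<partial>\<eta>0) \<le> ennreal Q0" "0 \<le> Q0" using eta0(2) by (auto simp: Q0_def less_top)
  define g0 where "g0 \<mu> = W2sq T d \<mu> \<eta>0" for \<mu>
  have g0m[measurable]: "g0 \<in> borel_measurable \<Omega>" unfolding g0_def by (rule W2m[OF eta0(1)])
  \<comment> \<open>A measurable minorant of the positive part of the entropy, with the same
    integral, stands in for it.\<close>
  obtain u where um[measurable]: "u \<in> borel_measurable \<Omega>" and ule: "\<And>\<mu>. u \<mu> \<le> e2ennreal (Ent m \<mu>)"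
    and ui: "(\<integral>\<^sup>+\<mu>. u \<mu> \<partial>\<Omega>) = (\<integral>\<^sup>+\<mu>. e2ennreal (Ent m \<mu>) \<partial>\<Omega>)"
    using nn_integral_lower_witness[of \<Omega> "\<lambda>\<mu>. e2ennreal (Ent m \<mu>)"] by blast
  have Pf: "(\<integral>\<^sup>+\<mu>. e2ennreal (Ent m \<mu>) \<partial>\<Omega>) < \<infinity>"
    using EI unfolding Ent_integral_def ereal_integral_def Let_def by (auto split: if_splits simp: less_top)
  define A where "A = \<bar>K\<bar> / 2 + 6 * c"
  have A: "0 < A" using c by (simp add: A_def add_nonneg_pos)
  \<comment> \<open>The budget of \<open>BCD_competitor\<close> with \<open>u \<mu> + 1\<close> as
    the bound on the entropy; this accounts for the added \<open>1\<close>.\<close>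
  define vv where "vv \<mu> = u \<mu> + ennreal A * g0 \<mu> + ennreal (4 * Q0 + 1)" for \<mu>
  have vvm[measurable]: "vv \<in> borel_measurable \<Omega>" unfolding vv_def by measurable
  have "(\<integral>\<^sup>+\<mu>. vv \<mu> \<partial>\<Omega>) = (\<integral>\<^sup>+\<mu>. u \<mu> \<partial>\<Omega>) + ennreal A * F \<eta>0 + ennreal (4 * Q0 + 1)"
    unfolding vv_def F_def g0_def[symmetric] by (simp add: nn_integral_add nn_integral_cmult Om.emeasure_space_1)
  then have vvf: "(\<integral>\<^sup>+\<mu>. vv \<mu> \<partial>\<Omega>) < \<infinity>"
    using Pf ui eta0(3) by (simp add: F_def ennreal_mult_less_top)
  \<comment> \<open>The added \<open>1\<close> makes \<open>C\<close> exceed the mean of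
    \<open>vv\<close> strictly, which provides the Slater point \<open>y0\<close> below.\<close>
  define C where "C = enn2real (\<integral>\<^sup>+\<mu>. vv \<mu> \<partial>\<Omega>) + 1"
  have C: "0 \<le> C" "(\<integral>\<^sup>+\<mu>. vv \<mu> \<partial>\<Omega>) < ennreal C"
  proof -
    show "0 \<le> C" by (simp add: C_def)
    obtain r where "(\<integral>\<^sup>+\<mu>. vv \<mu> \<partial>\<Omega>) = ennreal r" "0 \<le> r"
      using vvf by (cases "\<integral>\<^sup>+\<mu>. vv \<mu> \<partial>\<Omega>") auto
    then show "(\<integral>\<^sup>+\<mu>. vv \<mu> \<partial>\<Omega>) < ennreal C" unfolding C_def by (simp add: ennreal_less_iff)
  qed
  define v where "v \<mu> = enn2real (vv \<mu>)" for \<mu>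
  define E where "E = {\<mu> \<in> Prob T. e2ennreal (Ent m \<mu>) \<le> u \<mu> + 1 \<and> vv \<mu> < \<infinity>}"
  have EP: "E \<subseteq> Prob T" by (auto simp: E_def)
  \<comment> \<open>The entropy is not known to be measurable; \<open>E\<close> only has full outer measure.\<close>
  have outer: "emeasure \<Omega> N = 0" if N: "N \<in> sets \<Omega>" "N \<inter> E = {}" for N
  proof -
    have "AE \<mu> in \<Omega>. vv \<mu> \<noteq> \<infinity>" using vvf by (intro nn_integral_noteq_infinite) auto
    define N1 where "N1 = {\<mu> \<in> space \<Omega>. vv \<mu> < \<infinity>} \<inter> N"
    have N1[measurable]: "N1 \<in> sets \<Omega>" unfolding N1_def using N by measurable
    \<comment> \<open>Where \<open>vv\<close> is finite and \<open>\<mu>\<close> is outside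
      \<open>E\<close>, the entropy exceeds \<open>u\<close> by more than \<open>1\<close>; with
      \<open>N1\<close> of positive measure, \<open>u + indicator N1\<close> would be a minorant of
      larger integral.\<close>
    have "u \<mu> + indicator N1 \<mu> \<le> e2ennreal (Ent m \<mu>)" for \<mu>
      using ule[of \<mu>] N by (auto simp: N1_def E_def indicator_def sp not_le intro: less_imp_le)
    then have "(\<integral>\<^sup>+\<mu>. u \<mu> + indicator N1 \<mu> \<partial>\<Omega>) \<le> (\<integral>\<^sup>+\<mu>. e2ennreal (Ent m \<mu>) \<partial>\<Omega>)" by (intro nn_integral_mono)
    then have "(\<integral>\<^sup>+\<mu>. u \<mu> \<partial>\<Omega>) + emeasure \<Omega> N1 \<le> (\<integral>\<^sup>+\<mu>. u \<mu> \<partial>\<Omega>)" unfolding ui[symmetric] by (simp add: nn_integral_add)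
    then have "emeasure \<Omega> N1 = 0"
      using Pf unfolding ui[symmetric]
      by (metis add.right_neutral ennreal_add_left_cancel_le infinity_ennreal_def le_zero_eq less_irrefl)
    moreover have "emeasure \<Omega> N = emeasure \<Omega> N1"
      using \<open>AE \<mu> in \<Omega>. vv \<mu> \<noteq> \<infinity>\<close> N N1 by (intro emeasure_eq_AE) (auto elim!: eventually_mono simp: N1_def less_top dest: sets.sets_into_space)
    ultimately show ?thesis by simp
  qed
  have C1: "\<exists>\<rho>\<in>ent_dens ?M C. dm ?M \<rho> \<in> Prob T \<and> wsum w (\<lambda>\<mu>. W2sq T d \<mu> (dm ?M \<rho>)) \<le> wsum w (\<lambda>\<mu>. W2sq T d \<mu> \<eta>)"
    if w: "admissible E v C w" and eta: "\<eta> \<in> Prob T" for w \<eta>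
    unfolding wsum_def
  proof (rule BCD_competitor[OF m BCD psi c lip fin eta0(1) Q0 _ _ _ _ _ _ _ _ eta])
    let ?S = "{\<mu>. w \<mu> \<noteq> 0}"
    have S: "finite ?S" "?S \<subseteq> E" "\<And>\<mu>. 0 \<le> w \<mu>" "(\<Sum>\<mu>\<in>?S. w \<mu>) = 1" "(\<Sum>\<mu>\<in>?S. w \<mu> * v \<mu>) \<le> C"
      using w by (auto simp: admissible_def)
    show "finite ?S" "(\<Sum>\<mu>\<in>?S. w \<mu>) = 1" by fact+
    show "?S \<subseteq> Prob T" using S EP by auto
    show "0 \<le> w \<mu>" for \<mu> by fact
    have fin': "u \<mu> < top \<and> g0 \<mu> < top" if "\<mu> \<in> ?S" for \<mu>
      using S(2) that A by (auto simp: E_def vv_def ennreal_mult_less_top)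
    show "Ent m \<mu> \<le> ereal (enn2real (u \<mu>) + 1)" if "\<mu> \<in> ?S" for \<mu>
    proof (rule e2ennreal_le_ennreal)
      have "e2ennreal (Ent m \<mu>) \<le> u \<mu> + 1" using S(2) that by (auto simp: E_def)
      also have "\<dots> = ennreal (enn2real (u \<mu>) + 1)" using fin'[OF that] by simp
      finally show "e2ennreal (Ent m \<mu>) \<le> ennreal (enn2real (u \<mu>) + 1)" .
    qed simp
    show "W2sq T d \<mu> \<eta>0 = ennreal (enn2real (g0 \<mu>))" if "\<mu> \<in> ?S" for \<mu>
      using fin'[OF that] by (simp add: g0_def)
    show "0 \<le> enn2real (g0 \<mu>)" for \<mu> by simp
    have "(\<Sum>\<mu>\<in>?S. w \<mu> * ((enn2real (u \<mu>) + 1) + (\<bar>K\<bar> / 2 + 6 * c) * enn2real (g0 \<mu>) + 4 * Q0)) = (\<Sum>\<mu>\<in>?S. w \<mu> * v \<mu>)"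
    proof (intro sum.cong refl arg_cong2[where f="(*)"])
      fix \<mu> assume m: "\<mu> \<in> ?S"
      obtain a b where ab: "u \<mu> = ennreal a" "0 \<le> a" "g0 \<mu> = ennreal b" "0 \<le> b"
        using fin'[OF m] by (cases "u \<mu>"; cases "g0 \<mu>") auto
      have "vv \<mu> = ennreal (a + A * b + (4 * Q0 + 1))"
        using ab A Q0(2) by (simp add: vv_def ennreal_mult)
      then have "v \<mu> = a + A * b + (4 * Q0 + 1)" using ab A Q0(2) by (simp add: v_def del: ennreal_plus)
      then show "(enn2real (u \<mu>) + 1) + (\<bar>K\<bar> / 2 + 6 * c) * enn2real (g0 \<mu>) + 4 * Q0 = v \<mu>"
        using ab by (simp add: A_def)
    qed
    then show "(\<Sum>\<mu>\<in>?S. w \<mu> * ((enn2real (u \<mu>) + 1) + (\<bar>K\<bar> / 2 + 6 * c) * enn2real (g0 \<mu>) + 4 * Q0)) \<le> C"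
      using S(5) by simp
  qed
  have step: "\<exists>\<rho>\<in>ent_dens ?M C. dm ?M \<rho> \<in> Prob T \<and> F (dm ?M \<rho>) \<le> F \<eta>"
    if eta: "\<eta> \<in> Prob T" and Feta: "F \<eta> < \<infinity>" for \<eta>
  proof -
    define g where "g \<mu> = W2sq T d \<mu> \<eta>" for \<mu>
    have gm[measurable]: "g \<in> borel_measurable \<Omega>" unfolding g_def by (rule W2m[OF eta])
    \<comment> \<open>\<open>uniform_competitor\<close> wants finite values of \<open>g\<close>;
      where \<open>g = \<infinity>\<close> the final pointwise inequality is trivial.\<close>
    define E' where "E' = {\<mu> \<in> E. g \<mu> < \<infinity>}"
    have E'E: "E' \<subseteq> E" by (auto simp: E'_def)
    have admE: "admissible E v C w" if "admissible E' v C w" for w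
      using that E'E by (auto simp: admissible_def)
    obtain y0 where y0: "y0 \<in> E'" "v y0 < C"
    proof -
      define N where "N = {\<mu> \<in> space \<Omega>. g \<mu> < \<infinity> \<and> vv \<mu> < ennreal C}"
      have Ns: "N \<in> sets \<Omega>" unfolding N_def by measurable
      \<comment> \<open>\<open>E\<close> may be nonmeasurable, but it meets every measurable set of
        positive measure, and \<open>vv < C\<close> cannot fail almost everywhere.\<close>
      have "N \<inter> E \<noteq> {}"
      proof
        assume "N \<inter> E = {}"
        then have N0: "emeasure \<Omega> N = 0" by (rule outer[OF Ns])
        have "AE \<mu> in \<Omega>. g \<mu> \<noteq> \<infinity>" using Feta unfolding F_def g_def[symmetric] by (intro nn_integral_noteq_infinite) auto
        moreover have "AE \<mu> in \<Omega>. \<mu> \<notin> N" using N0 Ns by (intro AE_not_in) (simp add: null_sets_def)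
        ultimately have "AE \<mu> in \<Omega>. ennreal C \<le> vv \<mu>"
          using AE_space by eventually_elim (auto simp: N_def less_top not_less)
        then have "(\<integral>\<^sup>+\<mu>. ennreal C \<partial>\<Omega>) \<le> (\<integral>\<^sup>+\<mu>. vv \<mu> \<partial>\<Omega>)" by (rule nn_integral_mono_AE)
        then show False using C(2) by (simp add: Om.emeasure_space_1)
      qed
      then obtain y where y: "y \<in> E" "g y < \<infinity>" "vv y < ennreal C" by (auto simp: N_def)
      have "v y < C"
        using y(3) C(1) unfolding v_def by (cases "vv y") (auto simp: ennreal_less_iff)
      then show thesis using y that by (auto simp: E'_def)
    qed
    obtain \<rho> where \<rho>: "\<rho> \<in> ent_dens ?M C" "dm ?M \<rho> \<in> Prob T"
      and all: "\<And>w. admissible E' v C w \<Longrightarrow> wsum w (\<lambda>\<mu>. W2sq T d \<mu> (dm ?M \<rho>)) \<le> wsum w g"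
    proof (rule uniform_competitor[where M="?M" and E=E' and v=v and C=C and g=g and ?y0.0=y0, OF Mf Ms])
      show "E' \<subseteq> Prob T" using E'E EP by blast
      show "\<exists>\<rho>\<in>ent_dens ?M C. dm ?M \<rho> \<in> Prob T \<and> wsum w (\<lambda>\<mu>. W2sq T d \<mu> (dm ?M \<rho>)) \<le> wsum w g"
        if "admissible E' v C w" for w using C1[OF admE[OF that] eta] unfolding g_def .
      show "g \<mu> < \<infinity>" if "\<mu> \<in> E'" for \<mu> using that by (simp add: E'_def)
      show "y0 \<in> E'" "v y0 < C" by fact+
    qed (rule that; assumption)
    define h where "h \<mu> = W2sq T d \<mu> (dm ?M \<rho>)" for \<mu>
    have hm[measurable]: "h \<in> borel_measurable \<Omega>" unfolding h_def by (rule W2m[OF \<rho>(2)])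
    obtain s where s: "0 \<le> s" "\<And>\<mu>. \<mu> \<in> E' \<Longrightarrow> h \<mu> < \<infinity>"
      "\<And>\<mu>. \<mu> \<in> E' \<Longrightarrow> enn2real (h \<mu>) + s * C \<le> enn2real (g \<mu>) + s * v \<mu>"
    proof (rule lagrange_multiplier[of E' g y0 v C h])
      show "g x < \<infinity>" if "x \<in> E'" for x using that by (simp add: E'_def)
      show "y0 \<in> E'" "v y0 < C" by fact+
      show "ennreal (1-t) * h x + ennreal t * h y \<le> ennreal (1-t) * g x + ennreal t * g y"
        if "x \<in> E'" "y \<in> E'" "0 \<le> t" "t \<le> 1" "(1-t) * v x + t * v y \<le> C" for x y t
        using all[OF admissible_two_points(1)[OF that]] admissible_two_points(2)[OF that, of h] admissible_two_points(2)[OF that, of g]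
        unfolding h_def by simp
    qed (rule that; assumption)
    \<comment> \<open>The set where the pointwise inequality fails is measurable and misses
      \<open>E\<close>, hence is null.\<close>
    define N where "N = {\<mu> \<in> space \<Omega>. \<not> (h \<mu> + ennreal (s * C) \<le> g \<mu> + ennreal s * vv \<mu>)}"
    have Ns: "N \<in> sets \<Omega>" unfolding N_def by measurable
    have "N \<inter> E = {}"
    proof (rule ccontr)
      assume NE: "N \<inter> E \<noteq> {}"
      from NE obtain \<mu> where mu: "\<mu> \<in> N" "\<mu> \<in> E" by (meson disjoint_iff)
      have "g \<mu> < \<infinity>"
      proof (rule ccontr)
        assume "\<not> g \<mu> < \<infinity>"
        then have "g \<mu> = top" using top.not_eq_extremum[of "g \<mu>"] by auto
        then show False using mu(1) unfolding N_def by auto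
      qed
      then have E': "\<mu> \<in> E'" using mu by (simp add: E'_def)
      have "vv \<mu> < \<infinity>" using mu by (simp add: E_def)
      then obtain a b e where ab: "h \<mu> = ennreal a" "0 \<le> a" "g \<mu> = ennreal b" "0 \<le> b" "vv \<mu> = ennreal e" "0 \<le> e"
        using s(2)[OF E'] \<open>g \<mu> < \<infinity>\<close> by (cases "h \<mu>"; cases "g \<mu>"; cases "vv \<mu>") auto
      have "a + s * C \<le> b + s * e" using s(3)[OF E'] ab by (simp add: v_def)
      then have "ennreal (a + s * C) \<le> ennreal (b + s * e)" by (rule ennreal_leI)
      then have "h \<mu> + ennreal (s * C) \<le> g \<mu> + ennreal s * vv \<mu>"
        using ab s(1) C(1) by (simp add: ennreal_mult)
      then show False using mu by (simp add: N_def)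
    qed
    then have "emeasure \<Omega> N = 0" by (rule outer[OF Ns])
    then have "AE \<mu> in \<Omega>. \<mu> \<notin> N" using Ns by (intro AE_not_in) (simp add: null_sets_def)
    then have "AE \<mu> in \<Omega>. h \<mu> + ennreal (s * C) \<le> g \<mu> + ennreal s * vv \<mu>"
      using AE_space by eventually_elim (auto simp: N_def)
    then have "(\<integral>\<^sup>+\<mu>. h \<mu> + ennreal (s * C) \<partial>\<Omega>) \<le> (\<integral>\<^sup>+\<mu>. g \<mu> + ennreal s * vv \<mu> \<partial>\<Omega>)"
      by (rule nn_integral_mono_AE)
    then have "(\<integral>\<^sup>+\<mu>. h \<mu> \<partial>\<Omega>) + ennreal (s * C) \<le> (\<integral>\<^sup>+\<mu>. g \<mu> \<partial>\<Omega>) + ennreal s * (\<integral>\<^sup>+\<mu>. vv \<mu> \<partial>\<Omega>)"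
      by (simp add: nn_integral_add nn_integral_cmult Om.emeasure_space_1)
    also have "\<dots> \<le> (\<integral>\<^sup>+\<mu>. g \<mu> \<partial>\<Omega>) + ennreal s * ennreal C"
      using C(2) by (intro add_left_mono mult_left_mono) auto
    \<comment> \<open>The integral of \<open>vv\<close> is below \<open>C\<close>, so the multiplier
      term is at most \<open>s C\<close> and cancels.\<close>
    finally have "ennreal (s * C) + F (dm ?M \<rho>) \<le> ennreal (s * C) + F \<eta>"
      using s(1) C(1) unfolding F_def g_def h_def by (simp add: ennreal_mult add.commute)
    then have "F (dm ?M \<rho>) \<le> F \<eta>" by (subst (asm) ennreal_add_left_cancel_le) auto
    then show ?thesis using \<rho> by blast
  qed
  define B where "B \<eta> = {\<rho> \<in> ent_dens ?M C. dm ?M \<rho> \<in> Prob T \<and> F (dm ?M \<rho>) \<le> F \<eta>}" for \<eta>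
  define \<A> where "\<A> = {B \<eta> | \<eta>. \<eta> \<in> Prob T \<and> F \<eta> < \<infinity>}"
  have "\<exists>\<rho>. \<forall>X\<in>\<A>. \<rho> \<in> X"
  proof (rule M.ent_dens_directed_Inter)
    show "\<A> \<noteq> {}" using eta0(1,3) unfolding \<A>_def F_def[symmetric] by auto
    show "X \<noteq> {}" if X: "X \<in> \<A>" for X
    proof -
      obtain \<eta> where "X = B \<eta>" "\<eta> \<in> Prob T" "F \<eta> < \<infinity>" using X unfolding \<A>_def by auto
      then show ?thesis using step[of \<eta>] unfolding B_def by auto
    qed
    show "X \<subseteq> ent_dens ?M C" if "X \<in> \<A>" for X using that unfolding \<A>_def B_def by auto
    show "(\<lambda>x. (\<rho> x + \<sigma> x) / 2) \<in> X" if X: "X \<in> \<A>" and rs: "\<rho> \<in> X" "\<sigma> \<in> X" for X \<rho> \<sigma>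
    proof -
      obtain \<eta> where eta: "X = B \<eta>" using X unfolding \<A>_def by auto
      have r: "\<rho> \<in> ent_dens ?M C" "dm ?M \<rho> \<in> Prob T" "F (dm ?M \<rho>) \<le> F \<eta>"
        and s: "\<sigma> \<in> ent_dens ?M C" "dm ?M \<sigma> \<in> Prob T" "F (dm ?M \<sigma>) \<le> F \<eta>" using rs unfolding eta B_def by auto
      have half: "0 \<le> (1/2::real)" "(1/2::real) \<le> 1" by auto
      have eq: "(1 - 1/2) * \<rho> x + 1/2 * \<sigma> x = (\<rho> x + \<sigma> x) / 2" for x by (simp add: field_simps)
      have "F (dm ?M (\<lambda>x. (1 - 1/2) * \<rho> x + 1/2 * \<sigma> x)) \<le> ennreal (1 - 1/2) * F (dm ?M \<rho>) + ennreal (1/2) * F (dm ?M \<sigma>)"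
        unfolding F_def by (rule W2sq_nn_integral_convex[OF Om Mf Ms r(1,2) s(1,2)]) auto
      also have "\<dots> \<le> ennreal (1 - 1/2) * F \<eta> + ennreal (1/2) * F \<eta>"
        using r s by (intro add_mono mult_left_mono) auto
      also have "\<dots> = (ennreal (1 - 1/2) + ennreal (1/2)) * F \<eta>" by (rule distrib_right[symmetric])
      also have "ennreal (1 - 1/2) + ennreal (1/2) = 1" by (subst ennreal_plus[symmetric]) auto
      finally have "F (dm ?M (\<lambda>x. (\<rho> x + \<sigma> x) / 2)) \<le> F \<eta>" by (simp only: eq mult_1)
      moreover have "(\<lambda>x. (\<rho> x + \<sigma> x) / 2) \<in> ent_dens ?M C" "dm ?M (\<lambda>x. (\<rho> x + \<sigma> x) / 2) \<in> Prob T"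
        by (rule dm_mix(1,2)[OF Mf Ms r(1,2) s(1,2) half, unfolded eq])+
      ultimately show ?thesis unfolding eta B_def by blast
    qed
    show "\<sigma> \<in> X" if X: "X \<in> \<A>" and r: "\<And>n::nat. \<rho> n \<in> X" and s: "\<sigma> \<in> ent_dens ?M C"
      and lim: "(\<lambda>n. l1 ?M (\<rho> n) \<sigma>) \<longlonglongrightarrow> 0" for X \<rho> \<sigma>
    proof -
      obtain \<eta> where eta: "X = B \<eta>" using X unfolding \<A>_def by auto
      have rd: "\<And>n. \<rho> n \<in> ent_dens ?M C" "\<And>n. dm ?M (\<rho> n) \<in> Prob T" "\<And>n. F (dm ?M (\<rho> n)) \<le> F \<eta>"
        using r unfolding eta B_def by auto
      have "F (dm ?M \<sigma>) \<le> F \<eta>"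
        using rd(3) unfolding F_def by (intro W2sq_nn_integral_lsc[OF Om Ms rd(1,2) s lim])
      then show ?thesis using s dm_Prob_closed[OF Ms rd(1,2) s lim] unfolding eta B_def by blast
    qed
    show "\<exists>D\<in>\<A>. D \<subseteq> X \<inter> X'" if X: "X \<in> \<A>" "X' \<in> \<A>" for X X'
    proof -
      obtain \<eta> \<eta>' where eta: "X = B \<eta>" "X' = B \<eta>'" using X unfolding \<A>_def by auto
      \<comment> \<open>The sets \<open>B \<eta>\<close> are nested according to
        \<open>F \<eta>\<close>, so the family is a chain.\<close>
      have "B \<eta> \<subseteq> B \<eta>' \<or> B \<eta>' \<subseteq> B \<eta>"
        using linear[of "F \<eta>" "F \<eta>'"] unfolding B_def by (auto intro: order_trans)
      then show ?thesis using X unfolding eta by blast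
    qed
  qed
  then obtain \<rho> where "\<forall>X\<in>\<A>. \<rho> \<in> X" by auto
  then have \<rho>: "\<rho> \<in> B \<eta>" if "\<eta> \<in> Prob T" "F \<eta> < \<infinity>" for \<eta>
    using that unfolding \<A>_def by auto
  have rP: "dm ?M \<rho> \<in> Prob T" using \<rho>[OF eta0(1)] eta0(3) unfolding F_def B_def by auto
  have "F (dm ?M \<rho>) \<le> F \<eta>" if "\<eta> \<in> Prob T" for \<eta>
    using \<rho>[OF that] top.not_eq_extremum[of "F \<eta>"] unfolding B_def by (cases "F \<eta> < \<infinity>") auto
  then have "F (dm ?M \<rho>) \<le> Var T d \<Omega>" unfolding Var_def F_def by (intro INF_greatest)
  moreover have "Var T d \<Omega> \<le> F (dm ?M \<rho>)" unfolding Var_def F_def using rP by (intro INF_lower)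
  ultimately show ?thesis using rP unfolding barycenter_def F_def by (intro exI[of _ "dm ?M \<rho>"]) auto
qed

end

subsection \<open>Exponential volume growth from BCD\<close>

lemma Prob_uniform_measure:
  assumes M: "M \<in> Prob Z" and S: "S \<in> sets (borel_of Z)" "0 < measure M S" and H: "Hausdorff_space Z"
  shows "uniform_measure M S \<in> Prob Z"
proof -
  interpret prob_space M using M by (rule Prob_prob_space)
  have ne: "emeasure M S \<noteq> 0" "emeasure M S \<noteq> \<infinity>" using S by (auto simp: emeasure_eq_measure)
  show ?thesis
  proof (rule ProbI[OF prob_space_uniform_measure[OF ne]])
    show "sets (uniform_measure M S) = sets (borel_of Z)" using Prob_sets[OF M] by simp
    fix B and e :: real assume B: "B \<in> sets (borel_of Z)" and e: "0 < e"
    have BM: "B \<in> sets M" using B Prob_sets[OF M] by simp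
    have "0 < e * measure M S" using e S by simp
    moreover have "S \<inter> B \<in> sets (borel_of Z)" using S B by auto
    ultimately obtain K where K: "compactin Z K" "K \<subseteq> S \<inter> B" "measure M (S \<inter> B) \<le> measure M K + e * measure M S"
      using Prob_approx[OF M] by metis
    have Ks: "K \<in> sets M" using compactin_borel_of[OF H K(1)] Prob_sets[OF M] by simp
    have SK: "S \<inter> K = K" using K by auto
    have "measure (uniform_measure M S) B \<le> measure (uniform_measure M S) K + e"
      using K(3) S(2) by (simp add: measure_uniform_measure[OF ne BM] measure_uniform_measure[OF ne Ks] SK field_simps)
    then show "\<exists>K. compactin Z K \<and> K \<subseteq> B \<and> measure (uniform_measure M S) B \<le> measure (uniform_measure M S) K + e"
      using K by blast
  qed
qed

text \<open>Jensen's inequality: no measure carried by \<open>U\<close> has less entropy than the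
  uniform density \<open>1 / M\<close>. It is obtained by integrating the tangent of
  \<open>x ln x\<close> at \<open>1 / M\<close> over \<open>U\<close>.\<close>

lemma Ent_lower_bound:
  assumes nu: "prob_space \<nu>" and sets: "sets \<nu> = sets m" and U: "U \<in> sets m" "emeasure m U = ennreal M" "0 < M"
    and conc: "emeasure \<nu> (space m - U) = 0" and E: "Ent m \<nu> \<le> ereal e"
  shows "- ln M \<le> e"
proof -
  have "Ent m \<nu> < \<infinity>" using E by (rule le_less_trans) simp
  then obtain r where rm[measurable]: "r \<in> borel_measurable m" and r0: "\<And>x. 0 \<le> r x" and nue: "\<nu> = dm m r"
    and r1: "(\<integral>\<^sup>+x. ennreal (r x) \<partial>m) = 1" and Er: "Ent m \<nu> = ereal_integral m (\<lambda>x. ereal (r x * ln (r x)))"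
    using Ent_lessD[OF _ nu] by metis
  note [measurable] = U(1)
  have ir: "integrable m r" using r1 r0 by (intro integrableI_nonneg) auto
  have ir1: "(\<integral>x. r x \<partial>m) = 1"
    using integral_eq_nn_integral[OF rm] r0 r1 by simp
  have "(\<integral>\<^sup>+x. ennreal (r x) * indicator (space m - U) x \<partial>m) = 0"
    using conc unfolding nue by (subst (asm) emeasure_density) auto
  then have "AE x in m. ennreal (r x) * indicator (space m - U) x = 0"
    by (subst (asm) nn_integral_0_iff_AE) auto
  then have off: "AE x in m. x \<notin> U \<longrightarrow> r x = 0"
    using AE_space by eventually_elim (use r0 in \<open>auto simp: indicator_def ennreal_eq_0_iff antisym split: if_splits\<close>)
  define s where "s = 1 / M"
  have s: "0 < s" using U by (simp add: s_def)
  define g where "g x = (r x * ln s + r x) - s * indicator U x" for x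
  have iu: "integrable m (indicat_real U)" using U by (intro integrable_real_indicator) auto
  have ig: "integrable m g" unfolding g_def using ir iu by auto
  have le: "AE x in m. g x \<le> r x * ln (r x)"
    using off
  proof eventually_elim
    case (elim x)
    show ?case
    proof (cases "x \<in> U")
      case True then show ?thesis using xlnx_tangent[OF r0 s, of x] by (simp add: g_def)
    next
      case False then show ?thesis using elim by (simp add: g_def)
    qed
  qed
  have i: "integrable m (\<lambda>x. r x * ln (r x))"
  proof (rule ereal_integral_bounded_below)
    show "integrable m (\<lambda>x. - g x)" using ig by simp
    show "AE x in m. - (- g x) \<le> r x * ln (r x)" using le by simp
    show "ereal_integral m (\<lambda>x. ereal (r x * ln (r x))) < \<infinity>" using Er \<open>Ent m \<nu> < \<infinity>\<close> by simp
  qed measurable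
  have "(\<integral>x. g x \<partial>m) = ln s + 1 - s * M"
    unfolding g_def using ir iu ir1 U by (simp add: measure_def)
  also have "\<dots> = - ln M" using U by (simp add: s_def ln_div)
  finally have "- ln M = (\<integral>x. g x \<partial>m)" by simp
  also have "\<dots> \<le> (\<integral>x. r x * ln (r x) \<partial>m)" by (rule integral_mono_AE[OF ig i le])
  also have "\<dots> \<le> e" using E Er ereal_integral_integrable[OF i] by simp
  finally show ?thesis .
qed

context emt
begin

lemma UNIV_borel [simp]: "UNIV \<in> sets (borel_of T)"
  by (metis sets.top space_borel_T(1))

lemma Times_borel:
  "A \<in> sets (borel_of T) \<Longrightarrow> B \<in> sets (borel_of T) \<Longrightarrow> A \<times> B \<in> sets (borel_of TT)"
  by (auto intro!: subsetD[OF pair_sets_subset] pair_measureI)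

lemma uniform_compact:
  assumes m: "radon_measure T m" and A: "compactin T A" "emeasure m A = ennreal a" "0 < a"
  obtains \<mu> where "\<mu> \<in> Prob T" "measure \<mu> A = 1" "Ent m \<mu> = ereal (- ln a)"
proof -
  have sm: "sets m = sets (borel_of T)" using m by (simp add: radon_measure_def)
  have spm: "space m = UNIV" using sets_eq_imp_space_eq[OF sm] by (simp add: top)
  have As[measurable]: "A \<in> sets m" using compactin_borel_of[OF H A(1)] sm by simp
  define \<rho> where "\<rho> x = indicator A x / a" for x
  have rm[measurable]: "\<rho> \<in> borel_measurable m" unfolding \<rho>_def by measurable
  have r0: "0 \<le> \<rho> x" for x using A by (simp add: \<rho>_def)
  have em: "emeasure (dm m \<rho>) B = ennreal (1 / a) * emeasure m (A \<inter> B)" if B: "B \<in> sets m" for B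
  proof -
    have "emeasure (dm m \<rho>) B = (\<integral>\<^sup>+x. ennreal (1 / a) * indicator (A \<inter> B) x \<partial>m)"
      using B by (subst emeasure_density) (auto intro!: nn_integral_cong simp: \<rho>_def indicator_def)
    also have "\<dots> = ennreal (1 / a) * emeasure m (A \<inter> B)"
      using B by (intro nn_integral_cmult_indicator) auto
    finally show ?thesis .
  qed
  have one: "ennreal (1 / a) * ennreal a = 1" using A by (simp flip: ennreal_mult)
  have p: "prob_space (dm m \<rho>)"
    by (rule prob_spaceI) (simp add: em spm A one sets.top[of m, unfolded spm])
  then interpret p: prob_space "dm m \<rho>" .
  have meas: "measure (dm m \<rho>) B = 1 / a * measure m (A \<inter> B)" if "B \<in> sets m" for B
    using em[OF that] A by (simp add: measure_def enn2real_mult)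
  have AP: "dm m \<rho> \<in> Prob T"
  proof (rule ProbI[OF p])
    fix B and e :: real assume B: "B \<in> sets (borel_of T)" and e: "0 < e"
    have "emeasure m (A \<inter> B) \<le> emeasure m A" by (intro emeasure_mono) auto
    then have fin: "emeasure m (A \<inter> B) < \<infinity>" by (rule le_less_trans) (simp add: A(2))
    have AB: "A \<inter> B \<in> sets m" by (rule sets.Int[OF As B[folded sm]])
    have ea: "0 < e * a" using e A by simp
    obtain K where K: "compactin T K" "K \<subseteq> A \<inter> B" "emeasure m (A \<inter> B) \<le> emeasure m K + ennreal (e * a)"
      using radon_measure_approx[OF m AB fin ea] by metis
    have Ks: "K \<in> sets m" using compactin_borel_of[OF H K(1)] sm by simp
    have AK: "A \<inter> K = K" using K by auto
    have "emeasure m K < \<infinity>" using emeasure_mono[OF K(2) AB] fin by (rule le_less_trans)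
    then have mAB: "measure m (A \<inter> B) \<le> measure m K + e * a"
      using K(3) fin ea by (cases "emeasure m (A \<inter> B)"; cases "emeasure m K") (auto simp: measure_def simp flip: ennreal_plus)
    have "measure (dm m \<rho>) B \<le> measure (dm m \<rho>) K + e"
    proof -
      have "B \<in> sets m" using B[folded sm] .
      note eqs = meas[OF this] meas[OF Ks, unfolded AK]
      have "1 / a * measure m (A \<inter> B) \<le> 1 / a * (measure m K + e * a)"
        using mAB A(3) by (intro mult_left_mono) auto
      then show ?thesis unfolding eqs using A(3) by (simp add: distrib_left)
    qed
    then show "\<exists>K. compactin T K \<and> K \<subseteq> B \<and> measure (dm m \<rho>) B \<le> measure (dm m \<rho>) K + e"
      using K by blast
  qed (simp add: sm)
  have "measure (dm m \<rho>) A = 1" using meas[OF As] A by (simp add: measure_def)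
  moreover have "Ent m (dm m \<rho>) = ereal (- ln a)"
  proof -
    have eq: "(\<lambda>x. \<rho> x * ln (\<rho> x)) = (\<lambda>x. indicat_real A x * (- ln a / a))"
      using A by (auto simp: \<rho>_def indicator_def ln_div)
    have i: "integrable m (\<lambda>x. \<rho> x * ln (\<rho> x))"
      unfolding eq using A by (intro integrable_mult_left integrable_real_indicator) auto
    have "(\<integral>x. \<rho> x * ln (\<rho> x) \<partial>m) = - ln a" unfolding eq using A by (simp add: measure_def)
    moreover have "(\<integral>\<^sup>+x. ennreal (\<rho> x) \<partial>m) \<noteq> \<infinity>"
      using p.emeasure_space_1 by (simp add: emeasure_density cong: nn_integral_cong)
    ultimately show ?thesis using Ent_density[OF rm r0] ereal_integral_integrable[OF i] by simp
  qed
  ultimately show ?thesis using that AP by blast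
qed

lemma W2sq_refl:
  assumes mu: "\<mu> \<in> Prob T" shows "W2sq T d \<mu> \<mu> = 0"
    and diagonal_coupling: "\<exists>\<gamma>\<in>couplings T \<mu> \<mu>. (\<integral>\<^sup>+z. (d (fst z) (snd z))\<^sup>2 \<partial>\<gamma>) = 0"
proof -
  have cm: "continuous_map T TT (\<lambda>x. (x, x))" by (intro continuous_map_pairedI) auto
  let ?g = "distr \<mu> (borel_of TT) (\<lambda>x. (x, x))"
  have gP: "?g \<in> Prob TT" by (rule Prob_distr[OF mu cm HTT])
  have mm: "(\<lambda>x. (x, x)) \<in> \<mu> \<rightarrow>\<^sub>M borel_of TT"
    using continuous_map_measurable_borel_of[OF cm] Prob_sets[OF mu] by (simp cong: measurable_cong_sets)
  have f: "fst \<in> borel_of TT \<rightarrow>\<^sub>M borel_of T" "snd \<in> borel_of TT \<rightarrow>\<^sub>M borel_of T"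
    by (auto intro: continuous_map_measurable_borel_of continuous_map_fst continuous_map_snd)
  have id: "distr \<mu> (borel_of T) (\<lambda>x. x) = \<mu>"
    using Prob_sets[OF mu] by (intro distr_id2) simp
  have "distr ?g (borel_of T) fst = \<mu>" "distr ?g (borel_of T) snd = \<mu>"
    using distr_distr[OF f(1) mm] distr_distr[OF f(2) mm] id by (simp_all add: o_def)
  then have gc: "?g \<in> couplings T \<mu> \<mu>" by (rule couplingsI_distr[OF gP])
  have "(\<integral>\<^sup>+z. (d (fst z) (snd z))\<^sup>2 \<partial>?g) = 0"
    by (subst nn_integral_distr[OF mm]) (use d2_measurable in auto)
  note zero = this
  show "\<exists>\<gamma>\<in>couplings T \<mu> \<mu>. (\<integral>\<^sup>+z. (d (fst z) (snd z))\<^sup>2 \<partial>\<gamma>) = 0" using gc zero by (rule bexI[rotated])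
  have "W2sq T d \<mu> \<mu> \<le> 0" unfolding W2sq_def using zero by (intro INF_lower2[OF gc]) simp
  then show "W2sq T d \<mu> \<mu> = 0" by simp
qed

lemma coupling_cost_bounded:
  assumes g: "\<gamma> \<in> couplings T \<mu> \<nu>" and mu: "\<mu> \<in> Prob T" and nu: "\<nu> \<in> Prob T"
    and A: "A \<in> sets (borel_of T)" "measure \<mu> A = 1" and B: "B \<in> sets (borel_of T)" "measure \<nu> B = 1"
    and R: "\<And>x y. x \<in> A \<Longrightarrow> y \<in> B \<Longrightarrow> d x y \<le> ennreal R"
  shows "(\<integral>\<^sup>+z. (d (fst z) (snd z))\<^sup>2 \<partial>\<gamma>) \<le> (ennreal R)\<^sup>2"
proof -
  have gP: "\<gamma> \<in> Prob TT" using g by (simp add: couplings_def)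
  interpret g: prob_space \<gamma> using gP by (rule Prob_prob_space)
  have sg: "sets \<gamma> = sets (borel_of TT)" by (rule Prob_sets[OF gP])
  have "AE z in \<gamma>. z \<in> A \<times> UNIV" "AE z in \<gamma>. z \<in> UNIV \<times> B"
    using coupling_marginals[OF g A(1)] coupling_marginals[OF g B(1)] A B Times_borel sg
    by (auto intro!: g.AE_prob_1 simp: measure_def)
  then have "AE z in \<gamma>. (d (fst z) (snd z))\<^sup>2 \<le> (ennreal R)\<^sup>2"
    by eventually_elim (auto intro!: power_mono R)
  then have "(\<integral>\<^sup>+z. (d (fst z) (snd z))\<^sup>2 \<partial>\<gamma>) \<le> (\<integral>\<^sup>+z. (ennreal R)\<^sup>2 \<partial>\<gamma>)" by (rule nn_integral_mono_AE)
  then show ?thesis by (simp add: g.emeasure_space_1)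
qed

text \<open>Surgery on the plan \<open>\<gamma>\<close>: pairs ending in \<open>U\<close> are kept,
  and the sources of the others, with law \<open>\<alpha>\<close> and mass \<open>b\<close>, are
  sent by \<open>\<sigma>\<close> to \<open>\<beta>\<close> instead.\<close>

lemma reroute:
  assumes g: "\<gamma> \<in> couplings T \<mu> \<nu>" and mu: "\<mu> \<in> Prob T" and nu: "\<nu> \<in> Prob T"
    and U: "U \<in> sets (borel_of T)" and b: "b = measure \<nu> (UNIV - U)" "0 < b"
    and al: "\<alpha> = distr (uniform_measure \<gamma> (UNIV \<times> (UNIV - U))) (borel_of T) fst"
    and sg: "\<sigma> \<in> couplings T \<alpha> \<beta>"
    and n': "\<And>A. A \<in> sets (borel_of T) \<Longrightarrow> emeasure \<nu>' A = emeasure \<nu> (U \<inter> A) + ennreal b * emeasure \<beta> A"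
  shows "W2sq T d \<mu> \<nu>' \<le> (\<integral>\<^sup>+z. (d (fst z) (snd z))\<^sup>2 * indicator (UNIV \<times> U) z \<partial>\<gamma>)
     + ennreal b * (\<integral>\<^sup>+z. (d (fst z) (snd z))\<^sup>2 \<partial>\<sigma>)"
proof -
  let ?c = "\<lambda>z. (d (fst z) (snd z))\<^sup>2"
  have gP: "\<gamma> \<in> Prob TT" and sP: "\<sigma> \<in> Prob TT" using g sg by (auto simp: couplings_def)
  have sets[simp]: "sets \<gamma> = sets (borel_of TT)" "sets \<sigma> = sets (borel_of TT)"
    using Prob_sets[OF gP] Prob_sets[OF sP] by auto
  have sp: "space \<gamma> = UNIV" using Prob_space[OF gP] by (simp add: top)
  interpret g: prob_space \<gamma> using gP by (rule Prob_prob_space)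
  interpret s: prob_space \<sigma> using sP by (rule Prob_prob_space)
  have cU: "UNIV - U \<in> sets (borel_of T)" using U by (metis sets.compl_sets space_borel_T(1))
  have Us: "UNIV \<times> U \<in> sets \<gamma>" "UNIV \<times> (UNIV - U) \<in> sets \<gamma>" using Times_borel[OF _ U] Times_borel[OF _ cU] by simp_all
  have bS: "measure \<gamma> (UNIV \<times> (UNIV - U)) = b" using coupling_marginals(2)[OF g cU] b by simp
  have alA: "ennreal b * emeasure \<alpha> A = emeasure \<gamma> (A \<times> (UNIV - U))" if A: "A \<in> sets (borel_of T)" for A
  proof -
    have "fst \<in> uniform_measure \<gamma> (UNIV \<times> (UNIV - U)) \<rightarrow>\<^sub>M borel_of T"
      using coupling_distr(3)[OF g mu nu] by (simp cong: measurable_cong_sets)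
    then have "emeasure \<alpha> A = emeasure (uniform_measure \<gamma> (UNIV \<times> (UNIV - U))) (A \<times> UNIV)"
      unfolding al using A by (subst emeasure_distr) (auto simp: sp intro!: arg_cong2[where f=emeasure])
    also have "\<dots> = emeasure \<gamma> ((UNIV \<times> (UNIV - U)) \<inter> (A \<times> UNIV)) / emeasure \<gamma> (UNIV \<times> (UNIV - U))"
      using Us Times_borel[OF A UNIV_borel] by (intro emeasure_uniform_measure) auto
    also have "(UNIV \<times> (UNIV - U)) \<inter> (A \<times> UNIV) = A \<times> (UNIV - U)" by auto
    finally have "emeasure \<alpha> A = emeasure \<gamma> (A \<times> (UNIV - U)) / ennreal b" using bS by (simp add: g.emeasure_eq_measure)
    then show ?thesis using b(2)
      by (simp add: g.emeasure_eq_measure divide_ennreal flip: ennreal_mult)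
  qed
  define N where "N = case_bool (density \<gamma> (indicator (UNIV \<times> U))) \<sigma>"
  define w where "w = case_bool 1 b"
  define \<gamma>' where "\<gamma>' = lincomb (borel_of TT) UNIV (\<lambda>i. ennreal (w i)) N"
  have Ns: "sets (N i) = sets (borel_of TT)" for i by (cases i) (auto simp: N_def)
  have em: "emeasure \<gamma>' A = emeasure \<gamma> ((UNIV \<times> U) \<inter> A) + ennreal b * emeasure \<sigma> A" if "A \<in> sets (borel_of TT)" for A
    unfolding \<gamma>'_def using that Us by (subst emeasure_lincomb[OF Ns]) (auto simp: UNIV_bool N_def w_def emeasure_restricted)
  have m1: "emeasure \<gamma>' (A \<times> UNIV) = emeasure \<mu> A" "emeasure \<gamma>' (UNIV \<times> A) = emeasure \<nu>' A" if A: "A \<in> sets (borel_of T)" for A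
  proof -
    have "emeasure \<gamma>' (A \<times> UNIV) = emeasure \<gamma> (A \<times> U) + ennreal b * emeasure \<sigma> (A \<times> UNIV)"
      using em[OF Times_borel[OF A UNIV_borel]] by (simp add: Times_Int_Times)
    also have "emeasure \<sigma> (A \<times> UNIV) = emeasure \<alpha> A" using sg A by (simp add: couplings_def)
    also have "emeasure \<gamma> (A \<times> U) + ennreal b * emeasure \<alpha> A = emeasure \<gamma> (A \<times> U \<union> A \<times> (UNIV - U))"
      unfolding alA[OF A] using A U cU by (intro plus_emeasure) (auto intro!: Times_borel)
    also have "A \<times> U \<union> A \<times> (UNIV - U) = A \<times> UNIV" by auto
    also have "emeasure \<gamma> (A \<times> UNIV) = emeasure \<mu> A" using g A by (simp add: couplings_def)
    finally show "emeasure \<gamma>' (A \<times> UNIV) = emeasure \<mu> A" .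
    have "emeasure \<gamma>' (UNIV \<times> A) = emeasure \<gamma> (UNIV \<times> (U \<inter> A)) + ennreal b * emeasure \<sigma> (UNIV \<times> A)"
      using em[OF Times_borel[OF UNIV_borel A]] by (simp add: Times_Int_Times)
    also have "\<dots> = emeasure \<nu> (U \<inter> A) + ennreal b * emeasure \<beta> A"
      using g sg A U by (simp add: couplings_def sets.Int)
    finally show "emeasure \<gamma>' (UNIV \<times> A) = emeasure \<nu>' A" using n'[OF A] by simp
  qed
  have "radon_measure TT \<gamma>'" unfolding \<gamma>'_def
  proof (intro radon_lincomb HTT)
    fix i :: bool
    show "finite_measure (N i) \<and> radon_measure TT (N i)"
      using radon_restrict[OF g.finite_measure_axioms _ Us(1) HTT] gP sP s.finite_measure_axioms
      by (cases i) (auto simp: N_def Prob_def)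
    show "0 \<le> w i" using b by (cases i) (auto simp: w_def)
  qed simp
  moreover have "prob_space \<gamma>'"
  proof (rule prob_spaceI)
    show "emeasure \<gamma>' (space \<gamma>') = 1"
      using m1(1)[OF UNIV_borel] prob_space.emeasure_space_1[OF Prob_prob_space[OF mu]]
      by (simp add: \<gamma>'_def top Prob_space[OF mu])
  qed
  ultimately have "\<gamma>' \<in> couplings T \<mu> \<nu>'" using m1 by (simp add: couplings_def Prob_def)
  then have "W2sq T d \<mu> \<nu>' \<le> (\<integral>\<^sup>+z. ?c z \<partial>\<gamma>')" unfolding W2sq_def by (rule INF_lower)
  also have "\<dots> = (\<integral>\<^sup>+z. ?c z \<partial>density \<gamma> (indicator (UNIV \<times> U))) + ennreal b * (\<integral>\<^sup>+z. ?c z \<partial>\<sigma>)"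
    unfolding \<gamma>'_def by (subst nn_integral_lincomb[OF Ns d2_measurable]) (auto simp: UNIV_bool N_def w_def)
  also have "(\<integral>\<^sup>+z. ?c z \<partial>density \<gamma> (indicator (UNIV \<times> U))) = (\<integral>\<^sup>+z. ?c z * indicator (UNIV \<times> U) z \<partial>\<gamma>)"
    using Us d2_measurable by (subst nn_integral_density) (auto simp: mult.commute cong: measurable_cong_sets)
  finally show ?thesis .
qed

text \<open>A two-point barycenter stays near its heavy end: mass outside \<open>U\<close> could be moved back onto \<open>A\<close>.\<close>

lemma barycenter_localized:
  assumes mu0: "\<mu>0 \<in> Prob T" and mu1: "\<mu>1 \<in> Prob T" and nu: "\<nu> \<in> Prob T"
    and A: "A \<in> sets (borel_of T)" "measure \<mu>0 A = 1" and B: "B \<in> sets (borel_of T)" "measure \<mu>1 B = 1"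
    and U: "U \<in> sets (borel_of T)" and eps: "0 < \<epsilon>" "\<And>x y. x \<in> A \<Longrightarrow> y \<notin> U \<Longrightarrow> ennreal \<epsilon> \<le> d x y"
    and R: "0 \<le> R" "\<And>x y. x \<in> A \<Longrightarrow> y \<in> B \<Longrightarrow> d x y \<le> ennreal R"
    and t: "0 < t" "t < 1" "t * R\<^sup>2 < (1-t) * \<epsilon>\<^sup>2"
    and min: "\<And>\<eta>. \<eta> \<in> Prob T \<Longrightarrow> ennreal (1-t) * W2sq T d \<mu>0 \<nu> + ennreal t * W2sq T d \<mu>1 \<nu>
        \<le> ennreal (1-t) * W2sq T d \<mu>0 \<eta> + ennreal t * W2sq T d \<mu>1 \<eta>"
    and fin: "ennreal (1-t) * W2sq T d \<mu>0 \<nu> + ennreal t * W2sq T d \<mu>1 \<nu> < \<infinity>"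
  shows "measure \<nu> (UNIV - U) = 0"
proof (rule ccontr)
  let ?c = "\<lambda>z. (d (fst z) (snd z))\<^sup>2"
  define b where "b = measure \<nu> (UNIV - U)"
  assume "measure \<nu> (UNIV - U) \<noteq> 0"
  then have b: "0 < b" by (simp add: b_def zero_less_measure_iff)
  interpret n: prob_space \<nu> using nu by (rule Prob_prob_space)
  \<comment> \<open>Net gain of the surgery: the heavy end saves at least
    \<open>\<epsilon>\<^sup>2\<close> per unit of the mass \<open>b\<close>, the light end loses at
    most \<open>R\<^sup>2\<close>. Near-optimal plans may waste half of it.\<close>
  define \<kappa> where "\<kappa> = b * ((1-t) * \<epsilon>\<^sup>2 - t * R\<^sup>2)"
  have kap: "0 < \<kappa>" unfolding \<kappa>_def using b t by simp
  have cU: "UNIV - U \<in> sets (borel_of T)" using U by (metis sets.compl_sets space_borel_T(1))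
  have "W2sq T d \<mu>0 \<nu> < top" "W2sq T d \<mu>1 \<nu> < top" using fin t by (auto simp: ennreal_mult_less_top)
  then obtain w0 w1 where w: "W2sq T d \<mu>0 \<nu> = ennreal w0" "0 \<le> w0" "W2sq T d \<mu>1 \<nu> = ennreal w1" "0 \<le> w1"
    by (cases "W2sq T d \<mu>0 \<nu>"; cases "W2sq T d \<mu>1 \<nu>") auto
  have "W2sq T d \<mu>0 \<nu> < W2sq T d \<mu>0 \<nu> + ennreal (\<kappa>/2)" "W2sq T d \<mu>1 \<nu> < W2sq T d \<mu>1 \<nu> + ennreal (\<kappa>/2)"
    using kap w by (auto intro!: ennreal_less_add)
  then have "W2sq T d \<mu>0 \<nu> < ennreal (w0 + \<kappa>/2)" "W2sq T d \<mu>1 \<nu> < ennreal (w1 + \<kappa>/2)"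
    using w kap by auto
  note lt = this
  obtain \<gamma>0 where g0: "\<gamma>0 \<in> couplings T \<mu>0 \<nu>" "(\<integral>\<^sup>+z. ?c z \<partial>\<gamma>0) < ennreal (w0 + \<kappa>/2)"
    using lt(1) unfolding W2sq_def INF_less_iff by auto
  obtain \<gamma>1 where g1: "\<gamma>1 \<in> couplings T \<mu>1 \<nu>" "(\<integral>\<^sup>+z. ?c z \<partial>\<gamma>1) < ennreal (w1 + \<kappa>/2)"
    using lt(2) unfolding W2sq_def INF_less_iff by auto
  define S where "S = (UNIV :: 'a set) \<times> (UNIV - U)"
  have Ss: "S \<in> sets (borel_of TT)" unfolding S_def using cU by (intro Times_borel) auto
  have P: "\<gamma>0 \<in> Prob TT" "\<gamma>1 \<in> Prob TT" using g0 g1 by (auto simp: couplings_def)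
  interpret g0: prob_space \<gamma>0 using P by (intro Prob_prob_space)
  interpret g1: prob_space \<gamma>1 using P by (intro Prob_prob_space)
  have gS: "measure \<gamma>0 S = b" "measure \<gamma>1 S = b"
    using coupling_marginals(2)[OF g0(1) cU] coupling_marginals(2)[OF g1(1) cU] by (auto simp: S_def b_def)
  define \<alpha>0 where "\<alpha>0 = distr (uniform_measure \<gamma>0 S) (borel_of T) fst"
  define \<alpha>1 where "\<alpha>1 = distr (uniform_measure \<gamma>1 S) (borel_of T) fst"
  have a0: "\<alpha>0 \<in> Prob T" and a1: "\<alpha>1 \<in> Prob T"
    unfolding \<alpha>0_def \<alpha>1_def using P Ss gS b
    by (auto intro!: Prob_distr[OF _ continuous_map_fst H] Prob_uniform_measure[OF _ _ _ HTT])
  have marg1: "measure (distr (uniform_measure \<gamma> S) (borel_of T) fst) X = 1"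
    if g: "\<gamma> \<in> couplings T \<mu> \<nu>" and mu: "\<mu> \<in> Prob T" and X: "X \<in> sets (borel_of T)" "measure \<mu> X = 1" and gS: "measure \<gamma> S = b" for \<gamma> \<mu> X
  proof -
    have gP: "\<gamma> \<in> Prob TT" using g by (auto simp: couplings_def)
    interpret g: prob_space \<gamma> using gP by (intro Prob_prob_space)
    have sg: "sets \<gamma> = sets (borel_of TT)" "space \<gamma> = UNIV" using Prob_sets[OF gP] Prob_space[OF gP] by (auto simp: top)
    have ne: "emeasure \<gamma> S \<noteq> 0" "emeasure \<gamma> S \<noteq> \<infinity>" using gS b by (auto simp: g.emeasure_eq_measure)
    have fm: "fst \<in> uniform_measure \<gamma> S \<rightarrow>\<^sub>M borel_of T"
      using coupling_distr(3)[OF g mu nu] by (simp cong: measurable_cong_sets)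
    have XT: "X \<times> UNIV \<in> sets \<gamma>" using Times_borel[OF X(1) UNIV_borel] sg by simp
    have "fst -` X \<inter> space (uniform_measure \<gamma> S) = X \<times> UNIV" by (auto simp: sg)
    then have "measure (distr (uniform_measure \<gamma> S) (borel_of T) fst) X = measure (uniform_measure \<gamma> S) (X \<times> UNIV)"
      using measure_distr[OF fm X(1)] by simp
    also have "\<dots> = measure \<gamma> (S \<inter> (X \<times> UNIV)) / measure \<gamma> S" by (rule measure_uniform_measure[OF ne XT])
    also have "measure \<gamma> (S \<inter> (X \<times> UNIV)) = measure \<gamma> S"
    proof (rule g.finite_measure_eq_AE)
      have "AE z in \<gamma>. z \<in> X \<times> UNIV"
        using coupling_marginals(1)[OF g X(1)] X(2) XT by (intro g.AE_prob_1) auto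
      then show "AE z in \<gamma>. z \<in> S \<inter> (X \<times> UNIV) \<longleftrightarrow> z \<in> S" by eventually_elim auto
    qed (use Ss XT sg in auto)
    finally show ?thesis using gS b by simp
  qed
  have a0A: "measure \<alpha>0 A = 1" unfolding \<alpha>0_def by (rule marg1[OF g0(1) mu0 A gS(1)])
  have a1B: "measure \<alpha>1 B = 1" unfolding \<alpha>1_def by (rule marg1[OF g1(1) mu1 B gS(2)])
  \<comment> \<open>The new target is \<open>\<alpha>0\<close> for both ends: mass of the heavy end
    stays where it was, at no cost, and \<open>\<alpha>0\<close> is carried by \<open>A\<close>,
    within \<open>R\<close> of \<open>B\<close>.\<close>
  obtain \<sigma>0 where s0: "\<sigma>0 \<in> couplings T \<alpha>0 \<alpha>0" "(\<integral>\<^sup>+z. ?c z \<partial>\<sigma>0) = 0" using diagonal_coupling[OF a0] by blast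
  obtain \<sigma>1 where s1: "\<sigma>1 \<in> couplings T \<alpha>1 \<alpha>0" using product_coupling[OF a1 a0] by blast
  have s1c: "(\<integral>\<^sup>+z. ?c z \<partial>\<sigma>1) \<le> (ennreal R)\<^sup>2"
    using R(2) by (intro coupling_cost_bounded[OF s1 a1 a0 B(1) a1B A(1) a0A]) (metis d_sym)
  define \<nu>' where "\<nu>' = lincomb (borel_of T) UNIV (\<lambda>i. ennreal (case_bool 1 b i)) (case_bool (density \<nu> (indicator U)) \<alpha>0)"
  have sn: "sets (case_bool (density \<nu> (indicator U)) \<alpha>0 i) = sets (borel_of T)" for i
    using Prob_sets[OF nu] Prob_sets[OF a0] by (cases i) auto
  have Un: "U \<in> sets \<nu>" using U Prob_sets[OF nu] by simp
  have n': "emeasure \<nu>' X = emeasure \<nu> (U \<inter> X) + ennreal b * emeasure \<alpha>0 X" if "X \<in> sets (borel_of T)" for X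
    unfolding \<nu>'_def using that Un Prob_sets[OF nu]
    by (subst emeasure_lincomb[OF sn]) (auto simp: UNIV_bool emeasure_restricted)
  have nuP': "\<nu>' \<in> Prob T"
  proof -
    interpret a0: prob_space \<alpha>0 using a0 by (rule Prob_prob_space)
    have "radon_measure T \<nu>'" unfolding \<nu>'_def
    proof (intro radon_lincomb H)
      fix i :: bool
      show "finite_measure (case_bool (density \<nu> (indicator U)) \<alpha>0 i) \<and> radon_measure T (case_bool (density \<nu> (indicator U)) \<alpha>0 i)"
        using radon_restrict[OF n.finite_measure_axioms _ Un H] nu a0 a0.finite_measure_axioms
        by (cases i) (auto simp: Prob_def)
      show "0 \<le> case_bool 1 b i" using b by (cases i) auto
    qed simp
    moreover have "prob_space \<nu>'"
    proof (rule prob_spaceI)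
      have "emeasure \<nu>' UNIV = ennreal (measure \<nu> U) + ennreal b"
        using n'[OF UNIV_borel] a0.emeasure_space_1 by (simp add: n.emeasure_eq_measure Prob_space[OF a0] top)
      also have "\<dots> = 1"
        using n.prob_compl[OF Un] b by (simp add: b_def Prob_space[OF nu] top flip: ennreal_plus)
      finally show "emeasure \<nu>' (space \<nu>') = 1" by (simp add: \<nu>'_def top)
    qed
    ultimately show ?thesis by (simp add: Prob_def)
  qed
  have W0: "W2sq T d \<mu>0 \<nu>' + ennreal (\<epsilon>\<^sup>2 * b) \<le> ennreal (w0 + \<kappa>/2)"
  proof -
    have sg: "sets \<gamma>0 = sets (borel_of TT)" "space \<gamma>0 = UNIV" using Prob_sets[OF P(1)] Prob_space[OF P(1)] by (auto simp: top)
    have [measurable]: "?c \<in> borel_measurable \<gamma>0" using d2_measurable sg by (simp cong: measurable_cong_sets)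
    have Sg[measurable]: "S \<in> sets \<gamma>0" "UNIV \<times> U \<in> sets \<gamma>0" using Ss sg Times_borel[OF UNIV_borel U] by auto
    have "W2sq T d \<mu>0 \<nu>' \<le> (\<integral>\<^sup>+z. ?c z * indicator (UNIV \<times> U) z \<partial>\<gamma>0) + ennreal b * (\<integral>\<^sup>+z. ?c z \<partial>\<sigma>0)"
      by (rule reroute[OF g0(1) mu0 nu U b_def b \<alpha>0_def[unfolded S_def] s0(1) n'])
    then have "W2sq T d \<mu>0 \<nu>' \<le> (\<integral>\<^sup>+z. ?c z * indicator (UNIV \<times> U) z \<partial>\<gamma>0)" using s0(2) by simp
    then have "W2sq T d \<mu>0 \<nu>' + ennreal (\<epsilon>\<^sup>2 * b) \<le> (\<integral>\<^sup>+z. ?c z * indicator (UNIV \<times> U) z \<partial>\<gamma>0) + ennreal (\<epsilon>\<^sup>2 * b)"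
      by (rule add_right_mono)
    also have "\<dots> = (\<integral>\<^sup>+z. ?c z * indicator (UNIV \<times> U) z \<partial>\<gamma>0) + (\<integral>\<^sup>+z. ennreal (\<epsilon>\<^sup>2) * indicator S z \<partial>\<gamma>0)"
      using b gS by (simp add: nn_integral_cmult_indicator g0.emeasure_eq_measure ennreal_mult)
    also have "(\<integral>\<^sup>+z. ?c z * indicator (UNIV \<times> U) z \<partial>\<gamma>0) + (\<integral>\<^sup>+z. ennreal (\<epsilon>\<^sup>2) * indicator S z \<partial>\<gamma>0)
       = (\<integral>\<^sup>+z. ?c z * indicator (UNIV \<times> U) z + ennreal (\<epsilon>\<^sup>2) * indicator S z \<partial>\<gamma>0)"
      by (intro nn_integral_add[symmetric]) measurable
    \<comment> \<open>Almost surely sources lie in \<open>A\<close>; on \<open>S\<close> the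
      endpoint is outside \<open>U\<close>, so the old plan paid at least
      \<open>\<epsilon>\<^sup>2\<close> there.\<close>
    also have "\<dots> \<le> (\<integral>\<^sup>+z. ?c z \<partial>\<gamma>0)"
    proof (rule nn_integral_mono_AE)
      have "AE z in \<gamma>0. z \<in> A \<times> UNIV"
        using coupling_marginals(1)[OF g0(1) A(1)] A Times_borel[OF A(1) UNIV_borel] sg by (intro g0.AE_prob_1) auto
      then show "AE z in \<gamma>0. ?c z * indicator (UNIV \<times> U) z + ennreal (\<epsilon>\<^sup>2) * indicator S z \<le> ?c z"
      proof eventually_elim
        case (elim z)
        show ?case
        proof (cases "snd z \<in> U")
          case True then show ?thesis by (auto simp: S_def indicator_def mem_Times_iff)
        next
          case False
          have "(ennreal \<epsilon>)\<^sup>2 \<le> ?c z" using elim False by (intro power_mono eps) auto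
          then show ?thesis using False eps(1) by (auto simp: S_def indicator_def mem_Times_iff ennreal_power)
        qed
      qed
    qed
    also have "\<dots> \<le> ennreal (w0 + \<kappa>/2)" using g0(2) by simp
    finally show ?thesis .
  qed
  have W1: "W2sq T d \<mu>1 \<nu>' \<le> ennreal (w1 + \<kappa>/2 + b * R\<^sup>2)"
  proof -
    have "W2sq T d \<mu>1 \<nu>' \<le> (\<integral>\<^sup>+z. ?c z * indicator (UNIV \<times> U) z \<partial>\<gamma>1) + ennreal b * (\<integral>\<^sup>+z. ?c z \<partial>\<sigma>1)"
      by (rule reroute[OF g1(1) mu1 nu U b_def b \<alpha>1_def[unfolded S_def] s1 n'])
    also have "\<dots> \<le> ennreal (w1 + \<kappa>/2) + ennreal b * (ennreal R)\<^sup>2"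
    proof (intro add_mono mult_left_mono s1c)
      have "(\<integral>\<^sup>+z. ?c z * indicator (UNIV \<times> U) z \<partial>\<gamma>1) \<le> (\<integral>\<^sup>+z. ?c z \<partial>\<gamma>1)"
        by (intro nn_integral_mono) (auto simp: indicator_def)
      then show "(\<integral>\<^sup>+z. ?c z * indicator (UNIV \<times> U) z \<partial>\<gamma>1) \<le> ennreal (w1 + \<kappa>/2)" using g1(2) by simp
    qed simp
    also have "\<dots> = ennreal (w1 + \<kappa>/2 + b * R\<^sup>2)" using w kap b R(1) by (simp add: ennreal_power ennreal_mult)
    finally show ?thesis .
  qed
  obtain w0' where w0': "W2sq T d \<mu>0 \<nu>' = ennreal w0'" "0 \<le> w0'"
    using W0 by (cases "W2sq T d \<mu>0 \<nu>'") (auto simp: top_unique)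
  obtain w1' where w1': "W2sq T d \<mu>1 \<nu>' = ennreal w1'" "0 \<le> w1'"
    using W1 by (cases "W2sq T d \<mu>1 \<nu>'") (auto simp: top_unique)
  have i0: "w0' + \<epsilon>\<^sup>2 * b \<le> w0 + \<kappa>/2"
  proof -
    have "ennreal (w0' + \<epsilon>\<^sup>2 * b) \<le> ennreal (w0 + \<kappa>/2)" using W0 w0' b by simp
    then show ?thesis using w kap by (subst (asm) ennreal_le_iff) auto
  qed
  have i1: "w1' \<le> w1 + \<kappa>/2 + b * R\<^sup>2"
    using W1 unfolding w1'(1) by (subst (asm) ennreal_le_iff) (use w kap b in auto)
  have "ennreal ((1-t) * w0 + t * w1) \<le> ennreal ((1-t) * w0' + t * w1')"
    using min[OF nuP'] w w0' w1' t by (simp add: ennreal_mult)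
  then have "(1-t) * w0 + t * w1 \<le> (1-t) * w0' + t * w1'" using w0' w1' t by (subst (asm) ennreal_le_iff) auto
  also have "\<dots> \<le> (1-t) * (w0 + \<kappa>/2 - \<epsilon>\<^sup>2 * b) + t * (w1 + \<kappa>/2 + b * R\<^sup>2)"
    using i0 i1 t by (intro add_mono mult_left_mono) auto
  also have "\<dots> = (1-t) * w0 + t * w1 - \<kappa>/2"
    unfolding \<kappa>_def by (simp add: field_simps)
  finally show False using kap by simp
qed

end

section \<open>Volume growth and conclusion\<close>

context emt
begin

lemma compact_finite_nbhd:
  assumes m: "radon_measure T m" and A: "compactin T A"
  obtains U where "openin T U" "A \<subseteq> U" "emeasure m U < \<infinity>"
proof -
  have sm: "sets m = sets (borel_of T)" using m by (simp add: radon_measure_def)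
  have "\<forall>x. \<exists>U. openin T U \<and> x \<in> U \<and> emeasure m U < \<infinity>" using m by (simp add: radon_measure_def top)
  then obtain U where U: "\<And>x. openin T (U x)" "\<And>x. x \<in> U x" "\<And>x. emeasure m (U x) < \<infinity>" by metis
  have "A \<subseteq> \<Union> (U ` A)" using U(2) by auto
  then obtain \<F> where F: "finite \<F>" "\<F> \<subseteq> U ` A" "A \<subseteq> \<Union>\<F>"
    using compactinD[OF A, of "U ` A"] U(1) by auto
  have o: "openin T (\<Union>\<F>)" using F(2) U(1) by (intro openin_Union) auto
  have "emeasure m (\<Union>\<F>) = emeasure m (\<Union>V\<in>\<F>. V)" by simp
  also have "\<dots> \<le> (\<Sum>V\<in>\<F>. emeasure m V)"
    using F U(1) sm by (intro emeasure_subadditive_finite) (auto simp: openin_borel_of)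
  also have "\<dots> < \<infinity>"
  proof -
    have "emeasure m V \<noteq> top" if "V \<in> \<F>" for V using that F(2) U(3) by (auto simp: less_top)
    then show ?thesis using F(1) by (auto simp: less_top[symmetric])
  qed
  finally show ?thesis using that o F(3) by blast
qed

text \<open>The barycenter is carried by \<open>U\<close>, so its entropy is at least
  \<open>- ln M\<close>; BCD bounds it by a mean in which \<open>- ln \<beta>\<close> has weight
  \<open>t\<close>, so \<open>\<beta>\<close> cannot be too large. Dividing by \<open>t\<close>,
  which is of order \<open>1 / R\<^sup>2\<close> for large \<open>R\<close>, yields growth quadratic
  in \<open>R\<close>.\<close>

lemma volume_bound_aux:
  assumes m: "radon_measure T m" and BCD: "BCD T d m K"
    and A: "compactin T A" "emeasure m A = ennreal a" "0 < a"
    and B: "compactin T B" "emeasure m B = ennreal \<beta>" "0 < \<beta>"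
    and U: "openin T U" "A \<subseteq> U" "emeasure m U = ennreal M" "0 < M"
    and eps: "0 < \<epsilon>" "\<And>x y. x \<in> A \<Longrightarrow> y \<notin> U \<Longrightarrow> ennreal \<epsilon> \<le> d x y"
    and R: "0 \<le> R" "\<And>x y. x \<in> A \<Longrightarrow> y \<in> B \<Longrightarrow> d x y \<le> ennreal R"
  shows "ln \<beta> \<le> 2 * (1 + R\<^sup>2 / \<epsilon>\<^sup>2) * (\<bar>ln M\<bar> + \<bar>ln a\<bar>) + \<bar>K\<bar> / 2 * R\<^sup>2"
proof -
  have sm: "sets m = sets (borel_of T)" using m by (simp add: radon_measure_def)
  have spm: "space m = UNIV" using sets_eq_imp_space_eq[OF sm] by (simp add: top)
  obtain \<mu>0 where m0: "\<mu>0 \<in> Prob T" "measure \<mu>0 A = 1" "Ent m \<mu>0 = ereal (- ln a)" using uniform_compact[OF m A] by blast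
  obtain \<mu>1 where m1: "\<mu>1 \<in> Prob T" "measure \<mu>1 B = 1" "Ent m \<mu>1 = ereal (- ln \<beta>)" using uniform_compact[OF m B] by blast
  have As: "A \<in> sets (borel_of T)" and Bs: "B \<in> sets (borel_of T)" and Us: "U \<in> sets (borel_of T)"
    using A B U H by (auto intro: compactin_borel_of openin_borel_of)
  \<comment> \<open>Half the critical weight
    \<open>\<epsilon>\<^sup>2 / (\<epsilon>\<^sup>2 + R\<^sup>2)\<close> of
    \<open>barycenter_localized\<close>.\<close>
  define t where "t = \<epsilon>\<^sup>2 / (2 * (\<epsilon>\<^sup>2 + R\<^sup>2))"
  have pos: "0 < \<epsilon>\<^sup>2 + R\<^sup>2" using eps(1) by (simp add: add_pos_nonneg)
  have tE: "t * (\<epsilon>\<^sup>2 + R\<^sup>2) = \<epsilon>\<^sup>2 / 2"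
  proof -
    have "\<epsilon>\<^sup>2 / (2 * s) * s = \<epsilon>\<^sup>2 / 2" if "0 < s" for s :: real using that by simp
    then show ?thesis unfolding t_def using pos .
  qed
  have t0: "0 < t" unfolding t_def using eps(1) pos by simp
  have t1: "t \<le> 1 / 2"
  proof -
    have "\<epsilon>\<^sup>2 \<le> \<epsilon>\<^sup>2 + R\<^sup>2" by simp
    then show ?thesis unfolding t_def using pos by (simp add: divide_le_eq)
  qed
  have tR: "t * R\<^sup>2 < (1-t) * \<epsilon>\<^sup>2"
  proof -
    have "0 < \<epsilon>\<^sup>2" using eps(1) by simp
    moreover have "t * R\<^sup>2 + t * \<epsilon>\<^sup>2 = \<epsilon>\<^sup>2 / 2" using tE by (simp add: distrib_left)
    moreover have "(1-t) * \<epsilon>\<^sup>2 = \<epsilon>\<^sup>2 - t * \<epsilon>\<^sup>2" by (simp add: left_diff_distrib)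
    ultimately show ?thesis by linarith
  qed
  have tinv: "1 / t = 2 * (1 + R\<^sup>2 / \<epsilon>\<^sup>2)" unfolding t_def using eps(1) by (simp add: field_simps)
  define w where "w = (\<lambda>z. (if z = \<mu>0 then 1 - t else 0) + (if z = \<mu>1 then t else 0))"
  define e where "e \<mu> = real_of_ereal (Ent m \<mu>)" for \<mu>
  have e01: "e \<mu>0 = - ln a" "e \<mu>1 = - ln \<beta>" using m0 m1 by (auto simp: e_def)
  define E where "E = {\<mu>0, \<mu>1}"
  have t01: "0 \<le> t" "t \<le> 1" using t0 t1 by auto
  have adm: "admissible E e ((1-t) * e \<mu>0 + t * e \<mu>1) w"
    unfolding w_def by (rule admissible_two_points(1)) (use t01 in \<open>auto simp: E_def\<close>)
  have ws: "wsum w f = ennreal (1-t) * f \<mu>0 + ennreal t * f \<mu>1" for f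
    unfolding w_def by (rule admissible_two_points(2)[where E=E and v=e and C="(1-t) * e \<mu>0 + t * e \<mu>1"]) (use t01 in \<open>auto simp: E_def\<close>)
  define S where "S = {z. w z \<noteq> 0}"
  have S: "finite S" "S \<subseteq> E" "\<And>z. 0 \<le> w z" "(\<Sum>z\<in>S. w z) = 1" "(\<Sum>z\<in>S. w z * e z) \<le> (1-t) * e \<mu>0 + t * e \<mu>1"
    using adm unfolding admissible_def S_def by auto
  have SP: "S \<subseteq> Prob T" using S(2) m0 m1 by (auto simp: E_def)
  have Ve: "(\<Sum>\<mu>\<in>S. ennreal (w \<mu>) * W2sq T d \<mu> \<eta>) = ennreal (1-t) * W2sq T d \<mu>0 \<eta> + ennreal t * W2sq T d \<mu>1 \<eta>" for \<eta>
    using ws[of "\<lambda>\<mu>. W2sq T d \<mu> \<eta>"] unfolding wsum_def S_def .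
  have W10: "W2sq T d \<mu>1 \<mu>0 \<le> ennreal (R\<^sup>2)"
  proof -
    obtain \<sigma> where s: "\<sigma> \<in> couplings T \<mu>1 \<mu>0" using product_coupling[OF m1(1) m0(1)] by blast
    have "(\<integral>\<^sup>+z. (d (fst z) (snd z))\<^sup>2 \<partial>\<sigma>) \<le> (ennreal R)\<^sup>2"
      using R(2) by (intro coupling_cost_bounded[OF s m1(1) m0(1) Bs m1(2) As m0(2)]) (metis d_sym)
    then have "W2sq T d \<mu>1 \<mu>0 \<le> (ennreal R)\<^sup>2" unfolding W2sq_def by (rule INF_lower2[OF s])
    then show ?thesis using R(1) by (simp add: ennreal_power)
  qed
  \<comment> \<open>Testing with \<open>\<mu>0\<close> bounds the variance by
    \<open>t R\<^sup>2\<close>; the factor \<open>t\<close> cancels in the final division.\<close>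
  have V0: "ennreal (1-t) * W2sq T d \<mu>0 \<mu>0 + ennreal t * W2sq T d \<mu>1 \<mu>0 \<le> ennreal (t * R\<^sup>2)"
    using W2sq_refl(1)[OF m0(1)] mult_left_mono[OF W10, of "ennreal t"] t0 by (simp add: ennreal_mult)
  have V0f: "(\<Sum>\<mu>\<in>S. ennreal (w \<mu>) * W2sq T d \<mu> \<mu>0) < \<infinity>"
    unfolding Ve using V0 by (rule le_less_trans) simp
  have Ee: "Ent m \<mu> \<le> ereal (e \<mu>)" if "\<mu> \<in> S" for \<mu> using that S(2) m0 m1 by (auto simp: E_def e_def)
  obtain \<nu> where nu: "\<nu> \<in> Prob T"
    and min: "\<And>\<eta>. \<eta> \<in> Prob T \<Longrightarrow> (\<Sum>\<mu>\<in>S. ennreal (w \<mu>) * W2sq T d \<mu> \<nu>) \<le> (\<Sum>\<mu>\<in>S. ennreal (w \<mu>) * W2sq T d \<mu> \<eta>)"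
    and En: "Ent m \<nu> \<le> ereal ((\<Sum>\<mu>\<in>S. w \<mu> * e \<mu>) - K / 2 * enn2real (\<Sum>\<mu>\<in>S. ennreal (w \<mu>) * W2sq T d \<mu> \<nu>))"
    by (rule BCD_finite[OF BCD S(1) SP S(3) S(4) Ee m0(1) V0f]) (assumption | rule that)+
  define r where "r = enn2real (\<Sum>\<mu>\<in>S. ennreal (w \<mu>) * W2sq T d \<mu> \<nu>)"
  have VR: "(\<Sum>\<mu>\<in>S. ennreal (w \<mu>) * W2sq T d \<mu> \<nu>) \<le> ennreal (t * R\<^sup>2)"
    using min[OF m0(1)] V0 unfolding Ve by (rule order_trans)
  have r: "0 \<le> r" "r \<le> t * R\<^sup>2" using enn2real_mono[OF VR] t0 by (auto simp: r_def)
  have loc: "measure \<nu> (UNIV - U) = 0"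
  proof (rule barycenter_localized[OF m0(1) m1(1) nu As m0(2) Bs m1(2) Us eps R t0 _ tR])
    show "t < 1" using t1 by simp
    show "ennreal (1-t) * W2sq T d \<mu>0 \<nu> + ennreal t * W2sq T d \<mu>1 \<nu>
        \<le> ennreal (1-t) * W2sq T d \<mu>0 \<eta> + ennreal t * W2sq T d \<mu>1 \<eta>" if "\<eta> \<in> Prob T" for \<eta>
      using min[OF that] unfolding Ve .
    show "ennreal (1-t) * W2sq T d \<mu>0 \<nu> + ennreal t * W2sq T d \<mu>1 \<nu> < \<infinity>"
      using VR unfolding Ve by (rule le_less_trans) simp
  qed
  interpret n: prob_space \<nu> using nu by (rule Prob_prob_space)
  have "- ln M \<le> (\<Sum>\<mu>\<in>S. w \<mu> * e \<mu>) - K / 2 * r"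
  proof (rule Ent_lower_bound[OF Prob_prob_space[OF nu] _ _ U(3,4)])
    show "sets \<nu> = sets m" using Prob_sets[OF nu] sm by simp
    show "U \<in> sets m" using Us sm by simp
    show "emeasure \<nu> (space m - U) = 0" using loc by (simp add: spm n.emeasure_eq_measure)
    show "Ent m \<nu> \<le> ereal ((\<Sum>\<mu>\<in>S. w \<mu> * e \<mu>) - K / 2 * r)" using En unfolding r_def .
  qed
  also have "\<dots> \<le> ((1-t) * (- ln a) + t * (- ln \<beta>)) + \<bar>K\<bar> / 2 * (t * R\<^sup>2)"
  proof -
    have "- K / 2 * r \<le> \<bar>K\<bar> / 2 * (t * R\<^sup>2)" using r by (intro mult_mono) auto
    then show ?thesis using S(5) unfolding e01 by simp
  qed
  finally have "t * ln \<beta> \<le> ln M + (1-t) * (- ln a) + \<bar>K\<bar> / 2 * (t * R\<^sup>2)" by simp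
  also have "\<dots> \<le> (\<bar>ln M\<bar> + \<bar>ln a\<bar>) + \<bar>K\<bar> / 2 * (t * R\<^sup>2)"
  proof -
    have "(1-t) * (- ln a) \<le> (1-t) * \<bar>ln a\<bar>" using t01 by (intro mult_left_mono) auto
    moreover have "(1-t) * \<bar>ln a\<bar> \<le> 1 * \<bar>ln a\<bar>" using t01 by (intro mult_right_mono) auto
    ultimately have "(1-t) * (- ln a) \<le> \<bar>ln a\<bar>" by simp
    then show ?thesis by simp
  qed
  finally have "ln \<beta> \<le> 1 / t * (\<bar>ln M\<bar> + \<bar>ln a\<bar>) + \<bar>K\<bar> / 2 * R\<^sup>2"
    using t0 by (simp add: field_simps)
  then show ?thesis unfolding tinv .
qed

text \<open>\<open>volume_bound_aux\<close> with a fixed compact \<open>A\<close> and arbitrary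
  compact \<open>B\<close> in a ball bounds the volume of the ball, by inner regularity; a Gaussian
  with large \<open>c\<close> is then summed over shells.\<close>

theorem volume_growth:
  assumes m: "radon_measure T m" and BCD: "BCD T d m K" and x1: "0 < emeasure m {x. d x1 x < \<infinity>}"
  obtains c where "0 < c"
    "(\<integral>\<^sup>+x. ennreal (if ennreal c * (d x1 x)\<^sup>2 = \<infinity> then 0 else exp (- enn2real (ennreal c * (d x1 x)\<^sup>2))) \<partial>m) < \<infinity>"
proof -
  have sm: "sets m = sets (borel_of T)" using m by (simp add: radon_measure_def)
  have spm: "space m = UNIV" using sets_eq_imp_space_eq[OF sm] by (simp add: top)
  have dm[measurable]: "(\<lambda>x. d x1 x) \<in> borel_measurable m" using d_measurable1[of x1] sm by (simp cong: measurable_cong_sets)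
  define Ball where "Ball r = {x. d x1 x \<le> ennreal r}" for r
  have Bs[measurable]: "Ball r \<in> sets m" for r
  proof -
    have "{x \<in> space m. d x1 x \<le> ennreal r} \<in> sets m" by measurable
    then show ?thesis by (simp add: Ball_def spm)
  qed
  have inn: "emeasure m X = (SUP K\<in>{K. compactin T K \<and> K \<subseteq> X}. emeasure m K)" if "X \<in> sets m" for X
    using m that by (simp add: radon_measure_def inner_regular_compact_def)
  obtain n :: nat where n: "0 < emeasure m (Ball (real n))"
  proof -
    have U: "{x. d x1 x < \<infinity>} = (\<Union>n::nat. Ball (real n))"
    proof (intro set_eqI iffI)
      fix x assume "x \<in> {x. d x1 x < \<infinity>}"
      then obtain r where r: "d x1 x = ennreal r" "0 \<le> r" by (cases "d x1 x") auto
      obtain n :: nat where "r \<le> real n" using real_arch_simple by blast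
      then show "x \<in> (\<Union>n::nat. Ball (real n))" using r by (auto simp: Ball_def intro!: ennreal_leI)
    next
      fix x assume "x \<in> (\<Union>n::nat. Ball (real n))"
      then show "x \<in> {x. d x1 x < \<infinity>}" by (auto simp: Ball_def intro: le_less_trans)
    qed
    have "\<exists>n::nat. emeasure m (Ball (real n)) \<noteq> 0"
    proof (rule ccontr)
      assume "\<nexists>n::nat. emeasure m (Ball (real n)) \<noteq> 0"
      then have "emeasure m (\<Union>n::nat. Ball (real n)) = 0"
        by (intro emeasure_UN_eq_0) (use Bs in auto)
      then show False using x1 unfolding U by simp
    qed
    then show thesis using that by (auto simp: zero_less_iff_neq_zero)
  qed
  define D where "D = real n"
  \<comment> \<open>The radius \<open>D\<close> of a ball that contains \<open>A\<close> enters the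
    constants but not the rate \<open>Q\<close>.\<close>
  obtain A where A: "compactin T A" "A \<subseteq> Ball D" "0 < emeasure m A"
    using n unfolding inn[OF Bs] less_SUP_iff D_def by auto
  obtain U where U: "openin T U" "A \<subseteq> U" "emeasure m U < \<infinity>" using compact_finite_nbhd[OF m A(1)] by blast
  have Us: "U \<in> sets m" using U(1) sm by (simp add: openin_borel_of)
  have AU: "emeasure m A \<le> emeasure m U" using U Us by (intro emeasure_mono) auto
  obtain a where a: "emeasure m A = ennreal a" "0 < a"
    using A(3) le_less_trans[OF AU U(3)] by (cases "emeasure m A") auto
  obtain M where M: "emeasure m U = ennreal M" "0 < M"
    using less_le_trans[OF A(3) AU] U(3) by (cases "emeasure m U") auto
  obtain \<epsilon> where eps: "0 < \<epsilon>" "\<And>x y. x \<in> A \<Longrightarrow> y \<notin> U \<Longrightarrow> ennreal \<epsilon> \<le> d x y"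
    using compact_d_separated[OF A(1) U(1,2)] by metis
  define L where "L = \<bar>ln M\<bar> + \<bar>ln a\<bar>"
  define q where "q = 2 * L / \<epsilon>\<^sup>2 + \<bar>K\<bar> / 2"
  have q0: "0 \<le> q" unfolding q_def L_def by simp
  \<comment> \<open>The constants come from
    \<open>(D + r)\<^sup>2 \<le> 2 D\<^sup>2 + 2 r\<^sup>2\<close>.\<close>
  define P where "P = 2 * L + 2 * q * D\<^sup>2"
  define Q where "Q = 2 * q"
  have Q0: "0 \<le> Q" using q0 by (simp add: Q_def)
  have bound: "emeasure m (Ball r) \<le> ennreal (exp (P + Q * r\<^sup>2))" if r: "0 \<le> r" for r
    unfolding inn[OF Bs]
  proof (rule SUP_least, safe)
    fix B assume B: "compactin T B" "B \<subseteq> Ball r"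
    obtain U' where U': "openin T U'" "B \<subseteq> U'" "emeasure m U' < \<infinity>" using compact_finite_nbhd[OF m B(1)] by blast
    have "emeasure m B \<le> emeasure m U'" using U' sm by (intro emeasure_mono) (auto simp: openin_borel_of)
    then have Bf: "emeasure m B < \<infinity>" using U'(3) by (rule le_less_trans)
    show "emeasure m B \<le> ennreal (exp (P + Q * r\<^sup>2))"
    proof (cases "emeasure m B = 0")
      case False
      then obtain \<beta> where be: "emeasure m B = ennreal \<beta>" "0 < \<beta>"
        using Bf by (cases "emeasure m B") (auto simp: less_le)
      have dR: "d x y \<le> ennreal (D + r)" if "x \<in> A" "y \<in> B" for x y
      proof -
        have "d x y \<le> d x x1 + d x1 y" by (rule d_triangle)
        also have "\<dots> \<le> ennreal D + ennreal r"
          using that A B d_sym[of x x1] by (intro add_mono) (auto simp: Ball_def)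
        finally show ?thesis using r by (simp add: D_def)
      qed
      have Dr: "0 \<le> D + r" using r by (simp add: D_def)
      have "ln \<beta> \<le> 2 * (1 + (D + r)\<^sup>2 / \<epsilon>\<^sup>2) * (\<bar>ln M\<bar> + \<bar>ln a\<bar>) + \<bar>K\<bar> / 2 * (D + r)\<^sup>2"
        by (rule volume_bound_aux[OF m BCD A(1) a B(1) be U(1,2) M eps Dr dR])
      also have "\<dots> = 2 * L + q * (D + r)\<^sup>2"
        unfolding L_def[symmetric] q_def by (simp add: algebra_simps add_divide_distrib)
      also have "\<dots> \<le> 2 * L + q * (2 * D\<^sup>2 + 2 * r\<^sup>2)"
      proof -
        have "0 \<le> (D - r)\<^sup>2" by simp
        then have "(D + r)\<^sup>2 \<le> 2 * D\<^sup>2 + 2 * r\<^sup>2" by (simp add: power2_eq_square algebra_simps)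
        then show ?thesis using q0 by (simp add: mult_left_mono)
      qed
      also have "\<dots> = P + Q * r\<^sup>2" unfolding P_def Q_def by (simp add: algebra_simps)
      finally have "\<beta> \<le> exp (P + Q * r\<^sup>2)" using be(2) by (metis exp_le_cancel_iff exp_ln)
      then show ?thesis unfolding be(1) by (rule ennreal_leI)
    qed simp
  qed
  \<comment> \<open>\<open>Q (k + 1)\<^sup>2 \<le> 2 Q k\<^sup>2 + 2 Q\<close>, so this
    \<open>c\<close> leaves a factor \<open>exp (- k\<^sup>2)\<close>, which is below a geometric
    series.\<close>
  define c where "c = 2 * Q + 1"
  have c: "0 < c" using Q0 by (simp add: c_def)
  define f where "f x = ennreal (if ennreal c * (d x1 x)\<^sup>2 = \<infinity> then 0 else exp (- enn2real (ennreal c * (d x1 x)\<^sup>2)))" for x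
  \<comment> \<open>In the shell between radii \<open>k\<close> and \<open>k + 1\<close> the
    Gaussian is at most its value at radius \<open>k\<close>.\<close>
  have pw: "f x \<le> (\<Sum>k::nat. ennreal (exp (- c * (real k)\<^sup>2)) * indicator (Ball (real k + 1)) x)" for x
  proof (cases "d x1 x")
    case top
    then have "f x = 0" using c by (simp add: f_def ennreal_mult_eq_top_iff top_power_ennreal)
    then show ?thesis by simp
  next
    case (real r)
    define k where "k = nat \<lfloor>r\<rfloor>"
    have k: "real k \<le> r" "r \<le> real k + 1" using real(1) unfolding k_def by linarith+
    have "f x = ennreal (exp (- (c * r\<^sup>2)))"
      using real c by (simp add: f_def ennreal_power flip: ennreal_mult)
    also have "\<dots> \<le> ennreal (exp (- c * (real k)\<^sup>2))"
      using k c by (intro ennreal_leI) (simp add: power_mono)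
    also have "\<dots> = ennreal (exp (- c * (real k)\<^sup>2)) * indicator (Ball (real k + 1)) x"
      using real k by (simp add: Ball_def ennreal_leI del: ennreal_plus)
    also have "\<dots> = (\<Sum>j\<in>{k}. ennreal (exp (- c * (real j)\<^sup>2)) * indicator (Ball (real j + 1)) x)" by (subst sum.insert) auto
    also have "\<dots> \<le> (\<Sum>k::nat. ennreal (exp (- c * (real k)\<^sup>2)) * indicator (Ball (real k + 1)) x)"
      by (rule sum_le_suminf) auto
    finally show ?thesis .
  qed
  have "(\<integral>\<^sup>+x. f x \<partial>m) \<le> (\<integral>\<^sup>+x. (\<Sum>k::nat. ennreal (exp (- c * (real k)\<^sup>2)) * indicator (Ball (real k + 1)) x) \<partial>m)"
    by (intro nn_integral_mono pw)
  also have "\<dots> = (\<Sum>k::nat. \<integral>\<^sup>+x. ennreal (exp (- c * (real k)\<^sup>2)) * indicator (Ball (real k + 1)) x \<partial>m)"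
    by (rule nn_integral_suminf) measurable
  also have "\<dots> = (\<Sum>k::nat. ennreal (exp (- c * (real k)\<^sup>2)) * emeasure m (Ball (real k + 1)))"
    by (intro suminf_cong nn_integral_cmult_indicator) measurable
  also have "\<dots> \<le> (\<Sum>k::nat. ennreal (exp (P + 2 * Q) * exp (- 1) ^ k))"
  proof (intro suminf_le allI)
    fix k :: nat
    have "ennreal (exp (- c * (real k)\<^sup>2)) * emeasure m (Ball (real k + 1))
      \<le> ennreal (exp (- c * (real k)\<^sup>2)) * ennreal (exp (P + Q * (real k + 1)\<^sup>2))"
      by (intro mult_left_mono bound) auto
    also have "\<dots> = ennreal (exp (- c * (real k)\<^sup>2 + (P + Q * (real k + 1)\<^sup>2)))"
      by (subst exp_add[of "- c * (real k)\<^sup>2"], subst ennreal_mult) auto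
    also have "\<dots> \<le> ennreal (exp (P + 2 * Q - real k))"
    proof (intro ennreal_leI, subst exp_le_cancel_iff)
      have "0 \<le> (real k - 1)\<^sup>2" by simp
      then have "(real k + 1)\<^sup>2 \<le> 2 * (real k)\<^sup>2 + 2" by (simp add: power2_eq_square algebra_simps)
      then have "Q * (real k + 1)\<^sup>2 \<le> Q * (2 * (real k)\<^sup>2 + 2)" using Q0 by (rule mult_left_mono)
      moreover have "real k \<le> (real k)\<^sup>2"
        using power2_nat_le_imp_le[of k "k\<^sup>2"] by (cases k) (auto simp: power2_eq_square)
      moreover have "c * (real k)\<^sup>2 = Q * (2 * (real k)\<^sup>2) + (real k)\<^sup>2" unfolding c_def by (simp add: algebra_simps)
      ultimately show "- c * (real k)\<^sup>2 + (P + Q * (real k + 1)\<^sup>2) \<le> P + 2 * Q - real k"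
        unfolding mult_minus_left distrib_left[of Q "2 * (real k)\<^sup>2"] by linarith
    qed
    also have "exp (P + 2 * Q - real k) = exp (P + 2 * Q) * exp (- 1) ^ k"
      by (simp add: exp_diff exp_minus exp_of_nat_mult[symmetric] power_inverse field_simps)
    finally show "ennreal (exp (- c * (real k)\<^sup>2)) * emeasure m (Ball (real k + 1)) \<le> ennreal (exp (P + 2 * Q) * exp (- 1) ^ k)" .
  qed auto
  also have "\<dots> < \<infinity>"
  proof -
    have "summable (\<lambda>k::nat. exp (P + 2 * Q) * exp (- 1 :: real) ^ k)"
      by (intro summable_mult summable_geometric) simp
    then show ?thesis by (subst suminf_ennreal2) auto
  qed
  finally show ?thesis using that[OF c] unfolding f_def by blast
qed

text \<open>The centre \<open>x1\<close> comes from one measure \<open>\<mu>1\<close> of finite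
  second moment, finite entropy and finite cost to \<open>\<eta>\<close>: then \<open>m\<close>
  charges the points at finite distance from \<open>x1\<close>, and \<open>\<eta>\<close> inherits
  the moment.\<close>

lemma barycenter_Prob2:
  assumes m: "radon_measure T m" and BCD: "BCD T d m K" and Om: "prob_on_P T \<Omega>"
    and EI: "Ent_integral m \<Omega> < \<infinity>" and conc: "concentrated_on \<Omega> (Prob2 T d)"
    and eta: "\<eta> \<in> Prob T" "(\<integral>\<^sup>+\<mu>. W2sq T d \<mu> \<eta> \<partial>\<Omega>) < \<infinity>"
  shows "\<exists>\<nu>. barycenter T d \<Omega> \<nu>"
proof -
  interpret Om: prob_space \<Omega> using Om by (simp add: prob_on_P_def)
  have se: "sets \<Omega> = sets BP" using Om by (simp add: prob_on_P_def)
  have sm: "sets m = sets (borel_of T)" using m by (simp add: radon_measure_def)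
  have spm: "space m = UNIV" using sets_eq_imp_space_eq[OF sm] by (simp add: top)
  have Wm[measurable]: "(\<lambda>\<mu>. W2sq T d \<mu> \<eta>) \<in> borel_measurable \<Omega>"
    using W2sq_measurable[OF eta(1)] se by (simp cong: measurable_cong_sets)
  obtain A where A[measurable]: "A \<in> sets \<Omega>" "A \<subseteq> Prob2 T d" "emeasure \<Omega> A = 1"
    using conc Om.emeasure_space_1 by (auto simp: concentrated_on_def)
  obtain \<mu>1 where mu1: "\<mu>1 \<in> Prob2 T d" "W2sq T d \<mu>1 \<eta> < \<infinity>" "Ent m \<mu>1 < \<infinity>"
  proof -
    define A' where "A' = {\<mu> \<in> space \<Omega>. W2sq T d \<mu> \<eta> < \<infinity>} \<inter> A"
    have A's: "A' \<in> sets \<Omega>" unfolding A'_def by measurable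
    have "AE \<mu> in \<Omega>. W2sq T d \<mu> \<eta> \<noteq> \<infinity>" using eta(2) by (intro nn_integral_noteq_infinite) auto
    then have "emeasure \<Omega> A' = emeasure \<Omega> A"
      using A A's by (intro emeasure_eq_AE) (auto elim!: eventually_mono simp: A'_def less_top dest: sets.sets_into_space)
    then have one: "emeasure \<Omega> A' = 1" using A by simp
    \<comment> \<open>Infinite entropy throughout \<open>A'\<close> would make the integral of its
      positive part infinite; this needs measurability of \<open>A'\<close> but not of the
      entropy.\<close>
    have "\<exists>\<mu>\<in>A'. Ent m \<mu> < \<infinity>"
    proof (rule ccontr)
      assume no: "\<not> (\<exists>\<mu>\<in>A'. Ent m \<mu> < \<infinity>)"
      have "(\<integral>\<^sup>+\<mu>. \<infinity> * indicator A' \<mu> \<partial>\<Omega>) \<le> (\<integral>\<^sup>+\<mu>. e2ennreal (Ent m \<mu>) \<partial>\<Omega>)"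
        using no by (intro nn_integral_mono) (auto simp: indicator_def)
      moreover have "(\<integral>\<^sup>+\<mu>. \<infinity> * indicator A' \<mu> \<partial>\<Omega>) = \<infinity>"
        using A's one by (simp add: nn_integral_cmult_indicator)
      ultimately have "(\<integral>\<^sup>+\<mu>. e2ennreal (Ent m \<mu>) \<partial>\<Omega>) = \<infinity>" by (simp add: top_unique)
      then show False using EI by (simp add: Ent_integral_def ereal_integral_def)
    qed
    then show thesis using that A(2) unfolding A'_def by blast
  qed
  have mu1P: "\<mu>1 \<in> Prob T" using mu1(1) by (simp add: Prob2_def)
  interpret m1: prob_space \<mu>1 using mu1P by (rule Prob_prob_space)
  obtain x1 where x1: "(\<integral>\<^sup>+x. (d x1 x)\<^sup>2 \<partial>\<mu>1) < \<infinity>" using mu1(1) by (auto simp: Prob2_def)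
  have d1[measurable]: "(\<lambda>x. d x1 x) \<in> borel_measurable \<mu>1" "(\<lambda>x. d x1 x) \<in> borel_measurable m"
    using d_measurable1[of x1] Prob_sets[OF mu1P] sm by (simp_all cong: measurable_cong_sets)
  \<comment> \<open>\<open>\<mu>1\<close> is absolutely continuous with respect to \<open>m\<close>
    and lives at finite distance from \<open>x1\<close>.\<close>
  have "0 < emeasure m {x. d x1 x < \<infinity>}"
  proof (rule ccontr)
    assume "\<not> 0 < emeasure m {x. d x1 x < \<infinity>}"
    then have z: "emeasure m {x. d x1 x < \<infinity>} = 0" by (simp add: zero_less_iff_neq_zero)
    have s: "{x. d x1 x < \<infinity>} \<in> sets m"
    proof -
      have "{x \<in> space m. d x1 x < \<infinity>} \<in> sets m" by measurable
      then show ?thesis by (simp add: spm)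
    qed
    have "{x. d x1 x < \<infinity>} \<in> null_sets m" using z s by (simp add: null_sets_def)
    moreover obtain \<rho> where "\<rho> \<in> borel_measurable m" "\<mu>1 = dm m \<rho>"
      using Ent_lessD[OF mu1(3) m1.prob_space_axioms] by metis
    ultimately have "{x. d x1 x < \<infinity>} \<in> null_sets \<mu>1"
      using absolutely_continuousI_density[of "\<lambda>x. ennreal (\<rho> x)" m] by (auto simp: absolutely_continuous_def)
    then have "AE x in \<mu>1. x \<notin> {x. d x1 x < \<infinity>}" by (rule AE_not_in)
    moreover have "AE x in \<mu>1. (d x1 x)\<^sup>2 \<noteq> \<infinity>" using x1 by (intro nn_integral_noteq_infinite) auto
    ultimately have "AE x in \<mu>1. False"
      by eventually_elim (metis (no_types, lifting) infinity_ennreal_def mem_Collect_eq top.not_eq_extremum top_power_ennreal zero_neq_numeral)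
    then show False by simp
  qed
  then obtain c where c: "0 < c"
    "(\<integral>\<^sup>+x. ennreal (if ennreal c * (d x1 x)\<^sup>2 = \<infinity> then 0 else exp (- enn2real (ennreal c * (d x1 x)\<^sup>2))) \<partial>m) < \<infinity>"
    using volume_growth[OF m BCD] by blast
  define \<psi> where "\<psi> x = ennreal c * (d x1 x)\<^sup>2" for x
  have psi: "\<psi> \<in> borel_measurable (borel_of T)" unfolding \<psi>_def using d_measurable1[of x1] by measurable
  have lip: "\<psi> y \<le> ennreal (2 * c) * (d x y)\<^sup>2 + 2 * \<psi> x" for x y
  proof -
    have sq: "(a + b)\<^sup>2 \<le> 2 * a\<^sup>2 + 2 * b\<^sup>2" for a b :: ennreal
    proof (cases a; cases b)
      fix r s assume "0 \<le> r" "a = ennreal r" "0 \<le> s" "b = ennreal s"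
      moreover have "(r + s)\<^sup>2 \<le> 2 * r\<^sup>2 + 2 * s\<^sup>2"
        using zero_le_power2[of "r - s"] by (simp add: power2_eq_square algebra_simps)
      then have "ennreal ((r + s)\<^sup>2) \<le> ennreal (2 * r\<^sup>2 + 2 * s\<^sup>2)" by (rule ennreal_leI)
      ultimately show ?thesis by (simp add: ennreal_mult ennreal_power[symmetric])
    qed (auto simp: top_power_ennreal ennreal_mult_eq_top_iff)
    have "(d x1 y)\<^sup>2 \<le> (d x1 x + d x y)\<^sup>2" by (intro power_mono d_triangle) auto
    also have "\<dots> \<le> 2 * (d x1 x)\<^sup>2 + 2 * (d x y)\<^sup>2" by (rule sq)
    finally have "\<psi> y \<le> ennreal c * (2 * (d x1 x)\<^sup>2 + 2 * (d x y)\<^sup>2)" unfolding \<psi>_def by (rule mult_left_mono) simp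
    also have "\<dots> = ennreal (2 * c) * (d x y)\<^sup>2 + 2 * \<psi> x"
      using c(1) by (simp add: \<psi>_def distrib_left ennreal_mult mult_ac add.commute)
    finally show ?thesis .
  qed
  have "(\<integral>\<^sup>+x. \<psi> x \<partial>\<mu>1) < \<infinity>"
    using x1 unfolding \<psi>_def by (subst nn_integral_cmult) (auto simp: ennreal_mult_less_top)
  moreover have "(\<integral>\<^sup>+x. \<psi> x \<partial>\<eta>) \<le> ennreal (2 * c) * W2sq T d \<mu>1 \<eta> + 2 * (\<integral>\<^sup>+x. \<psi> x \<partial>\<mu>1)"
    by (rule moment_bound(1)[OF psi c(1) lip mu1P eta(1)])
  ultimately have "(\<integral>\<^sup>+x. \<psi> x \<partial>\<eta>) < \<infinity>"
    using mu1(2) by (elim le_less_trans) (simp add: ennreal_mult_less_top)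
  then show ?thesis
    using c(2) unfolding \<psi>_def[symmetric]
    by (intro barycenter_of_weighted[OF sm BCD psi c(1) lip _ Om EI eta(1) _ eta(2)])
qed

end

theorem theorem6p7:
  fixes T :: "'a topology" and d :: "'a \<Rightarrow> 'a \<Rightarrow> ennreal" and m :: "'a measure"
    and K :: real and \<Omega> :: "'a measure measure"
  assumes "ext_mms T d m"
    and "BCD T d m K"
    and "prob_on_P T \<Omega>"
    and "Var T d \<Omega> < \<infinity>"
    and "Ent_integral m \<Omega> < \<infinity>"
    and "(exp_volume_growth d m \<and> concentrated_on \<Omega> (Prob2 T d)) \<or> prob_space m"
  shows "\<exists>\<nu>. barycenter T d \<Omega> \<nu>"
  proof -
  have emt_sp: "emt_space T d" and rad: "radon_measure T m"
    using assms(1) by (auto simp: ext_mms_def)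
  interpret emt T d by unfold_locales (rule emt_sp)
  obtain \<eta> where eta: "\<eta> \<in> Prob T" "(\<integral>\<^sup>+\<mu>. W2sq T d \<mu> \<eta> \<partial>\<Omega>) < \<infinity>"
    using assms(4) unfolding Var_def INF_less_iff by auto
  have sm: "sets m = sets (borel_of T)" using rad by (simp add: radon_measure_def)
  from assms(6) show ?thesis
  proof
    assume "exp_volume_growth d m \<and> concentrated_on \<Omega> (Prob2 T d)"
    then show ?thesis using barycenter_Prob2[OF rad assms(2,3,5) _ eta] by blast
  next
    assume "prob_space m"
    \<comment> \<open>Here \<open>\<psi> = 0\<close>, so the weighting leaves the finite measure
      \<open>m\<close> unchanged; any positive \<open>c\<close> would do, and \<open>1\<close> is
      taken.\<close>
    then have "(\<integral>\<^sup>+x. ennreal (if (0::ennreal) = \<infinity> then 0 else exp (- enn2real 0)) \<partial>m) < \<infinity>"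
      by (simp add: prob_space.emeasure_space_1)
    then show ?thesis
      using barycenter_of_weighted[OF sm assms(2), of "\<lambda>_. 0" 1] assms(3,5) eta by simp
  qed
qed

end
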